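(* Let $B$ be a topological space, $\pi$ an abelian group, $n\ge1$. For every $z^{n+1}\in Z^{n+1}(B,\pi)$ and every abelian group $G$, the cohomology group $H^n(B,\pi)$ acts from the left on the homology groups $H_{q+1}(Y_{**z^{n+1}}(B,\pi,n)\otimes G)$ and the cohomology groups $H^{q+1}(\mathrm{Hom}(Y_{**z^{n+1}}(B,\pi,n),G))$ for every $q$. The action of the class of a cocycle $c^n\in Z^n(B,\pi)$ is the one induced by the chain map $$\varphi_{u(c^n,z^{n+1})}:Y_{**z^{n+1}}(B,\pi,n)\to Y_{**z^{n+1}}(B,\pi,n),\qquad \varphi_{u(c^n,z^{n+1})}(y)=(1+u(c^n,z^{n+1}))\,y .$$
   Context: **Cubical sets.** For a cubical set $Q$ with faces $d_i^\epsilon$ and degeneracies $s_i$, $C_*^\Box(Q)$ is the free graded abelian group on the cubes modulo the degenerate ones, with $d\sigma=\sum_i(-1)^i(d^0_i\sigma-d^1_i\sigma)$. $C_*(X)$, $C^*(X,\cdot)$ are unnormalized singular (simplicial) chains and cochains, $(\delta c)(\sigma)=c(\partial\sigma)$. **$L(\pi,n)$.** The cubical set whose $p$-cubes are the cellular $n$-cocycles $Z^n(I^p,\pi)$ of the standard cube; faces are restrictions to $x_i=\epsilon$, degeneracies are pull-backs along the projections omitting the $i$-th coordinate. The product $\sigma\circ\tau=pr_1^*\sigma+pr_2^*\tau\in Z^n(I^{p+q},\pi)$ of a $p$-cube and a $q$-cube makes $C_*^\Box(L(\pi,n))$ a differential graded ring, with unit the unique $0$-cube and $C_i^\Box(L(\pi,n))=0$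 for $0<i<n$. **$\kappa_z$.** For a space $X$, $z\in Z^{n+1}(X,\pi)$ and a singular $(m+1)$-simplex $\sigma$ of $X$ ($m\ge0$), the $m$-cube $\kappa_z(\sigma)\in Z^n(I^m,\pi)$ is: use coordinates $(x_2,\dots,x_{m+1})$ on $I^m$ and put $x_1=0$. Let $w$ be an $n$-face of $I^m$ with free coordinates $x_{i_1},\dots,x_{i_n}$, $i_1<\dots<i_n$, the others fixed at $0$ or $1$. If some fixed $x_l$ with $i_1<l<i_n$ is $0$, then $\kappa_z(\sigma)(w)=0$. Otherwise let $r$ be the largest index $<i_1$ with $x_r=0$, and $q$ the smallest index $>i_n$ with $x_q=0$ ($q=m+2$ if there is none); then $\kappa_z(\sigma)(w)$ is the value of $z$ on the face of $\sigma$ with vertices $r-1<i_1-1<\dots<i_n-1<q-1$. **Algebra and twisting element.** $A^{*,-*}(B,\pi,n)$ has $A^{p,-q}=\mathrm{Hom}(C_p(B),C_q^\Box(L(\pi,n)))$, total degree $m$ part $A^m=\prod_{p-q=m}A^{p,-q}$, $dx=d_L\circ x-(-1)^{|x|}x\circ\partial$, and product $(xy)(\sigma)=\sum_{i}(-1)^{|y|i}x(\sigma_{[0,\dots,i]})\,y(\sigma_{[i,\dots,p]})$ for a $p$-simplex $\sigma$. For $z\in Z^{n+1}(B,\pi)$, $a(z)\in A^1$ has components $a^{m+1,-m}(\sigma^{m+1})=-\kappa_z(\sigma^{m+1})$ for $m\ge n$, all others zero. **Model.** $Y_{**}(B,\pi,n)=C_*(B)\otimes C_*^\Box(L(\pi,n))$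 with $d(\sigma^p\otimes\tau)=\partial\sigma\otimes\tau+(-1)^p\sigma\otimes d\tau$ is a left $A^{*,-*}(B,\pi,n)$-module by $x(\sigma^p\otimes\tau)=\sum_i(-1)^{|x|i}\sigma_{[0,\dots,i]}\otimes x(\sigma_{[i,\dots,p]})\,\tau$. $Y_{**z}(B,\pi,n)$ is $Y_{**}(B,\pi,n)$ with differential $d_{a(z)}(y)=d(y)+a(z)y$. **$u(c,z)$.** For $z\in Z^{n+1}(B,\pi)$, $c\in C^n(B,\pi)$ let $\bar c\in C^n(B\times I,\pi)$ equal $c$ on simplices lying in $B\times1$ and zero on all others, and $z_{B\times I}=Pr^*z+\delta\bar c$. Then $u(c,z)\in A^0$ is given by $u(c,z)(\sigma^m)=\sum_{i=0}^m(-1)^i\kappa_{z_{B\times I}}\big((\sigma^m\times id)(b_0,\dots,b_i,b_i',\dots,b_m')\big)$ for $m\ge n$ and zero for $m<n$, where $b_j=(j,0)$, $b_j'=(j,1)$ are the vertices of $\Delta_m\times I$. On cohomology the class acts through the dual of $\varphi_{u(c^n,z^{n+1})}$. *)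

theory Defs
  imports "HOL-Homology.Homology" "HOL-Algebra.Group_Action"
begin

text \<open>
  Groups are HOL-Algebra records, hence written multiplicatively; \<open>\<pi>\<close> is a type of class
  \<^class>\<open>ab_group_add\<close>, because its elements are added inside the definitions.
\<close>

section \<open>Abelian groups\<close>

definition additive_group :: "'a::ab_group_add monoid" where
  "additive_group = \<lparr>carrier = UNIV, monoid.mult = (+), one = 0\<rparr>"

definition Hom_group ::
    "('a, 'c) monoid_scheme \<Rightarrow> ('b, 'd) monoid_scheme \<Rightarrow> ('a \<Rightarrow> 'b) monoid" where
  "Hom_group A B =
     \<lparr>carrier = hom A B \<inter> extensional (carrier A),
      monoid.mult = (\<lambda>f g. \<lambda>x\<in>carrier A. f x \<otimes>\<^bsub>B\<^esub> g x),
      one = (\<lambda>x\<in>carrier A. \<one>\<^bsub>B\<^esub>)\<rparr>"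

text \<open>The homomorphism sending \<open>g i\<close> to \<open>h i\<close> for all \<open>i \<in> I\<close>. It is used only where the
  elements \<open>g i\<close> generate \<open>A\<close> and such a homomorphism exists.\<close>

definition the_hom :: "('a, 'c) monoid_scheme \<Rightarrow> ('b, 'd) monoid_scheme
    \<Rightarrow> 'i set \<Rightarrow> ('i \<Rightarrow> 'a) \<Rightarrow> ('i \<Rightarrow> 'b) \<Rightarrow> 'a \<Rightarrow> 'b" where
  "the_hom A B I g h = (THE f. f \<in> carrier (Hom_group A B) \<and> (\<forall>i\<in>I. f (g i) = h i))"

definition tensor_relations ::
    "('a, 'c) monoid_scheme \<Rightarrow> ('b, 'd) monoid_scheme \<Rightarrow> (('a \<times> 'b) \<Rightarrow>\<^sub>0 int) set" where
  "tensor_relations A B = generate (free_Abelian_group (carrier A \<times> carrier B))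
     ({frag_of (a \<otimes>\<^bsub>A\<^esub> a', b) - frag_of (a, b) - frag_of (a', b) | a a' b.
         a \<in> carrier A \<and> a' \<in> carrier A \<and> b \<in> carrier B} \<union>
      {frag_of (a, b \<otimes>\<^bsub>B\<^esub> b') - frag_of (a, b) - frag_of (a, b') | a b b'.
         a \<in> carrier A \<and> b \<in> carrier B \<and> b' \<in> carrier B})"

definition tensor_group ::
    "('a, 'c) monoid_scheme \<Rightarrow> ('b, 'd) monoid_scheme \<Rightarrow> (('a \<times> 'b) \<Rightarrow>\<^sub>0 int) set monoid" where
  "tensor_group A B = free_Abelian_group (carrier A \<times> carrier B) Mod tensor_relations A B"

definition tens :: "('a, 'c) monoid_scheme \<Rightarrow> ('b, 'd) monoid_scheme
    \<Rightarrow> 'a \<Rightarrow> 'b \<Rightarrow> (('a \<times> 'b) \<Rightarrow>\<^sub>0 int) set" where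
  "tens A B a b =
     tensor_relations A B #>\<^bsub>free_Abelian_group (carrier A \<times> carrier B)\<^esub> frag_of (a, b)"

text \<open>\<open>f \<otimes> id\<close> for \<open>f: A \<rightarrow> A'\<close>.\<close>

definition tensor_map :: "('a, 'c) monoid_scheme \<Rightarrow> ('b, 'd) monoid_scheme
    \<Rightarrow> ('g, 'e) monoid_scheme \<Rightarrow> ('a \<Rightarrow> 'b)
    \<Rightarrow> (('a \<times> 'g) \<Rightarrow>\<^sub>0 int) set \<Rightarrow> (('b \<times> 'g) \<Rightarrow>\<^sub>0 int) set" where
  "tensor_map A A' G f = the_hom (tensor_group A G) (tensor_group A' G)
     (carrier A \<times> carrier G) (\<lambda>(a, g). tens A G a g) (\<lambda>(a, g). tens A' G (f a) g)"

text \<open>Homology of \<open>A \<rightarrow> C \<rightarrow> D\<close> at \<open>C\<close>, with maps \<open>f\<close> and \<open>g\<close>.\<close>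

definition homology_at :: "('a, 'i) monoid_scheme \<Rightarrow> ('a \<Rightarrow> 'b) \<Rightarrow> ('b, 'j) monoid_scheme
    \<Rightarrow> ('b \<Rightarrow> 'c) \<Rightarrow> ('c, 'k) monoid_scheme \<Rightarrow> 'b set monoid" where
  "homology_at A f C g D = C\<lparr>carrier := kernel C D g\<rparr> Mod (f ` carrier A)"

definition homology_class ::
    "('a, 'i) monoid_scheme \<Rightarrow> ('a \<Rightarrow> 'b) \<Rightarrow> ('b, 'j) monoid_scheme \<Rightarrow> 'b \<Rightarrow> 'b set" where
  "homology_class A f C y = (f ` carrier A) #>\<^bsub>C\<^esub> y"

definition chain_complex :: "(int \<Rightarrow> ('a, 'c) monoid_scheme) \<Rightarrow> ('a \<Rightarrow> 'a) \<Rightarrow> bool" where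
  "chain_complex C d \<longleftrightarrow> (\<forall>m. comm_group (C m) \<and> d \<in> hom (C m) (C (m - 1)) \<and>
     (\<forall>y\<in>carrier (C m). d (d y) = \<one>\<^bsub>C (m - 2)\<^esub>))"

definition chain_endomorphism ::
    "(int \<Rightarrow> ('a, 'c) monoid_scheme) \<Rightarrow> ('a \<Rightarrow> 'a) \<Rightarrow> ('a \<Rightarrow> 'a) \<Rightarrow> bool" where
  "chain_endomorphism C d f \<longleftrightarrow> chain_complex C d \<and>
     (\<forall>m. f \<in> hom (C m) (C m) \<and> (\<forall>y\<in>carrier (C m). f (d y) = d (f y)))"


section \<open>Singular chains and cochains\<close>

text \<open>The total group \<open>\<Oplus>\<^sub>p C\<^sub>p(X)\<close>. A simplex is tagged by its dimension, because
  one extensional function can be a \<^const>\<open>singular_simplex\<close> in several dimensions.\<close>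

type_synonym 'a simplex = "nat \<times> ((nat \<Rightarrow> real) \<Rightarrow> 'a)"

definition simplices :: "'a topology \<Rightarrow> 'a simplex set" where
  "simplices X = {(p, \<sigma>). singular_simplex p X \<sigma>}"

definition sing_chains :: "'a topology \<Rightarrow> ('a simplex \<Rightarrow>\<^sub>0 int) monoid" where
  "sing_chains X = free_Abelian_group (simplices X)"

definition sing_boundary :: "('a simplex \<Rightarrow>\<^sub>0 int) \<Rightarrow> ('a simplex \<Rightarrow>\<^sub>0 int)" where
  "sing_boundary = frag_extend (\<lambda>(p, \<sigma>). if p = 0 then 0
     else (\<Sum>k\<le>p. frag_cmul ((-1) ^ k) (frag_of (p - 1, singular_face p k \<sigma>))))"

text \<open>The face \<open>\<sigma>\<^bsub>[v\<^sub>0,\<dots>,v\<^sub>k]\<^esub>\<close> for the list \<open>vs = [v\<^sub>0,\<dots>,v\<^sub>k]\<close>.\<close>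

definition vertex_face :: "nat list \<Rightarrow> ((nat \<Rightarrow> real) \<Rightarrow> 'a) \<Rightarrow> ((nat \<Rightarrow> real) \<Rightarrow> 'a)" where
  "vertex_face vs \<sigma> = simplex_map (length vs - 1) \<sigma>
     (oriented_simplex (length vs - 1) (\<lambda>j i. if i = vs ! j then 1 else 0))"

definition cochain_group :: "nat \<Rightarrow> 'a topology \<Rightarrow> ('a chain \<Rightarrow> 'p::ab_group_add) monoid" where
  "cochain_group p X = Hom_group (chain_group p X) additive_group"

definition coboundary ::
    "nat \<Rightarrow> 'a topology \<Rightarrow> ('a chain \<Rightarrow> 'p::ab_group_add) \<Rightarrow> ('a chain \<Rightarrow> 'p)" where
  "coboundary p X c = (\<lambda>x\<in>carrier (chain_group (Suc p) X). c (chain_boundary (Suc p) x))"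

definition cocycles :: "nat \<Rightarrow> 'a topology \<Rightarrow> ('a chain \<Rightarrow> 'p::ab_group_add) set" where
  "cocycles p X = kernel (cochain_group p X) (cochain_group (Suc p) X) (coboundary p X)"

text \<open>Only for \<open>p \<ge> 1\<close>, the range in which they are used.\<close>

definition cohomology_group ::
    "nat \<Rightarrow> 'a topology \<Rightarrow> ('a chain \<Rightarrow> 'p::ab_group_add) set monoid" where
  "cohomology_group p X = homology_at (cochain_group (p - 1) X) (coboundary (p - 1) X)
     (cochain_group p X) (coboundary p X) (cochain_group (Suc p) X)"

definition cohomology_class ::
    "nat \<Rightarrow> 'a topology \<Rightarrow> ('a chain \<Rightarrow> 'p::ab_group_add) \<Rightarrow> ('a chain \<Rightarrow> 'p) set" where
  "cohomology_class p X c =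
     homology_class (cochain_group (p - 1) X) (coboundary (p - 1) X) (cochain_group p X) c"


section \<open>The cubical set \<open>L(\<pi>,n)\<close> and its normalized chains\<close>

text \<open>A face of \<open>I\<^sup>p\<close> is a list of length \<open>p\<close>: \<open>None\<close> is a free coordinate, \<open>Some False\<close> a
  coordinate fixed at \<open>0\<close> and \<open>Some True\<close> one fixed at \<open>1\<close>. Coordinates count from \<open>0\<close>.\<close>

type_synonym cell = "bool option list"

definition cells :: "nat \<Rightarrow> nat \<Rightarrow> cell set" where
  "cells p n = {w. length w = p \<and> count_list w None = n}"

definition signed :: "nat \<Rightarrow> 'p::ab_group_add \<Rightarrow> 'p" where
  "signed k x = (if even k then x else - x)"

text \<open>A cellular \<open>n\<close>-cochain of \<open>I\<^sup>p\<close> is a function on cells vanishing off the \<open>n\<close>-faces of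
  \<open>I\<^sup>p\<close>. In the boundary of an \<open>(n+1)\<close>-face, the sign of the faces in a free direction \<open>i\<close>
  depends on the number of free directions before \<open>i\<close>.\<close>

definition cell_cocycles :: "nat \<Rightarrow> nat \<Rightarrow> (cell \<Rightarrow> 'p::ab_group_add) set" where
  "cell_cocycles p n = {f. (\<forall>w. w \<notin> cells p n \<longrightarrow> f w = 0) \<and>
     (\<forall>w\<in>cells p (Suc n). (\<Sum>i\<in>{i. i < p \<and> w ! i = None}.
        signed (Suc (count_list (take i w) None))
          (f (w[i := Some False]) - f (w[i := Some True]))) = 0)}"

text \<open>The zero cocycle occurs in every dimension, so a cube carries its dimension.\<close>

type_synonym 'p cube = "nat \<times> (cell \<Rightarrow> 'p)"

definition L_cubes :: "nat \<Rightarrow> 'p::ab_group_add cube set" where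
  "L_cubes n = {(p, f). f \<in> cell_cocycles p n}"

definition L_face :: "nat \<Rightarrow> bool \<Rightarrow> 'p cube \<Rightarrow> 'p cube" where
  "L_face i e s = (fst s - 1, \<lambda>w. snd s (take i w @ Some e # drop i w))"

text \<open>Pull-back along the projection \<open>I\<^bsup>p+1\<^esup> \<rightarrow> I\<^sup>p\<close> omitting coordinate \<open>i\<close>; cells on which
  coordinate \<open>i\<close> is free are collapsed.\<close>

definition L_degen :: "nat \<Rightarrow> 'p::ab_group_add cube \<Rightarrow> 'p cube" where
  "L_degen i s = (Suc (fst s),
     \<lambda>w. if i < length w \<and> w ! i \<noteq> None then snd s (take i w @ drop (Suc i) w) else 0)"

text \<open>\<open>\<sigma> \<circ> \<tau> = pr\<^sub>1\<^sup>*\<sigma> + pr\<^sub>2\<^sup>*\<tau>\<close>.\<close>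

definition L_prod :: "'p::ab_group_add cube \<Rightarrow> 'p cube \<Rightarrow> 'p cube" where
  "L_prod s t = (fst s + fst t, \<lambda>w. if length w = fst s + fst t then
       (if None \<in> set (drop (fst s) w) then 0 else snd s (take (fst s) w)) +
       (if None \<in> set (take (fst s) w) then 0 else snd t (drop (fst s) w))
     else 0)"

definition L_degenerate_chains :: "nat \<Rightarrow> ('p::ab_group_add cube \<Rightarrow>\<^sub>0 int) set" where
  "L_degenerate_chains n =
     carrier (free_Abelian_group {L_degen i s | i s. s \<in> L_cubes n \<and> i \<le> fst s})"

definition L_chains :: "nat \<Rightarrow> ('p::ab_group_add cube \<Rightarrow>\<^sub>0 int) set monoid" where
  "L_chains n = free_Abelian_group (L_cubes n) Mod L_degenerate_chains n"

definition L_class :: "nat \<Rightarrow> 'p::ab_group_add cube \<Rightarrow> ('p cube \<Rightarrow>\<^sub>0 int) set" where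
  "L_class n s = L_degenerate_chains n #>\<^bsub>free_Abelian_group (L_cubes n)\<^esub> frag_of s"

definition L_diff ::
    "nat \<Rightarrow> ('p::ab_group_add cube \<Rightarrow>\<^sub>0 int) set \<Rightarrow> ('p cube \<Rightarrow>\<^sub>0 int) set" where
  "L_diff n = the_hom (L_chains n) (L_chains n) (L_cubes n) (L_class n)
     (\<lambda>s. \<Otimes>\<^bsub>L_chains n\<^esub>i\<in>{..<fst s}.
        (L_class n (L_face i False s) \<otimes>\<^bsub>L_chains n\<^esub> inv\<^bsub>L_chains n\<^esub> L_class n (L_face i True s))
          [^]\<^bsub>L_chains n\<^esub> ((-1) ^ Suc i :: int))"

text \<open>The biadditive product determined by \<open>[s][t] = [s \<circ> t]\<close> for cubes \<open>s\<close>, \<open>t\<close>.\<close>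

definition L_mult :: "nat \<Rightarrow> ('p::ab_group_add cube \<Rightarrow>\<^sub>0 int) set
    \<Rightarrow> ('p cube \<Rightarrow>\<^sub>0 int) set \<Rightarrow> ('p cube \<Rightarrow>\<^sub>0 int) set" where
  "L_mult n K K' = the_hom (L_chains n) (L_chains n) (L_cubes n) (L_class n)
     (\<lambda>s. the_hom (L_chains n) (L_chains n) (L_cubes n) (L_class n)
        (\<lambda>t. L_class n (L_prod s t)) K') K"


section \<open>The map \<open>\<kappa>\<^sub>z\<close>\<close>

text \<open>\<open>kappa n z m \<sigma>\<close> is the \<open>m\<close>-cube attached to the \<open>(m+1)\<close>-simplex \<open>\<sigma>\<close>. With
  \<open>x\<^sub>1 = 0\<close> and coordinates \<open>x\<^sub>2,\<dots>,x\<^bsub>m+1\<^esub>\<close> on \<open>I\<^sup>m\<close>, the coordinate \<open>x\<^sub>l\<close> of \<open>w\<close> is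
  \<open>(Some False # w) ! (l - 1)\<close>.\<close>

definition kappa :: "nat \<Rightarrow> ('a chain \<Rightarrow> 'p::ab_group_add) \<Rightarrow> nat
    \<Rightarrow> ((nat \<Rightarrow> real) \<Rightarrow> 'a) \<Rightarrow> 'p cube" where
  "kappa n z m \<sigma> = (m, \<lambda>w.
     let x = (\<lambda>l. (Some False # w) ! (l - 1));
         free = filter (\<lambda>l. x l = None) [1..<m + 2];
         r = Max {l. 1 \<le> l \<and> l < hd free \<and> x l = Some False};
         q = Min (insert (m + 2) {l. last free < l \<and> l \<le> m + 1 \<and> x l = Some False})
     in if w \<notin> cells m n \<or> (\<exists>l. hd free < l \<and> l < last free \<and> x l = Some False) then 0
        else z (frag_of (vertex_face (map (\<lambda>l. l - 1) (r # free @ [q])) \<sigma>)))"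


section \<open>The elements \<open>a(z)\<close> and \<open>1 + u(c,z)\<close>\<close>

text \<open>An element of \<open>A\<^sup>m = \<Prod>\<^bsub>p-q=m\<^esub> Hom(C\<^sub>p(B), C\<^sub>q(L))\<close> is a homomorphism from the total
  group \<^term>\<open>sing_chains B\<close> to \<^term>\<open>L_chains n\<close> lowering degrees by \<open>m\<close>. It is given by
  its values on simplices.\<close>

definition alg_group :: "'a topology \<Rightarrow> nat
    \<Rightarrow> (('a simplex \<Rightarrow>\<^sub>0 int) \<Rightarrow> ('p::ab_group_add cube \<Rightarrow>\<^sub>0 int) set) monoid" where
  "alg_group B n = Hom_group (sing_chains B) (L_chains n)"

definition alg_elt :: "'a topology \<Rightarrow> nat \<Rightarrow> ('a simplex \<Rightarrow> ('p::ab_group_add cube \<Rightarrow>\<^sub>0 int) set)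
    \<Rightarrow> ('a simplex \<Rightarrow>\<^sub>0 int) \<Rightarrow> ('p cube \<Rightarrow>\<^sub>0 int) set" where
  "alg_elt B n h = the_hom (sing_chains B) (L_chains n) (simplices B) frag_of h"

definition alg_one ::
    "'a topology \<Rightarrow> nat \<Rightarrow> ('a simplex \<Rightarrow>\<^sub>0 int) \<Rightarrow> ('p::ab_group_add cube \<Rightarrow>\<^sub>0 int) set" where
  "alg_one B n = alg_elt B n
     (\<lambda>(p, \<sigma>). if p = 0 then L_class n (0, \<lambda>w. 0) else \<one>\<^bsub>L_chains n\<^esub>)"

definition alg_a :: "'a topology \<Rightarrow> nat \<Rightarrow> ('a chain \<Rightarrow> 'p::ab_group_add)
    \<Rightarrow> ('a simplex \<Rightarrow>\<^sub>0 int) \<Rightarrow> ('p cube \<Rightarrow>\<^sub>0 int) set" where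
  "alg_a B n z = alg_elt B n
     (\<lambda>(p, \<sigma>). if Suc n \<le> p then inv\<^bsub>L_chains n\<^esub> L_class n (kappa n z (p - 1) \<sigma>)
       else \<one>\<^bsub>L_chains n\<^esub>)"

definition cylinder :: "'a topology \<Rightarrow> ('a \<times> real) topology" where
  "cylinder B = prod_topology B (top_of_set {0..1})"

definition bar_cochain :: "nat \<Rightarrow> 'a topology \<Rightarrow> ('a chain \<Rightarrow> 'p::ab_group_add)
    \<Rightarrow> ('a \<times> real) chain \<Rightarrow> 'p" where
  "bar_cochain n B c = the_hom (chain_group n (cylinder B)) additive_group
     (singular_simplex_set n (cylinder B)) frag_of
     (\<lambda>\<tau>. if \<tau> ` standard_simplex n \<subseteq> UNIV \<times> {1} then c (frag_of (simplex_map n fst \<tau>)) else 0)"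

definition z_cylinder :: "nat \<Rightarrow> 'a topology \<Rightarrow> ('a chain \<Rightarrow> 'p::ab_group_add)
    \<Rightarrow> ('a chain \<Rightarrow> 'p) \<Rightarrow> ('a \<times> real) chain \<Rightarrow> 'p" where
  "z_cylinder n B c z =
     (\<lambda>x\<in>carrier (chain_group (Suc n) (cylinder B)). z (chain_map (Suc n) fst x))
       \<otimes>\<^bsub>cochain_group (Suc n) (cylinder B)\<^esub> coboundary n (cylinder B) (bar_cochain n B c)"

text \<open>\<open>(\<sigma> \<times> id)(b\<^sub>0,\<dots>,b\<^sub>i,b\<^sub>i',\<dots>,b\<^sub>m')\<close>: the first \<open>i+1\<close> vertices lie over \<open>0\<close>,
  the others over \<open>1\<close>.\<close>

definition prism :: "nat \<Rightarrow> nat \<Rightarrow> ((nat \<Rightarrow> real) \<Rightarrow> 'a) \<Rightarrow> ((nat \<Rightarrow> real) \<Rightarrow> 'a \<times> real)" where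
  "prism i m \<sigma> = (\<lambda>x\<in>standard_simplex (Suc m).
     (\<sigma> (oriented_simplex (Suc m)
           (\<lambda>j k. if k = (if j \<le> i then j else j - 1) then 1 else 0) x),
      \<Sum>j\<in>{Suc i..Suc m}. x j))"

definition alg_u :: "'a topology \<Rightarrow> nat \<Rightarrow> ('a chain \<Rightarrow> 'p::ab_group_add) \<Rightarrow> ('a chain \<Rightarrow> 'p)
    \<Rightarrow> ('a simplex \<Rightarrow>\<^sub>0 int) \<Rightarrow> ('p cube \<Rightarrow>\<^sub>0 int) set" where
  "alg_u B n c z = alg_elt B n
     (\<lambda>(m, \<sigma>). if n \<le> m then
        \<Otimes>\<^bsub>L_chains n\<^esub>i\<in>{..m}. L_class n (kappa n (z_cylinder n B c z) m (prism i m \<sigma>))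
          [^]\<^bsub>L_chains n\<^esub> ((-1) ^ i :: int)
       else \<one>\<^bsub>L_chains n\<^esub>)"


section \<open>The model \<open>Y(B,\<pi>,n)\<close>\<close>

type_synonym ('a, 'p) model =
  "((('a simplex \<Rightarrow>\<^sub>0 int) \<times> ('p cube \<Rightarrow>\<^sub>0 int) set) \<Rightarrow>\<^sub>0 int) set"

definition Y_group :: "'a topology \<Rightarrow> nat \<Rightarrow> ('a, 'p::ab_group_add) model monoid" where
  "Y_group B n = tensor_group (sing_chains B) (L_chains n)"

definition Y_tens :: "'a topology \<Rightarrow> nat \<Rightarrow> ('a simplex \<Rightarrow>\<^sub>0 int)
    \<Rightarrow> ('p::ab_group_add cube \<Rightarrow>\<^sub>0 int) set \<Rightarrow> ('a, 'p) model" where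
  "Y_tens B n = tens (sing_chains B) (L_chains n)"

text \<open>The part of total degree \<open>m\<close>, trivial for \<open>m < 0\<close>.\<close>

definition Y_part :: "'a topology \<Rightarrow> nat \<Rightarrow> int \<Rightarrow> ('a, 'p::ab_group_add) model monoid" where
  "Y_part B n m = subgroup_generated (Y_group B n)
     {Y_tens B n (frag_of s) (L_class n t) | s t.
        s \<in> simplices B \<and> t \<in> L_cubes n \<and> int (fst s) + int (fst t) = m}"

text \<open>Endomorphisms of \<open>Y\<close> are given by their values on \<open>\<sigma>\<^sup>p \<otimes> \<tau>\<close>, where \<open>\<sigma>\<^sup>p\<close> is a
  simplex and \<open>\<tau>\<close> any normalized chain.\<close>

definition Y_hom :: "'a topology \<Rightarrow> nat
    \<Rightarrow> (nat \<Rightarrow> ((nat \<Rightarrow> real) \<Rightarrow> 'a) \<Rightarrow> ('p::ab_group_add cube \<Rightarrow>\<^sub>0 int) set \<Rightarrow> ('a, 'p) model)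
    \<Rightarrow> ('a, 'p) model \<Rightarrow> ('a, 'p) model" where
  "Y_hom B n h = the_hom (Y_group B n) (Y_group B n) (simplices B \<times> carrier (L_chains n))
     (\<lambda>(s, \<tau>). Y_tens B n (frag_of s) \<tau>) (\<lambda>((p, \<sigma>), \<tau>). h p \<sigma> \<tau>)"

definition Y_diff :: "'a topology \<Rightarrow> nat \<Rightarrow> ('a, 'p::ab_group_add) model \<Rightarrow> ('a, 'p) model" where
  "Y_diff B n = Y_hom B n (\<lambda>p \<sigma> \<tau>.
     Y_tens B n (sing_boundary (frag_of (p, \<sigma>))) \<tau> \<otimes>\<^bsub>Y_group B n\<^esub>
     Y_tens B n (frag_of (p, \<sigma>)) (L_diff n \<tau>) [^]\<^bsub>Y_group B n\<^esub> ((-1) ^ p :: int))"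

text \<open>The action of an element \<open>x\<close> of degree \<open>k = |x|\<close>.\<close>

definition Y_act :: "'a topology \<Rightarrow> nat \<Rightarrow> int
    \<Rightarrow> (('a simplex \<Rightarrow>\<^sub>0 int) \<Rightarrow> ('p::ab_group_add cube \<Rightarrow>\<^sub>0 int) set)
    \<Rightarrow> ('a, 'p) model \<Rightarrow> ('a, 'p) model" where
  "Y_act B n k x = Y_hom B n (\<lambda>p \<sigma> \<tau>. \<Otimes>\<^bsub>Y_group B n\<^esub>i\<in>{..p}.
     Y_tens B n (frag_of (i, vertex_face [0..<Suc i] \<sigma>))
         (L_mult n (x (frag_of (p - i, vertex_face [i..<Suc p] \<sigma>))) \<tau>)
       [^]\<^bsub>Y_group B n\<^esub> (if even (k * int i) then 1 else - 1 :: int))"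

definition Yz_diff :: "'a topology \<Rightarrow> nat \<Rightarrow> ('a chain \<Rightarrow> 'p::ab_group_add)
    \<Rightarrow> ('a, 'p) model \<Rightarrow> ('a, 'p) model" where
  "Yz_diff B n z y = Y_diff B n y \<otimes>\<^bsub>Y_group B n\<^esub> Y_act B n 1 (alg_a B n z) y"

definition phi :: "'a topology \<Rightarrow> nat \<Rightarrow> ('a chain \<Rightarrow> 'p::ab_group_add) \<Rightarrow> ('a chain \<Rightarrow> 'p)
    \<Rightarrow> ('a, 'p) model \<Rightarrow> ('a, 'p) model" where
  "phi B n c z = Y_act B n 0 (alg_one B n \<otimes>\<^bsub>alg_group B n\<^esub> alg_u B n c z)"


section \<open>Homology and cohomology of \<open>Y\<^sub>z\<close> with coefficients\<close>

abbreviation YG :: "'a topology \<Rightarrow> nat \<Rightarrow> ('g, 'b) monoid_scheme \<Rightarrow> int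
    \<Rightarrow> ((('a, 'p::ab_group_add) model \<times> 'g) \<Rightarrow>\<^sub>0 int) set monoid" where
  "YG B n G m \<equiv> tensor_group (Y_part B n m) G"

definition YG_diff :: "'a topology \<Rightarrow> nat \<Rightarrow> ('a chain \<Rightarrow> 'p::ab_group_add)
    \<Rightarrow> ('g, 'b) monoid_scheme \<Rightarrow> int
    \<Rightarrow> ((('a, 'p) model \<times> 'g) \<Rightarrow>\<^sub>0 int) set \<Rightarrow> ((('a, 'p) model \<times> 'g) \<Rightarrow>\<^sub>0 int) set" where
  "YG_diff B n z G m = tensor_map (Y_part B n m) (Y_part B n (m - 1)) G (Yz_diff B n z)"

definition YG_cycles :: "'a topology \<Rightarrow> nat \<Rightarrow> ('a chain \<Rightarrow> 'p::ab_group_add)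
    \<Rightarrow> ('g, 'b) monoid_scheme \<Rightarrow> int \<Rightarrow> ((('a, 'p) model \<times> 'g) \<Rightarrow>\<^sub>0 int) set set" where
  "YG_cycles B n z G m = kernel (YG B n G m) (YG B n G (m - 1)) (YG_diff B n z G m)"

definition Y_homology :: "'a topology \<Rightarrow> nat \<Rightarrow> ('a chain \<Rightarrow> 'p::ab_group_add)
    \<Rightarrow> ('g, 'b) monoid_scheme \<Rightarrow> int \<Rightarrow> ((('a, 'p) model \<times> 'g) \<Rightarrow>\<^sub>0 int) set set monoid" where
  "Y_homology B n z G m = homology_at (YG B n G (m + 1)) (YG_diff B n z G (m + 1))
     (YG B n G m) (YG_diff B n z G m) (YG B n G (m - 1))"

definition Y_homology_class :: "'a topology \<Rightarrow> nat \<Rightarrow> ('a chain \<Rightarrow> 'p::ab_group_add)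
    \<Rightarrow> ('g, 'b) monoid_scheme \<Rightarrow> int
    \<Rightarrow> ((('a, 'p) model \<times> 'g) \<Rightarrow>\<^sub>0 int) set \<Rightarrow> ((('a, 'p) model \<times> 'g) \<Rightarrow>\<^sub>0 int) set set" where
  "Y_homology_class B n z G m y =
     homology_class (YG B n G (m + 1)) (YG_diff B n z G (m + 1)) (YG B n G m) y"

abbreviation HomYG :: "'a topology \<Rightarrow> nat \<Rightarrow> ('g, 'b) monoid_scheme \<Rightarrow> int
    \<Rightarrow> (('a, 'p::ab_group_add) model \<Rightarrow> 'g) monoid" where
  "HomYG B n G m \<equiv> Hom_group (Y_part B n m) G"

definition HomYG_diff :: "'a topology \<Rightarrow> nat \<Rightarrow> ('a chain \<Rightarrow> 'p::ab_group_add) \<Rightarrow> int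
    \<Rightarrow> (('a, 'p) model \<Rightarrow> 'g) \<Rightarrow> (('a, 'p) model \<Rightarrow> 'g)" where
  "HomYG_diff B n z m f = (\<lambda>y\<in>carrier (Y_part B n (m + 1)). f (Yz_diff B n z y))"

definition HomYG_cocycles :: "'a topology \<Rightarrow> nat \<Rightarrow> ('a chain \<Rightarrow> 'p::ab_group_add)
    \<Rightarrow> ('g, 'b) monoid_scheme \<Rightarrow> int \<Rightarrow> (('a, 'p) model \<Rightarrow> 'g) set" where
  "HomYG_cocycles B n z G m = kernel (HomYG B n G m) (HomYG B n G (m + 1)) (HomYG_diff B n z m)"

definition Y_cohomology :: "'a topology \<Rightarrow> nat \<Rightarrow> ('a chain \<Rightarrow> 'p::ab_group_add)
    \<Rightarrow> ('g, 'b) monoid_scheme \<Rightarrow> int \<Rightarrow> (('a, 'p) model \<Rightarrow> 'g) set monoid" where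
  "Y_cohomology B n z G m = homology_at (HomYG B n G (m - 1)) (HomYG_diff B n z (m - 1))
     (HomYG B n G m) (HomYG_diff B n z m) (HomYG B n G (m + 1))"

definition Y_cohomology_class :: "'a topology \<Rightarrow> nat \<Rightarrow> ('a chain \<Rightarrow> 'p::ab_group_add)
    \<Rightarrow> ('g, 'b) monoid_scheme \<Rightarrow> int
    \<Rightarrow> (('a, 'p) model \<Rightarrow> 'g) \<Rightarrow> (('a, 'p) model \<Rightarrow> 'g) set" where
  "Y_cohomology_class B n z G m f =
     homology_class (HomYG B n G (m - 1)) (HomYG_diff B n z (m - 1)) (HomYG B n G m) f"

definition phi_tensor :: "'a topology \<Rightarrow> nat \<Rightarrow> ('a chain \<Rightarrow> 'p::ab_group_add)
    \<Rightarrow> ('a chain \<Rightarrow> 'p) \<Rightarrow> ('g, 'b) monoid_scheme \<Rightarrow> int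
    \<Rightarrow> ((('a, 'p) model \<times> 'g) \<Rightarrow>\<^sub>0 int) set \<Rightarrow> ((('a, 'p) model \<times> 'g) \<Rightarrow>\<^sub>0 int) set" where
  "phi_tensor B n c z G m = tensor_map (Y_part B n m) (Y_part B n m) G (phi B n c z)"

definition phi_dual :: "'a topology \<Rightarrow> nat \<Rightarrow> ('a chain \<Rightarrow> 'p::ab_group_add)
    \<Rightarrow> ('a chain \<Rightarrow> 'p) \<Rightarrow> int \<Rightarrow> (('a, 'p) model \<Rightarrow> 'g) \<Rightarrow> (('a, 'p) model \<Rightarrow> 'g)" where
  "phi_dual B n c z m f = (\<lambda>y\<in>carrier (Y_part B n m). f (phi B n c z y))"

end

theory Submission
 imports Defs "HOL-Library.Function_Algebras"
begin

text \<open>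
Fix a simplex \<open>\<sigma>\<close> of \<open>B\<close>. A cocycle of \<open>B\<close> restricts to a function \<open>\<zeta>\<close> on the vertex lists of
\<open>\<sigma>\<close>, and \<open>a(z)\<close>, \<open>u(c, z)\<close> become cochains on vertex lists with values in the ring of
cubical chains. The cubes \<open>\<kappa>\<close> are built so that a face at \<open>0\<close> is a product of the cubes of a front
and a back list, and a face at \<open>1\<close> is the cube of the list without an inner vertex. Hence, after
subtraction from the unit cochain on edges, they form a twisting cochain \<open>a\<close>, a solution of
\<open>d a + \<delta> a \<plusminus> a \<union> a = 0\<close> (\<open>twisting_twist_cochain\<close>). That is all the differential of the model
needs in order to square to zero.

This holds for every space, in particular for \<open>B \<times> I\<close> and for \<open>B\<close> times a triangle, with \<open>z\<close>
changed there by a coboundary. Summing the equation over the simplices of a prism and using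
Stokes' formula shows that \<open>1 + u(c, z)\<close> is a gauge transformation of \<open>a\<close>
(\<open>prism_gauge\<close>), so \<open>\<phi>\<close> is a chain map. Summing over the product with a triangle gives a homotopy
between the product of the gauge transformations of two edges and that of the third one
(\<open>triangle_gauge_homotopy\<close>). A suitable cochain on the triangle yields
\<open>\<phi>\<^sub>c \<phi>\<^sub>c\<^sub>' \<simeq> \<phi>\<^bsub>c + c'\<^esub>\<close>, another one yields \<open>\<phi>\<^bsub>\<delta>b\<^esub> \<phi>\<^sub>0 \<simeq> \<phi>\<^sub>0\<close>.

The map \<open>\<phi>\<^sub>0\<close> need not be the identity: degenerate simplices of the cylinder contribute to it. But
\<open>\<phi>\<^sub>0\<close> differs from the identity by an operator that lowers the dimension of the simplex factor,
so it is unipotent in each degree; being idempotent on homology, it is the identity there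
(\<open>homology_action\<close>). So the classes act by a group homomorphism. Chain homotopies and nilpotent
operators survive tensoring with \<open>G\<close> and passing to \<open>Hom(-, G)\<close>, where the order of composition
is reversed; that does no harm, since \<open>H\<^sup>n(B, \<pi>)\<close> is commutative.

To compare this with the model, an operator on \<open>C\<^sub>*(B) \<otimes> C\<^sub>*(L)\<close> is described by a family
indexed by a simplex and a list of its vertices that is natural for passing to faces. On such
families composition of operators turns into right cup products, so each identity on the model
is an identity of cochains on vertex lists. The model is a quotient of the free group on
pairs of a simplex and a cube (\<open>model_class\<close>), and the operators descend to it (\<open>realizes\<close>).
\<close>

section \<open>Cochains on vertex lists\<close>

definition cone_at :: "'v => ('v list => 'w) => 'v list => 'w" where
 "cone_at v f = (\<lambda>l. f (v # l))"

text \<open>Stripping the first vertex makes the inductions short; \<open>cobd_sum\<close> is the usual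
 alternating sum over the omitted vertices.\<close>

fun cobd :: "('v list => 'w::ab_group_add) => 'v list => 'w" where
 "cobd f [] = 0"
| "cobd f (v # l) = f l - cobd (cone_at v f) l"

text \<open>The front and the back part share a vertex, and \<open>b\<close> multiplies their values. No
 sign is built in: signs are carried by \<open>alt\<close>.\<close>

fun cup :: "('u::ab_group_add => 'r::ab_group_add => 'w::ab_group_add) => ('v list => 'u) => ('v list => 'r) => 'v list => 'w" where
 "cup b f g [] = 0"
| "cup b f g (v # l) = b (f [v]) (g (v # l)) + cup b (cone_at v f) g l"

text \<open>The sign of the dimension, which is one less than the number of vertices.\<close>

definition alt :: "('v list => 'w::ab_group_add) => 'v list => 'w" where
 "alt f l = signed (Suc (length l)) (f l)"

text \<open>The alternating sum over the standard triangulation of the prism between the copies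
 \<open>g0\<close> and \<open>g1\<close> of the list; \<open>prism_sum_paths\<close> is its closed
 form.\<close>

fun prism_sum :: "('v => 'v1) => ('v => 'v1) => ('v1 list => 'w::ab_group_add) => 'v list => 'w" where
 "prism_sum g0 g1 f [] = 0"
| "prism_sum g0 g1 f (v # l) =
  f (g0 v # g1 v # map g1 l) - prism_sum g0 g1 (cone_at (g0 v) f) l"

text \<open>The analogue for the product with a triangle: the paths from the copy \<open>g0\<close>
 through \<open>g1\<close> to \<open>g2\<close>.\<close>

fun triangle_sum :: "('v => 'v1) => ('v => 'v1) => ('v => 'v1) => ('v1 list => 'w::ab_group_add)
  => 'v list => 'w" where
 "triangle_sum g0 g1 g2 f [] = 0"
| "triangle_sum g0 g1 g2 f (v # l) =
  prism_sum g1 g2 (cone_at (g0 v) f) (v # l) + triangle_sum g0 g1 g2 (cone_at (g0 v) f) l"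

lemma cone_at_apply: "cone_at v f l = f (v # l)"
 and cone_at_Nil [simp]: "cone_at v f [] = f [v]"
 and cone_at_Cons [simp]: "cone_at v f (u # l) = f (v # u # l)"
 by (simp_all add: cone_at_def)

lemma cone_at_add [simp]: "cone_at v (f + g) = cone_at v f + cone_at v g"
 and cone_at_diff [simp]: "cone_at v (f - g) = cone_at v f - cone_at v g"
 and cone_at_uminus [simp]: "cone_at v (- f) = - cone_at v f"
 and cone_at_zero [simp]: "cone_at v 0 = 0"
 by (auto simp: fun_eq_iff cone_at_apply)

lemma signed_add [simp]: "signed k (x + y) = signed k x + signed k y"
 and signed_diff: "signed k (x - y) = signed k x - signed k y"
 and signed_uminus: "signed k (- x) = - signed k x"
 and signed_zero [simp]: "signed k 0 = 0"
 and signed_Suc [simp]: "signed (Suc k) x = - signed k x"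
 and signed_0 [simp]: "signed 0 x = x"
 by (auto simp: signed_def)

lemma signed_signed: "signed j (signed k x) = signed (j + k) x"
 by (auto simp: signed_def)

lemma signed_twice [simp]: "signed k (signed k x) = x"
 by (auto simp: signed_def)

lemma cone_at_alt [simp]: "cone_at v (alt f) = - alt (cone_at v f)"
 by (auto simp: fun_eq_iff cone_at_apply alt_def)

lemma alt_add: "alt (f + g) = alt f + alt g"
 and alt_diff: "alt (f - g) = alt f - alt g"
 and alt_uminus: "alt (- f) = - alt f"
 and alt_zero [simp]: "alt 0 = 0"
 and alt_alt [simp]: "alt (alt f) = f"
 by (auto simp: fun_eq_iff cone_at_apply alt_def signed_diff signed_uminus)

lemma additive_zero:
 fixes h :: "'u::ab_group_add => 'w::ab_group_add"
 assumes "\<And>x y. h (x + y) = h x + h y"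
 shows "h 0 = 0" "h (- x) = - h x" "h (x - y) = h x - h y" "h (signed k x) = signed k (h x)"
proof -
 interpret Modules.additive h
  by (standard) (rule assms)
 show "h 0 = 0" "h (- x) = - h x" "h (x - y) = h x - h y"
  by (auto simp: zero minus diff)
 then show "h (signed k x) = signed k (h x)"
  by (simp add: signed_def)
qed

lemma cobd_add: "cobd (f + g) = cobd f + cobd g"
proof -
 have "cobd (f + g) l = cobd f l + cobd g l" for l
  by (induction l arbitrary: f g) auto
 then show ?thesis by (simp add: fun_eq_iff cone_at_apply)
qed

lemma cobd_zero [simp]: "cobd 0 = 0"
 and cobd_uminus: "cobd (- f) = - cobd f"
 and cobd_diff: "cobd (f - g) = cobd f - cobd g"
 using additive_zero[of cobd, OF cobd_add] by auto

lemma cone_at_cobd: "cone_at v (cobd f) = f - cobd (cone_at v f)"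
 by (simp add: fun_eq_iff cone_at_apply)

lemma cobd_cobd: "cobd (cobd f) = 0"
proof -
 have "cobd (cobd f) l = 0" for l
  by (induction l arbitrary: f) (auto simp: cone_at_cobd cobd_diff)
 then show ?thesis by (simp add: fun_eq_iff cone_at_apply)
qed

lemma cobd_alt: "cobd (alt f) = - alt (cobd f)"
proof -
 have "cobd (alt f) l = - alt (cobd f) l" for l
  by (induction l arbitrary: f)
   (auto simp: cobd_uminus, auto simp: alt_def signed_diff)
 then show ?thesis by (simp add: fun_eq_iff cone_at_apply)
qed

lemma cobd_map: "cobd f (map h l) = cobd (\<lambda>l. f (map h l)) l"
proof (induction l arbitrary: f)
 case (Cons a l)
 show ?case by (simp add: Cons cone_at_def)
qed simp

lemma cobd_cong:
 assumes "\<And>l'. [|set l' \<subseteq> set l; Suc (length l') = length l|] ==> f l' = g l'"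
 shows "cobd f l = cobd g l"
 using assms
proof (induction l arbitrary: f g)
 case (Cons a l)
 have "cobd (cone_at a f) l = cobd (cone_at a g) l"
 proof (rule Cons.IH)
  show "cone_at a f l' = cone_at a g l'"
   if "set l' \<subseteq> set l" "Suc (length l') = length l" for l'
   using Cons.prems[of "a # l'"] that by (auto simp: cone_at_apply)
 qed
 with Cons.prems[of l] show ?case by auto
qed simp

lemma cobd_additive:
 fixes h :: "'u::ab_group_add => 'w::ab_group_add"
 assumes "\<And>x y. h (x + y) = h x + h y"
 shows "cobd (\<lambda>l. h (f l)) l = h (cobd f l)"
proof (induction l arbitrary: f)
 case (Cons a l)
 show ?case by (simp add: Cons cone_at_def additive_zero[of h, OF assms])
qed (simp add: additive_zero[of h, OF assms])

lemma cobd_sum: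
 "cobd f l = (\<Sum>j<length l. signed j (f (take j l @ drop (Suc j) l)))"
proof (induction l arbitrary: f)
 case (Cons a l)
 show ?case
  by (simp add: Cons cone_at_apply sum.lessThan_Suc_shift sum_negf del: sum.lessThan_Suc)
qed simp

lemma cup_sum:
 "cup b f g l = (\<Sum>j<length l. b (f (take (Suc j) l)) (g (drop j l)))"
proof (induction l arbitrary: f)
 case (Cons a l)
 show ?case
  by (simp add: Cons cone_at_apply sum.lessThan_Suc_shift del: sum.lessThan_Suc)
qed simp

lemma cup_map: "cup b f g (map h l) = cup b (\<lambda>l. f (map h l)) (\<lambda>l. g (map h l)) l"
 by (simp add: cup_sum take_map drop_map)

lemma cup_add_right:
 assumes "\<And>l r r'. b (f l) (r + r') = b (f l) r + b (f l) r'"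
 shows "cup b f (g + g') = cup b f g + cup b f g'"
  and "cup b f (- g) = - cup b f g"
  and "cup b f (g - g') = cup b f g - cup b f g'"
  and "cup b f 0 = 0"
proof -
 have b: "b (f l) 0 = 0" "b (f l) (- r) = - b (f l) r" "b (f l) (r - r') = b (f l) r - b (f l) r'" for l r r'
  using additive_zero[of "b (f l)", OF assms] by auto
 show "cup b f (g + g') = cup b f g + cup b f g'" "cup b f (- g) = - cup b f g"
   "cup b f (g - g') = cup b f g - cup b f g'" "cup b f 0 = 0"
  by (auto simp: fun_eq_iff cone_at_apply cup_sum assms b sum.distrib sum_negf sum_subtractf)
qed

lemma cup_add_left:
 assumes "\<And>h h' r. b (h + h') r = b h r + b h' r"
 shows "cup b (f + f') g = cup b f g + cup b f' g"
  and "cup b (- f) g = - cup b f g"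
  and "cup b (f - f') g = cup b f g - cup b f' g"
  and "cup b 0 g = 0"
proof -
 have b: "b 0 r = 0" "b (- h) r = - b h r" "b (h - h') r = b h r - b h' r" for h h' r
  using additive_zero[of "%h. b h r", OF assms] by auto
 show "cup b (f + f') g = cup b f g + cup b f' g" "cup b (- f) g = - cup b f g"
   "cup b (f - f') g = cup b f g - cup b f' g" "cup b 0 g = 0"
  by (auto simp: fun_eq_iff cone_at_apply cup_sum assms b sum.distrib sum_negf sum_subtractf)
qed

lemma alt_cup:
 fixes b :: "'u::ab_group_add => 'r::ab_group_add => 'w::ab_group_add"
 assumes "\<And>h h' r. b (h + h') r = b h r + b h' r"
  and "\<And>l r r'. b (f l) (r + r') = b (f l) r + b (f l) r'"
 shows "alt (cup b f g) = cup b (alt f) (alt g)"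
proof -
 have s1: "b (signed k h) r = signed k (b h r)" for k h r
  using additive_zero(4)[of "%h. b h r", OF assms(1)] by auto
 have s2: "b (f l) (signed k r) = signed k (b (f l) r)" for k l r
  using additive_zero(4)[of "b (f l)", OF assms(2)] by auto
 have "signed (Suc (length l)) (b (f (take (Suc j) l)) (g (drop j l)))
   = b (alt f (take (Suc j) l)) (alt g (drop j l))" if "j < length l" for j l
 proof -
  have "signed (Suc (length l)) x = signed (Suc (Suc j) + Suc (length l - j)) x" for x :: 'w
   using that by (auto simp: signed_def)
  moreover have "min (length l) (Suc j) = Suc j"
   using that by auto
  ultimately show ?thesis
   unfolding alt_def s1 s2 signed_signed length_take length_drop by auto
 qed
 moreover have "signed k (\<Sum>j\<in>A. h j) = (\<Sum>j\<in>A. signed k (h j))" for k A and h :: "nat => 'w"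
  by (auto simp: signed_def sum_negf)
 ultimately have "signed (Suc (length l)) (\<Sum>j<length l. b (f (take (Suc j) l)) (g (drop j l)))
   = (\<Sum>j<length l. b (alt f (take (Suc j) l)) (alt g (drop j l)))" for l
  by (simp del: signed_Suc)
 then show ?thesis
  unfolding fun_eq_iff cup_sum alt_def[of "cup b f g"] by blast
qed

lemma cone_at_cup:
 "cone_at v (cup b f g) = (\<lambda>l. b (f [v]) (cone_at v g l)) + cup b (cone_at v f) g"
 by (auto simp: fun_eq_iff cone_at_apply)

text \<open>The Leibniz rule holds on the nose because the last face of the front part cancels the first
 face of the back part.\<close>

lemma cobd_cup:
 assumes left: "\<And>h h' r. b (h + h') r = b h r + b h' r"
  and right: "\<And>l r r'. b (f l) (r + r') = b (f l) r + b (f l) r'"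
  and "f [] = 0" "g [] = 0"
 shows "cobd (cup b f g) = cup b (cobd f) g + cup b (alt f) (cobd g)"
proof -
 have "cobd (cup b f g) l = cup b (cobd f) g l + cup b (alt f) (cobd g) l - b (f []) (g l)" for l
  using right
 proof (induction l arbitrary: f)
  case Nil
  then show ?case
   using \<open>g [] = 0\<close> additive_zero(1)[of "b (f [])"] by simp
 next
  case (Cons v l)
  have IH: "cobd (cup b (cone_at v f) g) l = cup b (cobd (cone_at v f)) g l
    + cup b (alt (cone_at v f)) (cobd g) l - b (f [v]) (g l)"
  proof -
   have "b (cone_at v f l) (r + r') = b (cone_at v f l) r + b (cone_at v f l) r'" for l r r'
    unfolding cone_at_apply by (rule Cons.prems)
   from Cons.IH[of "cone_at v f", OF this] show ?thesis by simp
  qed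
  have "b (f [v]) (g l - r) = b (f [v]) (g l) - b (f [v]) r" for r
   using additive_zero(3)[of "b (f [v])", OF Cons.prems] by auto
  then show ?case
   using left
   by (simp add: cone_at_cup cobd_add IH cobd_additive[of "b (f [v])", OF Cons.prems]
     cone_at_cobd cup_add_left[OF left] alt_def[of _ "[_]"] del: signed_Suc)
    (simp add: signed_def)
 qed
 moreover have "b 0 r = 0" for r
  using additive_zero(1)[of "%h. b h r", OF left] by auto
 ultimately show ?thesis
  using \<open>f [] = 0\<close> by (auto simp: fun_eq_iff cone_at_apply)
qed

text \<open>Stated for a right action \<open>b\<close> of a ring, so that it serves both for ring valued
 cochains and for families of maps into a module.\<close>

lemma cup_assoc:
 fixes f :: "'v list => 'u::ab_group_add" and x y :: "'v list => 'r::ring_1"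
 assumes left: "\<And>h h' r. b (h + h') r = b h r + b h' r"
  and right: "\<And>l r r'. b (f l) (r + r') = b (f l) r + b (f l) r'"
  and assoc: "\<And>h r s. b (b h r) s = b h (r * s)"
 shows "cup b (cup b f x) y = cup b f (cup ((*) :: 'r => 'r => 'r) x y)"
proof -
 have shift: "cup b (%l. b (f k) (x l)) y l = b (f k) (cup (*) x y l)"
  if "!!l r r'. b (f l) (r + r') = b (f l) r + b (f l) r'"
  for f :: "'v list => 'u" and x :: "'v list => 'r" and l k
 proof -
  have "b (f k) (\<Sum>j\<in>A. h j) = (\<Sum>j\<in>A. b (f k) (h j))" if "finite A" for A :: "nat set" and h
   using that
   by (induction A) (auto simp: additive_zero(1)[of "b (f k)"] \<open>!!l r r'. b (f l) (r + r') = b (f l) r + b (f l) r'\<close>)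
  then show ?thesis
   by (simp add: cup_sum assoc)
 qed
 have "cup b (cup b f x) y l = cup b f (cup (*) x y) l" for l
  using right
 proof (induction l arbitrary: f)
  case (Cons v l)
  have "cup b (cup b (cone_at v f) x) y l = cup b (cone_at v f) (cup (*) x y) l"
   by (rule Cons.IH) (simp only: cone_at_apply Cons.prems)
  with shift[of f "[v]" "cone_at v x" l, OF Cons.prems] show ?case
   by (simp add: cone_at_cup cup_add_left[OF left] assoc Cons.prems)
 qed simp
 then show ?thesis by (simp add: fun_eq_iff cone_at_apply)
qed

section \<open>Sums over prisms and over triangles\<close>

lemma prism_sum_add: "prism_sum g0 g1 (f + g) = prism_sum g0 g1 f + prism_sum g0 g1 g"
proof -
 have "prism_sum g0 g1 (f + g) l = prism_sum g0 g1 f l + prism_sum g0 g1 g l" for l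
  by (induction l arbitrary: f g) auto
 then show ?thesis by (simp add: fun_eq_iff cone_at_apply)
qed

lemma prism_sum_zero [simp]: "prism_sum g0 g1 0 = 0"
 and prism_sum_uminus: "prism_sum g0 g1 (- f) = - prism_sum g0 g1 f"
 and prism_sum_diff: "prism_sum g0 g1 (f - g) = prism_sum g0 g1 f - prism_sum g0 g1 g"
 using additive_zero[of "prism_sum g0 g1", OF prism_sum_add] by auto

lemma prism_sum_alt: "prism_sum g0 g1 (alt f) = - alt (prism_sum g0 g1 f)"
proof -
 have "prism_sum g0 g1 (alt f) l = - alt (prism_sum g0 g1 f) l" for l
  by (induction l arbitrary: f)
   (auto simp: prism_sum_uminus, auto simp: alt_def signed_diff)
 then show ?thesis by (simp add: fun_eq_iff cone_at_apply)
qed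

lemma prism_sum_additive:
 fixes h :: "'u::ab_group_add => 'w::ab_group_add"
 assumes "\<And>x y. h (x + y) = h x + h y"
 shows "prism_sum g0 g1 (\<lambda>l. h (f l)) l = h (prism_sum g0 g1 f l)"
proof (induction l arbitrary: f)
 case (Cons a l)
 show ?case by (simp add: Cons cone_at_def additive_zero[of h, OF assms])
qed (simp add: additive_zero[of h, OF assms])

lemma prism_sum_cong:
 assumes "\<And>l'. [|set l' \<subseteq> g0 ` set l \<union> g1 ` set l; length l' = Suc (length l)|] ==> f l' = f' l'"
 shows "prism_sum g0 g1 f l = prism_sum g0 g1 f' l"
 using assms
proof (induction l arbitrary: f f')
 case (Cons a l)
 have "prism_sum g0 g1 (cone_at (g0 a) f) l = prism_sum g0 g1 (cone_at (g0 a) f') l"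
 proof (rule Cons.IH)
  show "cone_at (g0 a) f l' = cone_at (g0 a) f' l'"
   if "set l' \<subseteq> g0 ` set l \<union> g1 ` set l" "length l' = Suc (length l)" for l'
   using Cons.prems[of "g0 a # l'"] that by (auto simp: cone_at_apply)
 qed
 moreover have "f (g0 a # g1 a # map g1 l) = f' (g0 a # g1 a # map g1 l)"
  by (rule Cons.prems) auto
 ultimately show ?case by simp
qed simp

lemma prism_sum_map_out:
 "prism_sum (\<lambda>v. h (g0 v)) (\<lambda>v. h (g1 v)) f l = prism_sum g0 g1 (\<lambda>l. f (map h l)) l"
proof (induction l arbitrary: f)
 case (Cons a l)
 show ?case by (simp add: Cons cone_at_def comp_def)
qed simp

lemma prism_sum_map:
 "prism_sum g0 g1 f (map h l) = prism_sum (\<lambda>v. g0 (h v)) (\<lambda>v. g1 (h v)) f l"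
 by (induction l arbitrary: f) (auto simp: comp_def)

text \<open>Stokes' formula for the prism: the inner faces cancel in pairs and the two ends
 remain.\<close>

lemma prism_sum_cobd:
 "prism_sum g0 g1 (cobd f) = (\<lambda>l. f (map g1 l)) - (\<lambda>l. f (map g0 l)) - cobd (prism_sum g0 g1 f)"
proof -
 have "prism_sum g0 g1 (cobd f) l = f (map g1 l) - f (map g0 l) - cobd (prism_sum g0 g1 f) l" for l
 proof (induction l arbitrary: f)
  case (Cons v l)
  have "cone_at v (prism_sum g0 g1 f)
    = (%l. f (g0 v # g1 v # map g1 l)) - prism_sum g0 g1 (cone_at (g0 v) f)"
   by (simp add: fun_eq_iff cone_at_apply)
  moreover have "cobd (%l. f (g0 v # g1 v # map g1 l)) l = cobd (cone_at (g1 v) (cone_at (g0 v) f)) (map g1 l)"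
   by (simp add: cobd_map cone_at_def)
  ultimately show ?case
   by (simp add: cone_at_cobd cobd_diff prism_sum_diff Cons cone_at_apply[of _ _ "map _ _"])
 qed simp
 then show ?thesis by (simp add: fun_eq_iff cone_at_apply)
qed

text \<open>A path in the prism changes level once, either before or after the shared vertex; the other
 factor then sees only one end.\<close>

lemma prism_sum_cup:
 assumes left: "\<And>h h' r. b (h + h') r = b h r + b h' r"
  and right: "\<And>l r r'. b (f l) (r + r') = b (f l) r + b (f l) r'"
 shows "prism_sum g0 g1 (cup b f g)
  = cup b (alt (\<lambda>l. f (map g0 l))) (prism_sum g0 g1 g)
   + cup b (prism_sum g0 g1 f) (\<lambda>l. g (map g1 l))"
proof -
 have "prism_sum g0 g1 (cup b f g) l
   = cup b (alt (%l. f (map g0 l))) (prism_sum g0 g1 g) l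
   + cup b (prism_sum g0 g1 f) (%l. g (map g1 l)) l" for l
  using right
 proof (induction l arbitrary: f)
  case (Cons v l)
  let ?F = "cone_at (g0 v) f"
  have IH: "prism_sum g0 g1 (cup b ?F g) l = cup b (alt (%l. ?F (map g0 l))) (prism_sum g0 g1 g) l
   + cup b (prism_sum g0 g1 ?F) (%l. g (map g1 l)) l"
   by (rule Cons.IH) (simp only: cone_at_apply Cons.prems)
  have 1: "cone_at v (prism_sum g0 g1 f) = (%l. f (g0 v # g1 v # map g1 l)) - prism_sum g0 g1 ?F"
   by (simp add: fun_eq_iff cone_at_apply)
  have 2: "cup b (%l. f (g0 v # g1 v # map g1 l)) (%l. g (map g1 l)) l
    = cup b (cone_at (g1 v) ?F) g (map g1 l)"
   by (simp add: cup_map cone_at_def)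
  have 3: "cone_at v (%l. f (map g0 l)) = (%l. ?F (map g0 l))"
   by (simp add: fun_eq_iff cone_at_apply)
  have 4: "alt (%l. f (map g0 l)) [v] = f [g0 v]"
   by (simp add: alt_def)
  have 5: "b (f [g0 v]) (r - r') = b (f [g0 v]) r - b (f [g0 v]) r'" for r r'
   using additive_zero(3)[of "b (f [g0 v])", OF Cons.prems] by auto
  show ?case
   by (simp add: cone_at_cup prism_sum_add IH 1 2 3 4 5 cup_add_left[OF left]
     prism_sum_additive[of "b (f [g0 v])", OF Cons.prems])
 qed simp
 then show ?thesis by (simp add: fun_eq_iff cone_at_apply)
qed

lemma triangle_sum_add:
 "triangle_sum g0 g1 g2 (f + g) = triangle_sum g0 g1 g2 f + triangle_sum g0 g1 g2 g"
proof -
 have "triangle_sum g0 g1 g2 (f + g) l = triangle_sum g0 g1 g2 f l + triangle_sum g0 g1 g2 g l" for l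
  by (induction l arbitrary: f g) (auto simp: prism_sum_add)
 then show ?thesis by (simp add: fun_eq_iff cone_at_apply)
qed

lemma triangle_sum_zero [simp]: "triangle_sum g0 g1 g2 0 = 0"
 and triangle_sum_uminus: "triangle_sum g0 g1 g2 (- f) = - triangle_sum g0 g1 g2 f"
 and triangle_sum_diff: "triangle_sum g0 g1 g2 (f - g) = triangle_sum g0 g1 g2 f - triangle_sum g0 g1 g2 g"
 using additive_zero[of "triangle_sum g0 g1 g2", OF triangle_sum_add] by auto

lemma triangle_sum_alt: "triangle_sum g0 g1 g2 (alt f) = alt (triangle_sum g0 g1 g2 f)"
proof -
 have "triangle_sum g0 g1 g2 (alt f) l = alt (triangle_sum g0 g1 g2 f) l" for l
 proof (induction l arbitrary: f)
  case (Cons v l)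
  have "alt (triangle_sum g0 g1 g2 f) (v # l) = alt (prism_sum g1 g2 (cone_at (g0 v) f)) (v # l)
   - alt (triangle_sum g0 g1 g2 (cone_at (g0 v) f)) l"
   by (simp add: alt_def signed_diff del: prism_sum.simps)
  then show ?case
   by (simp add: Cons prism_sum_alt prism_sum_uminus triangle_sum_uminus del: prism_sum.simps)
 qed (simp add: alt_def)
 then show ?thesis by (simp add: fun_eq_iff cone_at_apply)
qed

lemma triangle_sum_additive:
 fixes h :: "'u::ab_group_add => 'w::ab_group_add"
 assumes "\<And>x y. h (x + y) = h x + h y"
 shows "triangle_sum g0 g1 g2 (\<lambda>l. h (f l)) l = h (triangle_sum g0 g1 g2 f l)"
proof (induction l arbitrary: f)
 case (Cons a l)
 show ?case
  by (simp add: Cons cone_at_def prism_sum_additive[of h, OF assms] assms del: prism_sum.simps)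
qed (simp add: additive_zero[of h, OF assms])

lemma triangle_sum_map_out:
 "triangle_sum (\<lambda>v. h (g0 v)) (\<lambda>v. h (g1 v)) (\<lambda>v. h (g2 v)) f l
  = triangle_sum g0 g1 g2 (\<lambda>l. f (map h l)) l"
proof (induction l arbitrary: f)
 case (Cons a l)
 show ?case by (simp add: Cons cone_at_def prism_sum_map_out del: prism_sum.simps)
qed simp

lemma triangle_sum_map:
 "triangle_sum g0 g1 g2 f (map h l)
  = triangle_sum (\<lambda>v. g0 (h v)) (\<lambda>v. g1 (h v)) (\<lambda>v. g2 (h v)) f l"
proof (induction l arbitrary: f)
 case (Cons a l)
 then show ?case
  using prism_sum_map[of g1 g2 "cone_at (g0 (h a)) f" h "a # l"] by (simp del: prism_sum.simps)
qed simp

text \<open>Stokes' formula: the faces over the boundary of the triangle form three prisms, one for each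
 edge.\<close>

lemma triangle_sum_cobd:
 "triangle_sum g0 g1 g2 (cobd f) = cobd (triangle_sum g0 g1 g2 f)
  + prism_sum g1 g2 f - prism_sum g0 g2 f + prism_sum g0 g1 f"
proof -
 have "triangle_sum g0 g1 g2 (cobd f) l = cobd (triangle_sum g0 g1 g2 f) l
  + prism_sum g1 g2 f l - prism_sum g0 g2 f l + prism_sum g0 g1 f l" for l
 proof (induction l arbitrary: f)
  case (Cons v l)
  let ?F = "cone_at (g0 v) f"
  have 1: "cone_at v (triangle_sum g0 g1 g2 f)
    = cone_at v (prism_sum g1 g2 ?F) + triangle_sum g0 g1 g2 ?F"
   by (simp add: fun_eq_iff cone_at_apply)
  have 2: "prism_sum g1 g2 (cobd ?F) (v # l) =
    ?F (map g2 (v # l)) - ?F (map g1 (v # l)) - cobd (prism_sum g1 g2 ?F) (v # l)"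
   by (simp add: prism_sum_cobd del: prism_sum.simps)
  have 3: "triangle_sum g0 g1 g2 (cobd f) (v # l)
   = prism_sum g1 g2 f (v # l) - prism_sum g1 g2 (cobd ?F) (v # l)
    + (triangle_sum g0 g1 g2 f l - triangle_sum g0 g1 g2 (cobd ?F) l)"
   by (simp add: cone_at_cobd prism_sum_diff triangle_sum_diff del: prism_sum.simps)
  have 4: "cobd (triangle_sum g0 g1 g2 f) (v # l) =
    triangle_sum g0 g1 g2 f l - cobd (cone_at v (prism_sum g1 g2 ?F)) l - cobd (triangle_sum g0 g1 g2 ?F) l"
   by (simp add: 1 cobd_add)
  show ?case
   unfolding 3 4 2 Cons by simp
 qed simp
 then show ?thesis by (simp add: fun_eq_iff cone_at_apply)
qed

text \<open>The two changes of level are distributed over the two factors in three ways; the middle one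
 is a product of two prism sums, the source of composition in
 \<open>triangle_gauge_homotopy\<close>.\<close>

lemma triangle_sum_cup:
 assumes left: "\<And>h h' r. b (h + h') r = b h r + b h' r"
  and right: "\<And>l r r'. b (f l) (r + r') = b (f l) r + b (f l) r'"
 shows "triangle_sum g0 g1 g2 (cup b f g)
  = cup b (\<lambda>l. f (map g0 l)) (triangle_sum g0 g1 g2 g)
   + cup b (alt (prism_sum g0 g1 f)) (prism_sum g1 g2 g)
   + cup b (triangle_sum g0 g1 g2 f) (\<lambda>l. g (map g2 l))"
proof -
 have "triangle_sum g0 g1 g2 (cup b f g) l
  = cup b (%l. f (map g0 l)) (triangle_sum g0 g1 g2 g) l
   + cup b (alt (prism_sum g0 g1 f)) (prism_sum g1 g2 g) l
   + cup b (triangle_sum g0 g1 g2 f) (%l. g (map g2 l)) l" for l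
  using right
 proof (induction l arbitrary: f)
  case (Cons v l)
  let ?F = "cone_at (g0 v) f"
  have R: "b (?F l) (r + r') = b (?F l) r + b (?F l) r'" for l r r'
   unfolding cone_at_apply by (rule Cons.prems)
  note IH = Cons.IH[of ?F, OF R]
  have add: "b (f [g0 v]) (r - r') = b (f [g0 v]) r - b (f [g0 v]) r'"
   "b (f [g0 v]) (r + r') = b (f [g0 v]) r + b (f [g0 v]) r'" for r r'
   using additive_zero(3)[of "b (f [g0 v])", OF Cons.prems] Cons.prems by auto
  have 1: "triangle_sum g0 g1 g2 (cup b f g) (v # l)
   = b (f [g0 v]) (triangle_sum g0 g1 g2 g (v # l))
    + prism_sum g1 g2 (cup b ?F g) (v # l) + triangle_sum g0 g1 g2 (cup b ?F g) l"
   by (simp add: cone_at_cup prism_sum_add triangle_sum_add add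
     prism_sum_additive[of "b (f [g0 v])", OF Cons.prems]
     triangle_sum_additive[of "b (f [g0 v])", OF Cons.prems] del: prism_sum.simps)
  have 2: "cup b (%l. f (map g0 l)) (triangle_sum g0 g1 g2 g) (v # l)
   = b (f [g0 v]) (triangle_sum g0 g1 g2 g (v # l)) + cup b (%l. ?F (map g0 l)) (triangle_sum g0 g1 g2 g) l"
   by (simp add: cone_at_def del: triangle_sum.simps)
  have 3: "cone_at v (triangle_sum g0 g1 g2 f)
    = cone_at v (prism_sum g1 g2 ?F) + triangle_sum g0 g1 g2 ?F"
   by (simp add: fun_eq_iff cone_at_apply)
  have 4: "cup b (triangle_sum g0 g1 g2 f) (%l. g (map g2 l)) (v # l)
   = cup b (prism_sum g1 g2 ?F) (%l. g (map g2 l)) (v # l)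
    + cup b (triangle_sum g0 g1 g2 ?F) (%l. g (map g2 l)) l"
   by (simp add: 3 cup_add_left[OF left])
  have 5: "cone_at v (prism_sum g0 g1 f)
    = (%l. ?F (map g1 (v # l))) - prism_sum g0 g1 ?F"
   by (simp add: fun_eq_iff cone_at_apply)
  have 6: "alt (prism_sum g0 g1 f) [v] = alt (%l. ?F (map g1 l)) [v]"
   by (simp add: alt_def)
  have 7: "cone_at v (%l. ?F (map g1 l)) = (%l. ?F (map g1 (v # l)))"
   by (simp add: fun_eq_iff cone_at_apply)
  have 8: "cup b (alt (prism_sum g0 g1 f)) (prism_sum g1 g2 g) (v # l)
   = cup b (alt (%l. ?F (map g1 l))) (prism_sum g1 g2 g) (v # l)
    + cup b (alt (prism_sum g0 g1 ?F)) (prism_sum g1 g2 g) l"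
   unfolding cup.simps 6 cone_at_alt 7 5
   by (simp add: alt_diff cup_add_left[OF left] del: prism_sum.simps)
  have 9: "prism_sum g1 g2 (cup b ?F g) (v # l)
   = cup b (alt (%l. ?F (map g1 l))) (prism_sum g1 g2 g) (v # l)
   + cup b (prism_sum g1 g2 ?F) (%l. g (map g2 l)) (v # l)"
   using prism_sum_cup[of b ?F g1 g2 g, OF left R]
   by (simp only: plus_fun_apply)
  show ?case
   unfolding 1 2 4 8 9 IH by (simp only: ac_simps)
 qed simp
 then show ?thesis by (simp add: fun_eq_iff cone_at_apply)
qed

section \<open>Twisting cochains and gauge transformations\<close>

definition unit_cochain :: "'v list => 'r::ring_1" where
 "unit_cochain l = (if length l = 1 then 1 else 0)"

lemma alt_unit_cochain [simp]: "alt unit_cochain = unit_cochain"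
 by (auto simp: fun_eq_iff alt_def unit_cochain_def)

lemma unit_cochain_Nil [simp]: "unit_cochain [] = 0"
 by (simp add: unit_cochain_def)

lemma cobd_unit_cochain [simp]: "cobd unit_cochain = (0 :: 'v list => 'r::ring_1)"
proof -
 have "cobd unit_cochain l = (0 :: 'r)" for l :: "'v list"
 proof (cases l)
  case (Cons v k)
  then show ?thesis
  proof (cases k)
   case (Cons w k')
   have "cobd (cone_at v unit_cochain) (w # k') = (cobd (%l. if l = [] then 1 else 0) (w # k') :: 'r)"
    by (rule cobd_cong) (auto simp: unit_cochain_def cone_at_apply)
   moreover have "cobd (cone_at w (%l. if l = [] then 1 else 0)) k' = (cobd (%_. 0) k' :: 'r)"
    by (rule cobd_cong) (auto simp: cone_at_apply)
   moreover have "cobd (%_. 0) k' = (0 :: 'r)"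
    by (induction k') (auto simp: cone_at_def)
   ultimately show ?thesis
    using Cons \<open>l = v # k\<close> by (auto simp: unit_cochain_def)
  qed (auto simp: unit_cochain_def)
 qed simp
 then show ?thesis by (simp add: fun_eq_iff)
qed

lemma cup_unit_left:
 fixes g :: "'v list => 'r::ring_1"
 assumes "g [] = 0"
 shows "cup (*) unit_cochain g = g"
proof -
 have "cup (*) unit_cochain g l = g l" for l
 proof (cases l)
  case (Cons v k)
  have "cup (*) (cone_at v unit_cochain) g k = (0 :: 'r)"
   by (auto simp: cup_sum cone_at_apply unit_cochain_def intro!: sum.neutral)
  then show ?thesis using Cons by (simp add: unit_cochain_def)
 qed (use assms in simp)
 then show ?thesis by (simp add: fun_eq_iff)
qed

lemma cup_unit_right:
 fixes f :: "'v list => 'u::ab_group_add" and b :: "'u => 'r::ring_1 => 'u"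
 assumes "f [] = 0" and "\<And>h. b h 1 = h" and zero: "\<And>l. b (f l) 0 = 0"
 shows "cup b f unit_cochain = f"
proof -
 have "cup b f unit_cochain l = f l" for l
 proof (cases l rule: rev_cases)
  case (snoc k v)
  have "cup b f unit_cochain l = (\<Sum>j<Suc (length k). if j = length k then f l else 0)"
   unfolding cup_sum snoc
   by (rule sum.cong) (auto simp: unit_cochain_def zero assms)
  then show ?thesis by simp
 qed (use assms in simp)
 then show ?thesis by (simp add: fun_eq_iff)
qed

text \<open>The sign operator \<open>e\<close> of the grading replaces degrees in the Leibniz
 rule.\<close>

locale dg_ring =
 fixes d e :: "'r::ring_1 => 'r"
 assumes d_add: "d (x + y) = d x + d y"
  and e_add: "e (x + y) = e x + e y"
  and leibniz: "d (x * y) = d x * y + e x * d y"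
  and d_d: "d (d x) = 0"
  and d_one [simp]: "d 1 = 0"
begin

lemmas d_simps = additive_zero[of d, OF d_add]

text \<open>The equation of a twisting cochain; the condition on \<open>e\<close> says that the values on
 a \<open>p\<close>-simplex have the parity of \<open>p - 1\<close>.\<close>

definition twisting :: "('v list => 'r) => bool" where
 "twisting a \<longleftrightarrow> a [] = 0 \<and> (\<forall>l. e (a l) = - alt a l)
  \<and> (\<lambda>l. d (a l)) + cobd a + cup (*) (alt a) a = 0"

text \<open>The transformation \<open>u\<close> intertwines the differentials twisted by
 \<open>a0\<close> and by \<open>a1\<close>.\<close>

definition gauge :: "('v list => 'r) => ('v list => 'r) => ('v list => 'r) => bool" where
 "gauge a0 a1 u \<longleftrightarrow> u [] = 0 \<and> (\<forall>l. e (u l) = alt u l)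
  \<and> (\<lambda>l. d (u l)) + cup (*) a0 u = cobd u + cup (*) (alt u) a1"

text \<open>The cochain \<open>u\<close> is the boundary of \<open>h\<close> for the differential twisted
 by \<open>a0\<close> on the left and by \<open>a1\<close> on the right.\<close>

definition gauge_homotopy ::
  "('v list => 'r) => ('v list => 'r) => ('v list => 'r) => ('v list => 'r) => bool" where
 "gauge_homotopy a0 a1 h u \<longleftrightarrow> h [] = 0 \<and> (\<forall>l. e (h l) = - alt h l)
  \<and> (\<lambda>l. d (h l)) + cobd h + cup (*) (alt a0) h + cup (*) (alt h) a1 = u"

lemmas cup_ring_simps =
 cup_add_left[of "(*) :: 'r => 'r => 'r", OF distrib_right]
 cup_add_right[of "(*) :: 'r => 'r => 'r", OF distrib_left]

lemma e_prism_sum: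
 assumes "\<And>l. e (a l) = - alt a l"
 shows "e (prism_sum g0 g1 a l) = alt (prism_sum g0 g1 a) l"
proof -
 have "e (prism_sum g0 g1 a l) = prism_sum g0 g1 (- alt a) l"
  using prism_sum_additive[of e g0 g1 a l, OF e_add] assms by (simp add: fun_Compl_def)
 then show ?thesis
  by (simp add: prism_sum_uminus prism_sum_alt)
qed

text \<open>Sum the equation of the twisting cochain over the prism: Stokes' formula gives the two ends,
 and the quadratic term splits into the two products with an end.\<close>

lemma prism_gauge:
 assumes a: "twisting a" and one: "e 1 = 1"
 shows "gauge (\<lambda>l. a (map g0 l)) (\<lambda>l. a (map g1 l)) (unit_cochain - prism_sum g0 g1 a)"
proof -
 let ?P = "prism_sum g0 g1 a"
 have e0: "e 0 = 0" and em: "e (x - y) = e x - e y" for x y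
  using additive_zero[of e, OF e_add] by auto
 have nil: "a (map g0 []) = 0" "a (map g1 []) = 0"
  using a by (simp_all add: twisting_def)
 have "prism_sum g0 g1 ((%l. d (a l)) + cobd a + cup (*) (alt a) a) = 0"
  using a by (simp add: twisting_def)
 moreover have "prism_sum g0 g1 (%l. d (a l)) = (%l. d (?P l))"
  using prism_sum_additive[of d g0 g1 a, OF d_add] by (simp add: fun_eq_iff)
 moreover have "(%l. alt a (map g0 l)) = alt (%l. a (map g0 l))"
  by (simp add: fun_eq_iff alt_def)
 ultimately have "(%l. d (?P l)) + ((%l. a (map g1 l)) - (%l. a (map g0 l)) - cobd ?P)
  + (cup (*) (%l. a (map g0 l)) ?P - cup (*) (alt ?P) (%l. a (map g1 l))) = 0"
  by (simp add: prism_sum_add prism_sum_cobd prism_sum_cup[OF distrib_right distrib_left]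
    prism_sum_alt cup_ring_simps)
 moreover have "(%l. d ((unit_cochain - ?P) l)) = - (%l. d (?P l))"
  by (auto simp: fun_eq_iff d_simps unit_cochain_def)
 ultimately have "(%l. d ((unit_cochain - ?P) l)) + cup (*) (%l. a (map g0 l)) (unit_cochain - ?P)
  = cobd (unit_cochain - ?P) + cup (*) (alt (unit_cochain - ?P)) (%l. a (map g1 l))"
  using cup_unit_left[of "%l. a (map g1 l)", OF nil(2)]
   cup_unit_right[of "%l. a (map g0 l)" "(*)", OF nil(1)]
  by (simp add: cobd_diff alt_diff cup_ring_simps algebra_simps)
 moreover have "e ((unit_cochain - ?P) l) = alt (unit_cochain - ?P) l" for l
 proof -
  have "e (unit_cochain l) = unit_cochain l"
   by (auto simp: unit_cochain_def one e0)
  moreover have "e (?P l) = alt ?P l"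
   using a by (intro e_prism_sum) (auto simp: twisting_def)
  ultimately show ?thesis
   by (simp add: em alt_diff)
 qed
 ultimately show ?thesis
  by (simp add: gauge_def)
qed

text \<open>Sum the equation over the product with a triangle. The three prisms and the product of two
 prism sums from the quadratic term add up to the difference of gauge transformations.\<close>

lemma triangle_gauge_homotopy:
 assumes a: "twisting a"
 shows "gauge_homotopy (\<lambda>l. a (map g0 l)) (\<lambda>l. a (map g2 l)) (triangle_sum g0 g1 g2 a)
  (cup (*) (unit_cochain - prism_sum g0 g1 a) (unit_cochain - prism_sum g1 g2 a)
   - (unit_cochain - prism_sum g0 g2 a))"
proof -
 let ?T = "triangle_sum g0 g1 g2 a"
 have "triangle_sum g0 g1 g2 ((%l. d (a l)) + cobd a + cup (*) (alt a) a) = 0"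
  using a by (simp add: twisting_def)
 moreover have "triangle_sum g0 g1 g2 (%l. d (a l)) = (%l. d (?T l))"
  using triangle_sum_additive[of d g0 g1 g2 a, OF d_add] by (simp add: fun_eq_iff)
 moreover have "(%l. alt a (map g0 l)) = alt (%l. a (map g0 l))"
  by (simp add: fun_eq_iff alt_def)
 ultimately have eq: "(%l. d (?T l))
  + (cobd ?T + prism_sum g1 g2 a - prism_sum g0 g2 a + prism_sum g0 g1 a)
  + (cup (*) (alt (%l. a (map g0 l))) ?T - cup (*) (prism_sum g0 g1 a) (prism_sum g1 g2 a)
    + cup (*) (alt ?T) (%l. a (map g2 l))) = 0"
  by (simp add: triangle_sum_add triangle_sum_cobd triangle_sum_cup[OF distrib_right distrib_left]
    triangle_sum_alt prism_sum_alt alt_uminus cup_ring_simps)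
 have prod: "cup (*) (unit_cochain - prism_sum g0 g1 a) (unit_cochain - prism_sum g1 g2 a)
  = unit_cochain - prism_sum g0 g1 a - prism_sum g1 g2 a + cup (*) (prism_sum g0 g1 a) (prism_sum g1 g2 a)"
  by (simp add: cup_ring_simps cup_unit_left cup_unit_right[of _ "(*)"])
 have "e (?T l) = - alt ?T l" for l
 proof -
  have "e (?T l) = triangle_sum g0 g1 g2 (- alt a) l"
   using triangle_sum_additive[of e g0 g1 g2 a l, OF e_add] a by (simp add: fun_Compl_def twisting_def)
  then show ?thesis
   by (simp add: triangle_sum_uminus triangle_sum_alt)
 qed
 then show ?thesis
  using eq unfolding gauge_homotopy_def prod by (simp add: algebra_simps)
qed

end

section \<open>Right operators on families of module maps\<close>

text \<open>Precomposition with a left multiplication makes the additive maps out of the ring a right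
 module over it, so that \<open>cup push\<close> can be iterated.\<close>

definition push :: "('r::ring_1 => 'w::ab_group_add) => 'r => 'r => 'w" where
 "push h r = (\<lambda>t. h (r * t))"

definition additive_family :: "('v list => 'r::ring_1 => 'w::ab_group_add) => bool" where
 "additive_family G \<longleftrightarrow> G [] = 0 \<and> (\<forall>l t t'. G l (t + t') = G l t + G l t')"

lemma push_add: "push (h + h') r = push h r + push h' r"
 by (simp add: push_def fun_eq_iff)

lemma push_add_right:
 assumes "additive_family G"
 shows "push (G l) (r + r') = push (G l) r + push (G l) r'"
 using assms by (simp add: push_def fun_eq_iff additive_family_def distrib_right)

lemma push_push: "push (push h r) s = push h (r * s)"
 by (simp add: push_def mult.assoc)

lemma additive_family_alt: "additive_family G ==> additive_family (alt G)"
 by (auto simp: additive_family_def alt_def signed_def fun_eq_iff)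

lemma sum_fun_apply: "(\<Sum>i\<in>A. f i) t = (\<Sum>i\<in>A. f i t)"
 for f :: "'i => 'a => 'b::ab_group_add"
 by (induction A rule: infinite_finite_induct) auto

lemma signed_fun_apply: "(signed k f) t = signed k (f t)"
 for f :: "'a => 'b::ab_group_add"
 by (simp add: signed_def)

lemma cup_push_apply:
 "cup push G a l t = (\<Sum>j<length l. G (take (Suc j) l) (a (drop j l) * t))"
 by (simp add: cup_sum sum_fun_apply push_def)

lemma additive_family_cup:
 assumes "additive_family G" shows "additive_family (cup push G a)"
 using assms
 by (auto simp: additive_family_def cup_push_apply distrib_left sum.distrib)

lemma additive_family_cobd:
 assumes "additive_family G" shows "additive_family (cobd G)"
 using assms
 by (auto simp: additive_family_def cobd_sum sum_fun_apply signed_fun_apply sum.distrib)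

lemma additive_family_add:
 "additive_family F ==> additive_family G ==> additive_family (F + G)"
 by (auto simp: additive_family_def algebra_simps)

context dg_ring begin

definition prec_d :: "('v list => 'r => 'w::ab_group_add) => 'v list => 'r => 'w" where
 "prec_d G = (\<lambda>l t. G l (d t))"

text \<open>The twisted differential on families of maps: boundary of the simplex, differential of the
 ring, and cap product with \<open>a\<close>, with the signs of the model.\<close>

definition twist :: "('v list => 'r) => ('v list => 'r => 'w::ab_group_add) => 'v list => 'r => 'w" where
 "twist a G = cobd G + prec_d (alt G) + cup push (alt G) a"

lemma prec_d_add: "prec_d (F + G) = prec_d F + prec_d G"
 and prec_d_uminus: "prec_d (- G) = - prec_d G"
 by (auto simp: prec_d_def fun_eq_iff)

lemma alt_prec_d: "alt (prec_d G) = prec_d (alt G)"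
 by (auto simp: prec_d_def fun_eq_iff alt_def signed_fun_apply)

lemma cobd_prec_d: "cobd (prec_d G) = prec_d (cobd G)"
 by (auto simp: prec_d_def fun_eq_iff cobd_sum sum_fun_apply signed_fun_apply)

lemma additive_family_prec_d: "additive_family G ==> additive_family (prec_d G)"
 by (auto simp: additive_family_def prec_d_def d_add fun_eq_iff)

lemma prec_d_prec_d: "additive_family G ==> prec_d (prec_d G) = 0"
 using additive_zero(1)[of "G _"] by (auto simp: prec_d_def d_d additive_family_def fun_eq_iff)

lemma cup_prec_d:
 assumes "additive_family G"
 shows "cup push (prec_d G) x = cup push G (\<lambda>l. d (x l)) + prec_d (cup push G (\<lambda>l. e (x l)))"
 using assms
 by (auto simp: fun_eq_iff cup_push_apply prec_d_def leibniz additive_family_def sum.distrib)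

lemma cup_push_zero: "additive_family G ==> cup push G 0 = 0"
 by (rule cup_add_right(4)) (rule push_add_right)

lemma twist_twist:
 assumes G: "additive_family G" and a: "twisting a"
 shows "twist a (twist a G) = 0"
proof -
 note AG = additive_family_alt[OF G]
 have cobd_cup': "cobd (cup push (alt G) a) = - cup push (alt (cobd G)) a + cup push G (cobd a)"
  using cobd_cup[of push "alt G" a, OF push_add push_add_right[OF AG]] G AG a
  by (simp add: additive_family_def twisting_def cobd_alt cup_add_left[of push, OF push_add])
 have alt_cup': "alt (cup push (alt G) a) = cup push G (alt a)"
  using alt_cup[of push "alt G" a, OF push_add push_add_right[OF AG]] by simp
 have assoc: "cup push (cup push G (alt a)) a = cup push G (cup (*) (alt a) a)"
  by (rule cup_assoc[OF push_add push_add_right[OF G] push_push])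
 have deg: "(%l. e (a l)) = - alt a"
  using a by (simp add: twisting_def fun_eq_iff)
 have leib: "cup push (prec_d G) a = cup push G (%l. d (a l)) - prec_d (cup push G (alt a))"
  by (simp add: cup_prec_d[OF G] deg cup_add_right(2)[of push, OF push_add_right[OF G]] prec_d_uminus)
 have "twist a (twist a G) = cup push G (cobd a) + cup push G (%l. d (a l)) + cup push G (cup (*) (alt a) a)"
  unfolding twist_def[of a "twist a G"] unfolding twist_def
  by (simp add: cobd_add alt_add prec_d_add cup_add_left[of push, OF push_add] cobd_cobd
    cobd_prec_d cobd_alt alt_uminus prec_d_uminus alt_prec_d prec_d_prec_d[OF G]
    cobd_cup' alt_cup' leib assoc)
 also have "... = cup push G ((%l. d (a l)) + cobd a + cup (*) (alt a) a)"
  by (simp add: cup_add_right[of push, OF push_add_right[OF G]] ac_simps)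
 also have "... = 0"
  using a by (simp add: twisting_def cup_push_zero[OF G])
 finally show ?thesis .
qed

text \<open>A gauge transformation acts on the right of a family, and the equation of
 \<open>gauge\<close> is exactly what lets the twisted differential pass through it.\<close>

lemma twist_gauge:
 assumes G: "additive_family G" and u: "gauge a0 a1 u"
 shows "twist a1 (cup push G u) = cup push (twist a0 G) u"
proof -
 note AG = additive_family_alt[OF G]
 have 1: "cobd (cup push G u) = cup push (cobd G) u + cup push (alt G) (cobd u)"
  using cobd_cup[of push G u, OF push_add push_add_right[OF G]] G u
  by (simp add: additive_family_def gauge_def)
 have 2: "alt (cup push G u) = cup push (alt G) (alt u)"
  by (rule alt_cup[of push, OF push_add push_add_right[OF G]])
 have 3: "cup push (cup push (alt G) x) y = cup push (alt G) (cup (*) x y)" for x y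
  by (rule cup_assoc[OF push_add push_add_right[OF AG] push_push])
 have deg: "(%l. e (u l)) = alt u"
  using u by (simp add: gauge_def fun_eq_iff)
 have 4: "cup push (prec_d (alt G)) u = cup push (alt G) (%l. d (u l)) + prec_d (cup push (alt G) (alt u))"
  by (simp add: cup_prec_d[OF AG] deg)
 have "cup push (alt G) ((%l. d (u l)) + cup (*) a0 u) = cup push (alt G) (cobd u + cup (*) (alt u) a1)"
  using u by (simp add: gauge_def)
 then show ?thesis
  unfolding twist_def
  by (simp add: 1 2 3 4 cup_add_left[of push, OF push_add] cup_add_right[of push, OF push_add_right[OF AG]]
    algebra_simps)
qed

lemma twist_gauge_homotopy:
 assumes G: "additive_family G" and h: "gauge_homotopy a0 a1 h u"
 shows "twist a1 (cup push (alt G) h) + cup push (alt (twist a0 G)) h = cup push G u"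
proof -
 note AG = additive_family_alt[OF G]
 have 1: "cobd (cup push (alt G) h) = - cup push (alt (cobd G)) h + cup push G (cobd h)"
  using cobd_cup[of push "alt G" h, OF push_add push_add_right[OF AG]] AG h
  by (simp add: additive_family_def gauge_homotopy_def cobd_alt cup_add_left[of push, OF push_add])
 have 2: "alt (cup push (alt G) x) = cup push G (alt x)" for x
  using alt_cup[of push "alt G" x, OF push_add push_add_right[OF AG]] by simp
 have 3: "cup push (cup push G x) y = cup push G (cup (*) x y)" for x y
  by (rule cup_assoc[OF push_add push_add_right[OF G] push_push])
 have deg: "(%l. e (h l)) = - alt h"
  using h by (simp add: gauge_homotopy_def fun_eq_iff)
 have 4: "cup push (prec_d G) h = cup push G (%l. d (h l)) - prec_d (cup push G (alt h))"
  by (simp add: cup_prec_d[OF G] deg cup_add_right(2)[of push, OF push_add_right[OF G]] prec_d_uminus)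
 have 5: "alt (prec_d (alt G)) = prec_d G"
  by (simp add: alt_prec_d)
 have "cup push G ((%l. d (h l)) + cobd h + cup (*) (alt a0) h + cup (*) (alt h) a1) = cup push G u"
  using h by (simp add: gauge_homotopy_def)
 then show ?thesis
  unfolding twist_def
  by (simp add: 1 2 3 4 5 alt_add cup_add_left[of push, OF push_add]
   cup_add_right[of push, OF push_add_right[OF G]] algebra_simps)
qed

end

section \<open>The ring of cubical chains\<close>

text \<open>Off the cells of the right length the value is fixed to be \<open>0\<close>. Then the product
 of cubes has a unit and is associative as an equation between functions, which a monoid class
 demands.\<close>

typedef (overloaded) 'p qcube = "{s :: 'p::ab_group_add cube. \<forall>w. length w \<noteq> fst s --> snd s w = 0}"
 by (rule exI[of _ "(0, \<lambda>w. 0)"]) simp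

definition qdim :: "'p::ab_group_add qcube => nat" where
 "qdim c = fst (Rep_qcube c)"

definition qval :: "'p::ab_group_add qcube => cell => 'p" where
 "qval c = snd (Rep_qcube c)"

definition mk_qcube :: "nat => (cell => 'p::ab_group_add) => 'p qcube" where
 "mk_qcube p f = Abs_qcube (p, \<lambda>w. if length w = p then f w else 0)"

lemma qdim_mk [simp]: "qdim (mk_qcube p f) = p"
 and qval_mk [simp]: "qval (mk_qcube p f) w = (if length w = p then f w else 0)"
 by (auto simp: qdim_def qval_def mk_qcube_def Abs_qcube_inverse)

lemma Rep_qcube_eq: "Rep_qcube c = (qdim c, qval c)"
 by (simp add: qdim_def qval_def)

lemma qval_off: "length w \<noteq> qdim c ==> qval c w = 0"
 using Rep_qcube[of c] by (simp add: qdim_def qval_def)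

lemma qcube_eqI:
 assumes "qdim c = qdim c'" "\<And>w. length w = qdim c ==> qval c w = qval c' w"
 shows "c = c'"
proof -
 have "qval c = qval c'"
 proof
  fix w show "qval c w = qval c' w"
   using assms qval_off[of w c] qval_off[of w c'] by (cases "length w = qdim c") auto
 qed
 with assms have "Rep_qcube c = Rep_qcube c'"
  by (simp add: Rep_qcube_eq)
 then show ?thesis
  by (simp add: Rep_qcube_inject)
qed

instantiation qcube :: (ab_group_add) monoid_add
begin

definition zero_qcube :: "'a qcube" where
 "zero_qcube = mk_qcube 0 (\<lambda>w. 0)"

definition plus_qcube :: "'a qcube => 'a qcube => 'a qcube" where
 "plus_qcube c c' = mk_qcube (qdim c + qdim c') (snd (L_prod (Rep_qcube c) (Rep_qcube c')))"

lemma qdim_plus: "qdim (c + c') = qdim c + qdim c'"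
 by (simp add: plus_qcube_def)

lemma qval_plus: "length w = qdim c + qdim c' ==> qval (c + c') w =
 (if None \<in> set (drop (qdim c) w) then 0 else qval c (take (qdim c) w)) +
 (if None \<in> set (take (qdim c) w) then 0 else qval c' (drop (qdim c) w))"
 by (simp add: plus_qcube_def L_prod_def Rep_qcube_eq)

instance
proof
 fix a b c :: "'a qcube"
 show "a + b + c = a + (b + c)"
 proof (rule qcube_eqI)
  fix w :: cell assume w: "length w = qdim (a + b + c)"
  define x y z where "x = take (qdim a) w" "y = take (qdim b) (drop (qdim a) w)"
   "z = drop (qdim b) (drop (qdim a) w)"
  have len: "length x = qdim a" "length y = qdim b" "length z = qdim c" and w': "w = x @ y @ z"
   using w by (auto simp: x_y_z_def qdim_plus simp del: drop_drop)
  show "qval (a + b + c) w = qval (a + (b + c)) w"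
   unfolding w' using len by (auto simp: qval_plus qdim_plus)
 qed (simp add: qdim_plus)
 show "0 + a = a"
  by (rule qcube_eqI) (auto simp: qdim_plus qval_plus zero_qcube_def)
 show "a + 0 = a"
  by (rule qcube_eqI) (auto simp: qdim_plus qval_plus zero_qcube_def)
qed

end

lemma Rep_qcube_plus: "Rep_qcube (c + c') = L_prod (Rep_qcube c) (Rep_qcube c')"
proof -
 have "qval (c + c') w = snd (L_prod (Rep_qcube c) (Rep_qcube c')) w" for w
  using qval_off[of w "c + c'"]
  by (cases "length w = qdim c + qdim c'") (auto simp: qval_plus qdim_plus L_prod_def Rep_qcube_eq)
 then show ?thesis
  by (simp add: Rep_qcube_eq qdim_plus L_prod_def fun_eq_iff)
qed

lemma Rep_qcube_zero: "Rep_qcube 0 = (0, \<lambda>w. 0)"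
 by (auto simp: Rep_qcube_eq zero_qcube_def fun_eq_iff)

definition qface :: "nat => bool => 'p::ab_group_add qcube => 'p qcube" where
 "qface i eps c = mk_qcube (qdim c - 1) (\<lambda>w. qval c (take i w @ Some eps # drop i w))"

lemma qdim_face [simp]: "qdim (qface i eps c) = qdim c - 1"
 by (simp add: qface_def)

lemma qval_face: "length w = qdim c - 1 ==> qval (qface i eps c) w = qval c (take i w @ Some eps # drop i w)"
 by (simp add: qface_def)

lemma Rep_qcube_face:
 assumes "0 < qdim c"
 shows "Rep_qcube (qface i eps c) = L_face i eps (Rep_qcube c)"
proof -
 have "qval (qface i eps c) w = snd (L_face i eps (Rep_qcube c)) w" for w
  using qval_off[of w "qface i eps c"] qval_off[of "take i w @ Some eps # drop i w" c] assms
  by (cases "length w = qdim c - 1") (auto simp: qval_face L_face_def Rep_qcube_eq)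
 then show ?thesis
  by (simp add: Rep_qcube_eq L_face_def fun_eq_iff)
qed

lemma qval_plus_append:
 "length x = qdim c ==> length y = qdim c' ==> qval (c + c') (x @ y) =
  (if None \<in> set y then 0 else qval c x) + (if None \<in> set x then 0 else qval c' y)"
 by (simp add: qval_plus)

lemma qval_face_append:
 "length x + length y = qdim c - 1 ==> qval (qface (length x) eps c) (x @ y) = qval c (x @ Some eps # y)"
 by (simp add: qval_face)

lemma split_list_at: "i \<le> length w ==> \<exists>x y. w = x @ y \<and> length x = i"
 by (metis append_take_drop_id length_take min.absorb2)

lemma qface_plus_left:
 assumes "i < qdim c"
 shows "qface i eps (c + c') = qface i eps c + c'"
proof (rule qcube_eqI)
 fix w :: cell assume w: "length w = qdim (qface i eps (c + c'))"
 have "i \<le> length w"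
  using w assms by (auto simp: qdim_plus)
 from split_list_at[OF this] obtain x v where v: "w = x @ v" "length x = i" by blast
 have "qdim c - 1 - i \<le> length v"
  using w v assms by (auto simp: qdim_plus)
 from split_list_at[OF this] obtain y z where z: "v = y @ z" "length y = qdim c - 1 - i" by blast
 have len: "length z = qdim c'" "length (x @ y) = qdim c - 1"
  using w v z assms by (auto simp: qdim_plus)
 have "qval (qface i eps (c + c')) w = qval (c + c') ((x @ Some eps # y) @ z)"
  using qval_face_append[of x v "c + c'" eps] v z w by simp
 also have "... = qval (qface i eps c + c') ((x @ y) @ z)"
  using len assms v qval_face_append[of x y c eps]
  by (subst (1 2) qval_plus_append) auto
 finally show "qval (qface i eps (c + c')) w = qval (qface i eps c + c') w"
  using v z by simp
qed (use assms in \<open>simp add: qdim_plus\<close>)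

lemma qface_plus_right:
 assumes "j < qdim c'"
 shows "qface (qdim c + j) eps (c + c') = c + qface j eps c'"
proof (rule qcube_eqI)
 fix w :: cell assume w: "length w = qdim (qface (qdim c + j) eps (c + c'))"
 have "qdim c \<le> length w"
  using w assms by (auto simp: qdim_plus)
 from split_list_at[OF this] obtain x v where v: "w = x @ v" "length x = qdim c" by blast
 have "j \<le> length v"
  using w v assms by (auto simp: qdim_plus)
 from split_list_at[OF this] obtain y z where z: "v = y @ z" "length y = j" by blast
 have len: "length (y @ z) = qdim c' - 1"
  using w v z assms by (auto simp: qdim_plus)
 have "qval (qface (qdim c + j) eps (c + c')) w = qval (c + c') (x @ (y @ Some eps # z))"
  using qval_face_append[of "x @ y" z "c + c'" eps] v z w by simp
 also have "... = qval (c + qface j eps c') (x @ (y @ z))"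
  using len assms v z qval_face_append[of y z c' eps]
  by (subst (1 2) qval_plus_append) auto
 finally show "qval (qface (qdim c + j) eps (c + c')) w = qval (c + qface j eps c') w"
  using v z by simp
qed (use assms in \<open>simp add: qdim_plus\<close>)

lemma qface_qface:
 assumes "i < j" "j < qdim c"
 shows "qface i eps (qface j eps' c) = qface (j - 1) eps' (qface i eps c)"
proof (rule qcube_eqI)
 fix w :: cell assume w: "length w = qdim (qface i eps (qface j eps' c))"
 have "i \<le> length w"
  using w assms by auto
 from split_list_at[OF this] obtain x v where v: "w = x @ v" "length x = i" by blast
 have "j - 1 - i \<le> length v"
  using w v assms by auto
 from split_list_at[OF this] obtain y z where z: "v = y @ z" "length y = j - 1 - i" by blast
 have "qval (qface i eps (qface j eps' c)) w = qval (qface j eps' c) ((x @ Some eps # y) @ z)"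
  using qval_face_append[of x v "qface j eps' c" eps] v z w by simp
 also have "... = qval c (x @ Some eps # y @ Some eps' # z)"
  using qval_face_append[of "x @ Some eps # y" z c eps'] v z w assms by simp
 also have "... = qval (qface i eps c) ((x @ y) @ Some eps' # z)"
  using qval_face_append[of x "y @ Some eps' # z" c eps] v z w assms by simp
 also have "... = qval (qface (j - 1) eps' (qface i eps c)) w"
  using qval_face_append[of "x @ y" z "qface i eps c" eps'] v z w assms by simp
 finally show "qval (qface i eps (qface j eps' c)) w = qval (qface (j - 1) eps' (qface i eps c)) w" .
qed simp

text \<open>Cubical chains before normalization. Finitely supported functions on a monoid carry the
 convolution product, which for cubes is the product \<open>\<circ>\<close> extended bilinearly.\<close>

type_synonym 'p cring = "'p qcube \<Rightarrow>\<^sub>0 int"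

lemma frag_of_times: "frag_of c * frag_of c' = frag_of (c + c')"
 by (simp add: mult_single)

definition face_diff :: "nat => 'p::ab_group_add cring => 'p cring" where
 "face_diff i = frag_extend (\<lambda>c. frag_of (qface i False c) - frag_of (qface i True c))"

definition cube_d :: "'p::ab_group_add cring => 'p cring" where
 "cube_d = frag_extend (\<lambda>c. \<Sum>i<qdim c. signed (Suc i) (face_diff i (frag_of c)))"

definition cube_sgn :: "'p::ab_group_add cring => 'p cring" where
 "cube_sgn = frag_extend (\<lambda>c. signed (qdim c) (frag_of c))"

lemma face_diff_of: "face_diff i (frag_of c) = frag_of (qface i False c) - frag_of (qface i True c)"
 by (simp add: face_diff_def)

lemma cube_d_of: "cube_d (frag_of c) = (\<Sum>i<qdim c. signed (Suc i) (face_diff i (frag_of c)))"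
 by (simp add: cube_d_def)

lemma cube_sgn_of: "cube_sgn (frag_of c) = signed (qdim c) (frag_of c)"
 by (simp add: cube_sgn_def)

lemma frag_extend_additive: "frag_extend b (x + y) = frag_extend b x + frag_extend b y"
 by (rule frag_extend_add)

lemmas face_diff_add = frag_extend_additive[where b = "\<lambda>c. frag_of (qface i False c) - frag_of (qface i True c)" for i, folded face_diff_def]

lemma cube_d_add: "cube_d (x + y) = cube_d x + cube_d y"
 and cube_sgn_add: "cube_sgn (x + y) = cube_sgn x + cube_sgn y"
 by (simp_all add: cube_d_def cube_sgn_def frag_extend_add)

lemmas face_diff_simps = additive_zero[of "face_diff i" for i, OF face_diff_add]
lemmas cube_d_simps = additive_zero[of cube_d, OF cube_d_add]
lemmas cube_sgn_simps = additive_zero[of cube_sgn, OF cube_sgn_add]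

lemma additive_sum:
 fixes h :: "'u::ab_group_add => 'w::ab_group_add"
 assumes "\<And>x y. h (x + y) = h x + h y"
 shows "h (\<Sum>i\<in>I. f i) = (\<Sum>i\<in>I. h (f i))"
 by (induction I rule: infinite_finite_induct) (auto simp: assms additive_zero(1)[of h, OF assms])

lemma additive_frag_eq:
 fixes h k :: "('a \<Rightarrow>\<^sub>0 int) => 'w::ab_group_add"
 assumes h: "\<And>x y. h (x + y) = h x + h y" and k: "\<And>x y. k (x + y) = k x + k y"
  and eq: "\<And>c. c \<in> Poly_Mapping.keys x ==> h (frag_of c) = k (frag_of c)"
 shows "h x = k x"
proof -
 have "Poly_Mapping.keys x \<subseteq> {c. h (frag_of c) = k (frag_of c)}"
  using eq by auto
 then show ?thesis
  by (rule frag_induction)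
   (auto simp: additive_zero[of h, OF h] additive_zero[of k, OF k])
qed

lemma signed_mult_left: "signed k x * y = signed k (x * y)"
 and signed_mult_right: "x * signed k y = signed k (x * y)"
 for x y :: "'r::ring_1"
 by (auto simp: signed_def)

lemma cube_leibniz_of:
 "cube_d (frag_of c * frag_of c') = cube_d (frag_of c) * frag_of c' + cube_sgn (frag_of c) * cube_d (frag_of c')"
proof -
 let ?p = "qdim c" and ?q = "qdim c'"
 let ?t = "%i. signed (Suc i) (face_diff i (frag_of (c + c')))"
 have "cube_d (frag_of c * frag_of c') = (\<Sum>i<?p + ?q. ?t i)"
  by (simp add: frag_of_times cube_d_of qdim_plus del: signed_Suc)
 also have "... = (\<Sum>i<?p. ?t i) + (\<Sum>j<?q. ?t (?p + j))"
 proof -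
  have "{..<?p + ?q} = {..<?p} \<union> {?p..<?p + ?q}" by auto
  then have "(\<Sum>i<?p + ?q. ?t i) = (\<Sum>i<?p. ?t i) + (\<Sum>i=?p..<?p + ?q. ?t i)"
   by (simp add: sum.union_disjoint ivl_disj_int del: signed_Suc)
  also have "(\<Sum>i=?p..<?p + ?q. ?t i) = (\<Sum>j<?q. ?t (?p + j))"
   using sum.shift_bounds_nat_ivl[of ?t 0 ?p ?q]
   by (simp add: lessThan_atLeast0 add.commute del: signed_Suc)
  finally show ?thesis .
 qed
 also have "(\<Sum>i<?p. ?t i) = cube_d (frag_of c) * frag_of c'"
  by (simp add: cube_d_of sum_distrib_right signed_mult_left face_diff_of qface_plus_left
    left_diff_distrib frag_of_times flip: sum_negf del: signed_Suc cong: sum.cong_simp)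
 also have "(\<Sum>j<?q. ?t (?p + j)) = cube_sgn (frag_of c) * cube_d (frag_of c')"
 proof -
  have "?t (?p + j) = signed ?p (frag_of c) * signed (Suc j) (face_diff j (frag_of c'))" if "j < ?q" for j
   using that by (simp add: face_diff_of qface_plus_right right_diff_distrib frag_of_times
     signed_mult_left signed_mult_right signed_signed signed_diff add.commute[of j])
  then show ?thesis
   by (simp add: cube_d_of cube_sgn_of sum_distrib_left del: signed_Suc cong: sum.cong_simp)
 qed
 finally show ?thesis .
qed

text \<open>A face in one of the first coordinates is a face of the first factor; the shift of the index
 of the other faces gives the sign.\<close>

lemma cube_leibniz: "cube_d (x * y) = cube_d x * y + cube_sgn x * cube_d y"
proof -
 have 1: "cube_d (frag_of c * y) = cube_d (frag_of c) * y + cube_sgn (frag_of c) * cube_d y" for c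
  by (rule additive_frag_eq[where h = "%y. cube_d (frag_of c * y)" and
    k = "%y. cube_d (frag_of c) * y + cube_sgn (frag_of c) * cube_d y"])
   (auto simp: distrib_left cube_d_add cube_leibniz_of)
 show ?thesis
  by (rule additive_frag_eq[where h = "%x. cube_d (x * y)" and
    k = "%x. cube_d x * y + cube_sgn x * cube_d y"])
   (auto simp: distrib_right cube_d_add cube_sgn_add 1)
qed

text \<open>The double sum underlying every proof that a boundary squares to zero: the simplicial
 identity pairs the terms with opposite signs.\<close>

lemma double_face_sum_zero:
 fixes A :: "nat => nat => 'w::ab_group_add"
 assumes "\<And>i j. i < j ==> j < p ==> A i j = A (j - 1) i"
 shows "(\<Sum>j<p. \<Sum>i<p - 1. signed (i + j) (A i j)) = 0"
proof -
 let ?S = "%P. \<Sum>(j, i)\<in>{(j, i). j < p \<and> i < p - 1 \<and> P i j}. signed (i + j) (A i j)"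
 have fin: "finite {(j, i). j < p \<and> i < p - 1 \<and> P i j}" for P
  by (rule finite_subset[of _ "{..<p} \<times> {..<p}"]) auto
 have "(\<Sum>j<p. \<Sum>i<p - 1. signed (i + j) (A i j)) = (\<Sum>(j, i)\<in>{..<p} \<times> {..<p - 1}. signed (i + j) (A i j))"
  by (simp add: sum.cartesian_product)
 also have "{..<p} \<times> {..<p - 1} = {(j, i). j < p \<and> i < p - 1 \<and> i < j} \<union> {(j, i). j < p \<and> i < p - 1 \<and> j \<le> i}"
  by auto
 also have "(\<Sum>(j, i)\<in>.... signed (i + j) (A i j)) = ?S (<) + ?S (%i j. j \<le> i)"
  by (rule sum.union_disjoint) (use fin in auto)
 also have "?S (<) = (\<Sum>(j, i)\<in>{(j, i). j < p \<and> i < p - 1 \<and> j \<le> i}. - signed (i + j) (A i j))"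
  by (rule sum.reindex_bij_witness[where i = "%(j, i). (Suc i, j)" and j = "%(j, i). (i, j - 1)"])
   (auto simp: assms[of _ "Suc _"], auto simp: assms signed_def)
 finally show ?thesis
  by (simp add: sum_negf case_prod_unfold)
qed

lemma cube_d_d: "cube_d (cube_d x) = 0"
proof -
 have "cube_d (cube_d (frag_of c)) = (0 :: 'a cring)" for c
 proof -
  let ?p = "qdim c"
  let ?A = "%i j. face_diff i (face_diff j (frag_of c))"
  have "cube_d (cube_d (frag_of c)) = (\<Sum>j<?p. signed (Suc j) (cube_d (face_diff j (frag_of c))))"
   by (simp add: cube_d_of additive_sum[of cube_d, OF cube_d_add] cube_d_simps del: signed_Suc)
  also have "... = (\<Sum>j<?p. \<Sum>i<?p - 1. signed (i + j) (?A i j))"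
  proof (rule sum.cong)
   fix j assume "j \<in> {..<?p}"
   have "cube_d (face_diff j (frag_of c)) = (\<Sum>i<?p - 1. signed (Suc i) (?A i j))"
    by (simp add: face_diff_of[of j] cube_d_simps cube_d_of face_diff_simps signed_diff sum_subtractf
      del: signed_Suc)
   then show "signed (Suc j) (cube_d (face_diff j (frag_of c))) = (\<Sum>i<?p - 1. signed (i + j) (?A i j))"
    by (simp only: additive_sum[of "signed (Suc j)", OF signed_add] signed_signed) (simp add: add.commute)
  qed simp
  also have "... = 0"
  proof (rule double_face_sum_zero)
   fix i j assume "i < j" "j < ?p"
   then show "?A i j = ?A (j - 1) i"
    by (simp add: face_diff_of face_diff_simps qface_qface)
  qed
  finally show ?thesis .
 qed
 then show ?thesis
  using additive_frag_eq[of "%x. cube_d (cube_d x)" "%x. 0" x] by (simp add: cube_d_add)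
qed

lemma one_cring: "(1 :: 'p::ab_group_add cring) = frag_of 0"
 by simp

lemma cube_sgn_one: "cube_sgn 1 = 1"
 unfolding one_cring cube_sgn_of by (simp add: zero_qcube_def)

interpretation cubical: dg_ring "cube_d :: 'p::ab_group_add cring => _" cube_sgn
proof
 have "cube_d (1 :: 'p cring) = 0"
  unfolding one_cring cube_d_of by (simp add: zero_qcube_def)
 then show "cube_d (1 :: 'p cring) = 0" .
qed (auto simp: cube_d_add cube_sgn_add cube_leibniz cube_d_d)

section \<open>Cubes of vertex lists and their twisting cochain\<close>

text \<open>A cell is read along the list: a free coordinate keeps its vertex, a coordinate at
 \<open>1\<close> drops it, and a coordinate at \<open>0\<close> ends the block \<open>acc\<close> and
 starts the next one with the same vertex.\<close>

fun scan :: "('v list => 'p::ab_group_add) => 'v list => 'v list => cell => 'p" where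
 "scan \<beta> acc [] w = 0"
| "scan \<beta> acc (v # vs) [] = \<beta> (acc @ [v])"
| "scan \<beta> acc (v # vs) (None # w) = scan \<beta> (acc @ [v]) vs w"
| "scan \<beta> acc (v # vs) (Some True # w) = scan \<beta> acc vs w"
| "scan \<beta> acc (v # vs) (Some False # w) = \<beta> (acc @ [v]) + scan \<beta> [v] vs w"

definition block :: "nat => ('v list => 'p::ab_group_add) => 'v list => 'p" where
 "block n \<zeta> b = (if length b = n + 2 then \<zeta> b else 0)"

text \<open>The cube of \<open>\<kappa>\<close> with the simplex forgotten. The only block that can have
 \<open>n + 2\<close> vertices is the one with all \<open>n\<close> free coordinates between its two end
 vertices, as in the index formula.\<close>

definition list_cube :: "nat => ('v list => 'p::ab_group_add) => 'v list => 'p qcube" where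
 "list_cube n \<zeta> l = mk_qcube (length l - 2)
  (\<lambda>w. if count_list w None = n then scan (block n \<zeta>) [hd l] (tl l) w else 0)"

lemma scan_True:
 "length u < length vs ==>
  scan \<beta> acc vs (u @ Some True # w) = scan \<beta> acc (take (length u) vs @ drop (Suc (length u)) vs) (u @ w)"
proof (induction u arbitrary: acc vs)
 case Nil
 then show ?case by (cases vs) auto
next
 case (Cons a u)
 then obtain v vs' where "vs = v # vs'" by (cases vs) auto
 with Cons show ?case by (cases a rule: option.exhaust; cases "the a") auto
qed

lemma scan_False:
 "length u < length vs ==>
  scan \<beta> acc vs (u @ Some False # w) =
   scan \<beta> acc (take (Suc (length u)) vs) u + scan \<beta> [vs ! length u] (drop (Suc (length u)) vs) w"
proof (induction u arbitrary: acc vs)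
 case Nil
 then show ?case by (cases vs) auto
next
 case (Cons a u)
 then obtain v vs' where "vs = v # vs'" by (cases vs) auto
 with Cons show ?case by (cases a rule: option.exhaust; cases "the a") (auto simp: add.assoc)
qed

text \<open>A block is worth something only if it carries all \<open>n\<close> free coordinates.\<close>

lemma scan_short:
 "acc \<noteq> [] ==> length acc + count_list w None < n + 1 ==> n \<ge> 1 ==> scan (block n \<zeta>) acc vs w = 0"
proof (induction "block n \<zeta>" acc vs w rule: scan.induct)
 case (5 acc v vs w)
 then show ?case by (cases acc) (auto simp: block_def)
qed (auto simp: block_def)

lemma scan_cong:
 assumes "\<And>l. set l \<subseteq> set acc \<union> set vs ==> \<beta> l = \<beta>' l"
 shows "scan \<beta> acc vs w = scan \<beta>' acc vs w"
 using assms
proof (induction \<beta> acc vs w rule: scan.induct)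
 case (5 \<beta> acc v vs w)
 have "scan \<beta> [v] vs w = scan \<beta>' [v] vs w"
  by (rule "5.IH") (use "5.prems" in auto)
 then show ?case using "5.prems"[of "acc @ [v]"] by auto
next
 case (3 \<beta> acc v vs w)
 have "scan \<beta> (acc @ [v]) vs w = scan \<beta>' (acc @ [v]) vs w"
  by (rule "3.IH") (use "3.prems" in auto)
 then show ?case by simp
next
 case (4 \<beta> acc v vs w)
 have "scan \<beta> acc vs w = scan \<beta>' acc vs w"
  by (rule "4.IH") (use "4.prems" in auto)
 then show ?case by simp
next
 case (2 \<beta> acc v vs)
 show ?case by (simp, rule "2.prems") auto
qed auto

lemma scan_map: "scan \<beta> (map h acc) (map h vs) w = scan (\<lambda>l. \<beta> (map h l)) acc vs w"
proof (induction w arbitrary: acc vs)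
 case Nil
 then show ?case by (cases vs) auto
next
 case (Cons a w)
 show ?case
 proof (cases vs)
  case (Cons v vs')
  then show ?thesis
   using Cons.IH[of "acc @ [v]" vs'] Cons.IH[of "[v]" vs'] Cons.IH[of acc vs']
   by (cases a rule: option.exhaust; cases "the a") auto
 qed simp
qed

lemma list_cube_cong:
 assumes "\<And>l'. set l' \<subseteq> set l ==> length l' = n + 2 ==> \<zeta> l' = \<zeta>' l'"
 shows "list_cube n \<zeta> l = list_cube n \<zeta>' l"
proof (rule qcube_eqI)
 fix w :: cell assume w: "length w = qdim (list_cube n \<zeta> l)"
 have "scan (block n \<zeta>) [hd l] (tl l) w = scan (block n \<zeta>') [hd l] (tl l) w"
 proof (cases "l = []")
  case False
  show ?thesis
  proof (rule scan_cong)
   fix l' assume "set l' \<subseteq> set [hd l] \<union> set (tl l)"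
   then have "set l' \<subseteq> set l" using False by (cases l) auto
   then show "block n \<zeta> l' = block n \<zeta>' l'"
    using assms by (simp add: block_def)
  qed
 qed simp
 then show "qval (list_cube n \<zeta> l) w = qval (list_cube n \<zeta>' l) w"
  by (simp add: list_cube_def)
qed (simp add: list_cube_def)

lemma list_cube_map:
 assumes "l \<noteq> []"
 shows "list_cube n \<zeta> (map h l) = list_cube n (\<lambda>l. \<zeta> (map h l)) l"
proof -
 have "block n (%l. \<zeta> (map h l)) = (%l. block n \<zeta> (map h l))"
  by (simp add: block_def fun_eq_iff)
 then have eq: "scan (block n \<zeta>) [hd (map h l)] (tl (map h l)) w
   = scan (block n (%l. \<zeta> (map h l))) [hd l] (tl l) w" for w
  using assms scan_map[of "block n \<zeta>" h "[hd l]" "tl l" w]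
  by (simp add: hd_map map_tl)
 show ?thesis
  unfolding list_cube_def length_map eq ..
qed

lemma qface_list_cube_True:
 assumes "length l = m + 2" "i < m"
 shows "qface i True (list_cube n \<zeta> l) = list_cube n \<zeta> (take (Suc i) l @ drop (Suc (Suc i)) l)"
proof (rule qcube_eqI)
 fix w :: cell assume w: "length w = qdim (qface i True (list_cube n \<zeta> l))"
 have "i \<le> length w" using w assms by (simp add: list_cube_def)
 from split_list_at[OF this] obtain x y where xy: "w = x @ y" "length x = i" by blast
 obtain v vs where l: "l = v # vs" using assms by (cases l) auto
 have "scan (block n \<zeta>) [v] vs (x @ Some True # y) = scan (block n \<zeta>) [v] (take i vs @ drop (Suc i) vs) (x @ y)"
  using scan_True[of x vs] xy assms l by simp
 then show "qval (qface i True (list_cube n \<zeta> l)) w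
   = qval (list_cube n \<zeta> (take (Suc i) l @ drop (Suc (Suc i)) l)) w"
  using w assms xy l by (simp add: qval_face list_cube_def)
qed (use assms in \<open>auto simp: list_cube_def\<close>)

lemma count_list_None_0: "count_list w None = 0 \<longleftrightarrow> None \<notin> set w"
 by (simp add: count_list_0_iff)

lemma qface_list_cube_False:
 assumes l: "length l = m + 2" "i < m" and n: "n \<ge> 1"
 shows "qface i False (list_cube n \<zeta> l)
  = list_cube n \<zeta> (take (Suc (Suc i)) l) + list_cube n \<zeta> (drop (Suc i) l)"
proof (rule qcube_eqI)
 show "qdim (qface i False (list_cube n \<zeta> l))
  = qdim (list_cube n \<zeta> (take (Suc (Suc i)) l) + list_cube n \<zeta> (drop (Suc i) l))"
  using l by (simp add: list_cube_def qdim_plus)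
next
 fix w :: cell assume w: "length w = qdim (qface i False (list_cube n \<zeta> l))"
 have "i \<le> length w" using w assms by (simp add: list_cube_def)
 from split_list_at[OF this] obtain x y where xy: "w = x @ y" "length x = i" by blast
 obtain v vs where lv: "l = v # vs" using assms by (cases l) auto
 have y: "length y = m - 1 - i" using w xy l by (simp add: list_cube_def)
 let ?s = "scan (block n \<zeta>) [v] (take (Suc i) vs) x"
 let ?t = "scan (block n \<zeta>) [vs ! i] (drop (Suc i) vs) y"
 have vs: "drop i vs = vs ! i # drop (Suc i) vs"
  using lv l by (simp add: Cons_nth_drop_Suc)
 have "scan (block n \<zeta>) [v] vs (x @ Some False # y) = ?s + ?t"
  using scan_False[of x vs] xy assms lv by simp
 then have lhs: "qval (qface i False (list_cube n \<zeta> l)) w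
   = (if count_list x None + count_list y None = n then ?s + ?t else 0)"
  using w l xy lv by (simp add: qval_face list_cube_def)
 have s: "qval (list_cube n \<zeta> (take (Suc (Suc i)) l)) x = (if count_list x None = n then ?s else 0)"
  using xy l lv by (simp add: list_cube_def)
 have t: "qval (list_cube n \<zeta> (drop (Suc i) l)) y = (if count_list y None = n then ?t else 0)"
  using y l lv vs by (simp add: list_cube_def)
 have rhs: "qval (list_cube n \<zeta> (take (Suc (Suc i)) l) + list_cube n \<zeta> (drop (Suc i) l)) w
  = (if None \<in> set y then 0 else if count_list x None = n then ?s else 0) +
   (if None \<in> set x then 0 else if count_list y None = n then ?t else 0)"
 proof -
  have "length x = qdim (list_cube n \<zeta> (take (Suc (Suc i)) l))"
   "length y = qdim (list_cube n \<zeta> (drop (Suc i) l))"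
   using xy y l by (auto simp: list_cube_def)
  then show ?thesis
   unfolding xy(1) by (simp only: qval_plus_append s t)
 qed
 have "?s = 0" if "count_list x None < n"
  by (rule scan_short) (use that n in auto)
 moreover have "?t = 0" if "count_list y None < n"
  by (rule scan_short) (use that n in auto)
 ultimately show "qval (qface i False (list_cube n \<zeta> l)) w
  = qval (list_cube n \<zeta> (take (Suc (Suc i)) l) + list_cube n \<zeta> (drop (Suc i) l)) w"
  unfolding lhs rhs
  using count_list_None_0[of x] count_list_None_0[of y] n by auto
qed

definition cube_cochain :: "nat => ('v list => 'p::ab_group_add) => 'v list => 'p cring" where
 "cube_cochain n \<zeta> l = (if length l < 2 then 0 else frag_of (list_cube n \<zeta> l))"

text \<open>The cubical boundary of the cube of a list lacks the faces that omit the first or the last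
 vertex. Adding the unit on edges supplies them as cup products.\<close>

definition edge_cochain :: "'v list => 'r::ring_1" where
 "edge_cochain l = (if length l = 2 then 1 else 0)"

text \<open>On edges both terms are the unit \<open>0\<close>-cube, so the difference vanishes there; on
 longer lists it is minus the cube, as in \<open>a(z)\<close>.\<close>

definition twist_cochain :: "nat => ('v list => 'p::ab_group_add) => 'v list => 'p cring" where
 "twist_cochain n \<zeta> = edge_cochain - cube_cochain n \<zeta>"

lemma sum_split_ends:
 fixes f :: "nat => 'w::ab_group_add"
 shows "(\<Sum>j<m + 2. f j) = f 0 + (\<Sum>i<m. f (Suc i)) + f (Suc m)"
 using sum.lessThan_Suc_shift[of f "Suc m"] by (simp add: add.assoc)

text \<open>Faces at \<open>0\<close> cut the list into overlapping halves and give the cup product,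
 faces at \<open>1\<close> delete an inner vertex and give the coboundary up to its two outer
 terms.\<close>

lemma cube_d_cube_cochain:
 assumes l: "length l = m + 2" and n: "n \<ge> 1"
 shows "cube_d (cube_cochain n \<zeta> l) = cup (*) (alt (cube_cochain n \<zeta>)) (cube_cochain n \<zeta>) l
  - cobd (cube_cochain n \<zeta>) l + cube_cochain n \<zeta> (tl l) + signed (Suc m) (cube_cochain n \<zeta> (butlast l))"
proof -
 let ?K = "cube_cochain n \<zeta>"
 let ?k = "%i. signed (Suc i) (?K (take (Suc (Suc i)) l) * ?K (drop (Suc i) l))"
 let ?b = "%i. signed (Suc i) (?K (take (Suc i) l @ drop (Suc (Suc i)) l))"
 have "cube_d (?K l) = (\<Sum>i<m. signed (Suc i) (face_diff i (frag_of (list_cube n \<zeta> l))))"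
  using l by (simp add: cube_cochain_def cube_d_of list_cube_def)
 also have "... = (\<Sum>i<m. ?k i - ?b i)"
 proof (rule sum.cong)
  fix i assume "i \<in> {..<m}"
  then have i: "i < m" by simp
  have "\<not> length (drop (Suc i) l) < 2" "\<not> length (take (Suc (Suc i)) l) < 2"
   "\<not> length (take (Suc i) l @ drop (Suc (Suc i)) l) < 2"
   using l i by auto
  then show "signed (Suc i) (face_diff i (frag_of (list_cube n \<zeta> l))) = ?k i - ?b i"
   by (simp add: face_diff_of qface_list_cube_True[OF l i] qface_list_cube_False[OF l i n]
     cube_cochain_def frag_of_times signed_diff)
 qed simp
 also have "... = (\<Sum>i<m. ?k i) - (\<Sum>i<m. ?b i)"
  by (rule sum_subtractf)
 finally have d: "cube_d (?K l) = (\<Sum>i<m. ?k i) - (\<Sum>i<m. ?b i)" .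
 have 1: "cup (*) (alt ?K) ?K l = (\<Sum>i<m. ?k i)"
 proof -
  have "cup (*) (alt ?K) ?K l = alt ?K (take (Suc 0) l) * ?K (drop 0 l)
    + (\<Sum>i<m. alt ?K (take (Suc (Suc i)) l) * ?K (drop (Suc i) l))
    + alt ?K (take (Suc (Suc m)) l) * ?K (drop (Suc m) l)"
   unfolding cup_sum l by (rule sum_split_ends)
  also have "... = (\<Sum>i<m. ?k i)"
   using l by (simp add: alt_def cube_cochain_def[of _ _ "take (Suc 0) l"]
     cube_cochain_def[of _ _ "drop (Suc m) l"] signed_mult_left)
  finally show ?thesis .
 qed
 have 2: "cobd ?K l = ?K (tl l) + (\<Sum>i<m. ?b i) + signed (Suc m) (?K (butlast l))"
 proof -
  have "cobd ?K l = signed 0 (?K (take 0 l @ drop (Suc 0) l)) + (\<Sum>i<m. ?b i)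
   + signed (Suc m) (?K (take (Suc m) l @ drop (Suc (Suc m)) l))"
   unfolding cobd_sum l by (rule sum_split_ends)
  then show ?thesis
   using l by (simp add: drop_Suc butlast_conv_take)
 qed
 show ?thesis
  unfolding d 1 2 by simp
qed

lemma twisting_twist_cochain:
 fixes \<zeta> :: "'v list => 'p::ab_group_add"
 assumes n: "n \<ge> 1"
 shows "cubical.twisting (twist_cochain n \<zeta>)"
 unfolding cubical.twisting_def
proof (intro conjI allI)
 let ?K = "cube_cochain n \<zeta>" and ?a = "twist_cochain n \<zeta>"
 let ?E = "edge_cochain :: 'v list => 'p cring"
 show nil: "?a [] = 0"
  by (simp add: twist_cochain_def edge_cochain_def cube_cochain_def)
 fix l :: "'v list"
 show "cube_sgn (?a l) = - alt ?a l"
 proof -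
  have "signed (length l - 2) x = signed (length l) x" if "length l \<ge> 2" for x :: "'p cring"
   using that by (auto simp: signed_def)
  then show ?thesis
   by (auto simp: twist_cochain_def cube_sgn_simps edge_cochain_def cube_cochain_def alt_def cube_sgn_one
     cube_sgn_of list_cube_def signed_diff numeral_2_eq_2)
 qed
next
 let ?K = "cube_cochain n \<zeta>" and ?a = "twist_cochain n \<zeta>"
 let ?E = "edge_cochain :: 'v list => 'p cring"
 have nil: "?a [] = 0"
  by (simp add: twist_cochain_def edge_cochain_def cube_cochain_def)
 have "cube_d (?a l) + cobd ?a l + cup (*) (alt ?a) ?a l = 0" for l
 proof (cases "length l < 2")
  case True
  then consider "l = []" | v where "l = [v]"
   by (cases l rule: list.exhaust; cases "tl l") auto
  then show ?thesis
   by cases (auto simp: twist_cochain_def edge_cochain_def cube_cochain_def cubical.d_simps)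
 next
  case False
  then obtain m where l: "length l = m + 2"
   by (metis add.commute le_Suc_ex not_less)
  have cupEf: "cup (*) (alt ?E) f l = - f (tl l)" for f :: "'v list => 'p cring"
  proof -
   have "cup (*) (alt ?E) f l = (\<Sum>j<length l. if j = 1 then - f (tl l) else 0)"
    unfolding cup_sum using l
    by (intro sum.cong) (auto simp: alt_def edge_cochain_def drop_Suc min_def)
   also have "... = - f (tl l)" using l by simp
   finally show ?thesis .
  qed
  have cupKE: "cup (*) (alt ?K) ?E l = - signed (Suc m) (?K (butlast l))"
  proof -
   have "cup (*) (alt ?K) ?E l = (\<Sum>j<length l. if j = m then - signed (Suc m) (?K (butlast l)) else 0)"
    unfolding cup_sum using l
    by (intro sum.cong) (auto simp: alt_def edge_cochain_def butlast_conv_take min_def)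
   also have "... = - signed (Suc m) (?K (butlast l))" using l by simp
   finally show ?thesis .
  qed
  have cobdE: "cobd ?E l = ?E (tl l)"
  proof (cases "length l = 3")
   case True
   then obtain x y z where "l = [x, y, z]"
    by (auto simp: numeral_3_eq_3 length_Suc_conv)
   then show ?thesis by (simp add: edge_cochain_def)
  next
   case False
   then have "length (take j l @ drop (Suc j) l) \<noteq> 2" if "j < length l" for j
    using that by auto
   then have "cobd ?E l = 0"
    unfolding cobd_sum edge_cochain_def by (intro sum.neutral) auto
   then show ?thesis
    using False by (simp add: edge_cochain_def)
  qed
  have dE: "cube_d (?E l) = 0"
   by (simp add: edge_cochain_def cubical.d_simps)
  show ?thesis
   using cube_d_cube_cochain[OF l n, of \<zeta>]
   by (simp add: twist_cochain_def cubical.d_simps cobd_diff alt_diff cubical.cup_ring_simps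
     cupEf cupKE cobdE dE algebra_simps del: signed_Suc)
 qed
 then show "(%l. cube_d (?a l)) + cobd ?a + cup (*) (alt ?a) ?a = 0"
  by (simp add: fun_eq_iff)
qed

section \<open>The cube of a cocycle is a cocycle\<close>

fun cell_cobd :: "(cell => 'p::ab_group_add) => cell => 'p" where
 "cell_cobd F [] = 0"
| "cell_cobd F (None # w) = F (Some False # w) - F (Some True # w) - cell_cobd (\<lambda>w. F (None # w)) w"
| "cell_cobd F (Some eps # w) = cell_cobd (\<lambda>w. F (Some eps # w)) w"

lemma cell_cobd_sum:
 "(\<Sum>i\<in>{i. i < length w \<and> w ! i = None}. signed (count_list (take i w) None)
   (F (w[i := Some False]) - F (w[i := Some True]))) = cell_cobd F w"
proof (induction w arbitrary: F)
 case (Cons a w)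
 let ?I = "{i. i < length w \<and> w ! i = None}"
 let ?J = "{i. i < length (a # w) \<and> (a # w) ! i = None}"
 let ?f = "%w i. signed (count_list (take i w) None) (F (w[i := Some False]) - F (w[i := Some True]))"
 have J: "?J = (if a = None then {0} else {}) \<union> Suc ` ?I"
  by (auto simp: image_iff less_Suc_eq_0_disj)
 have "(\<Sum>i\<in>?J. ?f (a # w) i) = (\<Sum>i\<in>(if a = None then {0} else {}). ?f (a # w) i) + (\<Sum>i\<in>Suc ` ?I. ?f (a # w) i)"
  unfolding J by (rule sum.union_disjoint) auto
 also have "(\<Sum>i\<in>Suc ` ?I. ?f (a # w) i) = (\<Sum>i\<in>?I. ?f (a # w) (Suc i))"
  by (simp add: sum.reindex)
 also have "... = (\<Sum>i\<in>?I. signed (if a = None then 1 else 0) (signed (count_list (take i w) None)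
   (F (a # w[i := Some False]) - F (a # w[i := Some True]))))"
  by (rule sum.cong) (auto)
 also have "... = signed (if a = None then 1 else 0) (cell_cobd (%w. F (a # w)) w)"
  by (subst additive_sum[of "signed _", OF signed_add, symmetric]) (simp add: Cons.IH[of "%w. F (a # w)"])
 finally show ?case
  by (cases a) auto
qed simp

lemma cell_cobd_const_add: "cell_cobd (\<lambda>w. c + F w) w = cell_cobd F w"
proof (induction w arbitrary: F)
 case (Cons a w)
 then show ?case by (cases a) auto
qed simp

fun first_block :: "'v list => cell => 'v list" where
 "first_block [] w = []"
| "first_block (v # vs) [] = [v]"
| "first_block (v # vs) (None # w) = v # first_block vs w"
| "first_block (v # vs) (Some True # w) = first_block vs w"
| "first_block (v # vs) (Some False # w) = [v]"

fun scan_rest :: "('v list => 'p::ab_group_add) => 'v list => cell => 'p" where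
 "scan_rest \<beta> [] w = 0"
| "scan_rest \<beta> (v # vs) [] = 0"
| "scan_rest \<beta> (v # vs) (None # w) = scan_rest \<beta> vs w"
| "scan_rest \<beta> (v # vs) (Some True # w) = scan_rest \<beta> vs w"
| "scan_rest \<beta> (v # vs) (Some False # w) = scan \<beta> [v] vs w"

lemma scan_first_block:
 "length vs = Suc (length w) ==> scan \<beta> acc vs w = \<beta> (acc @ first_block vs w) + scan_rest \<beta> vs w"
 by (induction \<beta> acc vs w rule: scan.induct) auto

lemma first_block_ne: "length vs = Suc (length w) ==> first_block vs w \<noteq> []"
 by (induction vs w rule: first_block.induct) auto

lemma length_first_block:
 "length vs = Suc (length w) ==> length (first_block vs w) \<le> Suc (count_list w None)"
 by (induction vs w rule: first_block.induct) auto

fun rest_cobd :: "('v list => 'p::ab_group_add) => 'v list => cell => 'p" where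
 "rest_cobd \<beta> [] w = 0"
| "rest_cobd \<beta> (v # vs) [] = 0"
| "rest_cobd \<beta> (v # vs) (None # w) = - rest_cobd \<beta> vs w"
| "rest_cobd \<beta> (v # vs) (Some True # w) = rest_cobd \<beta> vs w"
| "rest_cobd \<beta> (v # vs) (Some False # w) = cell_cobd (scan \<beta> [v] vs) w"

definition block_cobd :: "('v list => 'p::ab_group_add) => 'v list => 'v list => 'p" where
 "block_cobd \<beta> acc b = (\<Sum>j<length b - 1. signed j
  (\<beta> (acc @ take (Suc j) b) + \<beta> (drop j b) - \<beta> (acc @ take j b @ drop (Suc j) b)))"

lemma block_cobd_Cons:
 assumes "b \<noteq> []"
 shows "block_cobd \<beta> acc (v # b) = \<beta> (acc @ [v]) + \<beta> (v # b) - \<beta> (acc @ b) - block_cobd \<beta> (acc @ [v]) b"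
proof -
 obtain k where k: "length b = Suc k" using assms by (cases b) auto
 show ?thesis
  unfolding block_cobd_def using k
  by (simp add: sum.lessThan_Suc_shift sum_negf del: sum.lessThan_Suc)
qed

text \<open>Fixing a free coordinate at \<open>0\<close> splits its block, fixing it at \<open>1\<close> deletes a vertex; the
 other blocks cancel in the difference.\<close>

lemma cell_cobd_scan:
 "length vs = Suc (length w) ==>
  cell_cobd (scan \<beta> acc vs) w = block_cobd \<beta> acc (first_block vs w) + rest_cobd \<beta> vs w"
proof (induction w arbitrary: acc vs)
 case Nil
 then show ?case by (cases vs) (auto simp: block_cobd_def)
next
 case (Cons a w)
 then obtain v vs' where vs: "vs = v # vs'" and len: "length vs' = Suc (length w)"
  by (cases vs) auto
 consider "a = None" | "a = Some True" | "a = Some False"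
  by (cases a rule: option.exhaust; cases "the a") auto
 then show ?case
 proof cases
  case 1
  have "cell_cobd (scan \<beta> acc vs) (a # w)
   = \<beta> (acc @ [v]) + scan \<beta> [v] vs' w - scan \<beta> acc vs' w - cell_cobd (scan \<beta> (acc @ [v]) vs') w"
   by (simp add: 1 vs)
  then show ?thesis
   using first_block_ne[OF len]
   by (simp add: 1 vs Cons.IH[OF len] scan_first_block[OF len] block_cobd_Cons)
 next
  case 2
  then show ?thesis
   by (simp add: vs Cons.IH[OF len])
 next
  case 3
  then show ?thesis
   by (simp add: vs cell_cobd_const_add block_cobd_def)
 qed
qed

text \<open>If one block carries all \<open>n + 1\<close> free coordinates, its contribution is the simplicial
 coboundary of \<open>\<zeta>\<close>; a shorter block contributes nothing.\<close>

lemma block_cobd_zero: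
 assumes \<zeta>: "cobd \<zeta> (x # b) = 0 \<or> length b < n + 2" and b: "b \<noteq> []" "length b \<le> n + 2"
 shows "block_cobd (block n \<zeta>) [x] b = 0"
proof (cases "length b < n + 2")
 case True
 then show ?thesis
  unfolding block_cobd_def by (intro sum.neutral) (auto simp: block_def)
next
 case False
 then have len: "length b = n + 2" using b by simp
 let ?c = "%j. signed j (\<zeta> (x # take j b @ drop (Suc j) b))"
 have "block_cobd (block n \<zeta>) [x] b
  = (\<Sum>j<Suc n. (if j = n then signed n (\<zeta> (x # butlast b)) else 0)
    + (if j = 0 then \<zeta> b else 0) - ?c j)"
  unfolding block_cobd_def
  by (rule sum.cong) (use len in \<open>auto simp: block_def butlast_conv_take signed_diff min_def\<close>)
 also have "... = signed n (\<zeta> (x # butlast b)) + \<zeta> b - (\<Sum>j<Suc n. ?c j)"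
  by (simp add: sum.distrib sum_subtractf del: sum.lessThan_Suc)
 also have "... = cobd \<zeta> (x # b)"
  using len by (simp add: cobd_sum[of "cone_at x \<zeta>"] cone_at_apply butlast_conv_take)
 finally show ?thesis
  using \<zeta> False by simp
qed

lemma cell_cobd_scan_zero:
 assumes \<zeta>: "\<And>l. length l = n + 3 ==> cobd \<zeta> l = 0"
 shows "length vs = Suc (length w) ==> count_list w None \<le> Suc n ==>
  rest_cobd (block n \<zeta>) vs w = 0 \<and> cell_cobd (scan (block n \<zeta>) [x] vs) w = 0"
proof (induction w arbitrary: vs x)
 case Nil
 then show ?case by (cases vs) auto
next
 case (Cons a w)
 then obtain v vs' where vs: "vs = v # vs'" and len: "length vs' = Suc (length w)"
  by (cases vs) auto
 consider "a = None" | "a = Some True" | "a = Some False"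
  by (cases a rule: option.exhaust; cases "the a") auto
 then have rest: "rest_cobd (block n \<zeta>) vs (a # w) = 0"
  by cases (use Cons.prems Cons.IH[OF len] vs in auto)
 moreover have "block_cobd (block n \<zeta>) [x] (first_block vs (a # w)) = 0"
 proof (rule block_cobd_zero)
  show "first_block vs (a # w) \<noteq> []"
   using first_block_ne Cons.prems by blast
  show len': "length (first_block vs (a # w)) \<le> n + 2"
   using length_first_block[OF Cons.prems(1)] Cons.prems(2) by simp
  then show "cobd \<zeta> (x # first_block vs (a # w)) = 0 \<or> length (first_block vs (a # w)) < n + 2"
   using \<zeta>[of "x # first_block vs (a # w)"] by force
 qed
 ultimately show ?case
  using cell_cobd_scan[OF Cons.prems(1), of "block n \<zeta>" "[x]"] by simp
qed

lemma count_list_append: "count_list (x @ y) a = count_list x a + count_list y a"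
 by (induction x) auto

lemma cell_cobd_cong:
 assumes "\<And>w'. length w' = length w ==> Suc (count_list w' None) = count_list w None ==> F w' = F' w'"
 shows "cell_cobd F w = cell_cobd F' w"
 using assms
proof (induction w arbitrary: F F')
 case (Cons a w)
 have "cell_cobd (%w. F (a # w)) w = cell_cobd (%w. F' (a # w)) w"
  by (rule Cons.IH) (use Cons.prems[of "a # _"] in auto)
 with Cons.prems[of "Some _ # w"] show ?case
  by (cases a) auto
qed simp

text \<open>The cellular coboundary of the cube is, block by block, the simplicial coboundary of
 \<open>\<zeta>\<close>.\<close>

lemma list_cube_in_L_cubes:
 assumes \<zeta>: "\<And>l. length l = n + 3 ==> cobd \<zeta> l = 0" and l: "length l \<ge> 2"
 shows "Rep_qcube (list_cube n \<zeta> l) \<in> L_cubes n"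
proof -
 let ?m = "length l - 2"
 let ?f = "qval (list_cube n \<zeta> l)"
 obtain v vs where lv: "l = v # vs" using l by (cases l) auto
 have off: "?f w = 0" if "w \<notin> cells ?m n" for w
  using that by (auto simp: list_cube_def cells_def)
 have coc: "(\<Sum>i\<in>{i. i < ?m \<and> w ! i = None}. signed (Suc (count_list (take i w) None))
     (?f (w[i := Some False]) - ?f (w[i := Some True]))) = 0" if w: "w \<in> cells ?m (Suc n)" for w
 proof -
  have len: "length w = ?m" and cnt: "count_list w None = Suc n"
   using w by (auto simp: cells_def)
  have "cell_cobd ?f w = cell_cobd (scan (block n \<zeta>) [v] vs) w"
   by (rule cell_cobd_cong) (use len cnt lv in \<open>auto simp: list_cube_def\<close>)
  also have "... = 0"
   using cell_cobd_scan_zero[of n \<zeta> vs w v, OF \<zeta>] len cnt lv l by simp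
  finally show ?thesis
   using cell_cobd_sum[of w ?f] len by (simp add: sum_negf)
 qed
 show ?thesis
  using off coc by (simp add: L_cubes_def Rep_qcube_eq cell_cocycles_def list_cube_def[THEN arg_cong[where f = qdim]])
qed

section \<open>Comparison with the index formula for kappa\<close>

lemma scan_skip:
 assumes "None \<notin> set p" "n \<ge> 1"
 shows "\<exists>r. (r = a \<and> Some False \<notin> set p \<or> (\<exists>i<length p. r = k + i \<and> p ! i = Some False \<and> Some False \<notin> set (drop (Suc i) p)))
  \<and> scan (block n Z) [a] [k..<k + Suc (length p + length w)] (p @ w)
   = scan (block n Z) [r] [k + length p..<k + Suc (length p + length w)] w"
 using assms(1)
proof (induction p arbitrary: a k)
 case Nil
 show ?case by (intro exI[of _ a]) simp
next
 case (Cons e p)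
 have up: "[k..<k + Suc (length (e # p) + length w)] = k # [Suc k..<Suc k + Suc (length p + length w)]"
  by (simp add: upt_conv_Cons del: upt_Suc)
 have prem: "None \<notin> set p" using Cons.prems by simp
 consider "e = Some True" | "e = Some False"
  using Cons.prems by (cases e rule: option.exhaust; cases "the e") auto
 then show ?case
 proof cases
  case 1
  from Cons.IH[OF prem, of a "Suc k"] obtain r where
   r: "r = a \<and> Some False \<notin> set p \<or> (\<exists>i<length p. r = Suc k + i \<and> p ! i = Some False \<and> Some False \<notin> set (drop (Suc i) p))"
   and eq: "scan (block n Z) [a] [Suc k..<Suc k + Suc (length p + length w)] (p @ w)
   = scan (block n Z) [r] [Suc k + length p..<Suc k + Suc (length p + length w)] w"
   by blast
  have "r = a \<and> Some False \<notin> set (e # p) \<or> (\<exists>i<length (e # p). r = k + i \<and> (e # p) ! i = Some False \<and> Some False \<notin> set (drop (Suc i) (e # p)))"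
   using r
  proof (elim disjE exE conjE)
   fix i assume "i < length p" "r = Suc k + i" "p ! i = Some False" "Some False \<notin> set (drop (Suc i) p)"
   then show ?thesis by (intro disjI2 exI[of _ "Suc i"]) simp
  qed (use 1 in simp)
  moreover have "scan (block n Z) [a] [k..<k + Suc (length (e # p) + length w)] ((e # p) @ w)
   = scan (block n Z) [r] [k + length (e # p)..<k + Suc (length (e # p) + length w)] w"
   unfolding up using eq 1 by (simp del: upt_Suc)
  ultimately show ?thesis by blast
 next
  case 2
  from Cons.IH[OF prem, of k "Suc k"] obtain r where
   r: "r = k \<and> Some False \<notin> set p \<or> (\<exists>i<length p. r = Suc k + i \<and> p ! i = Some False \<and> Some False \<notin> set (drop (Suc i) p))"
   and eq: "scan (block n Z) [k] [Suc k..<Suc k + Suc (length p + length w)] (p @ w)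
   = scan (block n Z) [r] [Suc k + length p..<Suc k + Suc (length p + length w)] w"
   by blast
  have "r = a \<and> Some False \<notin> set (e # p) \<or> (\<exists>i<length (e # p). r = k + i \<and> (e # p) ! i = Some False \<and> Some False \<notin> set (drop (Suc i) (e # p)))"
   using r
  proof (elim disjE exE conjE)
   assume "r = k" "Some False \<notin> set p"
   then show ?thesis using 2 by (intro disjI2 exI[of _ 0]) simp
  next
   fix i assume "i < length p" "r = Suc k + i" "p ! i = Some False" "Some False \<notin> set (drop (Suc i) p)"
   then show ?thesis by (intro disjI2 exI[of _ "Suc i"]) simp
  qed
  moreover have "block n Z [a, k] = 0"
   using assms(2) by (simp add: block_def)
  then have "scan (block n Z) [a] [k..<k + Suc (length (e # p) + length w)] ((e # p) @ w)
   = scan (block n Z) [r] [k + length (e # p)..<k + Suc (length (e # p) + length w)] w"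
   unfolding up using eq 2 by (simp del: upt_Suc)
  ultimately show ?thesis by blast
 qed
qed

lemma scan_collect:
 assumes "Some False \<notin> set p"
 shows "scan \<beta> acc [k..<k + Suc (length p + length w)] (p @ w)
   = scan \<beta> (acc @ filter (\<lambda>v. p ! (v - k) = None) [k..<k + length p])
     [k + length p..<k + Suc (length p + length w)] w"
 using assms
proof (induction p arbitrary: acc k)
 case (Cons e p)
 have up: "[k..<k + Suc (length (e # p) + length w)] = k # [Suc k..<Suc k + Suc (length p + length w)]"
  and up': "[k..<k + length (e # p)] = k # [Suc k..<Suc k + length p]"
  by (simp_all add: upt_conv_Cons del: upt_Suc)
 have fl: "filter (%v. (e # p) ! (v - k) = None) [Suc k..<Suc k + length p]
  = filter (%v. p ! (v - Suc k) = None) [Suc k..<Suc k + length p]"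
  by (rule filter_cong) (auto simp: nth_Cons')
 consider "e = Some True" | "e = None"
  using Cons.prems by (cases e rule: option.exhaust; cases "the e") auto
 then show ?case
 proof cases
  case 1
  then show ?thesis
   unfolding up up' filter.simps fl using Cons.IH[of acc "Suc k"] Cons.prems by (simp del: upt_Suc)
 next
  case 2
  then show ?thesis
   unfolding up up' filter.simps fl using Cons.IH[of "acc @ [k]" "Suc k"] Cons.prems by (simp del: upt_Suc)
 qed
qed simp

lemma scan_finish:
 assumes "None \<notin> set s" "n \<ge> 1" "length acc = Suc n"
 shows "\<exists>q. (q = k + length s \<and> Some False \<notin> set s \<or> (\<exists>i<length s. q = k + i \<and> s ! i = Some False \<and> Some False \<notin> set (take i s)))
  \<and> scan (block n Z) acc [k..<k + Suc (length s)] s = Z (acc @ [q])"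
 using assms(1)
proof (induction s arbitrary: k)
 case Nil
 then show ?case using assms by (auto simp: block_def)
next
 case (Cons e s)
 have up: "[k..<k + Suc (length (e # s))] = k # [Suc k..<Suc k + Suc (length s)]"
  by (simp add: upt_conv_Cons del: upt_Suc)
 have prem: "None \<notin> set s" using Cons.prems by simp
 consider "e = Some True" | "e = Some False"
  using Cons.prems by (cases e rule: option.exhaust; cases "the e") auto
 then show ?case
 proof cases
  case 1
  from Cons.IH[OF prem, of "Suc k"] obtain q where
   q: "q = Suc k + length s \<and> Some False \<notin> set s \<or> (\<exists>i<length s. q = Suc k + i \<and> s ! i = Some False \<and> Some False \<notin> set (take i s))"
   and eq: "scan (block n Z) acc [Suc k..<Suc k + Suc (length s)] s = Z (acc @ [q])"
   by blast
  have "q = k + length (e # s) \<and> Some False \<notin> set (e # s) \<or> (\<exists>i<length (e # s). q = k + i \<and> (e # s) ! i = Some False \<and> Some False \<notin> set (take i (e # s)))"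
   using q
  proof (elim disjE exE conjE)
   fix i assume "i < length s" "q = Suc k + i" "s ! i = Some False" "Some False \<notin> set (take i s)"
   then show ?thesis using 1 by (intro disjI2 exI[of _ "Suc i"]) simp
  qed (use 1 in simp)
  moreover have "scan (block n Z) acc [k..<k + Suc (length (e # s))] (e # s) = Z (acc @ [q])"
   unfolding up using eq 1 by (simp del: upt_Suc)
  ultimately show ?thesis by blast
 next
  case 2
  have "scan (block n Z) [k] [Suc k..<Suc k + Suc (length s)] s = 0"
   by (rule scan_short) (use Cons.prems assms count_list_None_0[of s] in auto)
  then have "scan (block n Z) acc [k..<k + Suc (length (e # s))] (e # s) = Z (acc @ [k])"
   unfolding up using 2 assms by (simp add: block_def del: upt_Suc)
  then show ?thesis using 2 by (intro exI[of _ k] conjI disjI2 exI[of _ 0]) auto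
 qed
qed

lemma length_filter_None:
 "length (filter (\<lambda>v. p ! (v - k) = None) [k..<k + length p]) = count_list p None"
proof (induction p arbitrary: k)
 case (Cons e p)
 have up: "[k..<k + length (e # p)] = k # [Suc k..<Suc k + length p]"
  by (simp add: upt_conv_Cons del: upt_Suc)
 have fl: "filter (%v. (e # p) ! (v - k) = None) [Suc k..<Suc k + length p]
  = filter (%v. p ! (v - Suc k) = None) [Suc k..<Suc k + length p]"
  by (rule filter_cong) (auto simp: nth_Cons')
 show ?case
  unfolding up filter.simps fl using Cons.IH[of "Suc k"] by (simp del: upt_Suc)
qed simp

lemma kappa_value:
 fixes Z :: "nat list => 'p::ab_group_add"
 assumes n: "n \<ge> 1" and w: "w \<in> cells m n"
 defines "x \<equiv> (\<lambda>l. (Some False # w) ! (l - 1))"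
 defines "free \<equiv> filter (\<lambda>l. x l = None) [1..<m + 2]"
 defines "r \<equiv> Max {l. 1 \<le> l \<and> l < hd free \<and> x l = Some False}"
 defines "q \<equiv> Min (insert (m + 2) {l. last free < l \<and> l \<le> m + 1 \<and> x l = Some False})"
 shows "(if \<exists>l. hd free < l \<and> l < last free \<and> x l = Some False then 0
   else Z (map (\<lambda>l. l - 1) (r # free @ [q]))) = scan (block n Z) [0] [1..<m + 2] w"
proof -
 have len: "length w = m" and cnt: "count_list w None = n"
  using w by (auto simp: cells_def)
 have "None \<in> set w"
  using cnt n count_list_None_0[of w] by auto
 then obtain p t where wt: "w = p @ None # t" and p: "None \<notin> set p"
  by (meson split_list_first)
 have "None \<in> set (None # t)" by simp
 then obtain mid' s where ts: "None # t = mid' @ None # s" and s: "None \<notin> set s"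
  by (meson split_list_last)
 define mid where "mid = mid' @ [None]"
 have wd: "w = p @ mid @ s" using wt ts by (simp add: mid_def)
 define P M S where "P = length p" and "M = length mid" and "S = length s"
 have m: "m = P + M + S" and M: "M \<ge> 1"
  using len wd by (auto simp: P_def M_def S_def mid_def)
 have mid0: "mid ! 0 = None"
  using ts by (cases mid') (auto simp: mid_def)
 have midl: "mid ! (M - 1) = None"
  by (simp add: mid_def M_def)
 have x_p: "x (Suc (Suc i)) = p ! i" if "i < P" for i
  using that by (simp add: x_def wd P_def nth_append)
 have x_mid: "x (Suc (Suc (P + i))) = mid ! i" if "i < M" for i
  using that by (simp add: x_def wd P_def M_def nth_append)
 have x_s: "x (Suc (Suc (P + M + i))) = s ! i" if "i < S" for i
  using that by (simp add: x_def wd P_def M_def nth_append)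
 have x_1: "x 1 = Some False" by (simp add: x_def)
 define fv where "fv = filter (%v. mid ! (v - Suc P) = None) [Suc P..<Suc P + M]"
 have free: "free = map Suc fv"
 proof -
  have "[1..<m + 2] = map Suc [0..<Suc m]"
   by (simp add: map_Suc_upt)
  then have "free = map Suc (filter (%v. x (Suc v) = None) [0..<Suc m])"
   by (simp add: free_def filter_map comp_def del: upt_Suc)
  also have "[0..<Suc m] = [0..<Suc P] @ [Suc P..<Suc P + M] @ [Suc P + M..<Suc P + M + S]"
   using m upt_add_eq_append[of 0 "Suc P" "M + S"] upt_add_eq_append[of "Suc P" "Suc P + M" S]
   by (simp add: add.assoc del: upt_Suc)
  also have "filter (%v. x (Suc v) = None) ... = fv"
  proof -
   have 1: "filter (%v. x (Suc v) = None) [0..<Suc P] = []"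
   proof (rule filter_False, rule ballI)
    fix v assume "v \<in> set [0..<Suc P]"
    then have v: "v < Suc P" by (simp del: upt_Suc)
    show "x (Suc v) \<noteq> None"
    proof (cases v)
     case (Suc i)
     then have "i < P" using v by simp
     then have "p ! i \<in> set p" by (simp add: P_def)
     then show ?thesis using Suc x_p[OF \<open>i < P\<close>] p by metis
    qed (use x_1 in simp)
   qed
   have 2: "filter (%v. x (Suc v) = None) [Suc P + M..<Suc P + M + S] = []"
   proof (rule filter_False, rule ballI)
    fix v assume v: "v \<in> set [Suc P + M..<Suc P + M + S]"
    then obtain i where "v = Suc P + M + i" "i < S"
     by (metis add_less_cancel_left atLeastLessThan_iff atLeastLessThan_upt le_Suc_ex)
    then have "s ! i \<in> set s" "x (Suc v) = s ! i"
     using x_s[of i] by (simp_all add: S_def)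
    then show "x (Suc v) \<noteq> None"
     using s by metis
   qed
   have 3: "filter (%v. x (Suc v) = None) [Suc P..<Suc P + M] = fv"
    unfolding fv_def
   proof (rule filter_cong)
    fix v assume v: "v \<in> set [Suc P..<Suc P + M]"
    then obtain i where "v = Suc P + i" "i < M"
     by (metis add_less_cancel_left atLeastLessThan_iff atLeastLessThan_upt le_Suc_ex)
    then show "(x (Suc v) = None) = (mid ! (v - Suc P) = None)"
     using x_mid[of i] by simp
   qed simp
   show ?thesis unfolding filter_append 1 2 3 by simp
  qed
  finally show ?thesis .
 qed
 obtain M' where M': "M = Suc M'" using M by (cases M) auto
 have hd_fv: "fv \<noteq> []" "hd fv = Suc P"
  using mid0 by (simp_all add: fv_def M' upt_conv_Cons del: upt_Suc)
 have last_fv: "last fv = P + M"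
 proof -
  have "[Suc P..<Suc P + M] = [Suc P..<P + M] @ [P + M]"
   using M by (simp add: M')
  then show ?thesis
   using midl by (simp add: fv_def)
 qed
 have hd_free: "hd free = Suc (Suc P)" and last_free: "last free = Suc (P + M)"
  using hd_fv last_fv by (simp_all add: free hd_map last_map)
 show ?thesis
 proof (cases "Some False \<in> set mid")
  case True
  then obtain i where i: "i < M" "mid ! i = Some False"
   by (auto simp: in_set_conv_nth M_def)
  then have "i \<noteq> 0" "i \<noteq> M - 1"
   using mid0 midl by (metis option.distinct(1))+
  then have ex: "\<exists>l. hd free < l \<and> l < last free \<and> x l = Some False"
   using i x_mid[of i] unfolding hd_free last_free
   by (intro exI[of _ "Suc (Suc (P + i))"]) auto
  have u: "w = (p @ take i mid) @ Some False # (drop (Suc i) mid @ s)"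
   using i id_take_nth_drop[of i mid] wd by (metis M_def append_Cons append_assoc)
  let ?u = "p @ take i mid" and ?v = "drop (Suc i) mid @ s"
  have "None \<in> set ?u"
   using mid0 i \<open>i \<noteq> 0\<close> by (cases mid; cases i) (auto simp: M_def)
  have "None \<in> set ?v"
  proof -
   have "Suc i \<le> length mid'"
    using i \<open>i \<noteq> M - 1\<close> by (simp add: mid_def M_def)
   then have "drop (Suc i) mid = drop (Suc i) mid' @ [None]"
    by (simp add: mid_def)
   then show ?thesis by simp
  qed
  have "count_list ?u None + count_list (Some False # ?v) None = n"
   using cnt u count_list_append[of ?u "Some False # ?v" None] by metis
  moreover have "count_list (Some False # ?v) None = count_list ?v None" by simp
  moreover have "count_list ?u None \<noteq> 0" "count_list ?v None \<noteq> 0"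
   using \<open>None \<in> set ?u\<close> \<open>None \<in> set ?v\<close> count_list_None_0 by blast+
  ultimately have lt: "count_list ?u None < n" "count_list ?v None < n"
   by linarith+
  have "scan (block n Z) [0] [1..<m + 2] w
   = scan (block n Z) [0] (take (Suc (length ?u)) [1..<m + 2]) ?u
    + scan (block n Z) [[1..<m + 2] ! length ?u] (drop (Suc (length ?u)) [1..<m + 2]) ?v"
  proof -
   have "length ?u < length [1..<m + 2]" using len u by simp
   then show ?thesis by (subst u) (rule scan_False)
  qed
  also have "... = 0"
   using lt n by (simp add: scan_short)
  finally show ?thesis using ex by simp
 next
  case False
  have nex: "\<not> (\<exists>l. hd free < l \<and> l < last free \<and> x l = Some False)"
  proof
   assume "\<exists>l. hd free < l \<and> l < last free \<and> x l = Some False"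
   then obtain l where l: "Suc (Suc P) < l" "l < Suc (P + M)" "x l = Some False"
    unfolding hd_free last_free by blast
   define i where "i = l - Suc (Suc P)"
   have i: "l = Suc (Suc (P + i))" "i < M" using l by (auto simp: i_def)
   then have "mid ! i = Some False" using l x_mid[OF i(2)] by simp
   then show False using False i(2) nth_mem[of i mid] by (simp add: M_def)
  qed
  obtain r' where r': "r' = 0 \<and> Some False \<notin> set p \<or> (\<exists>i<P. r' = 1 + i \<and> p ! i = Some False \<and> Some False \<notin> set (drop (Suc i) p))"
   and eq1: "scan (block n Z) [0] [1..<1 + Suc (P + length (mid @ s))] (p @ (mid @ s))
    = scan (block n Z) [r'] [1 + P..<1 + Suc (P + length (mid @ s))] (mid @ s)"
   using scan_skip[OF p n, of 0 1 Z "mid @ s", folded P_def] by blast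
  have eq2: "scan (block n Z) [r'] [Suc P..<Suc P + Suc (M + S)] (mid @ s)
   = scan (block n Z) ([r'] @ fv) [Suc P + M..<Suc P + Suc (M + S)] s"
   using scan_collect[OF False, of "block n Z" "[r']" "Suc P" s] by (simp add: fv_def M_def S_def del: upt_Suc)
  have "length fv = n"
  proof -
   have "count_list mid None = n"
    using cnt p s by (simp add: wd count_list_append count_list_None_0)
   then show ?thesis
    using length_filter_None[of mid "Suc P"] by (simp add: fv_def M_def del: upt_Suc)
  qed
  then have "length ([r'] @ fv) = Suc n" by simp
  from scan_finish[OF s n this, of "Suc P + M" Z, folded S_def] obtain q' where
   q': "q' = Suc P + M + S \<and> Some False \<notin> set s \<or> (\<exists>i<S. q' = Suc P + M + i \<and> s ! i = Some False \<and> Some False \<notin> set (take i s))"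
   and eq3: "scan (block n Z) ([r'] @ fv) [Suc P + M..<Suc P + M + Suc S] s = Z (([r'] @ fv) @ [q'])"
   by blast
  have r: "r = Suc r'"
   unfolding r_def
  proof (rule Max_eqI)
   show "finite {l. 1 \<le> l \<and> l < hd free \<and> x l = Some False}"
    by (rule finite_subset[of _ "{..<hd free}"]) auto
   show "Suc r' \<in> {l. 1 \<le> l \<and> l < hd free \<and> x l = Some False}"
    using r' x_1 x_p unfolding hd_free by auto
   fix l assume "l \<in> {l. 1 \<le> l \<and> l < hd free \<and> x l = Some False}"
   then have l: "1 \<le> l" "l < Suc (Suc P)" "x l = Some False" unfolding hd_free by auto
   show "l \<le> Suc r'"
   proof (rule ccontr)
    assume "\<not> l \<le> Suc r'"
    then have "Suc r' < l" by simp
    define i where "i = l - 2"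
    have i: "l = Suc (Suc i)" "r' \<le> i"
     using \<open>Suc r' < l\<close> by (auto simp: i_def)
    then have "i < P" "p ! i = Some False" using l x_p[of i] by auto
    moreover from r' show False
    proof
     assume "r' = 0 \<and> Some False \<notin> set p"
     with \<open>i < P\<close> \<open>p ! i = Some False\<close> nth_mem[of i p] show False by (auto simp: P_def)
    next
     assume "\<exists>i<P. r' = 1 + i \<and> p ! i = Some False \<and> Some False \<notin> set (drop (Suc i) p)"
     then obtain j where j: "j < P" "r' = Suc j" "Some False \<notin> set (drop (Suc j) p)" by auto
     then have "drop (Suc j) p ! (i - Suc j) = Some False"
      using i \<open>i < P\<close> \<open>p ! i = Some False\<close> by (simp add: P_def)
     moreover have "i - Suc j < length (drop (Suc j) p)"
      using i j \<open>i < P\<close> by (simp add: P_def)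
     ultimately show False using j nth_mem by metis
    qed
   qed
  qed
  have q: "q = Suc q'"
   unfolding q_def
  proof (rule Min_eqI)
   show "finite (insert (m + 2) {l. last free < l \<and> l \<le> m + 1 \<and> x l = Some False})"
    by (rule finite_subset[of _ "{..m + 2}"]) auto
   show "Suc q' \<in> insert (m + 2) {l. last free < l \<and> l \<le> m + 1 \<and> x l = Some False}"
    using q' x_s unfolding last_free m by auto
   fix l assume "l \<in> insert (m + 2) {l. last free < l \<and> l \<le> m + 1 \<and> x l = Some False}"
   then consider "l = m + 2" | "Suc (P + M) < l" "l \<le> m + 1" "x l = Some False"
    unfolding last_free by auto
   then show "Suc q' \<le> l"
   proof cases
    case 1
    then show ?thesis using q' m by auto
   next
    case 2
    define i where "i = l - Suc (Suc (P + M))"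
    have i: "l = Suc (Suc (P + M + i))"
     using 2 by (auto simp: i_def)
    then have "i < S" "s ! i = Some False" using 2 m x_s[of i] by auto
    from q' show ?thesis
    proof
     assume "q' = Suc P + M + S \<and> Some False \<notin> set s"
     with \<open>i < S\<close> \<open>s ! i = Some False\<close> nth_mem[of i s] show ?thesis by (auto simp: S_def)
    next
     assume "\<exists>i<S. q' = Suc P + M + i \<and> s ! i = Some False \<and> Some False \<notin> set (take i s)"
     then obtain j where j: "j < S" "q' = Suc P + M + j" "Some False \<notin> set (take j s)" by auto
     have "\<not> i < j"
     proof
      assume "i < j"
      then have "take j s ! i = Some False" "i < length (take j s)"
       using \<open>s ! i = Some False\<close> \<open>i < S\<close> by (auto simp: S_def)
      with j nth_mem show False by metis
     qed
     then show ?thesis using i j by simp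
    qed
   qed
  qed
  have "scan (block n Z) [0] [1..<m + 2] w = Z (([r'] @ fv) @ [q'])"
  proof -
   have e: "1 + Suc (P + length (mid @ s)) = m + 2" "Suc P + Suc (M + S) = m + 2"
    "Suc P + M + Suc S = m + 2" "1 + P = Suc P"
    using m by (simp_all add: M_def S_def)
   show ?thesis
    using eq1 eq2 eq3 unfolding e wd by simp
  qed
  moreover have "map (%l. l - 1) (r # free @ [q]) = ([r'] @ fv) @ [q']"
   by (simp add: r q free comp_def)
  ultimately show ?thesis
   by (simp only: nex if_False)
 qed
qed

text \<open>The block of the free coordinates starts at the last coordinate \<open>0\<close> before them
 and ends at the first one after them, or at the end of the list: these are \<open>r\<close> and
 \<open>q\<close>.\<close>

lemma kappa_eq_list_cube:
 assumes n: "n \<ge> 1"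
 shows "kappa n z m \<sigma> = Rep_qcube (list_cube n (\<lambda>l. z (frag_of (vertex_face l \<sigma>))) [0..<m + 2])"
proof -
 let ?Z = "%l. z (frag_of (vertex_face l \<sigma>))"
 have "snd (kappa n z m \<sigma>) w = qval (list_cube n ?Z [0..<m + 2]) w" for w
 proof (cases "w \<in> cells m n")
  case True
  have up: "[0..<m + 2] = 0 # [1..<m + 2]" by (simp add: upt_conv_Cons)
  have "snd (kappa n z m \<sigma>) w = scan (block n ?Z) [0] [1..<m + 2] w"
   unfolding kappa_value[OF n True, of ?Z, symmetric]
   by (simp only: kappa_def Let_def snd_conv True not_True_eq_False simp_thms)
  also have "... = qval (list_cube n ?Z [0..<m + 2]) w"
   using True unfolding list_cube_def up list.sel by (simp add: cells_def)
  finally show ?thesis .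
 next
  case False
  then have "snd (kappa n z m \<sigma>) w = 0"
   by (simp only: kappa_def Let_def snd_conv not_False_eq_True simp_thms if_True)
  moreover have "qval (list_cube n ?Z [0..<m + 2]) w = 0"
   using False by (auto simp: list_cube_def cells_def)
  ultimately show ?thesis by simp
 qed
 then have "snd (kappa n z m \<sigma>) = qval (list_cube n ?Z [0..<m + 2])" ..
 moreover have "fst (kappa n z m \<sigma>) = qdim (list_cube n ?Z [0..<m + 2])"
  by (simp add: kappa_def list_cube_def)
 ultimately show ?thesis
  by (simp add: Rep_qcube_eq prod_eq_iff)
qed

section \<open>Homomorphisms given on generators\<close>

lemma hom_eq_on_generate:
 assumes "group A" "group B" "f \<in> hom A B" "g \<in> hom A B" "S \<subseteq> carrier A"
  and eq: "\<And>s. s \<in> S ==> f s = g s" and x: "x \<in> generate A S"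
 shows "f x = g x"
proof -
 interpret f: group_hom A B f using assms by (simp add: group_hom_def group_hom_axioms_def)
 interpret g: group_hom A B g using assms by (simp add: group_hom_def group_hom_axioms_def)
 show ?thesis
  using x
 proof (induction rule: generate.induct)
  case (eng a b)
  then show ?case
   using group.generate_in_carrier[OF assms(1) \<open>S \<subseteq> carrier A\<close>] by simp
 qed (use eq \<open>S \<subseteq> carrier A\<close> in auto)
qed

text \<open>A homomorphism is determined by its values on generators, so the definite description picks
 the given one.\<close>

lemma the_hom_eq:
 assumes "group A" "group B" and F: "F \<in> hom A B" and Fg: "\<And>i. i \<in> I ==> F (g i) = h i"
  and gI: "g ` I \<subseteq> carrier A" and gen: "carrier A \<subseteq> generate A (g ` I)"
 shows "the_hom A B I g h = restrict F (carrier A)"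
 unfolding the_hom_def
proof (rule the_equality)
 interpret group A by fact
 show "restrict F (carrier A) \<in> carrier (Hom_group A B) \<and> (\<forall>i\<in>I. restrict F (carrier A) (g i) = h i)"
  using F Fg gI by (auto simp: Hom_group_def hom_def Pi_iff)
 fix f assume f: "f \<in> carrier (Hom_group A B) \<and> (\<forall>i\<in>I. f (g i) = h i)"
 show "f = restrict F (carrier A)"
 proof
  fix x show "f x = restrict F (carrier A) x"
  proof (cases "x \<in> carrier A")
   case True
   have "f x = F x"
    by (rule hom_eq_on_generate[OF assms(1,2) _ F gI]) (use f Fg gen True in \<open>auto simp: Hom_group_def\<close>)
   then show ?thesis using True by simp
  next
   case False
   then show ?thesis using f by (auto simp: Hom_group_def extensional_def)
  qed
 qed
qed

lemma generate_image:
 assumes "group A" "group B" "f \<in> hom A B" "S \<subseteq> carrier A" "x \<in> generate A S"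
 shows "f x \<in> generate B (f ` S)"
proof -
 interpret f: group_hom A B f using assms by (simp add: group_hom_def group_hom_axioms_def)
 show ?thesis
  using assms(5)
 proof (induction rule: generate.induct)
  case (inv h)
  then show ?case using \<open>S \<subseteq> carrier A\<close> generate.inv[of "f h" "f ` S" B] by auto
 next
  case (eng a b)
  then show ?case
   using group.generate_in_carrier[OF assms(1) \<open>S \<subseteq> carrier A\<close>] by (simp add: generate.eng)
 qed (auto intro: generate.one generate.incl)
qed

lemma generate_subset_subgroup:
 assumes "group A" "subgroup H A" "S \<subseteq> H"
 shows "generate A S \<subseteq> H"
 using group.generate_subgroup_incl[OF assms(1) assms(3) assms(2)] .

lemma hom_pointwise_mult:
 assumes "comm_group B" "f \<in> hom A B" "g \<in> hom A B"
 shows "(\<lambda>x. f x \<otimes>\<^bsub>B\<^esub> g x) \<in> hom A B"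
proof -
 interpret comm_group B by fact
 show ?thesis
  using assms(2,3) by (auto simp: hom_def Pi_iff m_ac)
qed

lemma hom_pointwise_inv:
 assumes "comm_group B" "f \<in> hom A B"
 shows "(\<lambda>x. inv\<^bsub>B\<^esub> f x) \<in> hom A B"
proof -
 interpret comm_group B by fact
 show ?thesis
  using assms(2) by (auto simp: hom_def Pi_iff inv_mult)
qed

lemma hom_pointwise_one:
 assumes "group B"
 shows "(\<lambda>x. \<one>\<^bsub>B\<^esub>) \<in> hom A B"
proof -
 interpret group B by fact
 show ?thesis by (auto simp: hom_def)
qed

lemma quotient_hom:
 assumes "comm_group G" "group H" "subgroup N G" "h \<in> hom G H" "\<And>x. x \<in> N ==> h x = \<one>\<^bsub>H\<^esub>"
 obtains g where "g \<in> hom (G Mod N) H" "\<And>x. x \<in> carrier G ==> g (N #>\<^bsub>G\<^esub> x) = h x"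
proof -
 interpret G: comm_group G by fact
 interpret N: subgroup N G by fact
 interpret h: group_hom G H h
  using assms by (simp add: group_hom_def group_hom_axioms_def)
 have "h x = h y" if "x \<in> carrier G" "y \<in> carrier G" "N #>\<^bsub>G\<^esub> x = N #>\<^bsub>G\<^esub> y" for x y
 proof -
  have "x \<in> N #>\<^bsub>G\<^esub> y"
   using G.rcos_self[OF that(1) assms(3)] that by simp
  then obtain k where "k \<in> N" "x = k \<otimes>\<^bsub>G\<^esub> y" by (auto simp: r_coset_def)
  then show ?thesis using that assms(5) by simp
 qed
 then show thesis
  using FactGroup_universal[OF assms(4) G.subgroup_imp_normal[OF assms(3)]] that by blast
qed

lemma coset_eqI:
 assumes "comm_group G" "subgroup N G" "x \<in> carrier G" "y \<in> carrier G" "x \<otimes>\<^bsub>G\<^esub> inv\<^bsub>G\<^esub> y \<in> N"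
 shows "N #>\<^bsub>G\<^esub> x = N #>\<^bsub>G\<^esub> y"
proof -
 interpret comm_group G by fact
 have "x = (x \<otimes>\<^bsub>G\<^esub> inv\<^bsub>G\<^esub> y) \<otimes>\<^bsub>G\<^esub> y"
  using assms by (simp add: m_assoc)
 then have "x \<in> N #>\<^bsub>G\<^esub> y"
  using assms(5) by (auto simp: r_coset_def)
 then show ?thesis
  using repr_independence[of x N y] assms by simp
qed

lemma coset_eqD:
 assumes "comm_group G" "subgroup N G" "x \<in> carrier G" "y \<in> carrier G" "N #>\<^bsub>G\<^esub> x = N #>\<^bsub>G\<^esub> y"
 shows "x \<otimes>\<^bsub>G\<^esub> inv\<^bsub>G\<^esub> y \<in> N"
proof -
 interpret comm_group G by fact
 interpret N: subgroup N G by fact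
 have "x \<in> N #>\<^bsub>G\<^esub> y"
  using rcos_self[OF assms(3,2)] assms by simp
 then obtain k where k: "k \<in> N" "x = k \<otimes>\<^bsub>G\<^esub> y" by (auto simp: r_coset_def)
 then have "x \<otimes>\<^bsub>G\<^esub> inv\<^bsub>G\<^esub> y = k"
  using assms by (simp add: m_assoc)
 then show ?thesis using k by simp
qed

lemma quotient_comm_group: "comm_group G ==> subgroup N G ==> comm_group (G Mod N)"
 by (rule comm_group.abelian_FactGroup)

lemma coset_hom: "comm_group G ==> subgroup N G ==> (\<lambda>x. N #>\<^bsub>G\<^esub> x) \<in> hom G (G Mod N)"
 by (intro normal.r_coset_hom_Mod comm_group.subgroup_imp_normal)

lemma generate_free_Abelian_group:
 "carrier (free_Abelian_group S) \<subseteq> generate (free_Abelian_group S) (frag_of ` S)"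
proof
 fix x assume "x \<in> carrier (free_Abelian_group S)"
 then have x: "Poly_Mapping.keys x \<subseteq> S" by simp
 let ?G = "generate (free_Abelian_group S) (frag_of ` S)"
 have sub: "frag_of ` S \<subseteq> carrier (free_Abelian_group S)" by auto
 show "x \<in> ?G"
  using x
 proof (rule free_Abelian_group_induct)
  show "0 \<in> ?G" using generate.one[of "free_Abelian_group S"] by simp
  show "frag_of a \<in> ?G" if "a \<in> S" for a
   using that by (auto intro: generate.incl)
  show "y - z \<in> ?G" if "Poly_Mapping.keys y \<subseteq> S" "Poly_Mapping.keys z \<subseteq> S" "y \<in> ?G" "z \<in> ?G" for y z
   using generate.eng[OF that(3) group.generate_m_inv_closed[OF group_free_Abelian_group sub that(4)]] that
   by simp
 qed
qed

lemma the_hom_free: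
 assumes "comm_group H" "\<And>s. s \<in> S ==> h s \<in> carrier H"
 shows "the_hom (free_Abelian_group S) H S frag_of h \<in> hom (free_Abelian_group S) H"
  and "s \<in> S ==> the_hom (free_Abelian_group S) H S frag_of h (frag_of s) = h s"
proof -
 interpret H: comm_group H by fact
 obtain F where F: "F \<in> hom (free_Abelian_group S) H" "!!s. s \<in> S ==> F (frag_of s) = h s"
  using H.free_Abelian_group_universal[of h S] assms(2) by auto
 have "the_hom (free_Abelian_group S) H S frag_of h = restrict F (carrier (free_Abelian_group S))"
  by (rule the_hom_eq) (use F generate_free_Abelian_group in \<open>auto simp: H.is_group\<close>)
 then show "the_hom (free_Abelian_group S) H S frag_of h \<in> hom (free_Abelian_group S) H"
  and "s \<in> S ==> the_hom (free_Abelian_group S) H S frag_of h (frag_of s) = h s"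
  using F by (auto simp: hom_def Pi_iff group.subgroup_self intro: restrict_ext)
   (auto dest: subsetD[OF keys_add])
qed

section \<open>Tensor products\<close>

definition biadditive ::
  "('a, 'c) monoid_scheme => ('b, 'd) monoid_scheme => ('h, 'e) monoid_scheme => ('a => 'b => 'h) => bool" where
 "biadditive A B H f \<longleftrightarrow> (\<forall>b\<in>carrier B. (\<lambda>a. f a b) \<in> hom A H) \<and> (\<forall>a\<in>carrier A. f a \<in> hom B H)"

lemma tensor_relations_subgroup:
 assumes "group A" "group B"
 shows "subgroup (tensor_relations A B) (free_Abelian_group (carrier A \<times> carrier B))"
proof -
 interpret A: group A by fact
 interpret B: group B by fact
 have k: "Poly_Mapping.keys (frag_of x - frag_of y - frag_of z) \<subseteq> {x, y, z}" for x y z :: "'a \<times> 'c"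
  using keys_diff[of "frag_of x - frag_of y" "frag_of z"] keys_diff[of "frag_of x" "frag_of y"] by auto
 show ?thesis
  unfolding tensor_relations_def
  by (rule group.generate_is_subgroup[OF group_free_Abelian_group])
   (auto dest!: subsetD[OF k])
qed

lemma tensor_comm_group:
 assumes "group A" "group B"
 shows "comm_group (tensor_group A B)"
 unfolding tensor_group_def
 by (rule quotient_comm_group[OF abelian_free_Abelian_group tensor_relations_subgroup[OF assms]])

lemma tens_closed: "a \<in> carrier A ==> b \<in> carrier B ==> tens A B a b \<in> carrier (tensor_group A B)"
 by (auto simp: tens_def tensor_group_def carrier_FactGroup)

lemma tensor_coset_sum:
 assumes "group A" "group B" and R: "frag_of x - frag_of y - frag_of z \<in> tensor_relations A B"
  and xyz: "x \<in> carrier A \<times> carrier B" "y \<in> carrier A \<times> carrier B" "z \<in> carrier A \<times> carrier B"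
 shows "tens A B (fst x) (snd x) = tens A B (fst y) (snd y) \<otimes>\<^bsub>tensor_group A B\<^esub> tens A B (fst z) (snd z)"
proof -
 let ?F = "free_Abelian_group (carrier A \<times> carrier B)" and ?R = "tensor_relations A B"
 note sub = tensor_relations_subgroup[OF assms(1,2)]
 have yz: "frag_of y + frag_of z \<in> carrier ?F"
  using xyz keys_add[of "frag_of y" "frag_of z"] by auto
 have "?R #>\<^bsub>?F\<^esub> frag_of x = ?R #>\<^bsub>?F\<^esub> (frag_of y + frag_of z)"
  by (rule coset_eqI[OF abelian_free_Abelian_group sub]) (use R xyz yz in \<open>auto simp: algebra_simps\<close>)
 also have "... = (?R #>\<^bsub>?F\<^esub> frag_of y) \<otimes>\<^bsub>?F Mod ?R\<^esub> (?R #>\<^bsub>?F\<^esub> frag_of z)"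
  using hom_mult[OF coset_hom[OF abelian_free_Abelian_group sub], of "frag_of y" "frag_of z"] xyz by simp
 finally show ?thesis
  by (simp add: tens_def tensor_group_def)
qed

lemma tens_hom_left:
 assumes "group A" "group B" "b \<in> carrier B"
 shows "(\<lambda>a. tens A B a b) \<in> hom A (tensor_group A B)"
proof (rule homI)
 interpret A: group A by fact
 fix a a' assume a: "a \<in> carrier A" "a' \<in> carrier A"
 have "frag_of (a \<otimes>\<^bsub>A\<^esub> a', b) - frag_of (a, b) - frag_of (a', b) \<in> tensor_relations A B"
  unfolding tensor_relations_def by (rule generate.incl) (use a assms in blast)
 then show "tens A B (a \<otimes>\<^bsub>A\<^esub> a') b = tens A B a b \<otimes>\<^bsub>tensor_group A B\<^esub> tens A B a' b"
  using tensor_coset_sum[OF assms(1,2), of "(a \<otimes>\<^bsub>A\<^esub> a', b)" "(a, b)" "(a', b)"] a assms by simp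
qed (use assms in \<open>simp add: tens_closed\<close>)

lemma tens_hom_right:
 assumes "group A" "group B" "a \<in> carrier A"
 shows "tens A B a \<in> hom B (tensor_group A B)"
proof (rule homI)
 interpret B: group B by fact
 fix b b' assume b: "b \<in> carrier B" "b' \<in> carrier B"
 have "frag_of (a, b \<otimes>\<^bsub>B\<^esub> b') - frag_of (a, b) - frag_of (a, b') \<in> tensor_relations A B"
  unfolding tensor_relations_def by (rule generate.incl) (use b assms in blast)
 then show "tens A B a (b \<otimes>\<^bsub>B\<^esub> b') = tens A B a b \<otimes>\<^bsub>tensor_group A B\<^esub> tens A B a b'"
  using tensor_coset_sum[OF assms(1,2), of "(a, b \<otimes>\<^bsub>B\<^esub> b')" "(a, b)" "(a, b')"] b assms by simp
qed (use assms in \<open>simp add: tens_closed\<close>)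

lemma tensor_generated:
 assumes "group A" "group B"
 shows "carrier (tensor_group A B) \<subseteq> generate (tensor_group A B) ((\<lambda>(a, b). tens A B a b) ` (carrier A \<times> carrier B))"
proof
 let ?F = "free_Abelian_group (carrier A \<times> carrier B)" and ?R = "tensor_relations A B"
 note sub = tensor_relations_subgroup[OF assms]
 fix x assume "x \<in> carrier (tensor_group A B)"
 then obtain c where c: "x = ?R #>\<^bsub>?F\<^esub> c" "c \<in> carrier ?F"
  by (auto simp: tensor_group_def carrier_FactGroup)
 have gr: "group (?F Mod ?R)"
  using tensor_comm_group[OF assms] by (simp add: tensor_group_def comm_group_def)
 have "x \<in> generate (?F Mod ?R) ((%x. ?R #>\<^bsub>?F\<^esub> x) ` frag_of ` (carrier A \<times> carrier B))"
  unfolding c(1)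
  by (rule generate_image[OF group_free_Abelian_group gr coset_hom[OF abelian_free_Abelian_group sub]])
   (use c(2) subsetD[OF generate_free_Abelian_group c(2)] in auto)
 moreover have "(%x. ?R #>\<^bsub>?F\<^esub> x) ` frag_of ` (carrier A \<times> carrier B) = (%(a, b). tens A B a b) ` (carrier A \<times> carrier B)"
  by (auto simp: tens_def image_iff)
 ultimately show "x \<in> generate (tensor_group A B) ((%(a, b). tens A B a b) ` (carrier A \<times> carrier B))"
  by (simp add: tensor_group_def)
qed

text \<open>The endomorphisms of the model are prescribed on tensors whose first factor is a generator;
 this makes them unique.\<close>

lemma tensor_generated_left:
 assumes "group A" "group B" "S \<subseteq> carrier A" and gen: "carrier A \<subseteq> generate A S"
 shows "carrier (tensor_group A B) \<subseteq> generate (tensor_group A B) ((\<lambda>(a, b). tens A B a b) ` (S \<times> carrier B))"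
proof -
 let ?T = "tensor_group A B" and ?S = "(%(a, b). tens A B a b) ` (S \<times> carrier B)"
 interpret T: comm_group ?T using tensor_comm_group[OF assms(1,2)] .
 have S: "?S \<subseteq> carrier ?T"
  using assms(3) by (auto intro!: tens_closed)
 have "(%(a, b). tens A B a b) ` (carrier A \<times> carrier B) \<subseteq> generate ?T ?S"
 proof clarify
  fix a b assume ab: "a \<in> carrier A" "b \<in> carrier B"
  have "tens A B a b \<in> generate ?T ((%a. tens A B a b) ` S)"
   by (rule generate_image[OF assms(1) T.is_group tens_hom_left[OF assms(1,2) ab(2)] assms(3)]) (use ab gen in auto)
  also have "... \<subseteq> generate ?T ?S"
   by (rule T.mono_generate) (use ab in auto)
  finally show "tens A B a b \<in> generate ?T ?S" .
 qed
 then have "generate ?T ((%(a, b). tens A B a b) ` (carrier A \<times> carrier B)) \<subseteq> generate ?T ?S"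
  by (rule generate_subset_subgroup[OF T.is_group T.generate_is_subgroup[OF S]])
 then show ?thesis
  using tensor_generated[OF assms(1,2)] by blast
qed

lemma tensor_universal:
 assumes "group A" "group B" "comm_group H" and f: "biadditive A B H f"
 obtains F where "F \<in> hom (tensor_group A B) H"
  "\<And>a b. a \<in> carrier A ==> b \<in> carrier B ==> F (tens A B a b) = f a b"
proof -
 interpret A: group A by fact
 interpret B: group B by fact
 interpret H: comm_group H by fact
 let ?F = "free_Abelian_group (carrier A \<times> carrier B)" and ?R = "tensor_relations A B"
 note sub = tensor_relations_subgroup[OF assms(1,2)]
 have f1: "(%a. f a b) \<in> hom A H" if "b \<in> carrier B" for b
  using f that by (simp add: biadditive_def)
 have f2: "f a \<in> hom B H" if "a \<in> carrier A" for a
  using f that by (simp add: biadditive_def)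
 have fc: "f a b \<in> carrier H" if "a \<in> carrier A" "b \<in> carrier B" for a b
  using hom_in_carrier[OF f2[OF that(1)] that(2)] .
 have "(%x. f (fst x) (snd x)) ` (carrier A \<times> carrier B) \<subseteq> carrier H"
  using fc by auto
 from H.free_Abelian_group_universal[OF this]
 obtain h where h: "h \<in> hom ?F H" "!!x. x \<in> carrier A \<times> carrier B ==> h (frag_of x) = f (fst x) (snd x)"
  by blast
 interpret h: group_hom ?F H h
  using h by (simp add: group_hom_def group_hom_axioms_def H.is_group)
 have rel: "h (frag_of x - frag_of y - frag_of z) = h (frag_of x) \<otimes>\<^bsub>H\<^esub> inv\<^bsub>H\<^esub> h (frag_of y) \<otimes>\<^bsub>H\<^esub> inv\<^bsub>H\<^esub> h (frag_of z)"
  if "x \<in> carrier A \<times> carrier B" "y \<in> carrier A \<times> carrier B" "z \<in> carrier A \<times> carrier B" for x y z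
 proof -
  have "frag_of x - frag_of y - frag_of z = frag_of x \<otimes>\<^bsub>?F\<^esub> inv\<^bsub>?F\<^esub> frag_of y \<otimes>\<^bsub>?F\<^esub> inv\<^bsub>?F\<^esub> frag_of z"
   using that by simp
  moreover have "frag_of x \<in> carrier ?F" "frag_of y \<in> carrier ?F" "frag_of z \<in> carrier ?F"
   using that by auto
  ultimately show ?thesis
   by (simp only: h.hom_mult h.hom_inv h.G.m_closed h.G.inv_closed)
 qed
 have "h x = \<one>\<^bsub>H\<^esub>" if "x \<in> ?R" for x
 proof -
  have "?R \<subseteq> kernel ?F H h"
   unfolding tensor_relations_def
  proof (rule generate_subset_subgroup[OF group_free_Abelian_group h.subgroup_kernel])
   let ?gens = "{frag_of (a \<otimes>\<^bsub>A\<^esub> a', b) - frag_of (a, b) - frag_of (a', b) | a a' b.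
    a \<in> carrier A \<and> a' \<in> carrier A \<and> b \<in> carrier B} \<union>
   {frag_of (a, b \<otimes>\<^bsub>B\<^esub> b') - frag_of (a, b) - frag_of (a, b') | a b b'.
    a \<in> carrier A \<and> b \<in> carrier B \<and> b' \<in> carrier B}"
   show "?gens \<subseteq> kernel ?F H h"
   proof
    fix x assume x: "x \<in> ?gens"
    then have "x \<in> generate ?F ?gens" by (intro generate.incl)
    then have "x \<in> ?R" by (simp only: tensor_relations_def)
    then have xF: "x \<in> carrier ?F" using subgroup.mem_carrier[OF sub] by blast
    have "h x = \<one>\<^bsub>H\<^esub>"
     using x
    proof
     assume "x \<in> {frag_of (a \<otimes>\<^bsub>A\<^esub> a', b) - frag_of (a, b) - frag_of (a', b) | a a' b.
      a \<in> carrier A \<and> a' \<in> carrier A \<and> b \<in> carrier B}"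
     then obtain a a' b where ab: "a \<in> carrier A" "a' \<in> carrier A" "b \<in> carrier B"
      and xx: "x = frag_of (a \<otimes>\<^bsub>A\<^esub> a', b) - frag_of (a, b) - frag_of (a', b)" by blast
     have "f (a \<otimes>\<^bsub>A\<^esub> a') b = f a b \<otimes>\<^bsub>H\<^esub> f a' b" using hom_mult[OF f1[OF ab(3)] ab(1,2)] .
     then show ?thesis
      unfolding xx using ab by (simp add: rel h(2) fc H.m_ac H.inv_mult)
    next
     assume "x \<in> {frag_of (a, b \<otimes>\<^bsub>B\<^esub> b') - frag_of (a, b) - frag_of (a, b') | a b b'.
      a \<in> carrier A \<and> b \<in> carrier B \<and> b' \<in> carrier B}"
     then obtain a b b' where ab: "a \<in> carrier A" "b \<in> carrier B" "b' \<in> carrier B"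
      and xx: "x = frag_of (a, b \<otimes>\<^bsub>B\<^esub> b') - frag_of (a, b) - frag_of (a, b')" by blast
     have "f a (b \<otimes>\<^bsub>B\<^esub> b') = f a b \<otimes>\<^bsub>H\<^esub> f a b'" using hom_mult[OF f2[OF ab(1)] ab(2,3)] .
     then show ?thesis
      unfolding xx using ab by (simp add: rel h(2) fc H.m_ac H.inv_mult)
    qed
    then show "x \<in> kernel ?F H h" using xF by (simp add: kernel_def)
   qed
  qed
  then show ?thesis using that by (auto simp: kernel_def)
 qed
 then obtain g where g: "g \<in> hom (?F Mod ?R) H" "!!x. x \<in> carrier ?F ==> g (?R #>\<^bsub>?F\<^esub> x) = h x"
  using quotient_hom[OF abelian_free_Abelian_group H.is_group sub h(1)] by blast
 show thesis
 proof (rule that[of g])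
  show "g \<in> hom (tensor_group A B) H" using g by (simp add: tensor_group_def)
  fix a b assume ab: "a \<in> carrier A" "b \<in> carrier B"
  then have "frag_of (a, b) \<in> carrier ?F" by auto
  then show "g (tens A B a b) = f a b"
   unfolding tens_def using g(2) h(2)[of "(a, b)"] ab by simp
 qed
qed

lemma tensor_map_hom:
 assumes "group A" "group A'" "group G" "f \<in> hom A A'"
 shows "tensor_map A A' G f \<in> hom (tensor_group A G) (tensor_group A' G)" (is ?hom)
  and "a \<in> carrier A ==> g \<in> carrier G ==> tensor_map A A' G f (tens A G a g) = tens A' G (f a) g" (is "_ ==> _ ==> ?eq")
proof -
 interpret T: comm_group "tensor_group A G" using tensor_comm_group[OF assms(1,3)] .
 interpret T': comm_group "tensor_group A' G" using tensor_comm_group[OF assms(2,3)] .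
 have "biadditive A G (tensor_group A' G) (%a g. tens A' G (f a) g)"
  unfolding biadditive_def
  using hom_compose[OF assms(4) tens_hom_left[OF assms(2,3)]] tens_hom_right[OF assms(2,3)] hom_in_carrier[OF assms(4)]
  by (auto simp: comp_def)
 then obtain F where F: "F \<in> hom (tensor_group A G) (tensor_group A' G)"
  "!!a g. a \<in> carrier A ==> g \<in> carrier G ==> F (tens A G a g) = tens A' G (f a) g"
  using tensor_universal[OF assms(1,3) T'.comm_group_axioms] by blast
 have eq: "tensor_map A A' G f = restrict F (carrier (tensor_group A G))"
  unfolding tensor_map_def
  by (rule the_hom_eq[OF T.is_group T'.is_group F(1)])
   (use F(2) tensor_generated[OF assms(1,3)] in \<open>auto intro!: tens_closed\<close>)
 show ?hom
  unfolding eq using F(1) by (auto simp: hom_def Pi_iff)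
 show ?eq if "a \<in> carrier A" "g \<in> carrier G"
  unfolding eq using F(2)[OF that] tens_closed[OF that] by simp
qed

lemma tensor_hom_eqI:
 assumes "group A" "group G" "group H" "f \<in> hom (tensor_group A G) H" "f' \<in> hom (tensor_group A G) H"
  and "\<And>a g. a \<in> carrier A ==> g \<in> carrier G ==> f (tens A G a g) = f' (tens A G a g)"
  and "x \<in> carrier (tensor_group A G)"
 shows "f x = f' x"
proof (rule hom_eq_on_generate[OF _ assms(3,4,5)])
 show "group (tensor_group A G)" using tensor_comm_group[OF assms(1,2)] by (simp add: comm_group_def)
 show "x \<in> generate (tensor_group A G) ((%(a, b). tens A G a b) ` (carrier A \<times> carrier G))"
  using tensor_generated[OF assms(1,2)] assms(7) by blast
qed (use assms(6) in \<open>auto intro!: tens_closed\<close>)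

section \<open>Actions on homology\<close>

lemma subgroup_hom_image:
 assumes "group A" "group C" "f \<in> hom A C"
 shows "subgroup (f ` carrier A) C"
proof -
 interpret f: group_hom A C f using assms by (simp add: group_hom_def group_hom_axioms_def)
 show ?thesis by (rule f.img_is_subgroup)
qed

lemma subgroup_hom_kernel:
 assumes "group A" "group C" "f \<in> hom A C"
 shows "subgroup (kernel A C f) A"
proof -
 interpret f: group_hom A C f using assms by (simp add: group_hom_def group_hom_axioms_def)
 show ?thesis by (rule f.subgroup_kernel)
qed

lemma carrier_subgroup_comm_group:
 assumes "comm_group C" "subgroup K C"
 shows "comm_group (C\<lparr>carrier := K\<rparr>)"
proof -
 interpret comm_group C by fact
 interpret K: subgroup K C by fact
 show ?thesis
  by (rule group.group_comm_groupI[OF K.subgroup_is_group[OF is_group]])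
   (use K.mem_carrier in \<open>auto simp: m_comm\<close>)
qed

locale homology_setup =
 fixes A :: "('a, 'i) monoid_scheme" and f and C :: "('b, 'j) monoid_scheme" and g
  and D :: "('c, 'k) monoid_scheme"
 assumes A: "comm_group A" and C: "comm_group C" and D: "comm_group D"
  and f: "f \<in> hom A C" and g: "g \<in> hom C D"
  and gf: "\<And>x. x \<in> carrier A ==> g (f x) = \<one>\<^bsub>D\<^esub>"
begin

definition "cycles = kernel C D g"
definition "H = homology_at A f C g D"
definition "cls = homology_class A f C"

sublocale C: comm_group C by (rule C)

lemma grp: "group A" "group C" "group D"
 using A C D by (simp_all add: comm_group_def)

lemma cycles_subgroup: "subgroup cycles C"
 unfolding cycles_def by (rule subgroup_hom_kernel[OF grp(2,3) g])

lemma cycles_carrier: "y \<in> cycles ==> y \<in> carrier C"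
 by (simp add: cycles_def kernel_def)

lemma boundaries_subset: "f ` carrier A \<subseteq> cycles"
 using hom_in_carrier[OF f] gf by (auto simp: cycles_def kernel_def)

abbreviation "Z \<equiv> C\<lparr>carrier := cycles\<rparr>"

lemma Z: "comm_group Z"
 by (rule carrier_subgroup_comm_group[OF C cycles_subgroup])

lemma boundaries_subgroup: "subgroup (f ` carrier A) C" "subgroup (f ` carrier A) Z"
 using subgroup_hom_image[OF grp(1,2) f] C.subgroup_incl[OF _ cycles_subgroup boundaries_subset] by auto

lemma H_eq: "H = Z Mod (f ` carrier A)"
 by (simp add: H_def homology_at_def cycles_def)

lemma cls_eq: "cls y = f ` carrier A #>\<^bsub>Z\<^esub> y"
 by (simp add: cls_def homology_class_def r_coset_def)

lemma H: "comm_group H"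
 unfolding H_eq by (rule quotient_comm_group[OF Z boundaries_subgroup(2)])

lemma cls_hom: "cls \<in> hom Z H"
 using coset_hom[OF Z boundaries_subgroup(2)] unfolding H_eq cls_eq[abs_def] .

lemma cls_onto: "X \<in> carrier H ==> \<exists>y\<in>cycles. X = cls y"
 by (auto simp: H_eq carrier_FactGroup cls_eq)

lemma cls_closed: "y \<in> cycles ==> cls y \<in> carrier H"
 using hom_in_carrier[OF cls_hom] by simp

lemma inv_Z: "y \<in> cycles ==> inv\<^bsub>Z\<^esub> y = inv\<^bsub>C\<^esub> y"
 using C.m_inv_consistent[OF cycles_subgroup] .

lemma cls_eqI: "x \<in> cycles ==> y \<in> cycles ==> x \<otimes>\<^bsub>C\<^esub> inv\<^bsub>C\<^esub> y \<in> f ` carrier A ==> cls x = cls y"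
 unfolding cls_eq by (rule coset_eqI[OF Z boundaries_subgroup(2)]) (auto simp: inv_Z)

lemma cls_eqD: "x \<in> cycles ==> y \<in> cycles ==> cls x = cls y ==> x \<otimes>\<^bsub>C\<^esub> inv\<^bsub>C\<^esub> y \<in> f ` carrier A"
 unfolding cls_eq using coset_eqD[OF Z boundaries_subgroup(2), of x y] by (simp add: inv_Z)

lemma cls_mult: "x \<in> cycles ==> y \<in> cycles ==> cls (x \<otimes>\<^bsub>C\<^esub> y) = cls x \<otimes>\<^bsub>H\<^esub> cls y"
 using hom_mult[OF cls_hom, of x y] by simp

lemma cls_one: "y \<in> f ` carrier A ==> cls y = \<one>\<^bsub>H\<^esub>"
proof -
 interpret Z: comm_group Z by (rule Z)
 assume "y \<in> f ` carrier A"
 then show ?thesis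
  unfolding cls_eq H_eq
  using Z.coset_join2[OF _ boundaries_subgroup(2), of y] boundaries_subset by auto
qed

lemma induced_map:
 assumes "\<phi> \<in> hom C C" "\<And>y. y \<in> cycles ==> \<phi> y \<in> cycles"
  and "\<And>y. y \<in> f ` carrier A ==> \<phi> y \<in> f ` carrier A"
 obtains e where "e \<in> hom H H" "\<And>y. y \<in> cycles ==> e (cls y) = cls (\<phi> y)"
proof -
 have \<phi>: "\<phi> \<in> hom Z Z"
  using assms(1,2) cycles_carrier by (auto simp: hom_def Pi_iff)
 have "(%y. cls (\<phi> y)) \<in> hom Z H"
  using hom_compose[OF \<phi> cls_hom] by (simp add: comp_def)
 moreover have "cls (\<phi> y) = \<one>\<^bsub>H\<^esub>" if "y \<in> f ` carrier A" for y
  using cls_one assms(3) that by blast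
 moreover have "group H" using H by (simp add: comm_group_def)
 ultimately obtain e where "e \<in> hom (Z Mod (f ` carrier A)) H"
   "!!y. y \<in> carrier Z ==> e (f ` carrier A #>\<^bsub>Z\<^esub> y) = cls (\<phi> y)"
  using quotient_hom[OF Z _ boundaries_subgroup(2)] by metis
 then show thesis
  using that[of e] by (simp add: H_eq cls_eq)
qed

end

lemma funpow_commute_hom:
 assumes "\<And>y. y \<in> K ==> h (n y) = m (h y)" "\<And>y. y \<in> K ==> n y \<in> K" "y \<in> K"
 shows "h ((n ^^ k) y) = (m ^^ k) (h y) \<and> (n ^^ k) y \<in> K"
 using assms by (induction k) auto

text \<open>A family of chain endomorphisms that is multiplicative only up to homotopy, and whose
 member at \<open>1\<close> is merely unipotent, acts on homology: an idempotent unipotent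
 endomorphism is the identity.\<close>

lemma homology_action:
 fixes X0 :: "('x, 'i) monoid_scheme" and X1 :: "('y, 'j) monoid_scheme" and X2 :: "('w, 'k) monoid_scheme"
  and A :: "('a, 'l) monoid_scheme" and C :: "('b, 'm) monoid_scheme" and D :: "('c, 'n) monoid_scheme"
 assumes X: "homology_setup X0 d0 X1 d1 X2" and Y: "homology_setup A f C g D"
  and E_hom: "\<And>c. c \<in> kernel X1 X2 d1 ==> E c \<in> hom C C"
  and E_cyc: "\<And>c y. c \<in> kernel X1 X2 d1 ==> y \<in> kernel C D g ==> E c y \<in> kernel C D g"
  and E_bd: "\<And>c y. c \<in> kernel X1 X2 d1 ==> y \<in> f ` carrier A ==> E c y \<in> f ` carrier A"
  and E_mult: "\<And>c c' y. c \<in> kernel X1 X2 d1 ==> c' \<in> kernel X1 X2 d1 ==> y \<in> kernel C D g ==>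
    E c (E c' y) \<otimes>\<^bsub>C\<^esub> inv\<^bsub>C\<^esub> E (c \<otimes>\<^bsub>X1\<^esub> c') y \<in> f ` carrier A"
  and E_cob: "\<And>b y. b \<in> carrier X0 ==> y \<in> kernel C D g ==>
    E (d0 b) (E \<one>\<^bsub>X1\<^esub> y) \<otimes>\<^bsub>C\<^esub> inv\<^bsub>C\<^esub> E \<one>\<^bsub>X1\<^esub> y \<in> f ` carrier A"
  and nil: "\<And>y. y \<in> carrier C ==> ((\<lambda>y. y \<otimes>\<^bsub>C\<^esub> inv\<^bsub>C\<^esub> E \<one>\<^bsub>X1\<^esub> y) ^^ k) y = \<one>\<^bsub>C\<^esub>"
 shows "\<exists>\<alpha>. group_action (homology_at X0 d0 X1 d1 X2) (carrier (homology_at A f C g D)) \<alpha> \<and>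
  (\<forall>h\<in>carrier (homology_at X0 d0 X1 d1 X2). \<alpha> h \<in> auto (homology_at A f C g D)) \<and>
  (\<forall>c\<in>kernel X1 X2 d1. \<forall>y\<in>kernel C D g.
    \<alpha> (homology_class X0 d0 X1 c) (homology_class A f C y) = homology_class A f C (E c y))"
proof -
 interpret X: homology_setup X0 d0 X1 d1 X2 by (rule X)
 interpret Y: homology_setup A f C g D by (rule Y)
 interpret H: comm_group Y.H by (rule Y.H)
 interpret XH: comm_group X.H by (rule X.H)
 interpret XC: subgroup X.cycles X1 by (rule X.cycles_subgroup)
 interpret YC: subgroup Y.cycles C by (rule Y.cycles_subgroup)
 note E_hom = E_hom[folded X.cycles_def]
 note E_cyc = E_cyc[folded X.cycles_def Y.cycles_def]
 note E_bd = E_bd[folded X.cycles_def]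
 note E_mult = E_mult[folded X.cycles_def Y.cycles_def]
 note E_cob = E_cob[folded Y.cycles_def]
 have "\<exists>e. e \<in> hom Y.H Y.H \<and> (\<forall>y\<in>Y.cycles. e (Y.cls y) = Y.cls (E c y))" if "c \<in> X.cycles" for c
  by (rule Y.induced_map[of "E c"]) (use that E_hom E_cyc E_bd in auto)
 then obtain e where e_hom: "!!c. c \<in> X.cycles ==> e c \<in> hom Y.H Y.H"
  and e_cls: "!!c y. c \<in> X.cycles ==> y \<in> Y.cycles ==> e c (Y.cls y) = Y.cls (E c y)"
  by metis
 have e_closed: "e c u \<in> carrier Y.H" if "c \<in> X.cycles" "u \<in> carrier Y.H" for c u
  using hom_in_carrier[OF e_hom] that by blast
 have e_mult: "e (c \<otimes>\<^bsub>X1\<^esub> c') u = e c (e c' u)" if "c \<in> X.cycles" "c' \<in> X.cycles" "u \<in> carrier Y.H" for c c' u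
 proof -
  obtain y where y: "y \<in> Y.cycles" "u = Y.cls y" using Y.cls_onto \<open>u \<in> carrier Y.H\<close> by blast
  have "Y.cls (E c (E c' y)) = Y.cls (E (c \<otimes>\<^bsub>X1\<^esub> c') y)"
   by (rule Y.cls_eqI) (use E_cyc E_mult that y in auto)
  then show ?thesis using e_cls E_cyc y that by simp
 qed
 let ?o = "\<one>\<^bsub>X1\<^esub>"
 have one: "?o \<in> X.cycles" by simp
 let ?n = "%u. u \<otimes>\<^bsub>Y.H\<^esub> inv\<^bsub>Y.H\<^esub> e ?o u"
 let ?N = "%y. y \<otimes>\<^bsub>C\<^esub> inv\<^bsub>C\<^esub> E ?o y"
 interpret e1: group_hom Y.H Y.H "e ?o"
  using e_hom[OF one] by (simp add: group_hom_def group_hom_axioms_def)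
 have cls_inv: "Y.cls (inv\<^bsub>C\<^esub> y) = inv\<^bsub>Y.H\<^esub> Y.cls y" if "y \<in> Y.cycles" for y
 proof -
  interpret Z: comm_group "C\<lparr>carrier := Y.cycles\<rparr>" by (rule Y.Z)
  interpret c: group_hom "C\<lparr>carrier := Y.cycles\<rparr>" Y.H Y.cls
   using Y.cls_hom by (simp add: group_hom_def group_hom_axioms_def)
  show ?thesis using c.hom_inv[of y] that by (simp add: Y.inv_Z)
 qed
 have n_n: "?n (?n u) = ?n u" if u: "u \<in> carrier Y.H" for u
 proof -
  have "e ?o (e ?o u) = e ?o u"
   using e_mult[OF one one u] by simp
  then have "e ?o (?n u) = \<one>\<^bsub>Y.H\<^esub>"
   using u e_closed[OF one] by simp
  then show ?thesis using u e_closed[OF one] by simp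
 qed
 have N_cyc: "?N y \<in> Y.cycles" if "y \<in> Y.cycles" for y
  using that E_cyc[OF one] by simp
 have N_cls: "Y.cls (?N y) = ?n (Y.cls y)" if "y \<in> Y.cycles" for y
  using that E_cyc[OF one that] by (simp add: Y.cls_mult cls_inv e_cls one)
 have n_closed: "?n u \<in> carrier Y.H" if "u \<in> carrier Y.H" for u
  using that e_closed[OF one] by simp
 have e_one: "e ?o u = u" if u: "u \<in> carrier Y.H" for u
 proof -
  obtain y where y: "y \<in> Y.cycles" "u = Y.cls y" using Y.cls_onto u by blast
  have pow: "(?n ^^ Suc j) u = ?n u" for j
  proof (induction j)
   case (Suc j)
   then show ?case using n_n[OF u] by simp
  qed simp
  have "(?n ^^ k) u = Y.cls ((?N ^^ k) y)"
   using funpow_commute_hom[of Y.cycles Y.cls ?N ?n y k] N_cls N_cyc y by simp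
  also have "... = \<one>\<^bsub>Y.H\<^esub>"
   using nil[OF Y.cycles_carrier[OF y(1)]] Y.cls_one[of "\<one>\<^bsub>C\<^esub>"]
    subgroup.one_closed[OF Y.boundaries_subgroup(1)] by simp
  finally have "(?n ^^ k) u = \<one>\<^bsub>Y.H\<^esub>" .
  then have "?n u = \<one>\<^bsub>Y.H\<^esub>"
  proof (cases k)
   case 0
   then show ?thesis using \<open>(?n ^^ k) u = \<one>\<^bsub>Y.H\<^esub>\<close> e1.hom_one by simp
  next
   case (Suc j)
   then show ?thesis using \<open>(?n ^^ k) u = \<one>\<^bsub>Y.H\<^esub>\<close> pow[of j] by simp
  qed
  then have "u = inv\<^bsub>Y.H\<^esub> (inv\<^bsub>Y.H\<^esub> e ?o u)"
   using H.inv_equality[of u "inv\<^bsub>Y.H\<^esub> e ?o u"] u e_closed[OF one u] by simp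
  then show ?thesis using e_closed[OF one u] by simp
 qed
 have e_cob: "e (d0 b) u = u" if b: "b \<in> carrier X0" and u: "u \<in> carrier Y.H" for b u
 proof -
  obtain y where y: "y \<in> Y.cycles" "u = Y.cls y" using Y.cls_onto u by blast
  have c: "d0 b \<in> X.cycles" using X.boundaries_subset b by blast
  have "Y.cls (E (d0 b) (E ?o y)) = Y.cls (E ?o y)"
   by (rule Y.cls_eqI) (use E_cyc c one y E_cob b in auto)
  then have "e (d0 b) (e ?o u) = e ?o u"
   using e_cls E_cyc c one y by simp
  then show ?thesis using e_one u by simp
 qed
 have e_cong: "e c u = e c' u" if c: "c \<in> X.cycles" "c' \<in> X.cycles" "X.cls c = X.cls c'" and u: "u \<in> carrier Y.H" for c c' u
 proof -
  obtain b where b: "b \<in> carrier X0" "c \<otimes>\<^bsub>X1\<^esub> inv\<^bsub>X1\<^esub> c' = d0 b"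
   using X.cls_eqD[OF c] by blast
  have d: "d0 b \<in> X.cycles" using X.boundaries_subset b by blast
  have "c = d0 b \<otimes>\<^bsub>X1\<^esub> c'"
   using b(2)[symmetric] c X.cycles_carrier by (simp add: X.C.m_assoc)
  then show ?thesis
   using e_mult[OF d c(2) u] e_cob[OF b(1) e_closed[OF c(2) u]] by simp
 qed
 define rep where "rep X = (SOME c. c \<in> X.cycles \<and> X = X.cls c)" for X
 have rep: "rep X \<in> X.cycles" "X = X.cls (rep X)" if "X \<in> carrier X.H" for X
  using someI_ex[of "%c. c \<in> X.cycles \<and> X = X.cls c"] X.cls_onto[OF that] unfolding rep_def by blast+
 define \<alpha> where "\<alpha> X = restrict (e (rep X)) (carrier Y.H)" for X
 have \<alpha>_cls: "\<alpha> (X.cls c) u = e c u" if "c \<in> X.cycles" "u \<in> carrier Y.H" for c u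
  using e_cong[of "rep (X.cls c)" c u] rep[OF X.cls_closed[OF that(1)]] that by (simp add: \<alpha>_def)
 have inv_cyc: "inv\<^bsub>X1\<^esub> c \<in> X.cycles" if "c \<in> X.cycles" for c
  using that by simp
 have \<alpha>_bij: "\<alpha> X \<in> Bij (carrier Y.H)" if X: "X \<in> carrier X.H" for X
 proof -
  let ?c = "rep X"
  have c: "?c \<in> X.cycles" using rep X by blast
  have "bij_betw (e ?c) (carrier Y.H) (carrier Y.H)"
  proof (rule bij_betw_byWitness[where f' = "e (inv\<^bsub>X1\<^esub> ?c)"])
   show "\<forall>u\<in>carrier Y.H. e (inv\<^bsub>X1\<^esub> ?c) (e ?c u) = u" "\<forall>u\<in>carrier Y.H. e ?c (e (inv\<^bsub>X1\<^esub> ?c) u) = u"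
    using e_mult[OF inv_cyc[OF c] c] e_mult[OF c inv_cyc[OF c]] e_one X.cycles_carrier[OF c] by auto
  qed (use e_closed c inv_cyc in auto)
  then show ?thesis
   by (simp add: \<alpha>_def Bij_def bij_betw_restrict_eq)
 qed
 have \<alpha>_mult: "\<alpha> (X \<otimes>\<^bsub>X.H\<^esub> X') = compose (carrier Y.H) (\<alpha> X) (\<alpha> X')"
  if X: "X \<in> carrier X.H" "X' \<in> carrier X.H" for X X'
 proof
  fix u
  let ?c = "rep X" and ?c' = "rep X'"
  have c: "?c \<in> X.cycles" "?c' \<in> X.cycles" using rep X by auto
  show "\<alpha> (X \<otimes>\<^bsub>X.H\<^esub> X') u = compose (carrier Y.H) (\<alpha> X) (\<alpha> X') u"
  proof (cases "u \<in> carrier Y.H")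
   case True
   have "X \<otimes>\<^bsub>X.H\<^esub> X' = X.cls (?c \<otimes>\<^bsub>X1\<^esub> ?c')"
    using X.cls_mult[OF c] rep(2)[OF X(1)] rep(2)[OF X(2)] by simp
   then show ?thesis
    using \<alpha>_cls[of "?c \<otimes>\<^bsub>X1\<^esub> ?c'" u] True e_mult[OF c True] c e_closed[OF c(2) True]
    by (simp add: compose_def \<alpha>_def)
  qed (simp add: \<alpha>_def compose_def)
 qed
 have "group_hom X.H (BijGroup (carrier Y.H)) \<alpha>"
 proof -
  have "\<alpha> \<in> hom X.H (BijGroup (carrier Y.H))"
   using \<alpha>_bij \<alpha>_mult by (auto simp: hom_def BijGroup_def)
  then show ?thesis
   by (simp add: group_hom_def group_hom_axioms_def group_BijGroup XH.is_group)
 qed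
 moreover have "\<alpha> X \<in> auto Y.H" if "X \<in> carrier X.H" for X
  using \<alpha>_bij[OF that] e_hom[OF rep(1)[OF that]]
  by (auto simp: auto_def \<alpha>_def hom_def Pi_iff)
 moreover have "\<alpha> (X.cls c) (Y.cls y) = Y.cls (E c y)" if "c \<in> X.cycles" "y \<in> Y.cycles" for c y
  using \<alpha>_cls[OF that(1) Y.cls_closed[OF that(2)]] e_cls[OF that] by simp
 ultimately show ?thesis
  unfolding X.H_def[symmetric] Y.H_def[symmetric] X.cls_def[symmetric] Y.cls_def[symmetric]
   X.cycles_def[symmetric] Y.cycles_def[symmetric]
  by (intro exI[of _ \<alpha>]) (simp add: group_action_def)
qed

section \<open>Faces of singular simplices and of prisms\<close>

definition list_point :: "nat list => (nat => real) => nat => real" where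
 "list_point l x i = (\<Sum>j<length l. (if i = l ! j then x j else 0))"

lemma sum_list_point:
 assumes "finite P" "set l \<subseteq> P"
 shows "(\<Sum>i\<in>P. w i * list_point l x i) = (\<Sum>j<length l. w (l ! j) * x j)"
proof -
 have "(\<Sum>i\<in>P. w i * list_point l x i) = (\<Sum>i\<in>P. \<Sum>j<length l. w i * (if i = l ! j then x j else 0))"
  by (simp only: list_point_def sum_distrib_left)
 also have "... = (\<Sum>j<length l. \<Sum>i\<in>P. w i * (if i = l ! j then x j else 0))"
  by (rule sum.swap)
 also have "... = (\<Sum>j<length l. w (l ! j) * x j)"
 proof (rule sum.cong)
  fix j assume "j \<in> {..<length l}"
  then have j: "l ! j \<in> P" using assms(2) nth_mem by auto
  have "(\<Sum>i\<in>P. w i * (if i = l ! j then x j else 0)) = (\<Sum>i\<in>P. if i = l ! j then w i * x j else 0)"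
   by (rule sum.cong) simp_all
  also have "... = w (l ! j) * x j" using j assms(1) by simp
  finally show "(\<Sum>i\<in>P. w i * (if i = l ! j then x j else 0)) = w (l ! j) * x j" .
 qed simp
 finally show ?thesis .
qed

lemma list_point_compose:
 assumes "set k \<subseteq> {..<length l}"
 shows "list_point l (list_point k x) = list_point (map ((!) l) k) x"
proof
 fix i
 have "list_point l (list_point k x) i = (\<Sum>j<length l. (if i = l ! j then 1 else 0) * list_point k x j)"
  unfolding list_point_def[of l] by (rule sum.cong) auto
 also have "... = (\<Sum>j<length k. (if i = l ! (k ! j) then 1 else 0) * x j)"
  by (rule sum_list_point) (use assms in auto)
 also have "... = list_point (map ((!) l) k) x i"
  unfolding list_point_def by (rule sum.cong) auto
 finally show "list_point l (list_point k x) i = list_point (map ((!) l) k) x i" .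
qed

lemma length_Suc_pred: "l \<noteq> [] ==> {..length l - Suc 0} = {..<length l}"
 by (cases l) auto

lemma list_point_in_standard_simplex:
 assumes x: "x \<in> standard_simplex (length l - 1)" and l: "l \<noteq> []" "set l \<subseteq> {..p}"
 shows "list_point l x \<in> standard_simplex p"
proof -
 have x0: "0 \<le> x i" "x i \<le> 1" for i using x by (auto simp: standard_simplex_def)
 have sx: "(\<Sum>j<length l. x j) = 1"
  using x l length_Suc_pred[OF l(1)] by (simp add: standard_simplex_def)
 have pos: "0 \<le> list_point l x i" for i
  unfolding list_point_def by (rule sum_nonneg) (use x0 in auto)
 have le: "list_point l x i \<le> 1" for i
  unfolding list_point_def sx[symmetric] by (rule sum_mono) (use x0 in auto)
 have off: "list_point l x i = 0" if "i > p" for i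
  unfolding list_point_def
 proof (rule sum.neutral, rule ballI)
  fix j assume "j \<in> {..<length l}"
  then have "l ! j \<in> {..p}" using subsetD[OF l(2)] nth_mem[of j l] by blast
  then show "(if i = l ! j then x j else 0) = 0" using that by simp
 qed
 have "(\<Sum>i\<le>p. list_point l x i) = 1"
  using sum_list_point[of "{..p}" l "%_. 1" x] l sx by simp
 then show ?thesis
  using pos le off by (simp add: standard_simplex_def)
qed

lemma vertex_face_eq:
 assumes "l \<noteq> []"
 shows "vertex_face l \<sigma> = (\<lambda>x\<in>standard_simplex (length l - 1). \<sigma> (list_point l x))"
proof -
 have "oriented_simplex (length l - 1) (%j i. if i = l ! j then 1 else 0) x = list_point l x"
  if "x \<in> standard_simplex (length l - 1)" for x
 proof
  fix i
  have "oriented_simplex (length l - 1) (%j i. if i = l ! j then 1 else 0) x i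
    = (\<Sum>j\<le>length l - 1. (if i = l ! j then 1 else 0) * x j)"
   using that by (simp add: oriented_simplex_def)
  also have "{..length l - 1} = {..<length l}" using length_Suc_pred[OF assms] by simp
  also have "(\<Sum>j<length l. (if i = l ! j then 1 else 0) * x j) = list_point l x i"
   unfolding list_point_def by (rule sum.cong) auto
  finally show "oriented_simplex (length l - 1) (%j i. if i = l ! j then 1 else 0) x i = list_point l x i" .
 qed
 then show ?thesis
  unfolding vertex_face_def simplex_map_def by (intro restrict_ext) simp
qed

lemma vertex_face_compose:
 assumes "k \<noteq> []" "set k \<subseteq> {..<length l}"
 shows "vertex_face k (vertex_face l \<sigma>) = vertex_face (map ((!) l) k) \<sigma>"
proof -
 have l: "l \<noteq> []" using assms by (cases k) auto
 have "set k \<subseteq> {..length l - 1}" using assms length_Suc_pred[OF l] by auto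
 then have "list_point k x \<in> standard_simplex (length l - 1)" if "x \<in> standard_simplex (length k - 1)" for x
  using list_point_in_standard_simplex[OF that assms(1)] by blast
 moreover have "map ((!) l) k \<noteq> []" using assms by simp
 ultimately show ?thesis
  using assms l by (simp add: vertex_face_eq list_point_compose cong: restrict_cong)
qed

lemma list_point_upt:
 assumes "x \<in> standard_simplex p"
 shows "list_point [0..<Suc p] x = x"
proof
 fix i
 have "list_point [0..<Suc p] x i = (\<Sum>j<Suc p. if i = j then x j else 0)"
  unfolding list_point_def by (rule sum.cong) (auto simp del: upt_Suc)
 also have "... = x i"
  using assms by (auto simp: standard_simplex_def)
 finally show "list_point [0..<Suc p] x i = x i" .
qed

lemma vertex_face_all:
 assumes "\<sigma> \<in> extensional (standard_simplex p)"
 shows "vertex_face [0..<Suc p] \<sigma> = \<sigma>"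
proof -
 have "vertex_face [0..<Suc p] \<sigma> = (\<lambda>x\<in>standard_simplex p. \<sigma> (list_point [0..<Suc p] x))"
  using vertex_face_eq[of "[0..<Suc p]" \<sigma>] by (simp del: upt_Suc)
 also have "... = restrict \<sigma> (standard_simplex p)"
  by (rule restrict_ext) (simp only: list_point_upt)
 finally show ?thesis using assms by (simp add: extensional_restrict)
qed

lemma singular_simplex_vertex_face:
 assumes "singular_simplex p X \<sigma>" "l \<noteq> []" "set l \<subseteq> {..p}"
 shows "singular_simplex (length l - 1) X (vertex_face l \<sigma>)"
proof -
 let ?q = "length l - 1" and ?v = "%j i. if i = l ! j then 1 else (0::real)"
 have "(%i. \<Sum>j\<le>?q. ?v j i * x j) = list_point l x" for x
 proof
  fix i
  have "(\<Sum>j\<le>?q. ?v j i * x j) = (\<Sum>j<length l. ?v j i * x j)"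
   using length_Suc_pred[OF assms(2)] by simp
  also have "... = list_point l x i"
   unfolding list_point_def by (rule sum.cong) auto
  finally show "(\<Sum>j\<le>?q. ?v j i * x j) = list_point l x i" .
 qed
 then have "simplicial_simplex ?q (standard_simplex p) (oriented_simplex ?q ?v)"
  using list_point_in_standard_simplex[OF _ assms(2,3)]
  by (auto simp: simplicial_simplex_oriented_simplex)
 then have "singular_simplex ?q (subtopology (powertop_real UNIV) (standard_simplex p)) (oriented_simplex ?q ?v)"
  by (rule simplicial_imp_singular_simplex)
 then show ?thesis
  unfolding vertex_face_def
  by (rule singular_simplex_simplex_map) (use assms(1) in \<open>simp add: singular_simplex_def\<close>)
qed

definition del_nth :: "nat => 'v list => 'v list" where
 "del_nth k l = take k l @ drop (Suc k) l"

lemma length_del_nth: "k < length l ==> length (del_nth k l) = length l - 1"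
 by (simp add: del_nth_def)

lemma set_del_nth: "set (del_nth k l) \<subseteq> set l"
 by (auto simp: del_nth_def dest: in_set_takeD in_set_dropD)

lemma map_del_nth: "map h (del_nth k l) = del_nth k (map h l)"
 by (simp add: del_nth_def take_map drop_map)

lemma cobd_del_nth: "cobd f l = (\<Sum>j<length l. signed j (f (del_nth j l)))"
 by (simp add: cobd_sum del_nth_def)

lemma singular_face_eq_vertex_face:
 assumes "1 \<le> q" "k \<le> q"
 shows "singular_face q k \<tau> = vertex_face (del_nth k [0..<Suc q]) \<tau>"
proof -
 let ?l = "del_nth k [0..<Suc q]"
 have len: "length ?l = q" using assms length_del_nth[of k "[0..<Suc q]"] by (simp del: upt_Suc)
 have nth: "?l ! h = (if h < k then h else Suc h)" if "h < q" for h
  using that assms by (auto simp: del_nth_def nth_append simp del: upt_Suc)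
 have "simplical_face k x = list_point ?l x" if x: "x \<in> standard_simplex (q - 1)" for x :: "nat => real"
 proof
  fix i
  have out: "x j = 0" if "j \<ge> q" for j
   using x that assms by (auto simp: standard_simplex_def)
  have "list_point ?l x i = (\<Sum>h<q. if i = (if h < k then h else Suc h) then x h else 0)"
   unfolding list_point_def len by (rule sum.cong) (simp_all add: nth del: upt_Suc)
  also have "... = (\<Sum>h<q. if h = (if i < k then i else i - 1) \<and> i \<noteq> k then x h else 0)"
   by (rule sum.cong) (auto split: if_splits)
  also have "... = simplical_face k x i"
   using out[of i] out[of "i - 1"] assms by (auto simp: simplical_face_def)
  finally show "simplical_face k x i = list_point ?l x i" by simp
 qed
 moreover have "?l \<noteq> []" using len assms by auto
 ultimately show ?thesis
  using len by (simp add: singular_face_def vertex_face_eq cong: restrict_cong)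
qed

text \<open>The affine simplex of the cylinder whose vertices lie over the listed vertices at height
 equal to their label.\<close>

definition lab_simplex :: "((nat => real) => 'a) => (nat \<times> nat) list => (nat => real) => 'a \<times> real" where
 "lab_simplex \<sigma> L = (\<lambda>x\<in>standard_simplex (length L - 1).
  (\<sigma> (list_point (map fst L) x), \<Sum>j<length L. real (snd (L ! j)) * x j))"

lemma vertex_face_lab_simplex:
 assumes "k \<noteq> []" "set k \<subseteq> {..<length L}"
 shows "vertex_face k (lab_simplex \<sigma> L) = lab_simplex \<sigma> (map ((!) L) k)"
proof -
 have L: "L \<noteq> []" using assms by (cases k) auto
 have k: "set k \<subseteq> {..length L - 1}" using assms length_Suc_pred[OF L] by auto
 have m: "map fst (map ((!) L) k) = map ((!) (map fst L)) k"
  using assms by auto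
 have 1: "(\<Sum>j<length L. real (snd (L ! j)) * list_point k x j) = (\<Sum>j<length k. real (snd (L ! (k ! j))) * x j)" for x
  using sum_list_point[of "{..<length L}" k "%j. real (snd (L ! j))" x] assms by simp
 have 2: "list_point k x \<in> standard_simplex (length L - 1)" if "x \<in> standard_simplex (length k - 1)" for x
  using list_point_in_standard_simplex[OF that assms(1) k] .
 have 3: "list_point (map fst L) (list_point k x) = list_point (map ((!) (map fst L)) k) x" for x
  by (rule list_point_compose) (use assms in simp)
 have 4: "(\<Sum>j<length k. real (snd (L ! (k ! j))) * x j) = (\<Sum>j<length k. real (snd (map ((!) L) k ! j)) * x j)" for x :: "nat => real"
  by (rule sum.cong) auto
 show ?thesis
  unfolding vertex_face_eq[OF assms(1)] lab_simplex_def m length_map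
  by (rule restrict_ext) (simp only: 2 3 1 4 restrict_apply if_True)
qed

lemma map_nth_del_nth: "length l = Suc q ==> map ((!) l) (del_nth k [0..<Suc q]) = del_nth k l"
 using map_nth[of l] by (simp add: map_del_nth del: upt_Suc)

lemma set_del_nth_upt: "set (del_nth k [0..<Suc q]) \<subseteq> {..<Suc q}"
 using set_del_nth[of k "[0..<Suc q]"] by (auto simp del: upt_Suc)

lemma del_nth_ne: "1 \<le> q ==> k \<le> q ==> length l = Suc q ==> del_nth k l \<noteq> []"
 using length_del_nth[of k l] by auto

lemma singular_face_vertex_face:
 assumes "length l = Suc q" "1 \<le> q" "k \<le> q"
 shows "singular_face q k (vertex_face l \<sigma>) = vertex_face (del_nth k l) \<sigma>"
 using assms set_del_nth_upt[of k q] del_nth_ne[of q k "[0..<Suc q]"]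
 by (simp add: singular_face_eq_vertex_face vertex_face_compose map_nth_del_nth del: upt_Suc)

lemma singular_face_lab_simplex:
 assumes "length L = Suc q" "1 \<le> q" "k \<le> q"
 shows "singular_face q k (lab_simplex \<sigma> L) = lab_simplex \<sigma> (del_nth k L)"
 using assms set_del_nth_upt[of k q] del_nth_ne[of q k "[0..<Suc q]"]
 by (simp add: singular_face_eq_vertex_face vertex_face_lab_simplex map_nth_del_nth del: upt_Suc)

lemma fst_lab_simplex:
 "L \<noteq> [] ==> simplex_map (length L - 1) fst (lab_simplex \<sigma> L) = vertex_face (map fst L) \<sigma>"
 by (simp add: simplex_map_def lab_simplex_def vertex_face_eq cong: restrict_cong)

lemma singular_simplex_lab_simplex:
 assumes \<sigma>: "singular_simplex p B \<sigma>" and L: "L \<noteq> []" "fst ` set L \<subseteq> {..p}" "snd ` set L \<subseteq> {..1}"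
 shows "singular_simplex (length L - 1) (cylinder B) (lab_simplex \<sigma> L)"
proof -
 let ?S = "subtopology (powertop_real UNIV) (standard_simplex (length L - 1))"
 have "singular_simplex (length (map fst L) - 1) B (vertex_face (map fst L) \<sigma>)"
  by (rule singular_simplex_vertex_face[OF \<sigma>]) (use L in auto)
 then have "continuous_map ?S B (vertex_face (map fst L) \<sigma>)"
  by (simp add: singular_simplex_def)
 then have 1: "continuous_map ?S B (fst \<circ> lab_simplex \<sigma> L)"
  by (rule continuous_map_eq) (use L in \<open>auto simp: vertex_face_eq lab_simplex_def\<close>)
 have "continuous_map ?S euclideanreal (%x. \<Sum>j<length L. real (snd (L ! j)) * x j)"
  by (intro continuous_map_sum continuous_map_real_mult continuous_map_from_subtopology)
   (auto intro: continuous_map_product_projection)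
 moreover have "(\<Sum>j<length L. real (snd (L ! j)) * x j) \<in> {0..1}" if "x \<in> standard_simplex (length L - 1)" for x
 proof -
  have x0: "0 \<le> x i" for i using that by (auto simp: standard_simplex_def)
  have sx: "(\<Sum>j<length L. x j) = 1"
   using that length_Suc_pred[OF L(1)] by (simp add: standard_simplex_def)
  have lab: "real (snd (L ! j)) \<le> 1" if "j < length L" for j
   using L(3) nth_mem[OF that] by force
  have "(\<Sum>j<length L. real (snd (L ! j)) * x j) \<le> (\<Sum>j<length L. 1 * x j)"
   using lab x0 by (intro sum_mono mult_right_mono) auto
  then show ?thesis
   using sx x0 by (auto intro!: sum_nonneg)
 qed
 ultimately have "continuous_map ?S (top_of_set {0..1}) (%x. \<Sum>j<length L. real (snd (L ! j)) * x j)"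
  by (auto simp: continuous_map_in_subtopology)
 then have 2: "continuous_map ?S (top_of_set {0..1}) (snd \<circ> lab_simplex \<sigma> L)"
  by (rule continuous_map_eq) (auto simp: lab_simplex_def)
 have "continuous_map ?S (cylinder B) (lab_simplex \<sigma> L)"
  unfolding cylinder_def using 1 2 by (simp add: continuous_map_pairwise)
 then show ?thesis
  by (simp add: singular_simplex_def lab_simplex_def)
qed

definition prism_path :: "nat => nat => (nat \<times> nat) list" where
 "prism_path i m = map (\<lambda>v. (v, 0)) (take (Suc i) [0..<Suc m]) @ map (\<lambda>v. (v, 1)) (drop i [0..<Suc m])"

lemma prism_sum_paths:
 "prism_sum g0 g1 f l = (\<Sum>i<length l. signed i (f (map g0 (take (Suc i) l) @ map g1 (drop i l))))"
proof (induction l arbitrary: f)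
 case (Cons a l)
 show ?case
  by (simp add: Cons cone_at_apply sum.lessThan_Suc_shift sum_negf del: sum.lessThan_Suc)
qed simp

lemma length_prism_path: "i \<le> m ==> length (prism_path i m) = m + 2"
 by (simp add: prism_path_def del: upt_Suc)

lemma prism_eq_lab_simplex:
 assumes "i \<le> m"
 shows "prism i m \<sigma> = lab_simplex \<sigma> (prism_path i m)"
proof -
 let ?L = "prism_path i m"
 have len: "length ?L = Suc (Suc m)" using length_prism_path[OF assms] by simp
 have nth: "?L ! j = (if j \<le> i then (j, 0) else (j - 1, 1))" if "j < Suc (Suc m)" for j
  using that assms by (auto simp: prism_path_def nth_append simp del: upt_Suc)
 have 1: "oriented_simplex (Suc m) (%j k. if k = (if j \<le> i then j else j - 1) then 1 else 0) x = list_point (map fst ?L) x"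
  if "x \<in> standard_simplex (Suc m)" for x
 proof
  fix k
  have "oriented_simplex (Suc m) (%j k. if k = (if j \<le> i then j else j - 1) then 1 else 0) x k
    = (\<Sum>j<Suc (Suc m). (if k = (if j \<le> i then j else j - 1) then 1 else 0) * x j)"
   using that by (simp add: oriented_simplex_def lessThan_Suc_atMost del: sum.lessThan_Suc)
  also have "... = list_point (map fst ?L) x k"
   unfolding list_point_def length_map len by (rule sum.cong) (simp_all add: nth len)
  finally show "oriented_simplex (Suc m) (%j k. if k = (if j \<le> i then j else j - 1) then 1 else 0) x k
   = list_point (map fst ?L) x k" .
 qed
 have 2: "(\<Sum>j<length ?L. real (snd (?L ! j)) * x j) = (\<Sum>j\<in>{Suc i..Suc m}. x j)" for x
 proof -
  have "(\<Sum>j<length ?L. real (snd (?L ! j)) * x j) = (\<Sum>j<Suc (Suc m). if j \<in> {Suc i..Suc m} then x j else 0)"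
   unfolding len by (rule sum.cong) (auto simp: nth)
  also have "... = sum x ({..<Suc (Suc m)} \<inter> {Suc i..Suc m})"
   by (simp only: sum.inter_restrict[OF finite_lessThan])
  also have "{..<Suc (Suc m)} \<inter> {Suc i..Suc m} = {Suc i..Suc m}" by auto
  finally show ?thesis .
 qed
 show ?thesis
  unfolding prism_def lab_simplex_def 2 unfolding len diff_Suc_1 by (rule restrict_ext) (simp only: 1)
qed

section \<open>Singular cochains as cochains on vertex lists\<close>

lemma additive_group_comm: "comm_group (additive_group :: 'p::ab_group_add monoid)"
proof (rule comm_groupI)
 fix x :: 'p
 assume "x \<in> carrier additive_group"
 show "\<exists>y\<in>carrier additive_group. y \<otimes>\<^bsub>additive_group\<^esub> x = \<one>\<^bsub>additive_group\<^esub>"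
  by (rule bexI[of _ "- x"]) (auto simp: additive_group_def)
qed (auto simp: additive_group_def algebra_simps)

text \<open>Taking the minimum with the last vertex makes sense of every list, so that the cocycle
 equation needs no bound on the vertices.\<close>

definition list_cochain :: "('a chain => 'p::ab_group_add) => 'a simplex => nat list => 'p" where
 "list_cochain c s l = (if l = [] then 0 else c (frag_of (vertex_face (map (min (fst s)) l) (snd s))))"

lemma cochain_add:
 assumes "c \<in> carrier (cochain_group q X)" "singular_chain q X x" "singular_chain q X y"
 shows "c (x + y) = c x + c y"
 using assms by (auto simp: cochain_group_def Hom_group_def hom_def additive_group_def)

lemma cochain_zero: "c \<in> carrier (cochain_group q X) ==> c 0 = 0"
 using cochain_add[of c q X 0 0] by simp

lemma cochain_uminus:
 assumes "c \<in> carrier (cochain_group q X)" "singular_chain q X x"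
 shows "c (- x) = - c x"
 using cochain_add[OF assms(1), of x "- x"] assms cochain_zero[OF assms(1)] singular_chain_minus[of q X x]
 by (simp add: eq_neg_iff_add_eq_0 add.commute)

lemma cochain_sum:
 assumes "c \<in> carrier (cochain_group q X)" "\<And>i. i \<in> I ==> singular_chain q X (f i)"
 shows "c (\<Sum>i\<in>I. f i) = (\<Sum>i\<in>I. c (f i))"
 using assms(2)
proof (induction I rule: infinite_finite_induct)
 case (insert i I)
 then show ?case
  using cochain_add[OF assms(1), of "f i" "\<Sum>i\<in>I. f i"] singular_chain_sum[of I q X f] by auto
qed (simp_all add: cochain_zero[OF assms(1)])

lemma cochain_signed:
 assumes "c \<in> carrier (cochain_group q X)" "singular_chain q X x"
 shows "c (frag_cmul ((-1) ^ k) x) = signed k (c x)"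
 using cochain_uminus[OF assms] by (simp add: signed_def)

lemma cochain_boundary:
 assumes c: "c \<in> carrier (cochain_group q X)" and \<tau>: "singular_simplex (Suc q) X \<tau>"
 shows "c (chain_boundary (Suc q) (frag_of \<tau>)) = (\<Sum>k<Suc (Suc q). signed k (c (frag_of (singular_face (Suc q) k \<tau>))))"
proof -
 have f: "singular_chain q X (frag_of (singular_face (Suc q) k \<tau>))" if "k \<le> Suc q" for k
  using singular_simplex_singular_face[OF \<tau>, of k] that by (simp add: singular_chain_of)
 have "chain_boundary (Suc q) (frag_of \<tau>) = (\<Sum>k\<le>Suc q. frag_cmul ((-1) ^ k) (frag_of (singular_face (Suc q) k \<tau>)))"
  by (simp add: chain_boundary_of)
 then have "c (chain_boundary (Suc q) (frag_of \<tau>))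
  = c (\<Sum>k\<le>Suc q. frag_cmul ((-1) ^ k) (frag_of (singular_face (Suc q) k \<tau>)))"
  by (rule arg_cong)
 also have "... = (\<Sum>k\<le>Suc q. c (frag_cmul ((-1) ^ k) (frag_of (singular_face (Suc q) k \<tau>))))"
  by (rule cochain_sum[OF c]) (use f in \<open>auto intro: singular_chain_cmul\<close>)
 also have "... = (\<Sum>k<Suc (Suc q). signed k (c (frag_of (singular_face (Suc q) k \<tau>))))"
  unfolding lessThan_Suc_atMost using f by (intro sum.cong) (auto simp: cochain_signed[OF c])
 finally show ?thesis .
qed

lemma cobd_list_cochain:
 assumes c: "c \<in> carrier (cochain_group q X)" and s: "s \<in> simplices X" and l: "length l = q + 2"
 shows "cobd (list_cochain c s) l
  = c (chain_boundary (Suc q) (frag_of (vertex_face (map (min (fst s)) l) (snd s))))"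
proof -
 obtain p \<sigma> where ps: "s = (p, \<sigma>)" and \<sigma>: "singular_simplex p X \<sigma>"
  using s by (auto simp: simplices_def)
 have "singular_simplex (length (map (min p) l) - 1) X (vertex_face (map (min p) l) \<sigma>)"
  by (rule singular_simplex_vertex_face[OF \<sigma>]) (use l in auto)
 then have "singular_simplex (Suc q) X (vertex_face (map (min p) l) \<sigma>)"
  using l by simp
 then have "c (chain_boundary (Suc q) (frag_of (vertex_face (map (min p) l) \<sigma>)))
   = (\<Sum>k<Suc (Suc q). signed k (c (frag_of (singular_face (Suc q) k (vertex_face (map (min p) l) \<sigma>)))))"
  by (rule cochain_boundary[OF c])
 also have "... = (\<Sum>k<Suc (Suc q). signed k (list_cochain c s (del_nth k l)))"
 proof (rule sum.cong)
  fix k assume "k \<in> {..<Suc (Suc q)}"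
  moreover from this have "del_nth k l \<noteq> []"
   using del_nth_ne[of "Suc q" k l] l by simp
  ultimately show "signed k (c (frag_of (singular_face (Suc q) k (vertex_face (map (min p) l) \<sigma>))))
    = signed k (list_cochain c s (del_nth k l))"
   using l by (simp add: singular_face_vertex_face list_cochain_def map_del_nth ps)
 qed simp
 finally show ?thesis
  using l by (simp add: cobd_del_nth ps)
qed

lemma cocycle_D:
 assumes "c \<in> cocycles q X"
 shows "c \<in> carrier (cochain_group q X)" "singular_chain (Suc q) X x ==> c (chain_boundary (Suc q) x) = 0"
proof -
 show "c \<in> carrier (cochain_group q X)"
  using assms by (simp add: cocycles_def kernel_def)
 assume "singular_chain (Suc q) X x"
 moreover have "coboundary q X c = \<one>\<^bsub>cochain_group (Suc q) X\<^esub>"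
  using assms by (simp add: cocycles_def kernel_def)
 ultimately show "c (chain_boundary (Suc q) x) = 0"
  by (auto simp: coboundary_def cochain_group_def Hom_group_def additive_group_def fun_eq_iff split: if_splits
    dest!: fun_cong[of _ _ x])
qed

lemma cobd_list_cocycle:
 assumes c: "c \<in> cocycles q X" and s: "s \<in> simplices X" and l: "length l = q + 2"
 shows "cobd (list_cochain c s) l = 0"
proof -
 obtain p \<sigma> where ps: "s = (p, \<sigma>)" and \<sigma>: "singular_simplex p X \<sigma>"
  using s by (auto simp: simplices_def)
 have "singular_simplex (length (map (min p) l) - 1) X (vertex_face (map (min p) l) \<sigma>)"
  by (rule singular_simplex_vertex_face[OF \<sigma>]) (use l in auto)
 then show ?thesis
  using l cobd_list_cochain[OF cocycle_D(1)[OF c] s l] cocycle_D(2)[OF c] by (simp add: ps singular_chain_of)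
qed

definition top_cochain :: "('v list => 'p::zero) => ('v \<times> nat) list => 'p" where
 "top_cochain c L = (if \<forall>v\<in>set L. snd v = 1 then c (map fst L) else 0)"

lemma bar_cochain_lab_simplex:
 assumes \<sigma>: "singular_simplex p B \<sigma>" and L: "length L = Suc n" "fst ` set L \<subseteq> {..p}" "snd ` set L \<subseteq> {..1}"
 shows "bar_cochain n B c (frag_of (lab_simplex \<sigma> L)) = top_cochain (list_cochain c (p, \<sigma>)) L"
proof -
 have ne: "L \<noteq> []" using L by auto
 have sing: "singular_simplex n (cylinder B) (lab_simplex \<sigma> L)"
  using singular_simplex_lab_simplex[OF \<sigma> ne L(2,3)] L(1) by simp
 let ?h = "%\<tau>. if \<tau> ` standard_simplex n \<subseteq> UNIV \<times> {1} then c (frag_of (simplex_map n fst \<tau>)) else 0"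
 have 1: "bar_cochain n B c (frag_of (lab_simplex \<sigma> L)) = ?h (lab_simplex \<sigma> L)"
  unfolding bar_cochain_def chain_group_def
  by (rule the_hom_free(2)[OF additive_group_comm]) (use sing in \<open>auto simp: additive_group_def\<close>)
 have 2: "simplex_map n fst (lab_simplex \<sigma> L) = vertex_face (map (min p) (map fst L)) \<sigma>"
 proof -
  have "map (min p) (map fst L) = map fst L" using L(2) by (auto simp: min_def)
  then show ?thesis using fst_lab_simplex[OF ne, of \<sigma>] L(1) by (simp only: diff_Suc_1)
 qed
 have 3: "lab_simplex \<sigma> L ` standard_simplex n \<subseteq> UNIV \<times> {1} \<longleftrightarrow> (\<forall>v\<in>set L. snd v = 1)"
 proof
  assume all: "\<forall>v\<in>set L. snd v = 1"
  have "(\<Sum>j<length L. real (snd (L ! j)) * x j) = 1" if "x \<in> standard_simplex n" for x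
  proof -
   have "(\<Sum>j<length L. real (snd (L ! j)) * x j) = (\<Sum>j<length L. x j)"
    using all by (intro sum.cong) auto
   then show ?thesis using that L(1) by (simp add: standard_simplex_def lessThan_Suc_atMost)
  qed
  then show "lab_simplex \<sigma> L ` standard_simplex n \<subseteq> UNIV \<times> {1}"
   using L(1) by (auto simp: lab_simplex_def)
 next
  assume sub: "lab_simplex \<sigma> L ` standard_simplex n \<subseteq> UNIV \<times> {1}"
  show "\<forall>v\<in>set L. snd v = 1"
  proof
   fix v assume "v \<in> set L"
   then obtain i where i: "i < length L" "v = L ! i" by (auto simp: in_set_conv_nth)
   let ?x = "%j. if j = i then 1 else (0::real)"
   have x: "?x \<in> standard_simplex n" using i L(1) by simp
   have "lab_simplex \<sigma> L ?x \<in> UNIV \<times> {1}" using sub imageI[OF x] by (rule subsetD)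
   then have "snd (lab_simplex \<sigma> L ?x) = 1" by (simp add: mem_Times_iff)
   moreover have "snd (lab_simplex \<sigma> L ?x) = (\<Sum>j<length L. if j = i then real (snd (L ! j)) else 0)"
   proof -
    have "snd (lab_simplex \<sigma> L ?x) = (\<Sum>j<length L. real (snd (L ! j)) * ?x j)"
     using x L(1) by (simp add: lab_simplex_def del: sum.lessThan_Suc)
    also have "... = (\<Sum>j<length L. if j = i then real (snd (L ! j)) else 0)"
     by (rule sum.cong) auto
    finally show ?thesis .
   qed
   ultimately show "snd v = 1" using i by simp
  qed
 qed
 show ?thesis
  unfolding 1 2 3 using ne by (simp add: top_cochain_def list_cochain_def)
qed

text \<open>The cochain \<open>bar_cochain\<close> sees only simplices in the top, and an affine simplex
 lies there iff all its labels are \<open>1\<close>.\<close>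

lemma z_cylinder_lab_simplex:
 fixes c z :: "'a chain => 'p::ab_group_add"
 assumes \<sigma>: "singular_simplex p B \<sigma>" and L: "length L = n + 2" "fst ` set L \<subseteq> {..p}" "snd ` set L \<subseteq> {..1}"
 shows "z_cylinder n B c z (frag_of (lab_simplex \<sigma> L))
  = list_cochain z (p, \<sigma>) (map fst L) + cobd (top_cochain (list_cochain c (p, \<sigma>))) L"
proof -
 have ne: "L \<noteq> []" using L by auto
 have sing: "singular_simplex (Suc n) (cylinder B) (lab_simplex \<sigma> L)"
  using singular_simplex_lab_simplex[OF \<sigma> ne L(2,3)] L(1) by simp
 have bar: "bar_cochain n B c \<in> carrier (cochain_group n (cylinder B))"
 proof -
  let ?b = "bar_cochain n B c"
  have "?b \<in> hom (chain_group n (cylinder B)) additive_group"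
   unfolding bar_cochain_def chain_group_def
   by (rule the_hom_free(1)[OF additive_group_comm]) (auto simp: additive_group_def)
  moreover have "?b \<in> extensional (carrier (chain_group n (cylinder B)))"
  proof -
   obtain F where F: "F \<in> hom (chain_group n (cylinder B)) additive_group"
    "!!\<tau>. \<tau> \<in> singular_simplex_set n (cylinder B) ==> F (frag_of \<tau>) =
     (if \<tau> ` standard_simplex n \<subseteq> UNIV \<times> {1} then c (frag_of (simplex_map n fst \<tau>)) else 0)"
    using calculation the_hom_free(2)[OF additive_group_comm, of "singular_simplex_set n (cylinder B)"]
    unfolding bar_cochain_def chain_group_def by (auto simp: additive_group_def)
   have "?b = restrict F (carrier (chain_group n (cylinder B)))"
    unfolding bar_cochain_def chain_group_def
    using F additive_group_comm generate_free_Abelian_group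
    by (intro the_hom_eq) (auto simp: chain_group_def comm_group_def)
   then show ?thesis by simp
  qed
  ultimately show ?thesis
   by (simp add: cochain_group_def Hom_group_def)
 qed
 have min: "map (min p) (map fst L) = map fst L" using L(2) by (auto simp: min_def)
 have "z (chain_map (Suc n) fst (frag_of (lab_simplex \<sigma> L))) = list_cochain z (p, \<sigma>) (map fst L)"
 proof -
  have "simplex_map (Suc n) fst (lab_simplex \<sigma> L) = vertex_face (map fst L) \<sigma>"
   using fst_lab_simplex[OF ne, of \<sigma>] L(1) by simp
  then show ?thesis
   unfolding list_cochain_def fst_conv snd_conv min using ne by simp
 qed
 moreover have "bar_cochain n B c (chain_boundary (Suc n) (frag_of (lab_simplex \<sigma> L)))
  = cobd (top_cochain (list_cochain c (p, \<sigma>))) L"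
 proof -
  have "bar_cochain n B c (frag_of (singular_face (Suc n) k (lab_simplex \<sigma> L)))
   = top_cochain (list_cochain c (p, \<sigma>)) (del_nth k L)" if "k < Suc (Suc n)" for k
  proof -
   have "fst ` set (del_nth k L) \<subseteq> {..p}" "snd ` set (del_nth k L) \<subseteq> {..1}"
    using L(2,3) set_del_nth[of k L] by blast+
   then show ?thesis
    using that L(1) length_del_nth[of k L]
    by (simp add: singular_face_lab_simplex bar_cochain_lab_simplex[OF \<sigma>])
  qed
  then show ?thesis
   using L(1) unfolding cochain_boundary[OF bar sing] cobd_del_nth by simp
 qed
 ultimately show ?thesis
  using sing unfolding z_cylinder_def cochain_group_def
  by (simp add: Hom_group_def additive_group_def coboundary_def singular_chain_of)
qed

section \<open>Labelled vertex lists\<close>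

definition cube_part :: "nat => nat => 'p::ab_group_add cring set" where
 "cube_part n k = {x. \<forall>c\<in>Poly_Mapping.keys x. Rep_qcube c \<in> L_cubes n \<and> qdim c = k}"

lemma cube_part_zero [simp]: "0 \<in> cube_part n k"
 by (simp add: cube_part_def)

lemma cube_part_diff: "x \<in> cube_part n k ==> y \<in> cube_part n k ==> x - y \<in> cube_part n k"
 using keys_diff[of x y] by (auto simp: cube_part_def)

lemma cube_part_uminus: "x \<in> cube_part n k ==> - x \<in> cube_part n k"
 using cube_part_diff[of 0 n k x] by simp

lemma cube_part_add: "x \<in> cube_part n k ==> y \<in> cube_part n k ==> x + y \<in> cube_part n k"
 using cube_part_diff[of x n k "- y"] cube_part_uminus[of y n k] by simp

lemma unit_in_L_cubes: "Rep_qcube (0 :: 'p::ab_group_add qcube) \<in> L_cubes n"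
 by (simp add: Rep_qcube_zero L_cubes_def cell_cocycles_def signed_def)

lemma cube_part_one: "1 \<in> cube_part n 0"
 unfolding one_cring by (simp add: cube_part_def unit_in_L_cubes, simp add: zero_qcube_def)

lemma qdim_list_cube [simp]: "qdim (list_cube n \<zeta> l) = length l - 2"
 by (simp add: list_cube_def)

lemma twist_cochain_in_cube_part:
 fixes \<zeta> :: "'v list => 'p::ab_group_add"
 assumes "\<And>l. length l = n + 3 ==> cobd \<zeta> l = 0"
 shows "twist_cochain n \<zeta> l \<in> cube_part n (length l - 2)"
proof -
 have "(edge_cochain l :: 'p cring) \<in> cube_part n (length l - 2)"
  by (simp add: edge_cochain_def cube_part_one)
 moreover have "cube_cochain n \<zeta> l \<in> cube_part n (length l - 2)"
  using list_cube_in_L_cubes[of n \<zeta> l, OF assms] by (simp add: cube_cochain_def cube_part_def)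
 ultimately show ?thesis
  by (simp add: twist_cochain_def cube_part_diff)
qed

lemma prism_sum_in_cube_part:
 assumes "\<And>l'. length l' = Suc (length l) ==> f l' \<in> cube_part n k"
 shows "prism_sum g0 g1 f l \<in> cube_part n k"
 using assms
proof (induction l arbitrary: f)
 case (Cons v l)
 have "prism_sum g0 g1 (cone_at (g0 v) f) l \<in> cube_part n k"
  by (rule Cons.IH) (use Cons.prems in \<open>auto simp: cone_at_apply\<close>)
 then show ?case
  using Cons.prems by (simp add: cube_part_diff)
qed simp

lemma triangle_sum_in_cube_part:
 assumes "\<And>l'. length l' = Suc (Suc (length l)) ==> f l' \<in> cube_part n k"
 shows "triangle_sum g0 g1 g2 f l \<in> cube_part n k"
 using assms
proof (induction l arbitrary: f)
 case (Cons v l)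
 have "triangle_sum g0 g1 g2 (cone_at (g0 v) f) l \<in> cube_part n k"
  by (rule Cons.IH) (use Cons.prems in \<open>auto simp: cone_at_apply\<close>)
 moreover have "prism_sum g1 g2 (cone_at (g0 v) f) (v # l) \<in> cube_part n k"
  by (rule prism_sum_in_cube_part) (use Cons.prems in \<open>auto simp: cone_at_apply\<close>)
 ultimately show ?case
  by (simp add: cube_part_add del: prism_sum.simps)
qed simp

lemma twist_cochain_cong:
 assumes "\<And>l'. set l' \<subseteq> set l ==> length l' = n + 2 ==> \<zeta> l' = \<zeta>' l'"
 shows "twist_cochain n \<zeta> l = twist_cochain n \<zeta>' l"
 using list_cube_cong[of l n \<zeta> \<zeta>'] assms by (auto simp: twist_cochain_def cube_cochain_def)

lemma twist_cochain_map: "twist_cochain n \<zeta> (map h l) = twist_cochain n (\<lambda>l. \<zeta> (map h l)) l"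
 by (cases "l = []") (auto simp: twist_cochain_def cube_cochain_def edge_cochain_def list_cube_map)

text \<open>A cocycle on the product with an interval or a triangle: the pull-back of
 \<open>\<zeta>\<close> changed by the coboundary of \<open>e\<close>. Second components are the vertices
 of the interval or triangle.\<close>

definition lab_cocycle :: "('v list => 'p::ab_group_add) => (('v \<times> nat) list => 'p) => ('v \<times> nat) list => 'p" where
 "lab_cocycle \<zeta> e = (\<lambda>L. \<zeta> (map fst L) + cobd e L)"

text \<open>The list version of \<open>1 + u(c, z)\<close>.\<close>

definition gauge_cochain :: "nat => ('v list => 'p::ab_group_add) => ('v list => 'p) => 'v list => 'p cring" where
 "gauge_cochain n \<zeta> c = unit_cochain
  - prism_sum (\<lambda>v. (v, 0)) (\<lambda>v. (v, 1)) (twist_cochain n (lab_cocycle \<zeta> (top_cochain c)))"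

definition triangle_cochain ::
  "nat => ('v list => 'p::ab_group_add) => (('v \<times> nat) list => 'p) => 'v list => 'p cring" where
 "triangle_cochain n \<zeta> e =
  triangle_sum (\<lambda>v. (v, 0)) (\<lambda>v. (v, 1)) (\<lambda>v. (v, 2)) (twist_cochain n (lab_cocycle \<zeta> e))"

lemma cobd_lab_cocycle:
 assumes "\<And>l. length l = n + 3 ==> cobd \<zeta> l = 0" "length L = n + 3"
 shows "cobd (lab_cocycle \<zeta> e) L = 0"
proof -
 have "lab_cocycle \<zeta> e = (%L. \<zeta> (map fst L)) + cobd e"
  by (simp add: lab_cocycle_def fun_eq_iff)
 then have "cobd (lab_cocycle \<zeta> e) L = cobd \<zeta> (map fst L)"
  by (simp add: cobd_add cobd_cobd cobd_map)
 then show ?thesis using assms by simp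
qed

lemma twist_lab_cocycle_end:
 assumes "\<And>l. length l = n + 2 ==> cobd e (map (\<lambda>v. (v, b)) l) = 0"
 shows "twist_cochain n (lab_cocycle \<zeta> e) (map (\<lambda>v. (v, b)) l) = twist_cochain n \<zeta> l"
 unfolding twist_cochain_map
 by (rule twist_cochain_cong) (use assms in \<open>simp add: lab_cocycle_def comp_def\<close>)

lemma top_cochain_bottom: "l \<noteq> [] ==> top_cochain c (map (\<lambda>v. (v, 0)) l) = 0"
 by (cases l) (auto simp: top_cochain_def)

lemma top_cochain_top: "top_cochain c (map (\<lambda>v. (v, 1)) l) = c l"
 by (simp add: top_cochain_def comp_def)

lemma cobd_eq_0:
 assumes "\<And>l'. [|set l' \<subseteq> set l; Suc (length l') = length l|] ==> f l' = 0"
 shows "cobd f l = 0"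
 using cobd_cong[of l f 0] assms by simp

lemma cobd_top_cochain_bottom: "length l = n + 2 ==> cobd (top_cochain c) (map (\<lambda>v. (v, 0)) l) = 0"
 unfolding cobd_map by (rule cobd_eq_0) (auto intro!: top_cochain_bottom)

text \<open>Both ends of the prism carry the cocycle \<open>\<zeta>\<close>: at the bottom
 \<open>c\<close> is not seen, at the top its coboundary vanishes.\<close>

lemma gauge_gauge_cochain:
 assumes n: "n \<ge> 1" and c: "\<And>l. length l = n + 2 ==> cobd c l = 0"
 shows "cubical.gauge (twist_cochain n \<zeta>) (twist_cochain n \<zeta>) (gauge_cochain n \<zeta> c)"
proof -
 let ?t = "twist_cochain n (lab_cocycle \<zeta> (top_cochain c))"
 have 0: "?t (map (%v. (v, 0)) l) = twist_cochain n \<zeta> l" for l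
  by (rule twist_lab_cocycle_end) (rule cobd_top_cochain_bottom)
 have 1: "?t (map (%v. (v, 1)) l) = twist_cochain n \<zeta> l" for l
  by (rule twist_lab_cocycle_end) (simp only: cobd_map top_cochain_top c)
 show ?thesis
  using cubical.prism_gauge[OF twisting_twist_cochain[OF n] cube_sgn_one,
    of "lab_cocycle \<zeta> (top_cochain c)" "%v. (v, 0)" "%v. (v, 1)"]
  unfolding gauge_cochain_def 0 1 .
qed

text \<open>Only the coboundary of \<open>e\<close> over the edge matters for the sum over the prisms above it.\<close>

lemma prism_sum_edge:
 fixes \<alpha> \<beta> :: nat and \<zeta> :: "'v list => 'p::ab_group_add"
 assumes "\<And>L. [|length L = n + 2; snd ` set L \<subseteq> {0, 1}|] ==>
   cobd e (map (\<lambda>(v, b). (v, if b = 0 then \<alpha> else \<beta>)) L) = cobd (top_cochain c) L"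
 shows "unit_cochain - prism_sum (\<lambda>v. (v, \<alpha>)) (\<lambda>v. (v, \<beta>)) (twist_cochain n (lab_cocycle \<zeta> e))
  = gauge_cochain n \<zeta> c"
proof -
 let ?h = "%(v, b). (v, if b = (0::nat) then \<alpha> else \<beta>)"
 have "prism_sum (%v. (v, \<alpha>)) (%v. (v, \<beta>)) (twist_cochain n (lab_cocycle \<zeta> e)) l
  = prism_sum (%v. (v, 0)) (%v. (v, 1)) (twist_cochain n (lab_cocycle \<zeta> (top_cochain c))) l" for l
 proof -
  have "prism_sum (%v. (v, \<alpha>)) (%v. (v, \<beta>)) (twist_cochain n (lab_cocycle \<zeta> e)) l
   = prism_sum (%v. ?h (v, 0)) (%v. ?h (v, 1)) (twist_cochain n (lab_cocycle \<zeta> e)) l"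
   by simp
  also have "... = prism_sum (%v. (v, 0)) (%v. (v, 1)) (%L. twist_cochain n (lab_cocycle \<zeta> e) (map ?h L)) l"
   by (rule prism_sum_map_out)
  also have "... = prism_sum (%v. (v, 0)) (%v. (v, 1)) (twist_cochain n (lab_cocycle \<zeta> (top_cochain c))) l"
  proof (rule prism_sum_cong)
   fix L :: "('v \<times> nat) list"
   assume L: "set L \<subseteq> (%v. (v, 0)) ` set l \<union> (%v. (v, 1)) ` set l"
   show "twist_cochain n (lab_cocycle \<zeta> e) (map ?h L) = twist_cochain n (lab_cocycle \<zeta> (top_cochain c)) L"
    unfolding twist_cochain_map
   proof (rule twist_cochain_cong)
    fix L' assume L': "set L' \<subseteq> set L" "length L' = n + 2"
    have "map fst (map ?h L') = map fst L'" by auto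
    moreover have "snd ` set L' \<subseteq> {0, 1}" using L L' by force
    ultimately show "lab_cocycle \<zeta> e (map ?h L') = lab_cocycle \<zeta> (top_cochain c) L'"
     unfolding lab_cocycle_def using assms[OF L'(2)] by (simp only:)
   qed
  qed
  finally show ?thesis .
 qed
 then show ?thesis
  by (simp add: gauge_cochain_def fun_eq_iff)
qed

lemma triangle_cochain_homotopy:
 assumes n: "n \<ge> 1"
  and e0: "\<And>l :: 'v list. length l = n + 2 ==> cobd e (map (\<lambda>v. (v, 0)) l) = 0"
  and e2: "\<And>l :: 'v list. length l = n + 2 ==> cobd e (map (\<lambda>v. (v, 2)) l) = 0"
  and e01: "\<And>L. [|length L = n + 2; snd ` set L \<subseteq> {0, 1}|] ==>
    cobd e (map (\<lambda>(v, b). (v, if b = 0 then 0 else 1)) L) = cobd (top_cochain c01) L"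
  and e12: "\<And>L. [|length L = n + 2; snd ` set L \<subseteq> {0, 1}|] ==>
    cobd e (map (\<lambda>(v, b). (v, if b = 0 then 1 else 2)) L) = cobd (top_cochain c12) L"
  and e02: "\<And>L. [|length L = n + 2; snd ` set L \<subseteq> {0, 1}|] ==>
    cobd e (map (\<lambda>(v, b). (v, if b = 0 then 0 else 2)) L) = cobd (top_cochain c02) L"
 shows "cubical.gauge_homotopy (twist_cochain n \<zeta>) (twist_cochain n \<zeta>) (triangle_cochain n \<zeta> e)
  (cup (*) (gauge_cochain n \<zeta> c01) (gauge_cochain n \<zeta> c12) - gauge_cochain n \<zeta> c02)"
proof -
 let ?t = "twist_cochain n (lab_cocycle \<zeta> e)"
 have ends: "?t (map (%v. (v, 0)) l) = twist_cochain n \<zeta> l" "?t (map (%v. (v, 2)) l) = twist_cochain n \<zeta> l" for l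
  by (rule twist_lab_cocycle_end, rule e0, assumption) (rule twist_lab_cocycle_end, rule e2)
 have edges: "unit_cochain - prism_sum (%v. (v, 0)) (%v. (v, 1)) ?t = gauge_cochain n \<zeta> c01"
  "unit_cochain - prism_sum (%v. (v, 1)) (%v. (v, 2)) ?t = gauge_cochain n \<zeta> c12"
  "unit_cochain - prism_sum (%v. (v, 0)) (%v. (v, 2)) ?t = gauge_cochain n \<zeta> c02"
  using prism_sum_edge[of n e 0 1 c01 \<zeta>] prism_sum_edge[of n e 1 2 c12 \<zeta>] prism_sum_edge[of n e 0 2 c02 \<zeta>]
   e01 e12 e02 by blast+
 show ?thesis
  using cubical.triangle_gauge_homotopy[OF twisting_twist_cochain[OF n],
   of "lab_cocycle \<zeta> e" "%v. (v, 0)" "%v. (v, 2)" "%v. (v, 1)"]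
  unfolding ends edges triangle_cochain_def .
qed

definition supp_cochain :: "(nat => bool) => ('v list => 'p::zero) => ('v \<times> nat) list => 'p" where
 "supp_cochain Q c L = (if \<forall>v\<in>set L. Q (snd v) then c (map fst L) else 0)"

text \<open>A cochain that equals \<open>c\<close> on vertex \<open>1\<close> and \<open>c + c'\<close>
 on vertex \<open>2\<close>. Its coboundary is that of \<open>c\<close>, \<open>c'\<close> and \<open>c +
 c'\<close> in the cylinders over the edges \<open>01\<close>, \<open>12\<close>,
 \<open>02\<close>.\<close>

definition sum_triangle :: "('v list => 'p::ab_group_add) => ('v list => 'p) => ('v \<times> nat) list => 'p" where
 "sum_triangle c c' = supp_cochain (\<lambda>b. b \<ge> 1) c + supp_cochain (\<lambda>b. b = 2) c'"

text \<open>A cochain that is \<open>\<delta>b\<close> over vertex \<open>1\<close> and \<open>0\<close>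
 over vertex \<open>2\<close>, interpolated over the edge \<open>12\<close> by a coboundary so that
 nothing is changed there.\<close>

definition cobd_triangle :: "('v list => 'p::ab_group_add) => ('v \<times> nat) list => 'p" where
 "cobd_triangle b L = (if \<forall>v\<in>set L. snd v \<ge> 1 then cobd (supp_cochain (\<lambda>b. b = 1) b) L else 0)"

lemma labels_cases: "snd ` set L \<subseteq> {0, 1} ==> v \<in> set L ==> snd v = 0 \<or> snd v = (1::nat)"
 by auto

lemma gauge_product_homotopy:
 fixes c c' :: "'v list => 'p::ab_group_add"
 assumes n: "n \<ge> 1" and c: "\<And>l. length l = n + 2 ==> cobd c l = 0" "\<And>l. length l = n + 2 ==> cobd c' l = 0"
 shows "cubical.gauge_homotopy (twist_cochain n \<zeta>) (twist_cochain n \<zeta>) (triangle_cochain n \<zeta> (sum_triangle c c'))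
  (cup (*) (gauge_cochain n \<zeta> c) (gauge_cochain n \<zeta> c') - gauge_cochain n \<zeta> (c + c'))"
proof (rule triangle_cochain_homotopy[OF n])
 let ?e = "sum_triangle c c'"
 show "cobd ?e (map (%v. (v, 0)) l) = 0" if "length l = n + 2" for l
  unfolding cobd_map
  by (rule cobd_eq_0) (use that in \<open>auto simp: sum_triangle_def supp_cochain_def\<close>)
 show "cobd ?e (map (%v. (v, 2)) l) = 0" if "length l = n + 2" for l
 proof -
  have "(%l. ?e (map (%v. (v, 2)) l)) = c + c'"
   by (auto simp: sum_triangle_def supp_cochain_def fun_eq_iff comp_def)
  then show ?thesis
   unfolding cobd_map using c that by (simp add: cobd_add)
 qed
 fix L :: "('v \<times> nat) list"
 assume L: "length L = n + 2" "snd ` set L \<subseteq> {0, 1}"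
 show "cobd ?e (map (%(v, b). (v, if b = 0 then 0 else 1)) L) = cobd (top_cochain c) L"
  unfolding cobd_map
 proof (rule cobd_cong)
  fix L' assume L': "set L' \<subseteq> set L" "Suc (length L') = length L"
  then have ne: "L' \<noteq> []" using L by auto
  have lab: "snd v = 0 \<or> snd v = 1" if "v \<in> set L'" for v using labels_cases[OF L(2)] L' that by blast
  have "map fst (map (%(v, b). (v, if b = 0 then 0 else 1 :: nat)) L') = map fst L'" by auto
  moreover have "(\<forall>v\<in>set (map (%(v, b). (v, if b = 0 then 0 else 1 :: nat)) L'). snd v \<ge> 1) \<longleftrightarrow> (\<forall>v\<in>set L'. snd v = 1)"
   using lab by fastforce
  moreover have "\<not> (\<forall>v\<in>set (map (%(v, b). (v, if b = 0 then 0 else 1 :: nat)) L'). snd v = 2)"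
   using ne by (cases L') (auto split: if_splits)
  ultimately show "?e (map (%(v, b). (v, if b = 0 then 0 else 1)) L') = top_cochain c L'"
   by (simp only: sum_triangle_def supp_cochain_def top_cochain_def plus_fun_apply if_False add_0_right cong: if_cong)
 qed
 show "cobd ?e (map (%(v, b). (v, if b = 0 then 1 else 2)) L) = cobd (top_cochain c') L"
 proof -
  have "cobd (%L. ?e (map (%(v, b). (v, if b = 0 then 1 else 2)) L)) L
   = cobd ((%L. c (map fst L)) + top_cochain c') L"
  proof (rule cobd_cong)
   fix L' assume L': "set L' \<subseteq> set L" "Suc (length L') = length L"
   have lab: "snd v = 0 \<or> snd v = 1" if "v \<in> set L'" for v using labels_cases[OF L(2)] L' that by blast
   have "map fst (map (%(v, b). (v, if b = 0 then 1 else 2 :: nat)) L') = map fst L'" by auto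
   moreover have "(\<forall>v\<in>set (map (%(v, b). (v, if b = 0 then 1 else 2 :: nat)) L'). snd v \<ge> 1) = True"
    by auto
   moreover have "(\<forall>v\<in>set (map (%(v, b). (v, if b = 0 then 1 else 2 :: nat)) L'). snd v = 2) \<longleftrightarrow> (\<forall>v\<in>set L'. snd v = 1)"
    using lab by fastforce
   ultimately show "?e (map (%(v, b). (v, if b = 0 then 1 else 2)) L') = ((%L. c (map fst L)) + top_cochain c') L'"
    by (simp only: sum_triangle_def supp_cochain_def top_cochain_def plus_fun_apply if_True cong: if_cong)
  qed
  also have "... = cobd (top_cochain c') L"
   using c L by (simp add: cobd_add flip: cobd_map)
  finally show ?thesis unfolding cobd_map .
 qed
 show "cobd ?e (map (%(v, b). (v, if b = 0 then 0 else 2)) L) = cobd (top_cochain (c + c')) L"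
  unfolding cobd_map
 proof (rule cobd_cong)
  fix L' assume L': "set L' \<subseteq> set L" "Suc (length L') = length L"
  have lab: "snd v = 0 \<or> snd v = 1" if "v \<in> set L'" for v using labels_cases[OF L(2)] L' that by blast
  have "map fst (map (%(v, b). (v, if b = 0 then 0 else 2 :: nat)) L') = map fst L'" by auto
  moreover have "(\<forall>v\<in>set (map (%(v, b). (v, if b = 0 then 0 else 2 :: nat)) L'). snd v \<ge> 1) \<longleftrightarrow> (\<forall>v\<in>set L'. snd v = 1)"
   using lab by fastforce
  moreover have "(\<forall>v\<in>set (map (%(v, b). (v, if b = 0 then 0 else 2 :: nat)) L'). snd v = 2) \<longleftrightarrow> (\<forall>v\<in>set L'. snd v = 1)"
   using lab by fastforce
  ultimately show "?e (map (%(v, b). (v, if b = 0 then 0 else 2)) L') = top_cochain (c + c') L'"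
   by (simp only: sum_triangle_def supp_cochain_def top_cochain_def plus_fun_apply cong: if_cong) simp
 qed
qed

lemma gauge_coboundary_homotopy:
 fixes b :: "'v list => 'p::ab_group_add"
 assumes n: "n \<ge> 1"
 shows "cubical.gauge_homotopy (twist_cochain n \<zeta>) (twist_cochain n \<zeta>) (triangle_cochain n \<zeta> (cobd_triangle b))
  (cup (*) (gauge_cochain n \<zeta> (cobd b)) (gauge_cochain n \<zeta> 0) - gauge_cochain n \<zeta> 0)"
proof (rule triangle_cochain_homotopy[OF n])
 let ?e = "cobd_triangle b"
 have top0: "top_cochain (0 :: 'v list => 'p) = 0"
  by (auto simp: top_cochain_def fun_eq_iff)
 show "cobd ?e (map (%v. (v, 0)) l) = 0" if "length l = n + 2" for l
  unfolding cobd_map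
  by (rule cobd_eq_0) (use that in \<open>auto simp: cobd_triangle_def\<close>)
 show "cobd ?e (map (%v. (v, 2)) l) = 0" if "length l = n + 2" for l
  unfolding cobd_map
 proof (rule cobd_eq_0)
  fix l' assume l': "set l' \<subseteq> set l" "Suc (length l') = length l"
  have "cobd (supp_cochain (%b. b = 1) b) (map (%v. (v, 2)) l') = 0"
   unfolding cobd_map by (rule cobd_eq_0) (use l' that n in \<open>auto simp: supp_cochain_def\<close>)
  then show "?e (map (%v. (v, 2)) l') = 0"
   by (simp add: cobd_triangle_def)
 qed
 fix L :: "('v \<times> nat) list"
 assume L: "length L = n + 2" "snd ` set L \<subseteq> {0, 1}"
 show "cobd ?e (map (%(v, b). (v, if b = 0 then 0 else 1)) L) = cobd (top_cochain (cobd b)) L"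
  unfolding cobd_map[of ?e]
 proof (rule cobd_cong)
  fix L' assume L': "set L' \<subseteq> set L" "Suc (length L') = length L"
  let ?m = "map (%(v, b). (v, if b = 0 then 0 else 1 :: nat))"
  have lab: "snd v = 0 \<or> snd v = 1" if "v \<in> set L'" for v using labels_cases[OF L(2)] L' that by blast
  have eq: "(\<forall>v\<in>set (?m L'). snd v \<ge> 1) \<longleftrightarrow> (\<forall>v\<in>set L'. snd v = 1)"
   using lab by fastforce
  have "cobd (supp_cochain (%b. b = 1) b) (?m L') = cobd b (map fst L')" if "\<forall>v\<in>set L'. snd v = 1"
   unfolding cobd_map
  proof (rule cobd_cong)
   fix K assume K: "set K \<subseteq> set L'" "Suc (length K) = length L'"
   have "map fst (?m K) = map fst K" by auto
   moreover have "(\<forall>v\<in>set (?m K). snd v = 1) = True" using that K by fastforce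
   ultimately show "supp_cochain (%b. b = 1) b (?m K) = b (map fst K)"
    by (simp only: supp_cochain_def if_True)
  qed
  then show "?e (?m L') = top_cochain (cobd b) L'"
   unfolding cobd_triangle_def eq top_cochain_def by simp
 qed
 show "cobd ?e (map (%(v, b). (v, if b = 0 then 1 else 2)) L) = cobd (top_cochain 0) L"
 proof -
  let ?m = "map (%(v, b). (v, if b = 0 then 1 else 2 :: nat))"
  have "?e (?m L') = cobd (%K. supp_cochain (%b. b = 1) b (?m K)) L'" for L'
  proof -
   have "(\<forall>v\<in>set (?m L'). snd v \<ge> 1) = True" by auto
   then have "?e (?m L') = cobd (supp_cochain (%b. b = 1) b) (?m L')"
    unfolding cobd_triangle_def by (simp only: if_True)
   then show ?thesis by (simp only: cobd_map)
  qed
  then have eq: "(%L. ?e (?m L)) = cobd (%K. supp_cochain (%b. b = 1) b (?m K))"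
   by (rule ext)
  show ?thesis
   unfolding cobd_map[of ?e] eq top0 cobd_cobd cobd_zero ..
 qed
 show "cobd ?e (map (%(v, b). (v, if b = 0 then 0 else 2)) L) = cobd (top_cochain 0) L"
 proof -
  let ?m = "map (%(v, b). (v, if b = 0 then 0 else 2 :: nat))"
  have "cobd ?e (?m L) = 0"
   unfolding cobd_map[of ?e]
  proof (rule cobd_eq_0)
   fix L' assume L': "set L' \<subseteq> set L" "Suc (length L') = length L"
   have "cobd (supp_cochain (%b. b = 1) b) (?m L') = 0"
    unfolding cobd_map
   proof (rule cobd_eq_0)
    fix K assume "set K \<subseteq> set L'" "Suc (length K) = length L'"
    then have "K \<noteq> []" using L L' n by auto
    then have "\<not> (\<forall>v\<in>set (?m K). snd v = 1)" by (cases K) (auto split: if_splits)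
    then show "supp_cochain (%b. b = 1) b (?m K) = 0"
     by (simp only: supp_cochain_def if_False)
   qed
   then show "?e (?m L') = 0"
    by (simp only: cobd_triangle_def if_cancel)
  qed
  then show ?thesis by (simp add: top0)
 qed
qed

section \<open>Faces, degeneracies and products of cocycles\<close>

lemma cell_cocycles_iff:
 "f \<in> cell_cocycles p n \<longleftrightarrow>
  (\<forall>w. w \<notin> cells p n --> f w = 0) \<and> (\<forall>w\<in>cells p (Suc n). cell_cobd f w = 0)"
proof -
 have "(\<Sum>i\<in>{i. i < p \<and> w ! i = None}. signed (Suc (count_list (take i w) None))
     (f (w[i := Some False]) - f (w[i := Some True]))) = - cell_cobd f w" if "w \<in> cells p (Suc n)" for w
  using that cell_cobd_sum[of w f] by (simp add: cells_def sum_negf)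
 then show ?thesis
  by (auto simp: cell_cocycles_def)
qed

lemma cell_cobd_add: "cell_cobd (\<lambda>w. F w + F' w) w = cell_cobd F w + cell_cobd F' w"
proof (induction w arbitrary: F F')
 case (Cons a w)
 then show ?case by (cases a) auto
qed simp

lemma cell_cobd_zero [simp]: "cell_cobd (\<lambda>w. 0) w = 0"
proof (induction w)
 case (Cons a w)
 then show ?case by (cases a) auto
qed simp

lemma cell_cobd_face:
 "i \<le> length w ==> cell_cobd (\<lambda>w. f (take i w @ Some eps # drop i w)) w = cell_cobd f (take i w @ Some eps # drop i w)"
proof (induction i arbitrary: w f)
 case (Suc i)
 then obtain a v where w: "w = a # v" "i \<le> length v" by (cases w) auto
 then show ?case using Suc.IH[OF w(2), of "%w. f (a # w)"] by (cases a) (auto cong: if_cong)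
qed simp

lemma cell_cobd_degen:
 "i < length w ==> cell_cobd (\<lambda>w. if i < length w \<and> w ! i \<noteq> None then f (take i w @ drop (Suc i) w) else 0) w
  = (if w ! i \<noteq> None then cell_cobd f (take i w @ drop (Suc i) w) else 0)"
proof (induction i arbitrary: w f)
 case 0
 then obtain a v where w: "w = a # v" by (cases w) auto
 show ?case unfolding w by (cases a) auto
next
 case (Suc i)
 then obtain a v where w: "w = a # v" "i < length v" by (cases w) auto
 then show ?case using Suc.IH[OF w(2), of "%w. f (a # w)"] by (cases a) (auto cong: if_cong)
qed

lemma cell_cobd_no_None: "cell_cobd (\<lambda>w. if None \<in> set w then 0 else k) w = 0"
proof (induction w)
 case (Cons a w)
 then show ?case by (cases a) auto
qed simp

lemma cell_cobd_prod_left: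
 "cell_cobd (\<lambda>w. if None \<in> set (drop (length x) w) then 0 else f (take (length x) w)) (x @ y)
  = (if None \<in> set y then 0 else cell_cobd f x)"
proof (induction x arbitrary: f)
 case Nil
 then show ?case using cell_cobd_no_None[of "f []" y] by (simp cong: if_cong)
next
 case (Cons a x)
 then show ?case using Cons.IH[of "%w. f (a # w)"] by (cases a) (auto cong: if_cong)
qed

lemma cell_cobd_prod_right:
 "cell_cobd (\<lambda>w. if None \<in> set (take (length x) w) then 0 else g (drop (length x) w)) (x @ y)
  = (if None \<in> set x then 0 else cell_cobd g y)"
proof (induction x)
 case (Cons a x)
 then show ?case by (cases a) (auto cong: if_cong)
qed simp

lemma qcube_L_cubes_iff:
 "Rep_qcube c \<in> L_cubes n \<longleftrightarrow> (\<forall>w. length w = qdim c --> count_list w None \<noteq> n --> qval c w = 0)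
  \<and> (\<forall>w. length w = qdim c --> count_list w None = Suc n --> cell_cobd (qval c) w = 0)"
 using qval_off[of _ c] by (auto simp: L_cubes_def Rep_qcube_eq cell_cocycles_iff cells_def)

lemma cell_cobd_cong_length:
 assumes "\<And>w'. length w' = length w ==> F w' = F' w'"
 shows "cell_cobd F w = cell_cobd F' w"
 using cell_cobd_cong[of w F F'] assms by simp

lemma L_cubes_plus:
 assumes c: "Rep_qcube c \<in> L_cubes n" and c': "Rep_qcube c' \<in> L_cubes n"
 shows "Rep_qcube (c + c') \<in> L_cubes n"
 unfolding qcube_L_cubes_iff
proof (intro conjI allI impI)
 fix w :: cell assume w: "length w = qdim (c + c')"
 then have "qdim c \<le> length w" by (simp add: qdim_plus)
 from split_list_at[OF this] obtain x y where xy: "w = x @ y" "length x = qdim c" by blast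
 then have y: "length y = qdim c'" using w by (simp add: qdim_plus)
 have cx: "count_list x None \<noteq> n ==> qval c x = 0" "count_list x None = Suc n ==> cell_cobd (qval c) x = 0"
  and cy: "count_list y None \<noteq> n ==> qval c' y = 0" "count_list y None = Suc n ==> cell_cobd (qval c') y = 0"
  using c c' xy y unfolding qcube_L_cubes_iff by blast+
 have xN: "None \<notin> set x ==> count_list x None = 0" and yN: "None \<notin> set y ==> count_list y None = 0"
  using count_list_None_0 by blast+
 show "qval (c + c') w = 0" if cnt: "count_list w None \<noteq> n"
 proof -
  have "count_list x None + count_list y None \<noteq> n"
   using cnt by (simp add: xy(1) count_list_append)
  then have "(if None \<in> set y then 0 else qval c x) = 0" "(if None \<in> set x then 0 else qval c' y) = 0"
   using cx(1) cy(1) xN yN by auto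
  then show ?thesis
   unfolding xy(1) qval_plus_append[OF xy(2) y] by simp
 qed
 show "cell_cobd (qval (c + c')) w = 0" if cnt: "count_list w None = Suc n"
 proof -
  have "cell_cobd (qval (c + c')) w = cell_cobd (%w.
    (if None \<in> set (drop (length x) w) then 0 else qval c (take (length x) w)) +
    (if None \<in> set (take (length x) w) then 0 else qval c' (drop (length x) w))) w"
   by (rule cell_cobd_cong_length) (use w xy in \<open>simp add: qval_plus qdim_plus\<close>)
  also have "... = (if None \<in> set y then 0 else cell_cobd (qval c) x) + (if None \<in> set x then 0 else cell_cobd (qval c') y)"
   unfolding cell_cobd_add xy(1) cell_cobd_prod_left cell_cobd_prod_right ..
  also have "... = 0"
  proof -
   have "count_list x None + count_list y None = Suc n"
    using cnt by (simp add: xy(1) count_list_append)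
   then have "(if None \<in> set y then 0 else cell_cobd (qval c) x) = 0"
    "(if None \<in> set x then 0 else cell_cobd (qval c') y) = 0"
    using cx(2) cy(2) xN yN by auto
   then show ?thesis by simp
  qed
  finally show ?thesis .
 qed
qed

lemma L_cubes_qface:
 assumes c: "Rep_qcube c \<in> L_cubes n" and i: "i < qdim c"
 shows "Rep_qcube (qface i eps c) \<in> L_cubes n"
 unfolding qcube_L_cubes_iff
proof (intro conjI allI impI)
 fix w :: cell assume w: "length w = qdim (qface i eps c)"
 let ?w = "take i w @ Some eps # drop i w"
 have len: "length ?w = qdim c" using w i by simp
 have cnt: "count_list ?w None = count_list w None"
 proof -
  have "count_list w None = count_list (take i w) None + count_list (drop i w) None"
   using count_list_append[of "take i w" "drop i w" None] by (simp only: append_take_drop_id)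
  then show ?thesis by (simp add: count_list_append)
 qed
 have qw: "qval (qface i eps c) w = qval c ?w"
  by (rule qval_face) (use w in simp)
 show "qval (qface i eps c) w = 0" if "count_list w None \<noteq> n"
  using that c len cnt unfolding qw qcube_L_cubes_iff by metis
 show "cell_cobd (qval (qface i eps c)) w = 0" if "count_list w None = Suc n"
 proof -
  have "cell_cobd (qval (qface i eps c)) w = cell_cobd (%w. qval c (take i w @ Some eps # drop i w)) w"
   by (rule cell_cobd_cong_length) (use w in \<open>simp add: qval_face\<close>)
  also have "... = cell_cobd (qval c) ?w"
   by (rule cell_cobd_face) (use w i in simp)
  also have "... = 0" using c len cnt that unfolding qcube_L_cubes_iff by metis
  finally show ?thesis .
 qed
qed

definition qdegen :: "nat => 'p::ab_group_add qcube => 'p qcube" where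
 "qdegen i c = mk_qcube (Suc (qdim c))
  (\<lambda>w. if i < length w \<and> w ! i \<noteq> None then qval c (take i w @ drop (Suc i) w) else 0)"

lemma qdim_degen [simp]: "qdim (qdegen i c) = Suc (qdim c)"
 by (simp add: qdegen_def)

lemma qval_degen_append:
 "length x + length y = qdim c ==> qval (qdegen (length x) c) (x @ a # y) = (if a = None then 0 else qval c (x @ y))"
 by (simp add: qdegen_def)

lemma Rep_qdegen: "Rep_qcube (qdegen i c) = L_degen i (Rep_qcube c)"
proof -
 have "qval (qdegen i c) w = snd (L_degen i (Rep_qcube c)) w" for w
  using qval_off[of "take i w @ drop (Suc i) w" c]
  by (auto simp: qdegen_def L_degen_def Rep_qcube_eq)
 then show ?thesis
  by (simp add: Rep_qcube_eq L_degen_def fun_eq_iff)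
qed

lemma split_list_at_elem: "i < length w ==> \<exists>x a y. w = x @ a # y \<and> length x = i"
 by (metis id_take_nth_drop length_take min.absorb4)

lemma L_cubes_qdegen:
 assumes c: "Rep_qcube c \<in> L_cubes n" and i: "i \<le> qdim c"
 shows "Rep_qcube (qdegen i c) \<in> L_cubes n"
 unfolding qcube_L_cubes_iff
proof (intro conjI allI impI)
 fix w :: cell assume w: "length w = qdim (qdegen i c)"
 then have il: "i < length w" using i by simp
 from split_list_at_elem[OF this] obtain x a y where xy: "w = x @ a # y" "length x = i" by blast
 have len: "length (x @ y) = qdim c" using w xy by simp
 have cxy: "count_list (x @ y) None \<noteq> n ==> qval c (x @ y) = 0"
  "count_list (x @ y) None = Suc n ==> cell_cobd (qval c) (x @ y) = 0"
  using c len unfolding qcube_L_cubes_iff by blast+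
 have cw: "count_list w None = count_list (x @ y) None" if "a \<noteq> None"
  using that by (simp add: xy(1) count_list_append)
 have qw: "qval (qdegen i c) w = (if a = None then 0 else qval c (x @ y))"
  using qval_degen_append[of x y c a] xy len by simp
 show "qval (qdegen i c) w = 0" if "count_list w None \<noteq> n"
  using that cxy(1) cw unfolding qw by (metis (full_types))
 show "cell_cobd (qval (qdegen i c)) w = 0" if cnt: "count_list w None = Suc n"
 proof -
  have "cell_cobd (qval (qdegen i c)) w
   = cell_cobd (%w. if i < length w \<and> w ! i \<noteq> None then qval c (take i w @ drop (Suc i) w) else 0) w"
   by (rule cell_cobd_cong_length) (use w in \<open>simp add: qdegen_def\<close>)
  also have "... = (if w ! i \<noteq> None then cell_cobd (qval c) (take i w @ drop (Suc i) w) else 0)"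
   by (rule cell_cobd_degen[OF il])
  also have "... = (if a \<noteq> None then cell_cobd (qval c) (x @ y) else 0)"
   using xy by (auto simp: nth_append)
  also have "... = 0" using cnt cxy(2) cw by (metis (full_types))
  finally show ?thesis .
 qed
qed

lemma qdegen_plus_left:
 assumes "i \<le> qdim c"
 shows "qdegen i c + c' = qdegen i (c + c')"
proof (rule qcube_eqI)
 fix w :: cell assume w: "length w = qdim (qdegen i c + c')"
 then have "i < length w" using assms by (simp add: qdim_plus)
 from split_list_at_elem[OF this] obtain x a v where xv: "w = x @ a # v" "length x = i" by blast
 have "qdim c - i \<le> length v" using w xv assms by (simp add: qdim_plus)
 from split_list_at[OF this] obtain y z where yz: "v = y @ z" "length y = qdim c - i" by blast
 have z: "length z = qdim c'" and xy: "length x + length y = qdim c"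
  using w xv yz assms by (auto simp: qdim_plus)
 have "qval (qdegen i c + c') ((x @ a # y) @ z)
  = (if None \<in> set z then 0 else qval (qdegen i c) (x @ a # y)) + (if None \<in> set (x @ a # y) then 0 else qval c' z)"
  by (rule qval_plus_append) (use xy z in auto)
 moreover have "qval (c + c') ((x @ y) @ z)
  = (if None \<in> set z then 0 else qval c (x @ y)) + (if None \<in> set (x @ y) then 0 else qval c' z)"
  by (rule qval_plus_append) (use xy z in auto)
 ultimately show "qval (qdegen i c + c') w = qval (qdegen i (c + c')) w"
  using qval_degen_append[of x y c a] qval_degen_append[of x "y @ z" "c + c'" a] xv yz xy z
  by (auto simp: qdim_plus)
qed (simp add: qdim_plus)

lemma qdegen_plus_right:
 assumes "i \<le> qdim c'"
 shows "c + qdegen i c' = qdegen (qdim c + i) (c + c')"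
proof (rule qcube_eqI)
 fix w :: cell assume w: "length w = qdim (c + qdegen i c')"
 then have "qdim c + i < length w" using assms by (simp add: qdim_plus)
 from split_list_at_elem[OF this] obtain u a z where uz: "w = u @ a # z" "length u = qdim c + i" by blast
 have "qdim c \<le> length u" using uz by simp
 from split_list_at[OF this] obtain x y where xy: "u = x @ y" "length x = qdim c" by blast
 have y: "length y = i" and z: "length y + length z = qdim c'"
  using w uz xy assms by (auto simp: qdim_plus)
 have "qval (c + qdegen i c') (x @ (y @ a # z))
  = (if None \<in> set (y @ a # z) then 0 else qval c x) + (if None \<in> set x then 0 else qval (qdegen i c') (y @ a # z))"
  by (rule qval_plus_append) (use xy y z in auto)
 moreover have "qval (c + c') (x @ (y @ z))
  = (if None \<in> set (y @ z) then 0 else qval c x) + (if None \<in> set x then 0 else qval c' (y @ z))"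
  by (rule qval_plus_append) (use xy y z in auto)
 ultimately show "qval (c + qdegen i c') w = qval (qdegen (qdim c + i) (c + c')) w"
  using qval_degen_append[of y z c' a] qval_degen_append[of "x @ y" z "c + c'" a] uz xy y z
  by (auto simp: qdim_plus)
qed (simp add: qdim_plus)

lemma qface_qdegen_same:
 assumes "i \<le> qdim c"
 shows "qface i eps (qdegen i c) = c"
proof (rule qcube_eqI)
 fix w :: cell assume w: "length w = qdim (qface i eps (qdegen i c))"
 then have "i \<le> length w" using assms by simp
 from split_list_at[OF this] obtain x y where xy: "w = x @ y" "length x = i" by blast
 then show "qval (qface i eps (qdegen i c)) w = qval c w"
  using w qval_face_append[of x y "qdegen i c" eps] qval_degen_append[of x y c "Some eps"] by simp
qed simp

lemma qface_qdegen_less: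
 assumes "j < i" "i \<le> qdim c"
 shows "qface j eps (qdegen i c) = qdegen (i - 1) (qface j eps c)"
proof (rule qcube_eqI)
 fix w :: cell assume w: "length w = qdim (qface j eps (qdegen i c))"
 then have "i - 1 < length w" using assms by simp
 from split_list_at_elem[OF this] obtain u a z where uz: "w = u @ a # z" "length u = i - 1" by blast
 have "j \<le> length u" using uz assms by simp
 from split_list_at[OF this] obtain x y where xy: "u = x @ y" "length x = j" by blast
 have len: "length x + length y = i - 1" "length x + (length y + length z) = qdim c - 1" "i \<ge> 1"
  using w uz xy assms by auto
 have "qval (qface j eps (qdegen i c)) w = qval (qdegen i c) ((x @ Some eps # y) @ a # z)"
  using qval_face_append[of x "y @ a # z" "qdegen i c" eps] uz xy len assms by simp
 also have "... = (if a = None then 0 else qval c (x @ Some eps # y @ z))"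
  using qval_degen_append[of "x @ Some eps # y" z c a] len assms by simp
 also have "... = (if a = None then 0 else qval (qface j eps c) (x @ y @ z))"
  using qval_face_append[of x "y @ z" c eps] len xy by simp
 also have "... = qval (qdegen (i - 1) (qface j eps c)) w"
  using qval_degen_append[of "x @ y" z "qface j eps c" a] uz xy len assms by simp
 finally show "qval (qface j eps (qdegen i c)) w = qval (qdegen (i - 1) (qface j eps c)) w" .
qed (use assms in simp)

lemma qface_qdegen_greater:
 assumes "i < j" "j \<le> qdim c"
 shows "qface j eps (qdegen i c) = qdegen i (qface (j - 1) eps c)"
proof (rule qcube_eqI)
 fix w :: cell assume w: "length w = qdim (qface j eps (qdegen i c))"
 then have "i < length w" using assms by simp
 from split_list_at_elem[OF this] obtain x a v where xv: "w = x @ a # v" "length x = i" by blast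
 have "j - 1 - i \<le> length v" using xv w assms by simp
 from split_list_at[OF this] obtain y z where yz: "v = y @ z" "length y = j - 1 - i" by blast
 have len: "length x + length y = j - 1" "length x + (length y + length z) = qdim c - 1" "j \<ge> 1"
  using w xv yz assms by auto
 have "qval (qface j eps (qdegen i c)) w = qval (qdegen i c) (x @ a # (y @ Some eps # z))"
  using qval_face_append[of "x @ a # y" z "qdegen i c" eps] xv yz len assms by simp
 also have "... = (if a = None then 0 else qval c ((x @ y) @ Some eps # z))"
  using qval_degen_append[of x "y @ Some eps # z" c a] len xv assms by simp
 also have "... = (if a = None then 0 else qval (qface (j - 1) eps c) (x @ y @ z))"
  using qval_face_append[of "x @ y" z c eps] len by simp
 also have "... = qval (qdegen i (qface (j - 1) eps c)) w"
  using qval_degen_append[of x "y @ z" "qface (j - 1) eps c" a] xv yz len by simp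
 finally show "qval (qface j eps (qdegen i c)) w = qval (qdegen i (qface (j - 1) eps c)) w" .
qed (use assms in simp)

section \<open>Normalized chains as a quotient of the cubical ring\<close>

definition qchains :: "nat => 'p::ab_group_add cring set" where
 "qchains n = {x. Poly_Mapping.keys x \<subseteq> {c. Rep_qcube c \<in> L_cubes n}}"

text \<open>Spanned by the degenerate cubes; the lemmas below show that it is an ideal stable under the
 differential.\<close>

definition qdegenerate :: "nat => 'p::ab_group_add cring set" where
 "qdegenerate n = {x. Poly_Mapping.keys x \<subseteq> {qdegen i c | i c. Rep_qcube c \<in> L_cubes n \<and> i \<le> qdim c}}"

definition frag_span :: "'c set => ('c \<Rightarrow>\<^sub>0 int) set" where
 "frag_span S = {x. Poly_Mapping.keys x \<subseteq> S}"

lemma qchains_span: "qchains n = frag_span {c. Rep_qcube c \<in> L_cubes n}"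
 and qdegenerate_span: "qdegenerate n = frag_span {qdegen i c | i c. Rep_qcube c \<in> L_cubes n \<and> i \<le> qdim c}"
 by (simp_all add: qchains_def qdegenerate_def frag_span_def)

lemma frag_span_diff: "x \<in> frag_span S ==> y \<in> frag_span S ==> x - y \<in> frag_span S"
 using keys_diff[of x y] by (auto simp: frag_span_def)

lemma frag_span_zero [simp]: "0 \<in> frag_span S"
 by (simp add: frag_span_def)

lemma frag_span_uminus: "x \<in> frag_span S ==> - x \<in> frag_span S"
 using frag_span_diff[of 0 S x] by simp

lemma frag_span_add: "x \<in> frag_span S ==> y \<in> frag_span S ==> x + y \<in> frag_span S"
 using frag_span_diff[of x S "- y"] frag_span_uminus[of y S] by simp

lemma frag_span_signed: "x \<in> frag_span S ==> signed k x \<in> frag_span S"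
 by (simp add: signed_def frag_span_uminus)

lemma frag_span_sum: "(\<And>i. i \<in> I ==> f i \<in> frag_span S) ==> (\<Sum>i\<in>I. f i) \<in> frag_span S"
 by (induction I rule: infinite_finite_induct) (auto intro: frag_span_add)

lemma frag_span_of [simp]: "frag_of c \<in> frag_span S \<longleftrightarrow> c \<in> S"
 by (simp add: frag_span_def)

lemma additive_into_span:
 assumes h: "\<And>x y. h (x + y) = h x + h y" and "\<And>c. c \<in> S ==> h (frag_of c) \<in> frag_span T"
  and x: "x \<in> frag_span S"
 shows "h x \<in> frag_span T"
proof -
 have "Poly_Mapping.keys x \<subseteq> S" using x by (simp add: frag_span_def)
 then show ?thesis
  by (rule frag_induction) (use assms(2) in \<open>auto simp: additive_zero[of h, OF h] intro: frag_span_diff\<close>)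
qed

lemma cube_part_span: "cube_part n k = frag_span {c. Rep_qcube c \<in> L_cubes n \<and> qdim c = k}"
 by (auto simp: cube_part_def frag_span_def)

lemma cube_part_qchains: "x \<in> cube_part n k ==> x \<in> qchains n"
 by (auto simp: cube_part_def qchains_def)

lemma cube_d_qchains: "x \<in> qchains n ==> cube_d x \<in> qchains n"
 unfolding qchains_span
 by (rule additive_into_span[of cube_d, OF cube_d_add])
  (auto simp: cube_d_of face_diff_of simp del: signed_Suc intro!: frag_span_sum frag_span_signed frag_span_diff L_cubes_qface)

lemma mult_frag_span:
 fixes x y :: "'p::ab_group_add cring"
 assumes xy: "x \<in> frag_span S" "y \<in> frag_span T" and "\<And>c c'. c \<in> S ==> c' \<in> T ==> c + c' \<in> U"
 shows "x * y \<in> frag_span U"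
proof (rule additive_into_span[of "%x. x * y", OF distrib_right _ xy(1)])
 fix c assume c: "c \<in> S"
 show "frag_of c * y \<in> frag_span U"
  by (rule additive_into_span[of "%y. frag_of c * y", OF distrib_left _ xy(2)])
   (use assms(3)[OF c] in \<open>simp add: frag_of_times\<close>)
qed

lemma mult_qchains: "x \<in> qchains n ==> y \<in> qchains n ==> x * y \<in> qchains n"
 unfolding qchains_span by (rule mult_frag_span) (auto intro: L_cubes_plus)

lemma mult_qdegenerate_left: "x \<in> qdegenerate n ==> y \<in> qchains n ==> x * y \<in> qdegenerate n"
 unfolding qchains_span qdegenerate_span
proof (erule (1) mult_frag_span)
 fix c c' :: "'a qcube"
 assume "c \<in> {qdegen i c | i c. Rep_qcube c \<in> L_cubes n \<and> i \<le> qdim c}" and c': "c' \<in> {c. Rep_qcube c \<in> L_cubes n}"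
 then obtain i b where "c = qdegen i b" "Rep_qcube b \<in> L_cubes n" "i \<le> qdim b" by blast
 then have "c + c' = qdegen i (b + c')" "Rep_qcube (b + c') \<in> L_cubes n" "i \<le> qdim (b + c')"
  using c' qdegen_plus_left[of i b c'] L_cubes_plus[of b n c'] by (simp_all add: qdim_plus)
 then show "c + c' \<in> {qdegen i c | i c. Rep_qcube c \<in> L_cubes n \<and> i \<le> qdim c}" by blast
qed

lemma mult_qdegenerate_right: "x \<in> qchains n ==> y \<in> qdegenerate n ==> x * y \<in> qdegenerate n"
 unfolding qchains_span qdegenerate_span
proof (erule (1) mult_frag_span)
 fix c c' :: "'a qcube"
 assume c: "c \<in> {c. Rep_qcube c \<in> L_cubes n}" and "c' \<in> {qdegen i c | i c. Rep_qcube c \<in> L_cubes n \<and> i \<le> qdim c}"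
 then obtain i b where "c' = qdegen i b" "Rep_qcube b \<in> L_cubes n" "i \<le> qdim b" by blast
 then have "c + c' = qdegen (qdim c + i) (c + b)" "Rep_qcube (c + b) \<in> L_cubes n" "qdim c + i \<le> qdim (c + b)"
  using c qdegen_plus_right[of i b c] L_cubes_plus[of c n b] by (simp_all add: qdim_plus)
 then show "c + c' \<in> {qdegen i c | i c. Rep_qcube c \<in> L_cubes n \<and> i \<le> qdim c}" by blast
qed

lemma qface_qdegen_degenerate:
 assumes "Rep_qcube c \<in> L_cubes n" "i \<le> qdim c" "j \<le> qdim c" "j \<noteq> i"
 shows "frag_of (qface j eps (qdegen i c)) \<in> qdegenerate n"
proof (cases "j < i")
 case True
 then have "qface j eps (qdegen i c) = qdegen (i - 1) (qface j eps c)" "Rep_qcube (qface j eps c) \<in> L_cubes n"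
  "i - 1 \<le> qdim (qface j eps c)"
  using assms qface_qdegen_less[of j i c eps] L_cubes_qface[of c n j eps] by simp_all
 then show ?thesis unfolding qdegenerate_span frag_span_of by blast
next
 case False
 then have "qface j eps (qdegen i c) = qdegen i (qface (j - 1) eps c)" "Rep_qcube (qface (j - 1) eps c) \<in> L_cubes n"
  "i \<le> qdim (qface (j - 1) eps c)"
  using assms qface_qdegen_greater[of i j c eps] L_cubes_qface[of c n "j - 1" eps] by simp_all
 then show ?thesis unfolding qdegenerate_span frag_span_of by blast
qed

lemma cube_d_qdegenerate:
 assumes "x \<in> qdegenerate n"
 shows "cube_d x \<in> qdegenerate n"
 unfolding qdegenerate_span
proof (rule additive_into_span[of cube_d, OF cube_d_add _ assms[unfolded qdegenerate_span]])
 fix c :: "'a qcube"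
 assume "c \<in> {qdegen i c | i c. Rep_qcube c \<in> L_cubes n \<and> i \<le> qdim c}"
 then obtain i b where b: "c = qdegen i b" "Rep_qcube b \<in> L_cubes n" "i \<le> qdim b" by blast
 have "signed (Suc j) (face_diff j (frag_of c)) \<in> qdegenerate n" if "j < qdim c" for j
 proof (cases "j = i")
  case True
  then have "face_diff j (frag_of c) = 0" using b by (simp add: face_diff_of qface_qdegen_same)
  then show ?thesis by (simp add: qdegenerate_span)
 next
  case False
  then have "frag_of (qface j eps c) \<in> qdegenerate n" for eps
   using qface_qdegen_degenerate[OF b(2,3), of j] that b by simp
  then have "face_diff j (frag_of c) \<in> qdegenerate n"
   unfolding face_diff_of qdegenerate_span by (simp only: frag_span_diff)
  then show ?thesis
   unfolding qdegenerate_span by (rule frag_span_signed)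
 qed
 then show "cube_d (frag_of c) \<in> frag_span {qdegen i c | i c. Rep_qcube c \<in> L_cubes n \<and> i \<le> qdim c}"
  unfolding cube_d_of qdegenerate_span by (intro frag_span_sum) (simp only: lessThan_iff)
qed

lemma L_cubes_Rep: "s \<in> L_cubes n ==> \<exists>c. s = Rep_qcube c"
proof -
 assume s: "s \<in> L_cubes n"
 then have "s \<in> {s. \<forall>w. length w \<noteq> fst s --> snd s w = 0}"
  by (auto simp: L_cubes_def cell_cocycles_def cells_def)
 then have "Rep_qcube (Abs_qcube s) = s" by (rule Abs_qcube_inverse)
 then show ?thesis by (intro exI[of _ "Abs_qcube s"]) simp
qed

abbreviation L_free :: "nat => ('p::ab_group_add cube \<Rightarrow>\<^sub>0 int) monoid" where
 "L_free n \<equiv> free_Abelian_group (L_cubes n)"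

definition cube_class :: "nat => 'p::ab_group_add cring => ('p cube \<Rightarrow>\<^sub>0 int) set" where
 "cube_class n x = L_degenerate_chains n #>\<^bsub>L_free n\<^esub> frag_extend (\<lambda>c. frag_of (Rep_qcube c)) x"

lemma subgroup_free_subset:
 assumes "S \<subseteq> T"
 shows "subgroup (carrier (free_Abelian_group S)) (free_Abelian_group T)"
proof (rule group.subgroupI[OF group_free_Abelian_group])
 show "carrier (free_Abelian_group S) \<subseteq> carrier (free_Abelian_group T)"
  using assms by auto
 show "carrier (free_Abelian_group S) \<noteq> {}"
  using monoid.one_closed[OF group.is_monoid[OF group_free_Abelian_group[of S]]] by blast
 fix a b assume a: "a \<in> carrier (free_Abelian_group S)" and b: "b \<in> carrier (free_Abelian_group S)"
 have "inv\<^bsub>free_Abelian_group T\<^esub> a = - a" using a assms by (intro inv_free_Abelian_group) auto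
 then show "inv\<^bsub>free_Abelian_group T\<^esub> a \<in> carrier (free_Abelian_group S)"
  using a by (simp add: keys_minus)
 show "a \<otimes>\<^bsub>free_Abelian_group T\<^esub> b \<in> carrier (free_Abelian_group S)"
  using a b keys_add[of a b] by (auto simp: subset_iff)
qed

lemma L_degenerate_subgroup: "subgroup (L_degenerate_chains n) (L_free n :: ('p::ab_group_add cube \<Rightarrow>\<^sub>0 int) monoid)"
 unfolding L_degenerate_chains_def
proof (rule subgroup_free_subset, rule subsetI)
 fix t :: "'p cube"
 assume "t \<in> {L_degen i s | i s. s \<in> L_cubes n \<and> i \<le> fst s}"
 then obtain i s where t: "t = L_degen i s" and s: "s \<in> L_cubes n" "i \<le> fst s" by blast
 obtain c where "s = Rep_qcube c" using L_cubes_Rep[OF s(1)] by blast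
 then show "t \<in> L_cubes n"
  unfolding t using L_cubes_qdegen[of c n i] s by (simp add: Rep_qdegen qdim_def)
qed

lemma L_chains_comm_group: "comm_group (L_chains n)"
 unfolding L_chains_def by (rule quotient_comm_group[OF abelian_free_Abelian_group L_degenerate_subgroup])

lemma L_chains_group: "group (L_chains n)"
 using L_chains_comm_group unfolding comm_group_def by blast

lemma Rep_span:
 assumes "x \<in> qchains n"
 shows "frag_extend (\<lambda>c. frag_of (Rep_qcube c)) x \<in> carrier (L_free n)"
proof -
 have "s \<in> L_cubes n" if s: "s \<in> Poly_Mapping.keys (frag_extend (%c. frag_of (Rep_qcube c)) x)" for s
 proof -
  obtain c where "c \<in> Poly_Mapping.keys x" "s = Rep_qcube c"
   using subsetD[OF keys_frag_extend s] by auto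
  then show ?thesis using assms unfolding qchains_def by blast
 qed
 then show ?thesis unfolding carrier_free_Abelian_group_iff by blast
qed

lemma cube_class_closed: "x \<in> qchains n ==> cube_class n x \<in> carrier (L_chains n)"
 unfolding cube_class_def L_chains_def carrier_FactGroup by (rule imageI[OF Rep_span])

lemma cube_class_add:
 assumes "x \<in> qchains n" "y \<in> qchains n"
 shows "cube_class n (x + y) = cube_class n x \<otimes>\<^bsub>L_chains n\<^esub> cube_class n y"
 using hom_mult[OF coset_hom[OF abelian_free_Abelian_group L_degenerate_subgroup] Rep_span[OF assms(1)] Rep_span[OF assms(2)]]
 by (simp add: cube_class_def L_chains_def frag_extend_add)

lemma cube_class_of: "cube_class n (frag_of c) = L_class n (Rep_qcube c)"
 by (simp add: cube_class_def L_class_def)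

lemma qchains_zero [simp]: "0 \<in> qchains n"
 by (simp add: qchains_def)

lemma cube_class_zero [simp]: "cube_class n 0 = \<one>\<^bsub>L_chains n\<^esub>"
proof -
 interpret F: comm_group "L_free n" by (rule abelian_free_Abelian_group)
 have "cube_class n 0 = L_degenerate_chains n"
  unfolding cube_class_def
  using F.coset_join2[of 0, OF _ L_degenerate_subgroup] subgroup.one_closed[OF L_degenerate_subgroup[of n]] by simp
 then show ?thesis by (simp add: L_chains_def)
qed

lemma qchains_uminus: "x \<in> qchains n ==> - x \<in> qchains n"
 and qchains_add: "x \<in> qchains n ==> y \<in> qchains n ==> x + y \<in> qchains n"
 and qchains_diff: "x \<in> qchains n ==> y \<in> qchains n ==> x - y \<in> qchains n"
 and qchains_signed: "x \<in> qchains n ==> signed k x \<in> qchains n"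
 by (simp_all add: qchains_span frag_span_uminus frag_span_add frag_span_diff frag_span_signed)

lemma cube_class_uminus:
 assumes "x \<in> qchains n"
 shows "cube_class n (- x) = inv\<^bsub>L_chains n\<^esub> cube_class n x"
proof -
 interpret L: comm_group "L_chains n" by (rule L_chains_comm_group)
 have "cube_class n (- x) \<otimes>\<^bsub>L_chains n\<^esub> cube_class n x = \<one>\<^bsub>L_chains n\<^esub>"
  using cube_class_add[OF qchains_uminus[OF assms] assms] by simp
 then show ?thesis
  using assms by (intro L.inv_equality[symmetric]) (auto intro: cube_class_closed qchains_uminus)
qed

lemma cube_class_degenerate:
 assumes "x \<in> qdegenerate n"
 shows "cube_class n x = \<one>\<^bsub>L_chains n\<^esub>"
proof -
 interpret F: comm_group "L_free n" by (rule abelian_free_Abelian_group)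
 let ?y = "frag_extend (%c. frag_of (Rep_qcube c)) x"
 have "Poly_Mapping.keys ?y \<subseteq> Rep_qcube ` Poly_Mapping.keys x"
  using keys_frag_extend[of "%c. frag_of (Rep_qcube c)" x] by auto
 also have "... \<subseteq> {L_degen i s | i s. s \<in> L_cubes n \<and> i \<le> fst s}"
 proof (rule image_subsetI)
  fix c assume "c \<in> Poly_Mapping.keys x"
  then have "c \<in> {qdegen i c | i c. Rep_qcube c \<in> L_cubes n \<and> i \<le> qdim c}"
   using assms unfolding qdegenerate_def by blast
  then obtain i b where "c = qdegen i b" "Rep_qcube b \<in> L_cubes n" "i \<le> qdim b" by blast
  then have "Rep_qcube c = L_degen i (Rep_qcube b)" "Rep_qcube b \<in> L_cubes n" "i \<le> fst (Rep_qcube b)"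
   by (simp_all add: Rep_qdegen qdim_def)
  then show "Rep_qcube c \<in> {L_degen i s | i s. s \<in> L_cubes n \<and> i \<le> fst s}" by blast
 qed
 finally have y: "?y \<in> L_degenerate_chains n"
  unfolding L_degenerate_chains_def carrier_free_Abelian_group_iff .
 then have "cube_class n x = L_degenerate_chains n"
  unfolding cube_class_def
  using F.coset_join2[OF _ L_degenerate_subgroup] subgroup.mem_carrier[OF L_degenerate_subgroup y] by blast
 then show ?thesis by (simp add: L_chains_def)
qed

lemma cube_class_onto:
 assumes "K \<in> carrier (L_chains n)"
 shows "\<exists>x\<in>qchains n. K = cube_class n x"
proof -
 obtain y where y: "y \<in> carrier (L_free n)" "K = L_degenerate_chains n #>\<^bsub>L_free n\<^esub> y"
  using assms by (auto simp: L_chains_def carrier_FactGroup)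
 let ?x = "frag_extend (%s. frag_of (Abs_qcube s)) y"
 have Abs: "Rep_qcube (Abs_qcube s) = s" if "s \<in> L_cubes n" for s
  using L_cubes_Rep[OF that] by (auto simp: Rep_qcube_inverse)
 have "?x \<in> qchains n"
 proof -
  have "Poly_Mapping.keys y \<subseteq> L_cubes n" using y(1) by simp
  then have "Rep_qcube c \<in> L_cubes n" if c: "c \<in> Poly_Mapping.keys (frag_extend (%s. frag_of (Abs_qcube s)) y)" for c
  proof -
   obtain s where s: "s \<in> Poly_Mapping.keys y" "c = Abs_qcube s"
    using subsetD[OF keys_frag_extend c] by auto
   have "s \<in> L_cubes n" using subsetD[OF \<open>Poly_Mapping.keys y \<subseteq> L_cubes n\<close> s(1)] .
   from this Abs[OF this] show ?thesis unfolding s(2) by (simp only:)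
  qed
  then show ?thesis unfolding qchains_def by blast
 qed
 moreover have Abs': "Rep_qcube (Abs_qcube s) = s" if "s \<in> Poly_Mapping.keys y" for s
  using that by (meson Abs carrier_free_Abelian_group_iff subsetD y(1))
 have "frag_extend (%c. frag_of (Rep_qcube c)) ?x = y"
  by (rule additive_frag_eq[of "%y. frag_extend (%c. frag_of (Rep_qcube c)) (frag_extend (%s. frag_of (Abs_qcube s)) y)" "%y. y"])
   (simp_all add: frag_extend_add Abs')
 ultimately show ?thesis
  using y(2) by (intro bexI[of _ ?x]) (simp_all add: cube_class_def)
qed

text \<open>The differential and the products are defined on normalized chains by their values on cubes; this identifies them with the operations of the cubical ring.\<close>

lemma cube_class_descend:
 fixes \<Phi> :: "'p::ab_group_add cring => 'p cring"
 assumes add: "\<And>x y. \<Phi> (x + y) = \<Phi> x + \<Phi> y" and ch: "\<And>x. x \<in> qchains n ==> \<Phi> x \<in> qchains n"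
  and deg: "\<And>x. x \<in> qdegenerate n ==> \<Phi> x \<in> qdegenerate n"
 obtains F where "F \<in> hom (L_chains n) (L_chains n)" "\<And>x. x \<in> qchains n ==> F (cube_class n x) = cube_class n (\<Phi> x)"
proof -
 let ?A = "%y :: 'p cube \<Rightarrow>\<^sub>0 int. frag_extend (%s. frag_of (Abs_qcube s)) y"
 have Abs: "Rep_qcube (Abs_qcube s) = s" if "s \<in> L_cubes n" for s :: "'p cube"
  using L_cubes_Rep[OF that] by (auto simp: Rep_qcube_inverse)
 have Aq: "?A y \<in> qchains n" if "y \<in> carrier (L_free n)" for y
 proof -
  have "Poly_Mapping.keys y \<subseteq> L_cubes n" using that by simp
  then have "Rep_qcube c \<in> L_cubes n" if c: "c \<in> Poly_Mapping.keys (frag_extend (%s. frag_of (Abs_qcube s)) y)" for c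
  proof -
   obtain s where s: "s \<in> Poly_Mapping.keys y" "c = Abs_qcube s"
    using subsetD[OF keys_frag_extend c] by auto
   have "s \<in> L_cubes n" using subsetD[OF \<open>Poly_Mapping.keys y \<subseteq> L_cubes n\<close> s(1)] .
   from this Abs[OF this] show ?thesis unfolding s(2) by (simp only:)
  qed
  then show ?thesis unfolding qchains_def by blast
 qed
 have hom: "(%y. cube_class n (\<Phi> (?A y))) \<in> hom (L_free n) (L_chains n)"
  using Aq ch by (auto simp: hom_def frag_extend_add add cube_class_add cube_class_closed)
 have triv: "cube_class n (\<Phi> (?A y)) = \<one>\<^bsub>L_chains n\<^esub>" if y: "y \<in> L_degenerate_chains n" for y
 proof (rule cube_class_degenerate, rule deg)
  have "Poly_Mapping.keys (?A y) \<subseteq> Abs_qcube ` Poly_Mapping.keys y"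
   using keys_frag_extend[of "%s. frag_of (Abs_qcube s)" y] by auto
  also have "... \<subseteq> {qdegen i c | i c. Rep_qcube c \<in> L_cubes n \<and> i \<le> qdim c}"
  proof clarify
   fix s assume "s \<in> Poly_Mapping.keys y"
   then have "s \<in> {L_degen i t | i t. t \<in> L_cubes n \<and> i \<le> fst t}"
    using y unfolding L_degenerate_chains_def carrier_free_Abelian_group_iff by blast
   then obtain i t where t: "s = L_degen i t" "t \<in> L_cubes n" "i \<le> fst t" by blast
   then obtain c where c: "t = Rep_qcube c" using L_cubes_Rep by blast
   then have "Abs_qcube s = qdegen i c"
    using t by (simp add: Rep_qdegen[symmetric] Rep_qcube_inverse)
   then show "\<exists>i c. Abs_qcube s = qdegen i c \<and> Rep_qcube c \<in> L_cubes n \<and> i \<le> qdim c"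
    using t c by (intro exI[of _ i] exI[of _ c]) (simp add: qdim_def)
  qed
  finally show "?A y \<in> qdegenerate n" unfolding qdegenerate_def by blast
 qed
 have grp: "group (L_chains n :: ('p cube \<Rightarrow>\<^sub>0 int) set monoid)" by (rule L_chains_group)
 obtain F where F: "F \<in> hom (L_free n Mod L_degenerate_chains n) (L_chains n)"
  "!!y. y \<in> carrier (L_free n) ==> F (L_degenerate_chains n #>\<^bsub>L_free n\<^esub> y) = cube_class n (\<Phi> (?A y))"
  using quotient_hom[OF abelian_free_Abelian_group grp L_degenerate_subgroup hom triv] by blast
 have "?A (frag_extend (%c. frag_of (Rep_qcube c)) x) = x" for x :: "'p cring"
  by (rule additive_frag_eq[of "%x. ?A (frag_extend (%c. frag_of (Rep_qcube c)) x)" "%x. x"])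
   (auto simp: frag_extend_add Rep_qcube_inverse)
 then have "F (cube_class n x) = cube_class n (\<Phi> x)" if "x \<in> qchains n" for x
  using F(2)[OF Rep_span[OF that]] by (simp add: cube_class_def)
 then show thesis using that[of F] F(1) by (simp add: L_chains_def)
qed

lemma L_chains_generated:
 "carrier (L_chains n) \<subseteq> generate (L_chains n) (L_class n ` L_cubes n)"
proof
 fix K assume "K \<in> carrier (L_chains n)"
 then obtain y where y: "y \<in> carrier (L_free n)" "K = L_degenerate_chains n #>\<^bsub>L_free n\<^esub> y"
  by (auto simp: L_chains_def carrier_FactGroup)
 have grp: "group (L_free n Mod L_degenerate_chains n)"
  using quotient_comm_group[OF abelian_free_Abelian_group L_degenerate_subgroup] unfolding comm_group_def by blast
 have "K \<in> generate (L_free n Mod L_degenerate_chains n) ((%y. L_degenerate_chains n #>\<^bsub>L_free n\<^esub> y) ` frag_of ` L_cubes n)"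
  unfolding y(2)
  by (rule generate_image[OF group_free_Abelian_group grp coset_hom[OF abelian_free_Abelian_group L_degenerate_subgroup]])
   (use subsetD[OF generate_free_Abelian_group y(1)] in auto)
 then show "K \<in> generate (L_chains n) (L_class n ` L_cubes n)"
  by (simp add: L_chains_def image_image L_class_def)
qed

lemma L_class_closed: "s \<in> L_cubes n ==> L_class n s \<in> carrier (L_chains n)"
 by (auto simp: L_class_def L_chains_def carrier_FactGroup)

lemma the_hom_L_chains:
 assumes F: "F \<in> hom (L_chains n) (L_chains n)" and h: "\<And>s. s \<in> L_cubes n ==> F (L_class n s) = h s"
 shows "the_hom (L_chains n) (L_chains n) (L_cubes n) (L_class n) h = restrict F (carrier (L_chains n))"
 by (rule the_hom_eq[OF L_chains_group L_chains_group F h _ L_chains_generated]) (auto intro: L_class_closed)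

lemma cube_class_signed:
 assumes "x \<in> qchains n"
 shows "cube_class n (signed k x) = cube_class n x [^]\<^bsub>L_chains n\<^esub> ((-1) ^ k :: int)"
proof -
 interpret L: comm_group "L_chains n" by (rule L_chains_comm_group)
 show ?thesis
  using cube_class_closed[OF assms] cube_class_uminus[OF assms]
  by (auto simp: signed_def L.int_pow_neg)
qed

lemma cube_class_sum:
 assumes "finite I" "\<And>i. i \<in> I ==> f i \<in> qchains n"
 shows "cube_class n (\<Sum>i\<in>I. f i) = (\<Otimes>\<^bsub>L_chains n\<^esub>i\<in>I. cube_class n (f i))"
 using assms
proof (induction I)
 case empty
 show ?case
  by (simp only: sum.empty cube_class_zero comm_monoid.finprod_empty[OF comm_group.axioms(1)[OF L_chains_comm_group]])
next
 case (insert i I)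
 interpret L: comm_group "L_chains n" by (rule L_chains_comm_group)
 have "(\<Sum>i\<in>I. f i) \<in> qchains n"
  using insert.prems by (auto simp: qchains_span intro!: frag_span_sum)
 then show ?case
  using insert by (simp add: cube_class_add cube_class_closed L.finprod_insert Pi_iff)
qed

lemma L_diff_cube_class:
 fixes x :: "'p::ab_group_add cring"
 assumes "x \<in> qchains n"
 shows "L_diff n (cube_class n x) = cube_class n (cube_d x)"
proof -
 interpret L: comm_group "L_chains n :: ('p cube \<Rightarrow>\<^sub>0 int) set monoid" by (rule L_chains_comm_group)
 obtain F where F: "F \<in> hom (L_chains n :: ('p cube \<Rightarrow>\<^sub>0 int) set monoid) (L_chains n)" "!!x. x \<in> qchains n ==> F (cube_class n x) = cube_class n (cube_d x)"
  using cube_class_descend[of cube_d n, OF cube_d_add cube_d_qchains cube_d_qdegenerate] by blast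
 have "F (L_class n s) = (\<Otimes>\<^bsub>L_chains n\<^esub>i\<in>{..<fst s}.
    (L_class n (L_face i False s) \<otimes>\<^bsub>L_chains n\<^esub> inv\<^bsub>L_chains n\<^esub> L_class n (L_face i True s))
     [^]\<^bsub>L_chains n\<^esub> ((-1) ^ Suc i :: int))" if s: "s \<in> L_cubes n" for s
 proof -
  obtain c where c: "s = Rep_qcube c" using L_cubes_Rep[OF s] by blast
  then have cq: "frag_of c \<in> qchains n" using s by (simp add: qchains_def)
  have face: "frag_of (qface i eps c) \<in> qchains n" if "i < qdim c" for i eps
   using L_cubes_qface[of c n i eps] s c that by (simp add: qchains_def)
  have "F (L_class n s) = cube_class n (\<Sum>i<qdim c. signed (Suc i) (face_diff i (frag_of c)))"
   using F(2)[OF cq] by (simp add: cube_class_of c cube_d_of)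
  also have "... = (\<Otimes>\<^bsub>L_chains n\<^esub>i\<in>{..<qdim c}. cube_class n (signed (Suc i) (face_diff i (frag_of c))))"
   by (rule cube_class_sum) (use face in \<open>auto simp: face_diff_of simp del: signed_Suc intro!: qchains_signed qchains_diff\<close>)
  also have "... = (\<Otimes>\<^bsub>L_chains n\<^esub>i\<in>{..<fst s}.
    (L_class n (L_face i False s) \<otimes>\<^bsub>L_chains n\<^esub> inv\<^bsub>L_chains n\<^esub> L_class n (L_face i True s))
     [^]\<^bsub>L_chains n\<^esub> ((-1) ^ Suc i :: int))"
  proof (rule L.finprod_cong')
   show "{..<qdim c} = {..<fst s}" by (simp add: c qdim_def)
   have eq: "cube_class n (signed (Suc i) (face_diff i (frag_of c)))
    = (L_class n (L_face i False s) \<otimes>\<^bsub>L_chains n\<^esub> inv\<^bsub>L_chains n\<^esub> L_class n (L_face i True s))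
     [^]\<^bsub>L_chains n\<^esub> ((-1) ^ Suc i :: int)" if "i < qdim c" for i
   proof -
    have "face_diff i (frag_of c) = frag_of (qface i False c) + - frag_of (qface i True c)"
     by (simp add: face_diff_of)
    then have "cube_class n (face_diff i (frag_of c))
     = L_class n (L_face i False s) \<otimes>\<^bsub>L_chains n\<^esub> inv\<^bsub>L_chains n\<^esub> L_class n (L_face i True s)"
     using that face[OF that] by (simp only: cube_class_add cube_class_uminus qchains_uminus cube_class_of Rep_qcube_face c)
    then show ?thesis
     using cube_class_signed[of "face_diff i (frag_of c)" n "Suc i"] face[OF that]
     by (simp add: face_diff_of qchains_diff del: signed_Suc)
   qed
   show "(%i. (L_class n (L_face i False s) \<otimes>\<^bsub>L_chains n\<^esub> inv\<^bsub>L_chains n\<^esub> L_class n (L_face i True s))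
     [^]\<^bsub>L_chains n\<^esub> ((-1) ^ Suc i :: int)) \<in> {..<fst s} \<rightarrow> carrier (L_chains n)"
   proof
    fix i assume "i \<in> {..<fst s}"
    then have i: "i < qdim c" by (simp add: c qdim_def)
    have "signed (Suc i) (face_diff i (frag_of c)) \<in> qchains n"
     unfolding face_diff_of by (intro qchains_signed qchains_diff face i)
    then show "(L_class n (L_face i False s) \<otimes>\<^bsub>L_chains n\<^esub> inv\<^bsub>L_chains n\<^esub> L_class n (L_face i True s))
     [^]\<^bsub>L_chains n\<^esub> ((-1) ^ Suc i :: int) \<in> carrier (L_chains n)"
     unfolding eq[OF i, symmetric] by (rule cube_class_closed)
   qed
   show "!!i. i \<in> {..<fst s} ==> cube_class n (signed (Suc i) (face_diff i (frag_of c)))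
    = (L_class n (L_face i False s) \<otimes>\<^bsub>L_chains n\<^esub> inv\<^bsub>L_chains n\<^esub> L_class n (L_face i True s))
     [^]\<^bsub>L_chains n\<^esub> ((-1) ^ Suc i :: int)"
    using eq by (simp add: simp_implies_def c qdim_def del: signed_Suc)
  qed
  finally show ?thesis .
 qed
 then have "L_diff n = restrict F (carrier (L_chains n))"
  unfolding L_diff_def by (rule the_hom_L_chains[OF F(1)])
 then show ?thesis
  using F(2)[OF assms] cube_class_closed[OF assms] by simp
qed

lemma L_mult_cube_class:
 assumes x: "x \<in> qchains n" and y: "y \<in> qchains n"
 shows "L_mult n (cube_class n x) (cube_class n y) = cube_class n (x * y)"
proof -
 let ?in = "%s. the_hom (L_chains n) (L_chains n) (L_cubes n) (L_class n) (%t. L_class n (L_prod s t))"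
 have inner: "?in (Rep_qcube c) (cube_class n y) = cube_class n (frag_of c * y)" if c: "Rep_qcube c \<in> L_cubes n" for c
 proof -
  have cq: "frag_of c \<in> qchains n" using c by (simp add: qchains_def)
  obtain F where F: "F \<in> hom (L_chains n) (L_chains n)" "!!y. y \<in> qchains n ==> F (cube_class n y) = cube_class n (frag_of c * y)"
   using cube_class_descend[of "%y. frag_of c * y" n, OF distrib_left mult_qchains[OF cq] mult_qdegenerate_right[OF cq]] by blast
  have "F (L_class n t) = L_class n (L_prod (Rep_qcube c) t)" if t: "t \<in> L_cubes n" for t
  proof -
   obtain c' where c': "t = Rep_qcube c'" using L_cubes_Rep[OF t] by blast
   then have "frag_of c' \<in> qchains n" using t by (simp add: qchains_def)
   then show ?thesis
    using F(2)[of "frag_of c'"] by (simp add: c' cube_class_of frag_of_times Rep_qcube_plus)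
  qed
  then have "?in (Rep_qcube c) = restrict F (carrier (L_chains n))"
   by (rule the_hom_L_chains[OF F(1)])
  then show ?thesis
   using F(2)[OF y] cube_class_closed[OF y] by simp
 qed
 obtain F where F: "F \<in> hom (L_chains n) (L_chains n)" "!!x. x \<in> qchains n ==> F (cube_class n x) = cube_class n (x * y)"
  using cube_class_descend[of "%x. x * y" n, OF distrib_right mult_qchains[OF _ y] mult_qdegenerate_left[OF _ y]] by blast
 have "F (L_class n s) = ?in s (cube_class n y)" if s: "s \<in> L_cubes n" for s
 proof -
  obtain c where c: "s = Rep_qcube c" using L_cubes_Rep[OF s] by blast
  then have "frag_of c \<in> qchains n" using s by (simp add: qchains_def)
  then show ?thesis
   using F(2)[of "frag_of c"] inner[of c] s by (simp add: c cube_class_of)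
 qed
 then have "the_hom (L_chains n) (L_chains n) (L_cubes n) (L_class n) (%s. ?in s (cube_class n y)) = restrict F (carrier (L_chains n))"
  by (rule the_hom_L_chains[OF F(1)])
 then show ?thesis
  using F(2)[OF x] cube_class_closed[OF x] by (simp add: L_mult_def)
qed

section \<open>Families of list cochains indexed by simplices\<close>

text \<open>The face spanned by a vertex list, with the same convention for vertices out of range as in
 \<open>list_cochain\<close>.\<close>

definition face_simplex :: "'a simplex => nat list => 'a simplex" where
 "face_simplex s l = (length l - 1, vertex_face (map (min (fst s)) l) (snd s))"

definition reindex :: "nat list => nat => nat" where
 "reindex l i = l ! min (length l - 1) i"

lemma fst_face_simplex [simp]: "fst (face_simplex s l) = length l - 1"
 by (simp add: face_simplex_def)

lemma map_reindex: "map (reindex l) [0..<length l] = l"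
 by (rule nth_equalityI) (simp_all add: reindex_def min_absorb2)

lemma face_simplex_face_simplex:
 assumes "l \<noteq> []" "k \<noteq> []"
 shows "face_simplex (face_simplex s l) k = face_simplex s (map (reindex l) k)"
proof -
 have "vertex_face (map (min (length l - 1)) k) (vertex_face (map (min (fst s)) l) (snd s))
  = vertex_face (map ((!) (map (min (fst s)) l)) (map (min (length l - 1)) k)) (snd s)"
  by (rule vertex_face_compose) (use assms in \<open>auto simp: min_less_iff_disj\<close>)
 moreover have "map ((!) (map (min (fst s)) l)) (map (min (length l - 1)) k) = map (min (fst s)) (map (reindex l) k)"
 proof -
  have "min (length l - 1) x < length l" for x
   using assms(1) by (cases l) (auto simp: min_less_iff_disj)
  then show ?thesis by (simp add: reindex_def del: One_nat_def)
 qed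
 ultimately show ?thesis
  by (simp only: face_simplex_def fst_conv snd_conv length_map)
qed

lemma face_simplex_in_simplices:
 assumes "s \<in> simplices B" "l \<noteq> []"
 shows "face_simplex s l \<in> simplices B"
proof -
 obtain p \<sigma> where s: "s = (p, \<sigma>)" "singular_simplex p B \<sigma>" using assms by (auto simp: simplices_def)
 have "singular_simplex (length (map (min p) l) - 1) B (vertex_face (map (min p) l) \<sigma>)"
  by (rule singular_simplex_vertex_face[OF s(2)]) (use assms in auto)
 then show ?thesis using s by (simp add: face_simplex_def simplices_def)
qed

lemma map_min_upt: "set l \<subseteq> {..p} ==> map (min p) l = l" for p :: nat
 by (rule map_idI) (auto simp: min_def)

lemma face_simplex_all:
 assumes "s \<in> simplices B"
 shows "face_simplex s [0..<Suc (fst s)] = s"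
proof -
 obtain p \<sigma> where s: "s = (p, \<sigma>)" "singular_simplex p B \<sigma>" using assms by (auto simp: simplices_def)
 have "map (min p) [0..<Suc p] = [0..<Suc p]" by (rule map_min_upt) auto
 then show ?thesis
  using s vertex_face_all[of \<sigma> p] by (simp add: face_simplex_def singular_simplex_def del: upt_Suc)
qed

text \<open>The value at a list depends only on the face that the list spans. This is what turns a family
 into one function of simplices.\<close>

definition natural_family :: "('a simplex => nat list => 'r::zero) => bool" where
 "natural_family F \<longleftrightarrow> (\<forall>s. F s [] = 0) \<and> (\<forall>s l. l \<noteq> [] --> F (face_simplex s l) [0..<length l] = F s l)"

lemma natural_family_map:
 assumes F: "natural_family F" and l: "l \<noteq> []"
 shows "F (face_simplex s l) k = F s (map (reindex l) k)"
proof (cases "k = []")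
 case True
 have "F t [] = 0" for t using F unfolding natural_family_def by blast
 then show ?thesis using True by (simp only: list.map)
next
 case False
 have "F (face_simplex s l) k = F (face_simplex (face_simplex s l) k) [0..<length k]"
  using F False unfolding natural_family_def by metis
 also have "... = F (face_simplex s (map (reindex l) k)) [0..<length (map (reindex l) k)]"
  unfolding face_simplex_face_simplex[OF l False] by simp
 also have "... = F s (map (reindex l) k)"
  using F False unfolding natural_family_def by (metis map_is_Nil_conv)
 finally show ?thesis .
qed

lemma list_cochain_face_simplex:
 fixes s :: "'a simplex"
 assumes "l \<noteq> []"
 shows "list_cochain c (face_simplex s l) = (\<lambda>k. list_cochain c s (map (reindex l) k))"
proof
 fix k
 show "list_cochain c (face_simplex s l) k = list_cochain c s (map (reindex l) k)"
 proof (cases "k = []")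
  case False
  have "snd (face_simplex (face_simplex s l) k) = snd (face_simplex s (map (reindex l) k))"
   by (simp only: face_simplex_face_simplex[OF assms False])
  then show ?thesis
   using False unfolding list_cochain_def by (simp only: list.map_disc_iff if_False face_simplex_def fst_conv snd_conv)
 qed (simp add: list_cochain_def)
qed

lemma lab_cocycle_map:
 fixes h :: "'v => 'w" and e :: "('w \<times> nat) list => 'p::ab_group_add"
 assumes "\<And>L. e' L = e (map (map_prod h id) L)"
 shows "lab_cocycle (\<lambda>l. \<zeta> (map h l)) e' = (\<lambda>L. lab_cocycle \<zeta> e (map (map_prod h id) L))"
proof -
 have "map h (map fst L) = map fst (map (map_prod h id) L)" for L :: "('v \<times> nat) list" by simp
 moreover have "e' = (%L. e (map (map_prod h id) L))" using assms by auto
 ultimately show ?thesis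
  unfolding lab_cocycle_def cobd_map[of e] by simp
qed

lemma top_cochain_map: "top_cochain (\<lambda>l. c (map h l)) L = top_cochain c (map (map_prod h id) L)"
 and supp_cochain_map: "supp_cochain Q (\<lambda>l. c (map h l)) L = supp_cochain Q c (map (map_prod h id) L)"
 by (simp_all add: top_cochain_def supp_cochain_def comp_def)

lemma sum_triangle_map:
 "sum_triangle (\<lambda>l. c (map h l)) (\<lambda>l. c' (map h l)) L = sum_triangle c c' (map (map_prod h id) L)"
 by (simp add: sum_triangle_def supp_cochain_map)

lemma cobd_triangle_map:
 "cobd_triangle (\<lambda>l. b (map h l)) L = cobd_triangle b (map (map_prod h id) L)"
proof -
 have "cobd (supp_cochain (%b. b = 1) (%l. b (map h l))) L = cobd (supp_cochain (%b. b = 1) b) (map (map_prod h id) L)"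
  unfolding cobd_map by (rule cobd_cong) (simp add: supp_cochain_map)
 then show ?thesis by (simp add: cobd_triangle_def)
qed

lemma gauge_cochain_map:
 "gauge_cochain n (\<lambda>l. \<zeta> (map h l)) (\<lambda>l. c (map h l)) l = gauge_cochain n \<zeta> c (map h l)"
proof -
 have t: "twist_cochain n (lab_cocycle (%l. \<zeta> (map h l)) (top_cochain (%l. c (map h l))))
  = (%L. twist_cochain n (lab_cocycle \<zeta> (top_cochain c)) (map (map_prod h id) L))"
  using lab_cocycle_map[of "top_cochain (%l. c (map h l))" "top_cochain c" h \<zeta>]
  by (simp add: top_cochain_map twist_cochain_map)
 show ?thesis
  unfolding gauge_cochain_def t
  by (simp add: prism_sum_map_out[symmetric] prism_sum_map unit_cochain_def)
qed

lemma triangle_cochain_map: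
 assumes "\<And>L. e' L = e (map (map_prod h id) L)"
 shows "triangle_cochain n (\<lambda>l. \<zeta> (map h l)) e' l = triangle_cochain n \<zeta> e (map h l)"
proof -
 have t: "twist_cochain n (lab_cocycle (%l. \<zeta> (map h l)) e')
  = (%L. twist_cochain n (lab_cocycle \<zeta> e) (map (map_prod h id) L))"
  using lab_cocycle_map[of e' e h \<zeta>, OF assms] by (simp add: twist_cochain_map)
 show ?thesis
  unfolding triangle_cochain_def t
  by (simp add: triangle_sum_map_out[symmetric] triangle_sum_map)
qed

lemma sum_triangle_cochain_map:
 "triangle_cochain n (\<lambda>l. \<zeta> (map h l)) (sum_triangle (\<lambda>l. c (map h l)) (\<lambda>l. c' (map h l))) l
  = triangle_cochain n \<zeta> (sum_triangle c c') (map h l)"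
 by (rule triangle_cochain_map) (rule sum_triangle_map)

lemma cobd_triangle_cochain_map:
 "triangle_cochain n (\<lambda>l. \<zeta> (map h l)) (cobd_triangle (\<lambda>l. b (map h l))) l
  = triangle_cochain n \<zeta> (cobd_triangle b) (map h l)"
 by (rule triangle_cochain_map) (rule cobd_triangle_map)

lemma twist_cochain_Nil: "twist_cochain n \<zeta> [] = 0"
 by (simp add: twist_cochain_def edge_cochain_def cube_cochain_def)

lemma natural_twist: "natural_family (\<lambda>s. twist_cochain n (list_cochain z s))"
 unfolding natural_family_def
 by (simp add: list_cochain_face_simplex twist_cochain_map[symmetric] map_reindex twist_cochain_Nil)

lemma natural_gauge: "natural_family (\<lambda>s. gauge_cochain n (list_cochain z s) (list_cochain c s))"
 unfolding natural_family_def
 by (simp add: list_cochain_face_simplex gauge_cochain_map map_reindex, simp add: gauge_cochain_def)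

lemma natural_sum_triangle:
 "natural_family (\<lambda>s. triangle_cochain n (list_cochain z s) (sum_triangle (list_cochain c s) (list_cochain c' s)))"
 unfolding natural_family_def
 by (simp add: list_cochain_face_simplex sum_triangle_cochain_map map_reindex,
   simp add: triangle_cochain_def)

lemma natural_cobd_triangle:
 "natural_family (\<lambda>s. triangle_cochain n (list_cochain z s) (cobd_triangle (list_cochain b s)))"
 unfolding natural_family_def
 by (simp add: list_cochain_face_simplex cobd_triangle_cochain_map map_reindex,
   simp add: triangle_cochain_def)

section \<open>Values of the elements a(z) and 1 + u(c, z)\<close>

text \<open>A cube of positive dimension below \<open>n\<close> has no \<open>n\<close>-faces, so it is
 the zero cocycle and degenerate. Hence the truncations in \<open>a(z)\<close> and \<open>u(c, z)\<close>
 do not change the classes.\<close>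

lemma list_cube_short_degenerate:
 assumes l: "3 \<le> length l" "length l - 2 < n"
 shows "frag_of (list_cube n \<zeta> l) \<in> qdegenerate n"
proof -
 let ?c = "mk_qcube (length l - 3) (%w. 0) :: 'b qcube"
 have "list_cube n \<zeta> l = qdegen 0 ?c"
 proof (rule qcube_eqI)
  show "qdim (list_cube n \<zeta> l) = qdim (qdegen 0 ?c)" using l by simp
  fix w :: cell assume "length w = qdim (list_cube n \<zeta> l)"
  then have "length w = length l - 2" by simp
  moreover have "count_list w None \<le> length w" by (rule count_le_length)
  ultimately show "qval (list_cube n \<zeta> l) w = qval (qdegen 0 ?c) w"
   using l by (simp add: list_cube_def qdegen_def)
 qed
 moreover have "Rep_qcube ?c \<in> L_cubes n"
 proof -
  have "cell_cobd (qval ?c) w = cell_cobd (%w. 0) w" for w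
   by (rule cell_cobd_cong) simp
  then show ?thesis by (simp add: qcube_L_cubes_iff)
 qed
 ultimately show ?thesis
  unfolding qdegenerate_span frag_span_of by blast
qed

lemma list_cube_2:
 assumes "n \<ge> 1" "length l = 2"
 shows "list_cube n \<zeta> l = 0"
 by (rule qcube_eqI) (use assms in \<open>auto simp: list_cube_def zero_qcube_def\<close>)

lemma twist_cochain_long: "3 \<le> length l ==> twist_cochain n \<zeta> l = - frag_of (list_cube n \<zeta> l)"
 by (auto simp: twist_cochain_def edge_cochain_def cube_cochain_def)

lemma twist_cochain_2: "n \<ge> 1 ==> length l \<le> 2 ==> twist_cochain n \<zeta> l = 0"
 using list_cube_2[of n l \<zeta>] by (auto simp: twist_cochain_def edge_cochain_def cube_cochain_def)

lemma kappa_list_cochain: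
 assumes n: "n \<ge> 1" and p: "1 \<le> p"
 shows "kappa n z (p - 1) \<sigma> = Rep_qcube (list_cube n (list_cochain z (p, \<sigma>)) [0..<Suc p])"
proof -
 have "list_cube n (%l. z (frag_of (vertex_face l \<sigma>))) [0..<Suc p] = list_cube n (list_cochain z (p, \<sigma>)) [0..<Suc p]"
 proof (rule list_cube_cong)
  fix l assume l: "set l \<subseteq> set [0..<Suc p]" "length l = n + 2"
  then have "map (min p) l = l" by (intro map_min_upt) auto
  then show "z (frag_of (vertex_face l \<sigma>)) = list_cochain z (p, \<sigma>) l"
   using l(2) by (auto simp: list_cochain_def)
 qed
 then show ?thesis
  using kappa_eq_list_cube[OF n, of z "p - 1" \<sigma>] p by simp
qed

lemma cocycle_list_cochain:
 assumes "c \<in> cocycles q B" "s \<in> simplices B" "length l = q + 2"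
 shows "cobd (list_cochain c s) l = 0"
 using cobd_list_cocycle[OF assms] .

lemma twist_part:
 assumes "z \<in> cocycles (n + 1) B" "s \<in> simplices B"
 shows "twist_cochain n (list_cochain z s) l \<in> cube_part n (length l - 2)"
 by (rule twist_cochain_in_cube_part) (use cocycle_list_cochain[OF assms] in simp)

lemma lab_twist_part:
 assumes "z \<in> cocycles (n + 1) B" "s \<in> simplices B"
 shows "twist_cochain n (lab_cocycle (list_cochain z s) e) L \<in> cube_part n (length L - 2)"
 by (rule twist_cochain_in_cube_part) (rule cobd_lab_cocycle, use cocycle_list_cochain[OF assms] in simp_all)

lemma gauge_part:
 assumes "z \<in> cocycles (n + 1) B" "s \<in> simplices B"
 shows "gauge_cochain n (list_cochain z s) c l \<in> cube_part n (length l - 1)"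
proof -
 have "prism_sum (%v. (v, 0)) (%v. (v, 1)) (twist_cochain n (lab_cocycle (list_cochain z s) (top_cochain c))) l
  \<in> cube_part n (length l - 1)"
 proof (rule prism_sum_in_cube_part)
  fix L :: "(nat \<times> nat) list" assume "length L = Suc (length l)"
  then show "twist_cochain n (lab_cocycle (list_cochain z s) (top_cochain c)) L \<in> cube_part n (length l - 1)"
   using lab_twist_part[OF assms, of "top_cochain c" L] by simp
 qed
 moreover have "unit_cochain l \<in> cube_part n (length l - 1)"
  by (simp add: unit_cochain_def cube_part_one)
 ultimately show ?thesis
  unfolding gauge_cochain_def fun_diff_def by (rule cube_part_diff[rotated])
qed

lemma triangle_part:
 assumes "z \<in> cocycles (n + 1) B" "s \<in> simplices B"
 shows "triangle_cochain n (list_cochain z s) e l \<in> cube_part n (length l)"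
 unfolding triangle_cochain_def
proof (rule triangle_sum_in_cube_part)
 fix L :: "(nat \<times> nat) list" assume "length L = Suc (Suc (length l))"
 then show "twist_cochain n (lab_cocycle (list_cochain z s) e) L \<in> cube_part n (length l)"
  using lab_twist_part[OF assms, of e L] by simp
qed

lemma alg_elt_of:
 assumes "\<And>s. s \<in> simplices B ==> h s \<in> carrier (L_chains n)" "s \<in> simplices B"
 shows "alg_elt B n h (frag_of s) = h s"
 unfolding alg_elt_def sing_chains_def by (rule the_hom_free(2)[OF L_chains_comm_group]) (use assms in auto)

lemma alg_a_value:
 fixes z :: "'a chain => 'p::ab_group_add"
 assumes n: "n \<ge> 1" and z: "z \<in> cocycles (n + 1) B" and s: "s \<in> simplices B"
 shows "alg_a B n z (frag_of s) = cube_class n (twist_cochain n (list_cochain z s) [0..<Suc (fst s)])"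
proof -
 let ?h = "%(p, \<sigma>). if Suc n \<le> p then inv\<^bsub>L_chains n\<^esub> L_class n (kappa n z (p - 1) \<sigma>) else \<one>\<^bsub>L_chains n\<^esub>"
 have h: "?h s = cube_class n (twist_cochain n (list_cochain z s) [0..<Suc (fst s)])" if s: "s \<in> simplices B" for s
 proof -
  obtain p \<sigma> where ps: "s = (p, \<sigma>)" by (cases s) auto
  let ?l = "[0..<Suc p]"
  let ?c = "list_cube n (list_cochain z (p, \<sigma>)) ?l"
  have coc: "cobd (list_cochain z (p, \<sigma>)) l = 0" if "length l = n + 3" for l
   using cocycle_list_cochain[OF z s] that by (simp add: ps)
  consider "p \<le> 1" | "2 \<le> p" "p \<le> n" | "Suc n \<le> p" by linarith
  then show ?thesis
  proof cases
   case 1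
   then have "twist_cochain n (list_cochain z s) ?l = 0"
    using n by (intro twist_cochain_2) auto
   then show ?thesis using 1 n by (simp add: ps del: upt_Suc)
  next
   case 2
   have t: "twist_cochain n (list_cochain z s) ?l = - frag_of ?c"
    unfolding ps by (rule twist_cochain_long) (use 2 in simp)
   have "frag_of ?c \<in> qdegenerate n"
    by (rule list_cube_short_degenerate) (use 2 in auto)
   then have "- frag_of ?c \<in> qdegenerate n"
    unfolding qdegenerate_span by (rule frag_span_uminus)
   then show ?thesis
    unfolding ps fst_conv t[unfolded ps] using 2 cube_class_degenerate[of "- frag_of ?c" n] by (simp del: upt_Suc)
  next
   case 3
   have t: "twist_cochain n (list_cochain z s) ?l = - frag_of ?c"
    unfolding ps by (rule twist_cochain_long) (use 3 n in simp)
   have "frag_of ?c \<in> qchains n"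
    using list_cube_in_L_cubes[of n "list_cochain z (p, \<sigma>)" ?l, OF coc] 3 n by (simp add: qchains_def del: upt_Suc)
   then have "cube_class n (- frag_of ?c) = inv\<^bsub>L_chains n\<^esub> L_class n (kappa n z (p - 1) \<sigma>)"
    using kappa_list_cochain[OF n, of p z \<sigma>] 3 by (simp add: cube_class_uminus cube_class_of del: upt_Suc)
   then show ?thesis
    unfolding ps fst_conv t[unfolded ps] using 3 by (simp del: upt_Suc)
  qed
 qed
 have "?h s \<in> carrier (L_chains n)" if "s \<in> simplices B" for s
  unfolding h[OF that] by (intro cube_class_closed cube_part_qchains[OF twist_part[OF z that]])
 then show ?thesis
  unfolding alg_a_def using h[OF s] alg_elt_of[of B ?h n s, OF _ s] by simp
qed

lemma prism_cube_class:
 fixes c z :: "'a chain => 'p::ab_group_add"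
 assumes n: "n \<ge> 1" and s: "(m, \<sigma>) \<in> simplices B" and i: "i \<le> m"
 shows "kappa n (z_cylinder n B c z) m (prism i m \<sigma>)
  = Rep_qcube (list_cube n (lab_cocycle (list_cochain z (m, \<sigma>)) (top_cochain (list_cochain c (m, \<sigma>)))) (prism_path i m))"
proof -
 let ?\<zeta> = "lab_cocycle (list_cochain z (m, \<sigma>)) (top_cochain (list_cochain c (m, \<sigma>)))"
 let ?L = "prism_path i m"
 have \<sigma>: "singular_simplex m B \<sigma>" using s by (simp add: simplices_def)
 have len: "length ?L = m + 2" using length_prism_path[OF i] .
 have fst: "fst ` set ?L \<subseteq> {..m}" and snd: "snd ` set ?L \<subseteq> {..1}"
  by (auto simp: prism_path_def simp del: upt_Suc dest!: in_set_takeD in_set_dropD)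
 have "list_cube n (%l. z_cylinder n B c z (frag_of (vertex_face l (prism i m \<sigma>)))) [0..<m + 2]
  = list_cube n (%l. ?\<zeta> (map ((!) ?L) l)) [0..<m + 2]"
 proof (rule list_cube_cong)
  fix l assume l: "set l \<subseteq> set [0..<m + 2]" "length l = n + 2"
  then have l': "l \<noteq> []" "set l \<subseteq> {..<length ?L}" using len by (auto simp del: upt_Suc)
  have sub: "set (map ((!) ?L) l) \<subseteq> set ?L" using l'(2) by auto
  have "vertex_face l (prism i m \<sigma>) = lab_simplex \<sigma> (map ((!) ?L) l)"
   unfolding prism_eq_lab_simplex[OF i] by (rule vertex_face_lab_simplex[OF l'])
  moreover have "z_cylinder n B c z (frag_of (lab_simplex \<sigma> (map ((!) ?L) l))) = ?\<zeta> (map ((!) ?L) l)"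
   unfolding lab_cocycle_def
   by (rule z_cylinder_lab_simplex[OF \<sigma>])
    (use l(2) image_mono[OF sub, of fst] image_mono[OF sub, of snd] fst snd in \<open>simp, blast, blast\<close>)
  ultimately show "z_cylinder n B c z (frag_of (vertex_face l (prism i m \<sigma>))) = ?\<zeta> (map ((!) ?L) l)"
   by simp
 qed
 also have "... = list_cube n ?\<zeta> (map ((!) ?L) [0..<m + 2])"
  by (rule list_cube_map[symmetric]) simp
 also have "map ((!) ?L) [0..<m + 2] = ?L"
  using map_nth[of ?L] len by simp
 finally show ?thesis
  unfolding kappa_eq_list_cube[OF n] by simp
qed

text \<open>The dimension \<open>0\<close> part of \<open>u(c, z)\<close> is cut off by definition; in
 the list version it vanishes because the twisting cochain is zero on edges.\<close>

lemma alg_gauge_value: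
 fixes c z :: "'a chain => 'p::ab_group_add"
 assumes n: "n \<ge> 1" and z: "z \<in> cocycles (n + 1) B" and s: "s \<in> simplices B"
 shows "(alg_one B n \<otimes>\<^bsub>alg_group B n\<^esub> alg_u B n c z) (frag_of s)
  = cube_class n (gauge_cochain n (list_cochain z s) (list_cochain c s) [0..<Suc (fst s)])"
proof -
 interpret L: comm_group "L_chains n :: ('p cube \<Rightarrow>\<^sub>0 int) set monoid" by (rule L_chains_comm_group)
 let ?one = "%(p :: nat, \<sigma> :: (nat => real) => 'a). if p = 0 then L_class n (0, %w. 0) else \<one>\<^bsub>L_chains n\<^esub> :: ('p cube \<Rightarrow>\<^sub>0 int) set"
 let ?u = "%(m, \<sigma> :: (nat => real) => 'a). if n \<le> m then
    \<Otimes>\<^bsub>L_chains n\<^esub>i\<in>{..m}. L_class n (kappa n (z_cylinder n B c z) m (prism i m \<sigma>))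
     [^]\<^bsub>L_chains n\<^esub> ((-1) ^ i :: int)
   else \<one>\<^bsub>L_chains n\<^esub>"
 let ?\<zeta> = "%s. lab_cocycle (list_cochain z s) (top_cochain (list_cochain c s))"
 let ?C = "%i s. frag_of (list_cube n (?\<zeta> s) (prism_path i (fst s)))"
 have C: "?C i s \<in> qchains n" if s: "s \<in> simplices B" and i: "i \<le> fst s" for i s
 proof -
  have "cobd (?\<zeta> s) L = 0" if "length L = n + 3" for L
   using cobd_lab_cocycle[of n "list_cochain z s" L, OF _ that] cocycle_list_cochain[OF z s] by simp
  then have "Rep_qcube (list_cube n (?\<zeta> s) (prism_path i (fst s))) \<in> L_cubes n"
   by (rule list_cube_in_L_cubes) (simp_all add: length_prism_path[OF i])
  then show ?thesis by (simp add: qchains_def)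
 qed
 have u: "?u s = cube_class n (if fst s = 0 then 0 else \<Sum>i<Suc (fst s). signed i (?C i s))" if s: "s \<in> simplices B" for s
 proof -
  obtain m \<sigma> where ms: "s = (m, \<sigma>)" by (cases s) auto
  show ?thesis
  proof (cases "n \<le> m")
   case True
   have "?u s = (\<Otimes>\<^bsub>L_chains n\<^esub>i\<in>{..m}. L_class n (kappa n (z_cylinder n B c z) m (prism i m \<sigma>)) [^]\<^bsub>L_chains n\<^esub> ((-1) ^ i :: int))"
    using True by (simp add: ms)
   also have "... = (\<Otimes>\<^bsub>L_chains n\<^esub>i\<in>{..m}. cube_class n (signed i (?C i s)))"
   proof (rule L.finprod_cong')
    show "(%i. cube_class n (signed i (?C i s))) \<in> {..m} \<rightarrow> carrier (L_chains n)"
     using C[OF s] by (auto simp: ms intro!: cube_class_closed qchains_signed)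
    fix i assume "i \<in> {..m}"
    then have i: "i \<le> m" by simp
    show "L_class n (kappa n (z_cylinder n B c z) m (prism i m \<sigma>)) [^]\<^bsub>L_chains n\<^esub> ((-1) ^ i :: int)
     = cube_class n (signed i (?C i s))"
     using cube_class_signed[OF C[OF s, of i]] i prism_cube_class[OF n s[unfolded ms] i, of c z]
     by (simp add: ms cube_class_of)
   qed simp
   also have "... = cube_class n (\<Sum>i\<in>{..m}. signed i (?C i s))"
    by (rule cube_class_sum[symmetric]) (use C[OF s] in \<open>auto simp: ms intro!: qchains_signed\<close>)
   finally show ?thesis using True n by (simp add: ms lessThan_Suc_atMost del: sum.lessThan_Suc)
  next
   case False
   have "cube_class n (\<Sum>i<Suc m. signed i (?C i s)) = \<one>\<^bsub>L_chains n\<^esub>" if "m > 0"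
   proof (rule cube_class_degenerate)
    show "(\<Sum>i<Suc m. signed i (?C i s)) \<in> qdegenerate n"
     unfolding qdegenerate_span
    proof (rule frag_span_sum)
     fix i assume "i \<in> {..<Suc m}"
     then have "length (prism_path i m) = m + 2" by (intro length_prism_path) auto
     then have "?C i s \<in> qdegenerate n"
      using list_cube_short_degenerate[of "prism_path i m" n "?\<zeta> s"] False that by (simp add: ms)
     then show "signed i (?C i s) \<in> frag_span {qdegen i c | i c. Rep_qcube c \<in> L_cubes n \<and> i \<le> qdim c}"
      unfolding qdegenerate_span by (rule frag_span_signed)
    qed
   qed
   then show ?thesis using False by (simp add: ms del: sum.lessThan_Suc)
  qed
 qed
 have one: "?one s = cube_class n (unit_cochain [0..<Suc (fst s)])" for s
 proof -
  have "cube_class n (1 :: 'p cring) = L_class n (0, %w. 0)"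
   unfolding one_cring cube_class_of Rep_qcube_zero ..
  then show ?thesis
   by (cases s) (simp add: unit_cochain_def del: upt_Suc)
 qed
 have sum_q: "(if fst s = 0 then 0 else \<Sum>i<Suc (fst s). signed i (?C i s)) \<in> qchains n" if "s \<in> simplices B" for s
  using C[OF that] by (auto simp: qchains_span simp del: sum.lessThan_Suc intro!: frag_span_sum frag_span_signed)
 have unit_q: "unit_cochain [0..<Suc p] \<in> (qchains n :: 'p cring set)" for p
  using cube_part_qchains[OF cube_part_one, where 'a = 'p] by (simp add: unit_cochain_def)
 have gauge: "gauge_cochain n (list_cochain z s) (list_cochain c s) [0..<Suc (fst s)]
  = unit_cochain [0..<Suc (fst s)] + (if fst s = 0 then 0 else \<Sum>i<Suc (fst s). signed i (?C i s))" for s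
 proof (cases "fst s = 0")
  case True
  have "prism_sum (%v. (v, 0)) (%v. (v, 1)) (twist_cochain n (?\<zeta> s)) [0..<Suc (fst s)] = 0"
   using True by (simp add: twist_cochain_2[OF n])
  then show ?thesis using True by (simp add: gauge_cochain_def del: upt_Suc)
 next
  case False
  have "prism_sum (%v. (v, 0)) (%v. (v, 1)) (twist_cochain n (?\<zeta> s)) [0..<Suc (fst s)]
   = (\<Sum>i<Suc (fst s). signed i (twist_cochain n (?\<zeta> s) (prism_path i (fst s))))"
   unfolding prism_sum_paths prism_path_def by (simp del: upt_Suc sum.lessThan_Suc)
  also have "... = (\<Sum>i<Suc (fst s). - signed i (?C i s))"
  proof (rule sum.cong)
   fix i assume "i \<in> {..<Suc (fst s)}"
   then have "length (prism_path i (fst s)) = fst s + 2" by (intro length_prism_path) auto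
   then show "signed i (twist_cochain n (?\<zeta> s) (prism_path i (fst s))) = - signed i (?C i s)"
    using False by (simp add: twist_cochain_long signed_uminus)
  qed simp
  finally show ?thesis
   using False by (simp add: gauge_cochain_def sum_negf del: upt_Suc sum.lessThan_Suc)
 qed
 have one_c: "?one s \<in> carrier (L_chains n)" for s
  using cube_class_closed[OF unit_q, of "fst s"] one[of s] by simp
 have u_c: "?u s \<in> carrier (L_chains n)" if "s \<in> simplices B" for s
  using cube_class_closed[OF sum_q[OF that]] u[OF that] by simp
 have sc: "frag_of s \<in> carrier (sing_chains B)" using s by (simp add: sing_chains_def)
 have "(alg_one B n \<otimes>\<^bsub>alg_group B n\<^esub> alg_u B n c z) (frag_of s)
  = alg_one B n (frag_of s) \<otimes>\<^bsub>L_chains n\<^esub> alg_u B n c z (frag_of s)"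
  using sc by (simp add: alg_group_def Hom_group_def)
 also have "alg_one B n (frag_of s) = ?one s"
  unfolding alg_one_def by (rule alg_elt_of[OF one_c s])
 also have "alg_u B n c z (frag_of s) = ?u s"
  unfolding alg_u_def by (rule alg_elt_of[OF u_c s])
 also have "?one s \<otimes>\<^bsub>L_chains n\<^esub> ?u s
  = cube_class n (gauge_cochain n (list_cochain z s) (list_cochain c s) [0..<Suc (fst s)])"
  using cube_class_add[OF unit_q sum_q[OF s], of "fst s"] one[of s] u[OF s] gauge[of s] by simp
 finally show ?thesis .
qed

section \<open>Natural operators on simplices tensored with cubes\<close>

type_synonym ('a, 'p) cell_module = "('a simplex \<times> 'p qcube) \<Rightarrow>\<^sub>0 int"

definition tn :: "'a simplex => 'p cring => ('a, 'p::ab_group_add) cell_module" where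
 "tn s r = frag_extend (\<lambda>c. frag_of (s, c)) r"

text \<open>The universal natural family: every operator below is obtained from it by the operations on
 families.\<close>

definition face_tn :: "'a simplex => nat list => 'p cring => ('a, 'p::ab_group_add) cell_module" where
 "face_tn s l = (if l = [] then 0 else tn (face_simplex s l))"

text \<open>Only the values on the list of all vertices are used; by naturality they determine the
 family.\<close>

definition op_of :: "('a simplex => nat list => 'p cring => ('a, 'p) cell_module)
  => ('a, 'p::ab_group_add) cell_module => ('a, 'p) cell_module" where
 "op_of G = frag_extend (\<lambda>(s, c). G s [0..<Suc (fst s)] (frag_of c))"

definition natural_operator :: "('a simplex => nat list => 'p::ab_group_add cring => ('a, 'p) cell_module) => bool" where
 "natural_operator G \<longleftrightarrow> natural_family G \<and> (\<forall>s. additive_family (G s))"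

lemma tn_add: "tn s (r + r') = tn s r + tn s r'"
 by (simp add: tn_def frag_extend_add)

lemma tn_of [simp]: "tn s (frag_of c) = frag_of (s, c)"
 by (simp add: tn_def)

lemma op_of_add: "op_of G (x + y) = op_of G x + op_of G y"
 by (simp add: op_of_def frag_extend_add)

lemma additive_familyD: "additive_family G ==> G l (t + t') = G l t + G l t'"
 by (simp add: additive_family_def)

lemma op_of_tn:
 assumes "additive_family (G s)"
 shows "op_of G (tn s r) = G s [0..<Suc (fst s)] r"
proof (rule additive_frag_eq[of "%r. op_of G (tn s r)"])
 show "op_of G (tn s (x + y)) = op_of G (tn s x) + op_of G (tn s y)" for x y
  by (simp only: tn_add op_of_add)
 show "G s [0..<Suc (fst s)] (x + y) = G s [0..<Suc (fst s)] x + G s [0..<Suc (fst s)] y" for x y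
  by (rule additive_familyD[OF assms])
 show "op_of G (tn s (frag_of c)) = G s [0..<Suc (fst s)] (frag_of c)" for c
  by (simp add: op_of_def)
qed

text \<open>Since an additive map commutes with the operations on families, this reduces the composition
 of two operators to an operation applied to the second family.\<close>

lemma op_of_face_tn:
 assumes "natural_operator G"
 shows "op_of G (face_tn s l t) = G s l t"
proof (cases "l = []")
 case True
 have "G s [] = 0" using assms unfolding natural_operator_def natural_family_def by (elim conjE allE)
 then show ?thesis using True additive_zero(1)[of "op_of G", OF op_of_add] by (simp add: face_tn_def)
next
 case False
 have "additive_family (G (face_simplex s l))" using assms unfolding natural_operator_def by (elim conjE allE)
 then have "op_of G (face_tn s l t) = G (face_simplex s l) [0..<Suc (length l - 1)] t"
  using False by (simp add: face_tn_def op_of_tn del: upt_Suc)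
 also have "Suc (length l - 1) = length l" using False by (cases l) auto
 also have "G (face_simplex s l) [0..<length l] = G s l"
  using assms False unfolding natural_operator_def natural_family_def by (metis (no_types))
 finally show ?thesis .
qed

lemma natural_familyI:
 assumes "\<And>s. F s [] = 0" "\<And>s l. l \<noteq> [] ==> F (face_simplex s l) = (\<lambda>k. F s (map (reindex l) k))"
 shows "natural_family F"
 unfolding natural_family_def using assms by (simp add: map_reindex)

lemma natural_family_fun:
 "natural_family F ==> l \<noteq> [] ==> F (face_simplex s l) = (\<lambda>k. F s (map (reindex l) k))"
 by (rule ext) (rule natural_family_map)

lemma natural_family_Nil: "natural_family F ==> F s [] = 0"
 unfolding natural_family_def by (elim conjE allE)

lemma natural_face_tn: "natural_operator face_tn"
proof -
 have "natural_family face_tn"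
  by (rule natural_familyI) (simp_all add: face_tn_def face_simplex_face_simplex fun_eq_iff)
 moreover have "additive_family (face_tn s)" for s
  by (simp add: additive_family_def face_tn_def tn_add)
 ultimately show ?thesis unfolding natural_operator_def by blast
qed

lemma natural_operatorD:
 assumes "natural_operator G"
 shows "natural_family G" "additive_family (G s)"
 using assms unfolding natural_operator_def by blast+

lemma alt_map: "alt f (map h l) = alt (\<lambda>l. f (map h l)) l"
 by (simp add: alt_def)

lemma natural_alt:
 assumes "natural_operator G"
 shows "natural_operator (\<lambda>s. alt (G s))"
 unfolding natural_operator_def
 using natural_operatorD[OF assms]
 by (auto intro!: natural_familyI additive_family_alt simp: natural_family_fun natural_family_Nil alt_map)
  (simp_all add: alt_def natural_family_Nil)

lemma natural_cup:
 assumes "natural_operator G" "natural_family F"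
 shows "natural_operator (\<lambda>s. cup push (G s) (F s))"
proof -
 have "natural_family (%s. cup push (G s) (F s))"
  by (rule natural_familyI)
   (simp_all only: not_False_eq_True cup.simps(1) cup_map natural_family_fun[OF natural_operatorD(1)[OF assms(1)]] natural_family_fun[OF assms(2)])
 then show ?thesis
  unfolding natural_operator_def using additive_family_cup natural_operatorD(2)[OF assms(1)] by blast
qed

lemma natural_add:
 assumes "natural_operator G" "natural_operator G'"
 shows "natural_operator (\<lambda>s. G s + G' s)"
proof -
 have "natural_family (%s. G s + G' s)"
  by (rule natural_familyI)
   (simp_all add: natural_family_Nil[OF natural_operatorD(1)[OF assms(1)]] natural_family_Nil[OF natural_operatorD(1)[OF assms(2)]]
    natural_family_fun[OF natural_operatorD(1)[OF assms(1)]] natural_family_fun[OF natural_operatorD(1)[OF assms(2)]] plus_fun_def zero_fun_def)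
 then show ?thesis
  unfolding natural_operator_def using additive_family_add natural_operatorD(2)[OF assms(1)] natural_operatorD(2)[OF assms(2)] by blast
qed

lemma natural_cobd:
 assumes "natural_operator G"
 shows "natural_operator (\<lambda>s. cobd (G s))"
proof -
 have "natural_family (%s. cobd (G s))"
  by (rule natural_familyI) (simp_all only: not_False_eq_True cobd.simps(1) cobd_map natural_family_fun[OF natural_operatorD(1)[OF assms]])
 then show ?thesis
  unfolding natural_operator_def using additive_family_cobd natural_operatorD(2)[OF assms] by blast
qed

lemma natural_prec_d:
 assumes "natural_operator G"
 shows "natural_operator (\<lambda>s. cubical.prec_d (G s))"
proof -
 have "natural_family (%s. cubical.prec_d (G s))"
 proof (rule natural_familyI)
  show "cubical.prec_d (G s) [] = 0" for s
   by (rule ext) (simp add: cubical.prec_d_def natural_family_Nil[OF natural_operatorD(1)[OF assms]])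
 qed (simp add: cubical.prec_d_def natural_family_fun[OF natural_operatorD(1)[OF assms]])
 then show ?thesis
  unfolding natural_operator_def using cubical.additive_family_prec_d natural_operatorD(2)[OF assms] by blast
qed

lemma natural_twist_operator:
 assumes "natural_operator G" "natural_family a"
 shows "natural_operator (\<lambda>s. cubical.twist (a s) (G s))"
 unfolding cubical.twist_def
 by (intro natural_add natural_cobd natural_prec_d natural_cup natural_alt assms)

lemma additive_family_pointwise:
 assumes h: "\<And>x y. h (x + y) = h x + h y"
 shows "alt (\<lambda>l t. h (G l t)) l t = h (alt G l t)"
  and "cobd (\<lambda>l t. h (G l t)) l t = h (cobd G l t)"
  and "cup push (\<lambda>l t. h (G l t)) a l t = h (cup push G a l t)"
proof -
 show "alt (%l t. h (G l t)) l t = h (alt G l t)"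
  by (simp add: alt_def signed_fun_apply additive_zero(2,4)[of h, OF h])
 have "cobd (%l. (%g t. h (g t)) (G l)) l = (%g t. h (g t)) (cobd G l)"
  by (rule cobd_additive[of "%g t. h (g t)"]) (simp add: fun_eq_iff h)
 then show "cobd (%l t. h (G l t)) l t = h (cobd G l t)" by (simp add: fun_eq_iff)
 show "cup push (%l t. h (G l t)) a l t = h (cup push G a l t)"
  by (simp only: cup_push_apply additive_sum[of h, OF h])
qed

lemma twist_pointwise:
 assumes h: "\<And>x y. h (x + y) = h x + h y"
 shows "cubical.twist a (\<lambda>l t. h (G l t)) l t = h (cubical.twist a G l t)"
proof -
 have alt: "alt (%l t. h (G l t)) = (%l t. h (alt G l t))"
  by (rule ext, rule ext, rule additive_family_pointwise(1)[OF h])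
 show ?thesis
  unfolding cubical.twist_def cubical.prec_d_def alt
  by (simp add: additive_family_pointwise[OF h] h)
qed

lemma op_of_op_twist:
 assumes "natural_operator G" "additive_family (cubical.twist (a s) (face_tn s))"
 shows "op_of G (op_of (\<lambda>s. cubical.twist (a s) (face_tn s)) (tn s r)) = cubical.twist (a s) (G s) [0..<Suc (fst s)] r"
 unfolding op_of_tn[of "\<lambda>s. cubical.twist (a s) (face_tn s)", OF assms(2)]
  twist_pointwise[of "op_of G", OF op_of_add, symmetric] op_of_face_tn[OF assms(1)] ..

lemma op_of_op_cup:
 assumes "natural_operator G"
 shows "op_of G (op_of (\<lambda>s. cup push (face_tn s) (F s)) (tn s r)) = cup push (G s) (F s) [0..<Suc (fst s)] r"
  and "op_of G (op_of (\<lambda>s. cup push (alt (face_tn s)) (F s)) (tn s r)) = cup push (alt (G s)) (F s) [0..<Suc (fst s)] r"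
proof -
 note add = natural_operatorD(2)[OF natural_face_tn, of s]
 show "op_of G (op_of (%s. cup push (face_tn s) (F s)) (tn s r)) = cup push (G s) (F s) [0..<Suc (fst s)] r"
  unfolding op_of_tn[of "%s. cup push (face_tn s) (F s)", OF additive_family_cup[OF add]]
   additive_family_pointwise(3)[of "op_of G", OF op_of_add, symmetric] op_of_face_tn[OF assms] ..
 have alt: "(%l t. op_of G (alt (face_tn s) l t)) = alt (G s)"
  by (rule ext, rule ext, subst additive_family_pointwise(1)[of "op_of G", OF op_of_add, symmetric])
   (simp only: op_of_face_tn[OF assms])
 show "op_of G (op_of (%s. cup push (alt (face_tn s)) (F s)) (tn s r)) = cup push (alt (G s)) (F s) [0..<Suc (fst s)] r"
  unfolding op_of_tn[of "%s. cup push (alt (face_tn s)) (F s)", OF additive_family_cup[OF additive_family_alt[OF add]]]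
   additive_family_pointwise(3)[of "op_of G", OF op_of_add, symmetric] alt ..
qed

definition D_op :: "('a simplex => nat list => 'p cring) => ('a, 'p::ab_group_add) cell_module => ('a, 'p) cell_module" where
 "D_op a = op_of (\<lambda>s. cubical.twist (a s) (face_tn s))"

definition cap_op :: "('a simplex => nat list => 'p cring) => ('a, 'p::ab_group_add) cell_module => ('a, 'p) cell_module" where
 "cap_op u = op_of (\<lambda>s. cup push (face_tn s) (u s))"

definition alt_cap_op :: "('a simplex => nat list => 'p cring) => ('a, 'p::ab_group_add) cell_module => ('a, 'p) cell_module" where
 "alt_cap_op h = op_of (\<lambda>s. cup push (alt (face_tn s)) (h s))"

lemma additive_family_face_tn: "additive_family (face_tn s)"
 by (rule natural_operatorD(2)[OF natural_face_tn])

lemma additive_family_twist: "additive_family G ==> additive_family (cubical.twist a G)"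
 unfolding cubical.twist_def
 by (intro additive_family_add additive_family_cobd cubical.additive_family_prec_d additive_family_alt additive_family_cup)

lemma D_op_D_op:
 assumes "natural_family a" "cubical.twisting (a s)"
 shows "D_op a (D_op a (tn s r)) = 0"
 unfolding D_op_def
  op_of_op_twist[OF natural_twist_operator[OF natural_face_tn assms(1)] additive_family_twist[OF additive_family_face_tn]]
  cubical.twist_twist[OF additive_family_face_tn assms(2)]
 by simp

lemma D_op_cap_op:
 assumes "natural_family a" "natural_family u" "cubical.gauge (a s) (a s) (u s)"
 shows "D_op a (cap_op u (tn s r)) = cap_op u (D_op a (tn s r))"
 unfolding D_op_def cap_op_def
  op_of_op_twist[OF natural_cup[OF natural_face_tn assms(2)] additive_family_twist[OF additive_family_face_tn]]
  op_of_op_cup(1)[OF natural_twist_operator[OF natural_face_tn assms(1)]]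
  cubical.twist_gauge[OF additive_family_face_tn assms(3)] ..

lemma cap_op_cap_op:
 assumes "natural_family u"
 shows "cap_op u (cap_op v (tn s r)) = cap_op (\<lambda>s. cup (*) (u s) (v s)) (tn s r)"
proof -
 have "cup push (cup push (face_tn s) (u s)) (v s) = cup push (face_tn s) (cup (*) (u s) (v s))"
  by (rule cup_assoc) (simp_all add: push_add push_add_right[OF additive_family_face_tn] push_push)
 then show ?thesis
  unfolding cap_op_def op_of_op_cup(1)[OF natural_cup[OF natural_face_tn assms]]
   op_of_tn[of "%s. cup push (face_tn s) (cup (*) (u s) (v s))", OF additive_family_cup[OF additive_family_face_tn]]
  by simp
qed

lemma cap_op_tn: "cap_op u (tn s r) = cup push (face_tn s) (u s) [0..<Suc (fst s)] r"
 unfolding cap_op_def by (rule op_of_tn[OF additive_family_cup[OF additive_family_face_tn]])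

lemma alt_cap_op_tn: "alt_cap_op u (tn s r) = cup push (alt (face_tn s)) (u s) [0..<Suc (fst s)] r"
 unfolding alt_cap_op_def by (rule op_of_tn[OF additive_family_cup[OF additive_family_alt[OF additive_family_face_tn]]])

lemma cap_op_diff:
 "u s = v s - w s ==> cap_op u (tn s r) = cap_op v (tn s r) - cap_op w (tn s r)"
 unfolding cap_op_tn by (simp add: cup_add_right(3) push_add_right[OF additive_family_face_tn])

text \<open>The identity \<open>twist_gauge_homotopy\<close> for the universal family.\<close>

lemma homotopy_op:
 assumes "natural_family a" "natural_family h" "cubical.gauge_homotopy (a s) (a s) (h s) (v s - w s)"
 shows "D_op a (alt_cap_op h (tn s r)) + alt_cap_op h (D_op a (tn s r)) = cap_op v (tn s r) - cap_op w (tn s r)"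
proof -
 have "D_op a (alt_cap_op h (tn s r)) + alt_cap_op h (D_op a (tn s r)) = cap_op (%s. v s - w s) (tn s r)"
  unfolding D_op_def alt_cap_op_def cap_op_tn
   op_of_op_twist[OF natural_cup[OF natural_alt[OF natural_face_tn] assms(2)] additive_family_twist[OF additive_family_face_tn]]
   op_of_op_cup(2)[OF natural_twist_operator[OF natural_face_tn assms(1)]]
  using fun_cong[OF fun_cong[OF cubical.twist_gauge_homotopy[OF additive_family_face_tn assms(3), of s]], of "[0..<Suc (fst s)]" r]
  by (simp add: add.commute del: upt_Suc)
 then show ?thesis using cap_op_diff[of "%s. v s - w s" s v w r] by simp
qed

section \<open>The model as a quotient of the cell module\<close>

definition model_cells :: "'a topology => nat => ('a simplex \<times> 'p::ab_group_add qcube) set" where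
 "model_cells B n = simplices B \<times> {c. Rep_qcube c \<in> L_cubes n}"

definition part_cells :: "'a topology => nat => int => ('a simplex \<times> 'p::ab_group_add qcube) set" where
 "part_cells B n m = {(s, c) \<in> model_cells B n. int (fst s) + int (qdim c) = m}"

text \<open>The quotient map from the free group on pairs of a simplex and a cube; it is onto, so
 identities of operators can be checked before passing to the quotient.\<close>

definition model_class :: "'a topology => nat => ('a, 'p::ab_group_add) cell_module => ('a, 'p) model" where
 "model_class B n = the_hom (free_Abelian_group (model_cells B n)) (Y_group B n) (model_cells B n) frag_of
  (\<lambda>(s, c). Y_tens B n (frag_of s) (L_class n (Rep_qcube c)))"

lemma frag_span_carrier: "frag_span S = carrier (free_Abelian_group S)"
 by (auto simp: frag_span_def)

lemma free_homI:
 assumes "\<And>x. x \<in> frag_span S ==> f x \<in> carrier H"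
  and "\<And>x y. x \<in> frag_span S ==> y \<in> frag_span S ==> f (x + y) = f x \<otimes>\<^bsub>H\<^esub> f y"
 shows "f \<in> hom (free_Abelian_group S) H"
 using assms unfolding frag_span_carrier by (auto simp: hom_def)

lemma sing_chains_group: "group (sing_chains B)"
 by (simp add: sing_chains_def)

lemma Y_comm_group: "comm_group (Y_group B n)"
 unfolding Y_group_def by (rule tensor_comm_group[OF sing_chains_group L_chains_group])

lemma free_hom_eqI:
 assumes "group H" "f \<in> hom (free_Abelian_group S) H" "g \<in> hom (free_Abelian_group S) H"
  and "\<And>s. s \<in> S ==> f (frag_of s) = g (frag_of s)" "x \<in> frag_span S"
 shows "f x = g x"
 by (rule hom_eq_on_generate[of "free_Abelian_group S" H f g "frag_of ` S"])
  (use assms generate_free_Abelian_group[of S] in \<open>auto simp: frag_span_def\<close>)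

lemma free_hom_apply:
 assumes H: "comm_group H" and f: "f \<in> hom (free_Abelian_group S) H"
 shows "x \<in> frag_span S ==> f x \<in> carrier H"
  and "x \<in> frag_span S ==> y \<in> frag_span S ==> f (x + y) = f x \<otimes>\<^bsub>H\<^esub> f y"
  and "f 0 = \<one>\<^bsub>H\<^esub>"
  and "x \<in> frag_span S ==> f (- x) = inv\<^bsub>H\<^esub> f x"
  and "x \<in> frag_span S ==> f (signed k x) = f x [^]\<^bsub>H\<^esub> ((-1) ^ k :: int)"
proof -
 interpret H: comm_group H by fact
 show 1: "f x \<in> carrier H" if "x \<in> frag_span S" for x
  using f that by (auto simp: hom_def frag_span_carrier)
 show 2: "f (x + y) = f x \<otimes>\<^bsub>H\<^esub> f y" if "x \<in> frag_span S" "y \<in> frag_span S" for x y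
  using f that by (auto simp: hom_def frag_span_carrier)
 have 0: "f 0 \<in> carrier H" by (rule 1) simp
 show 3: "f 0 = \<one>\<^bsub>H\<^esub>"
  using 2[of 0 0] 0 H.l_cancel_one'[OF 0 0] by simp
 show 4: "f (- x) = inv\<^bsub>H\<^esub> f x" if "x \<in> frag_span S" for x
 proof (rule H.inv_equality[symmetric])
  show "f (- x) \<otimes>\<^bsub>H\<^esub> f x = \<one>\<^bsub>H\<^esub>" using 2[OF frag_span_uminus[OF that] that] 3 by simp
 qed (use 1 that frag_span_uminus in auto)
 show "f (signed k x) = f x [^]\<^bsub>H\<^esub> ((-1) ^ k :: int)" if "x \<in> frag_span S"
  using 1[OF that] 4[OF that] H.int_pow_neg[of "f x" 1] by (simp add: signed_def)
qed

lemma free_hom_sum: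
 assumes H: "comm_group H" and f: "f \<in> hom (free_Abelian_group S) H"
  and "finite I" "\<And>i. i \<in> I ==> x i \<in> frag_span S"
 shows "f (\<Sum>i\<in>I. x i) = (\<Otimes>\<^bsub>H\<^esub>i\<in>I. f (x i))"
 using assms(3,4)
proof (induction I rule: finite_induct)
 case empty
 then show ?case using free_hom_apply(3)[OF H f] by (simp add: comm_group.axioms comm_monoid.finprod_empty[OF comm_group.axioms(1)[OF H]])
next
 case (insert i I)
 interpret H: comm_group H by fact
 have "(%i. f (x i)) \<in> I \<rightarrow> carrier H" "f (x i) \<in> carrier H"
  using insert.prems free_hom_apply(1)[OF H f] by auto
 then show ?case
  using insert free_hom_apply(2)[OF H f, of "x i" "\<Sum>i\<in>I. x i"]
  by (simp add: frag_span_sum)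
qed

lemma Y_tens_closed:
 "ch \<in> carrier (sing_chains B) ==> K \<in> carrier (L_chains n) ==> Y_tens B n ch K \<in> carrier (Y_group B n)"
 unfolding Y_tens_def Y_group_def by (rule tens_closed)

lemma frag_of_sing_chains: "s \<in> simplices B ==> frag_of s \<in> carrier (sing_chains B)"
 by (simp add: sing_chains_def)

lemma model_class_hom: "model_class B n \<in> hom (free_Abelian_group (model_cells B n)) (Y_group B n)"
 and model_class_of: "s \<in> simplices B ==> Rep_qcube c \<in> L_cubes n ==>
  model_class B n (frag_of (s, c)) = Y_tens B n (frag_of s) (L_class n (Rep_qcube c))"
proof -
 have h: "(case x of (s, c) => Y_tens B n (frag_of s) (L_class n (Rep_qcube c))) \<in> carrier (Y_group B n)"
  if "x \<in> model_cells B n" for x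
  using that by (cases x) (simp add: model_cells_def Y_tens_closed frag_of_sing_chains L_class_closed)
 note the_hom = the_hom_free[OF Y_comm_group h]
 show "model_class B n \<in> hom (free_Abelian_group (model_cells B n)) (Y_group B n)"
  unfolding model_class_def by (rule the_hom(1))
 show "model_class B n (frag_of (s, c)) = Y_tens B n (frag_of s) (L_class n (Rep_qcube c))"
  if "s \<in> simplices B" "Rep_qcube c \<in> L_cubes n"
  unfolding model_class_def by (subst the_hom(2)) (use that in \<open>simp_all add: model_cells_def\<close>)
qed

lemmas model_class_apply = free_hom_apply[OF Y_comm_group model_class_hom]
lemmas model_class_sum = free_hom_sum[OF Y_comm_group model_class_hom]

lemma tn_span:
 assumes "s \<in> S" "r \<in> frag_span C"
 shows "tn s r \<in> frag_span (S \<times> C)"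
 by (rule additive_into_span[of "tn s" C]) (use assms in \<open>auto simp: tn_add\<close>)

lemma tn_model_span: "s \<in> simplices B ==> r \<in> qchains n ==> tn s r \<in> frag_span (model_cells B n)"
 unfolding model_cells_def qchains_span by (rule tn_span)

lemma model_class_tn:
 fixes r :: "'p::ab_group_add cring"
 assumes s: "s \<in> simplices B" and r: "r \<in> qchains n"
 shows "model_class B n (tn s r) = Y_tens B n (frag_of s) (cube_class n r)"
proof (rule free_hom_eqI[of "Y_group B n" "%r. model_class B n (tn s r)" "{c. Rep_qcube c \<in> L_cubes n}" "%r. Y_tens B n (frag_of s) (cube_class n r)"])
 interpret Y: comm_group "Y_group B n" by (rule Y_comm_group)
 show "group (Y_group B n)" by (rule Y.is_group)
 have tens: "Y_tens B n (frag_of s) \<in> hom (L_chains n :: ('p cube \<Rightarrow>\<^sub>0 int) set monoid) (Y_group B n)"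
  unfolding Y_tens_def Y_group_def
  by (rule tens_hom_right[OF sing_chains_group L_chains_group frag_of_sing_chains[OF s]])
 show "(%r :: 'p cring. model_class B n (tn s r)) \<in> hom (free_Abelian_group {c. Rep_qcube c \<in> L_cubes n}) (Y_group B n)"
  by (intro free_homI) (simp_all add: qchains_span[symmetric] tn_add model_class_apply tn_model_span[OF s])
 show "(%r :: 'p cring. Y_tens B n (frag_of s) (cube_class n r)) \<in> hom (free_Abelian_group {c. Rep_qcube c \<in> L_cubes n}) (Y_group B n)"
  using hom_mult[OF tens] hom_in_carrier[OF tens]
  by (intro free_homI) (simp_all add: qchains_span[symmetric] cube_class_closed cube_class_add)
 show "model_class B n (tn s (frag_of c)) = Y_tens B n (frag_of s) (cube_class n (frag_of c))"
  if "c \<in> {c. Rep_qcube c \<in> L_cubes n}" for c :: "'p qcube"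
  using that s by (simp add: model_class_of cube_class_of)
 show "r \<in> frag_span {c. Rep_qcube c \<in> L_cubes n}" using r by (simp add: qchains_span)
qed

definition chain_tn :: "('a simplex \<Rightarrow>\<^sub>0 int) => 'p cring => ('a, 'p::ab_group_add) cell_module" where
 "chain_tn ch r = frag_extend (\<lambda>s. tn s r) ch"

lemma chain_tn_add: "chain_tn (ch + ch') r = chain_tn ch r + chain_tn ch' r"
 by (simp add: chain_tn_def frag_extend_add)

lemma chain_tn_span:
 assumes "ch \<in> carrier (sing_chains B)" "r \<in> qchains n"
 shows "chain_tn ch r \<in> frag_span (model_cells B n)"
proof (rule additive_into_span[of "%ch. chain_tn ch r" "simplices B"])
 show "chain_tn (frag_of s) r \<in> frag_span (model_cells B n)" if "s \<in> simplices B" for s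
  using tn_model_span[OF that assms(2)] by (simp add: chain_tn_def)
 show "ch \<in> frag_span (simplices B)"
  using assms(1) by (simp add: sing_chains_def frag_span_carrier)
qed (rule chain_tn_add)

lemma model_class_chain_tn:
 assumes ch: "ch \<in> carrier (sing_chains B)" and r: "r \<in> qchains n"
 shows "model_class B n (chain_tn ch r) = Y_tens B n ch (cube_class n r)"
proof (rule free_hom_eqI[of "Y_group B n" "%ch. model_class B n (chain_tn ch r)" "simplices B" "%ch. Y_tens B n ch (cube_class n r)"])
 interpret Y: comm_group "Y_group B n" by (rule Y_comm_group)
 show "group (Y_group B n)" by (rule Y.is_group)
 show "(%ch. Y_tens B n ch (cube_class n r)) \<in> hom (free_Abelian_group (simplices B)) (Y_group B n)"
  using tens_hom_left[OF sing_chains_group L_chains_group cube_class_closed[OF r], of B]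
  by (simp add: Y_tens_def Y_group_def sing_chains_def)
 show "(%ch. model_class B n (chain_tn ch r)) \<in> hom (free_Abelian_group (simplices B)) (Y_group B n)"
  using chain_tn_span[OF _ r, of _ B]
  by (intro free_homI) (simp_all add: sing_chains_def frag_span_carrier chain_tn_add model_class_apply)
 show "model_class B n (chain_tn (frag_of s) r) = Y_tens B n (frag_of s) (cube_class n r)" if "s \<in> simplices B" for s
  using model_class_tn[OF that r] by (simp add: chain_tn_def)
 show "ch \<in> frag_span (simplices B)" using ch by (simp add: sing_chains_def frag_span_def)
qed

lemma Y_generated:
 "carrier (Y_group B n) \<subseteq> generate (Y_group B n) ((\<lambda>(s, \<tau>). Y_tens B n (frag_of s) \<tau>) ` (simplices B \<times> carrier (L_chains n)))"
proof -
 have "carrier (tensor_group (sing_chains B) (L_chains n)) \<subseteq> generate (tensor_group (sing_chains B) (L_chains n))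
   ((%(a, b). tens (sing_chains B) (L_chains n) a b) ` (frag_of ` simplices B \<times> carrier (L_chains n)))"
  by (rule tensor_generated_left[OF sing_chains_group L_chains_group])
   (use generate_free_Abelian_group[of "simplices B"] in \<open>auto simp: sing_chains_def\<close>)
 also have "(%(a, b). tens (sing_chains B) (L_chains n) a b) ` (frag_of ` simplices B \<times> carrier (L_chains n))
  = (%(s, \<tau>). Y_tens B n (frag_of s) \<tau>) ` (simplices B \<times> carrier (L_chains n))"
  by (force simp: Y_tens_def)
 finally show ?thesis by (simp add: Y_group_def)
qed

text \<open>For each chain of \<open>L\<close> the values on simplices extend to the free group of chains
 of \<open>B\<close>; the result is biadditive, so it factors through the tensor product.\<close>

lemma Y_hom_tens:
 assumes h: "\<And>s. s \<in> simplices B ==> h (fst s) (snd s) \<in> hom (L_chains n) (Y_group B n)"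
 shows "Y_hom B n h \<in> hom (Y_group B n) (Y_group B n)"
  and "s \<in> simplices B ==> \<tau> \<in> carrier (L_chains n) ==> Y_hom B n h (Y_tens B n (frag_of s) \<tau>) = h (fst s) (snd s) \<tau>"
proof -
 interpret Y: comm_group "Y_group B n" by (rule Y_comm_group)
 interpret L: comm_group "L_chains n" by (rule L_chains_comm_group)
 let ?f = "%c \<tau>. the_hom (free_Abelian_group (simplices B)) (Y_group B n) (simplices B) frag_of (%s. h (fst s) (snd s) \<tau>) c"
 have f: "?f c \<in> UNIV" for c by simp
 have closed: "h (fst s) (snd s) \<tau> \<in> carrier (Y_group B n)" if "s \<in> simplices B" "\<tau> \<in> carrier (L_chains n)" for s \<tau>
  using hom_in_carrier[OF h[OF that(1)] that(2)] .
 have f1: "(%c. ?f c \<tau>) \<in> hom (free_Abelian_group (simplices B)) (Y_group B n)" if "\<tau> \<in> carrier (L_chains n)" for \<tau>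
  by (rule the_hom_free(1)[OF Y_comm_group closed[OF _ that]])
 have f2: "?f (frag_of s) \<tau> = h (fst s) (snd s) \<tau>" if "\<tau> \<in> carrier (L_chains n)" "s \<in> simplices B" for \<tau> s
  by (rule the_hom_free(2)[OF Y_comm_group closed[OF _ that(1)] that(2)])
 have "biadditive (sing_chains B) (L_chains n) (Y_group B n) ?f"
  unfolding biadditive_def
 proof (intro conjI ballI)
  show "(%c. ?f c \<tau>) \<in> hom (sing_chains B) (Y_group B n)" if "\<tau> \<in> carrier (L_chains n)" for \<tau>
   unfolding sing_chains_def by (rule f1[OF that])
  fix c assume "c \<in> carrier (sing_chains B)"
  then have c: "c \<in> frag_span (simplices B)" by (simp add: sing_chains_def frag_span_def)
  show "?f c \<in> hom (L_chains n) (Y_group B n)"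
  proof (rule homI)
   show "?f c \<tau> \<in> carrier (Y_group B n)" if "\<tau> \<in> carrier (L_chains n)" for \<tau>
    by (rule free_hom_apply(1)[OF Y_comm_group f1[OF that] c])
   show "?f c (\<tau> \<otimes>\<^bsub>L_chains n\<^esub> \<tau>') = ?f c \<tau> \<otimes>\<^bsub>Y_group B n\<^esub> ?f c \<tau>'"
    if \<tau>: "\<tau> \<in> carrier (L_chains n)" "\<tau>' \<in> carrier (L_chains n)" for \<tau> \<tau>'
   proof (rule free_hom_eqI[OF Y.is_group f1[OF L.m_closed[OF \<tau>]] _ _ c])
    show "(%c. ?f c \<tau> \<otimes>\<^bsub>Y_group B n\<^esub> ?f c \<tau>') \<in> hom (free_Abelian_group (simplices B)) (Y_group B n)"
     by (rule hom_pointwise_mult[OF Y_comm_group f1[OF \<tau>(1)] f1[OF \<tau>(2)]])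
    show "?f (frag_of s) (\<tau> \<otimes>\<^bsub>L_chains n\<^esub> \<tau>') = ?f (frag_of s) \<tau> \<otimes>\<^bsub>Y_group B n\<^esub> ?f (frag_of s) \<tau>'"
     if "s \<in> simplices B" for s
     unfolding f2[OF L.m_closed[OF \<tau>] that] f2[OF \<tau>(1) that] f2[OF \<tau>(2) that]
     by (rule hom_mult[OF h[OF that] \<tau>])
   qed
  qed
 qed
 from tensor_universal[OF sing_chains_group L_chains_group Y_comm_group this]
 obtain F where F: "F \<in> hom (Y_group B n) (Y_group B n)"
  and F_tens: "!!c \<tau>. c \<in> carrier (sing_chains B) ==> \<tau> \<in> carrier (L_chains n) ==> F (Y_tens B n c \<tau>) = ?f c \<tau>"
  unfolding Y_group_def Y_tens_def by blast
 have Fs: "F (Y_tens B n (frag_of s) \<tau>) = h (fst s) (snd s) \<tau>" if "s \<in> simplices B" "\<tau> \<in> carrier (L_chains n)" for s \<tau>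
  using F_tens[OF frag_of_sing_chains[OF that(1)] that(2)] f2[OF that(2,1)] by simp
 have eq: "Y_hom B n h = restrict F (carrier (Y_group B n))"
  unfolding Y_hom_def
 proof (rule the_hom_eq[OF Y.is_group Y.is_group F])
  show "F (case i of (s, \<tau>) => Y_tens B n (frag_of s) \<tau>) = (case i of (x, xa) => (case x of (p, \<sigma>) => %\<tau>. h p \<sigma> \<tau>) xa)"
   if "i \<in> simplices B \<times> carrier (L_chains n)" for i
   using that Fs[of "fst i" "snd i"] by (simp add: case_prod_unfold mem_Times_iff)
  show "(%(s, \<tau>). Y_tens B n (frag_of s) \<tau>) ` (simplices B \<times> carrier (L_chains n)) \<subseteq> carrier (Y_group B n)"
   by (auto intro: Y_tens_closed frag_of_sing_chains)
 qed (rule Y_generated)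
 show "Y_hom B n h \<in> hom (Y_group B n) (Y_group B n)"
  unfolding eq using F by (auto simp: hom_def Pi_def)
 show "Y_hom B n h (Y_tens B n (frag_of s) \<tau>) = h (fst s) (snd s) \<tau>"
  if "s \<in> simplices B" "\<tau> \<in> carrier (L_chains n)"
  unfolding eq using Fs[OF that] Y_tens_closed[OF frag_of_sing_chains[OF that(1)] that(2)] by simp
qed

section \<open>Realising natural operators on the model\<close>

lemma cells_eqI:
 fixes f g :: "('a, 'p::ab_group_add) cell_module => ('a, 'p) cell_module"
 assumes f: "\<And>x y. f (x + y) = f x + f y" and g: "\<And>x y. g (x + y) = g x + g y"
  and eq: "\<And>s c. s \<in> simplices B ==> Rep_qcube c \<in> L_cubes n ==> f (tn s (frag_of c)) = g (tn s (frag_of c))"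
  and x: "x \<in> frag_span (model_cells B n)"
 shows "f x = g x"
proof (rule additive_frag_eq[of f g x, OF f g])
 fix sc assume "sc \<in> Poly_Mapping.keys x"
 then have "sc \<in> model_cells B n" using x by (auto simp: frag_span_def)
 then have "fst sc \<in> simplices B" "Rep_qcube (snd sc) \<in> L_cubes n" by (auto simp: model_cells_def)
 from eq[OF this] show "f (frag_of sc) = g (frag_of sc)" by simp
qed

text \<open>The degree is an integer, so that \<open>graded n (-1)\<close> is trivial and no case
 distinction is needed for differentials and negative shifts.\<close>

definition graded :: "nat => int => 'p::ab_group_add cring set" where
 "graded n j = frag_span {c. Rep_qcube c \<in> L_cubes n \<and> int (qdim c) = j}"

lemma cube_part_graded: "cube_part n q = graded n (int q)"
 by (simp add: graded_def cube_part_span)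

lemma frag_span_mono: "S \<subseteq> T ==> x \<in> frag_span S ==> x \<in> frag_span T"
 by (auto simp: frag_span_def)

lemma graded_qchains: "x \<in> graded n j ==> x \<in> qchains n"
 unfolding graded_def qchains_span by (erule frag_span_mono[rotated]) auto

lemma mult_graded: "x \<in> graded n i ==> y \<in> graded n j ==> x * y \<in> graded n (i + j)"
 unfolding graded_def by (rule mult_frag_span) (auto simp: L_cubes_plus qdim_plus)

lemma graded_of: "Rep_qcube c \<in> L_cubes n ==> frag_of c \<in> graded n (int (qdim c))"
 by (simp add: graded_def)

lemma cube_d_graded:
 assumes "Rep_qcube c \<in> L_cubes n"
 shows "cube_d (frag_of c) \<in> graded n (int (qdim c) - 1)"
 unfolding cube_d_of graded_def
proof (rule frag_span_sum)
 fix i assume "i \<in> {..<qdim c}"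
 then have i: "i < qdim c" by simp
 have "frag_of (qface i eps c) \<in> frag_span {c'. Rep_qcube c' \<in> L_cubes n \<and> int (qdim c') = int (qdim c) - 1}" for eps
  using L_cubes_qface[OF assms i] i by (simp add: qface_def of_nat_diff)
 then show "signed (Suc i) (face_diff i (frag_of c)) \<in> frag_span {c'. Rep_qcube c' \<in> L_cubes n \<and> int (qdim c') = int (qdim c) - 1}"
  unfolding face_diff_def frag_extend_of by (intro frag_span_signed frag_span_diff)
qed

lemma tn_graded:
 assumes "s \<in> simplices B" "r \<in> graded n j" "int (fst s) + j = m"
 shows "tn s r \<in> frag_span (part_cells B n m)"
proof -
 have "tn s r \<in> frag_span ({s} \<times> {c. Rep_qcube c \<in> L_cubes n \<and> int (qdim c) = j})"
  by (rule tn_span) (use assms in \<open>simp_all add: graded_def\<close>)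
 then show ?thesis
  by (rule frag_span_mono[rotated]) (use assms in \<open>auto simp: part_cells_def model_cells_def\<close>)
qed

lemma face_tn_graded:
 assumes "s \<in> simplices B" "l \<noteq> [] ==> r \<in> graded n j" "l \<noteq> [] ==> int (length l) - 1 + j = m"
 shows "face_tn s l r \<in> frag_span (part_cells B n m)"
proof (cases "l = []")
 case False
 then have "tn (face_simplex s l) r \<in> frag_span (part_cells B n m)"
  using assms face_simplex_in_simplices[OF assms(1) False]
  by (intro tn_graded[of _ B r n j]) (auto simp: of_nat_diff Suc_le_eq)
 then show ?thesis using False by (simp add: face_tn_def)
qed (simp add: face_tn_def)

definition graded_family :: "'a topology => nat => int => ('a simplex => nat list => 'p::ab_group_add cring) => bool" where
 "graded_family B n k F \<longleftrightarrow> (\<forall>s\<in>simplices B. \<forall>l. l \<noteq> [] --> F s l \<in> graded n (int (length l) - 1 - k))"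

definition degree_op :: "'a topology => nat => int => (('a, 'p::ab_group_add) cell_module => ('a, 'p) cell_module) => bool" where
 "degree_op B n k P \<longleftrightarrow> (\<forall>x y. P (x + y) = P x + P y) \<and>
  (\<forall>s\<in>simplices B. \<forall>c. Rep_qcube c \<in> L_cubes n -->
    P (tn s (frag_of c)) \<in> frag_span (part_cells B n (int (fst s) + int (qdim c) - k)))"

lemma degree_opD:
 assumes "degree_op B n k P"
 shows "P (x + y) = P x + P y"
  and "s \<in> simplices B ==> Rep_qcube c \<in> L_cubes n ==>
   P (tn s (frag_of c)) \<in> frag_span (part_cells B n (int (fst s) + int (qdim c) - k))"
 using assms unfolding degree_op_def by blast+

lemma part_cells_subset: "part_cells B n m \<subseteq> model_cells B n"
 by (auto simp: part_cells_def)

lemma degree_op_part: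
 assumes P: "degree_op B n k P" and x: "x \<in> frag_span (part_cells B n m)"
 shows "P x \<in> frag_span (part_cells B n (m - k))"
proof (rule additive_into_span[of P "part_cells B n m"])
 fix sc :: "'a simplex \<times> 'b qcube" assume "sc \<in> part_cells B n m"
 then have "fst sc \<in> simplices B" "Rep_qcube (snd sc) \<in> L_cubes n" "int (fst (fst sc)) + int (qdim (snd sc)) = m"
  by (auto simp: part_cells_def model_cells_def)
 with degree_opD(2)[OF P this(1,2)] show "P (frag_of sc) \<in> frag_span (part_cells B n (m - k))" by simp
qed (use degree_opD(1)[OF P] x in auto)

lemma degree_op_cells:
 assumes P: "degree_op B n k P" and x: "x \<in> frag_span (model_cells B n)"
 shows "P x \<in> frag_span (model_cells B n)"
proof (rule additive_into_span[of P "model_cells B n"])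
 fix sc :: "'a simplex \<times> 'b qcube" assume "sc \<in> model_cells B n"
 then have "fst sc \<in> simplices B" "Rep_qcube (snd sc) \<in> L_cubes n" by (auto simp: model_cells_def)
 with frag_span_mono[OF part_cells_subset degree_opD(2)[OF P this(1,2)]]
 show "P (frag_of sc) \<in> frag_span (model_cells B n)" by simp
qed (use degree_opD(1)[OF P] x in auto)

lemma degree_op_cap:
 assumes F: "graded_family B n k F"
 shows "degree_op B n k (cap_op F)" "degree_op B n k (alt_cap_op F)"
proof -
 have summand: "face_tn s (take (Suc j) [0..<Suc (fst s)]) (F s (drop j [0..<Suc (fst s)]) * frag_of c)
   \<in> frag_span (part_cells B n (int (fst s) + int (qdim c) - k))"
  if s: "s \<in> simplices B" and c: "Rep_qcube c \<in> L_cubes n" and j: "j < Suc (fst s)" for s c j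
 proof (rule face_tn_graded[OF s])
  have "F s (drop j [0..<Suc (fst s)]) \<in> graded n (int (Suc (fst s) - j) - 1 - k)"
   using F[unfolded graded_family_def, rule_format, OF s, of "drop j [0..<Suc (fst s)]"] j by (simp del: upt_Suc)
  from mult_graded[OF this graded_of[OF c]]
  show "F s (drop j [0..<Suc (fst s)]) * frag_of c \<in> graded n (int (Suc (fst s) - j) - 1 - k + int (qdim c))" .
 qed (use j in \<open>simp add: of_nat_diff del: upt_Suc\<close>)
 show "degree_op B n k (cap_op F)"
  unfolding degree_op_def cap_op_tn cup_push_apply
  by (intro conjI allI ballI impI frag_span_sum, simp_all only: cap_op_def op_of_add)
   (rule summand, simp_all del: upt_Suc)
 show "degree_op B n k (alt_cap_op F)"
  unfolding degree_op_def alt_cap_op_tn cup_push_apply alt_def signed_fun_apply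
  by (intro conjI allI ballI impI frag_span_sum frag_span_signed, simp_all only: alt_cap_op_def op_of_add)
   (rule summand, simp_all del: upt_Suc)
qed

lemma face_tn_all: "s \<in> simplices B ==> face_tn s [0..<Suc (fst s)] = tn s"
 using face_simplex_all[of s B] by (simp add: face_tn_def del: upt_Suc)

definition D0_op :: "('a, 'p::ab_group_add) cell_module => ('a, 'p) cell_module" where
 "D0_op = op_of (\<lambda>s. cobd (face_tn s) + cubical.prec_d (alt (face_tn s)))"

lemma D0_op_tn:
 fixes r :: "'p::ab_group_add cring"
 assumes "s \<in> simplices B"
 shows "D0_op (tn s r) = cobd (face_tn s) [0..<Suc (fst s)] r + signed (fst s) (tn s (cube_d r))"
proof -
 have "additive_family (cobd (face_tn s :: nat list => 'p cring => _) + cubical.prec_d (alt (face_tn s)))"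
  by (intro additive_family_add additive_family_cobd cubical.additive_family_prec_d additive_family_alt additive_family_face_tn)
 from op_of_tn[of "%s. cobd (face_tn s) + cubical.prec_d (alt (face_tn s))", OF this] show ?thesis
  unfolding D0_op_def
  by (simp add: face_tn_all[OF assms] cubical.prec_d_def alt_def signed_fun_apply del: upt_Suc)
qed

lemma D_op_split: "D_op a x = D0_op x + alt_cap_op a x"
proof (rule additive_frag_eq[of "D_op a" "%x. D0_op x + alt_cap_op a x"])
 show "D_op a (frag_of sc) = D0_op (frag_of sc) + alt_cap_op a (frag_of sc)" for sc
  by (simp add: D_op_def D0_op_def alt_cap_op_def op_of_def cubical.twist_def split_beta del: upt_Suc)
qed (simp_all add: D_op_def D0_op_def alt_cap_op_def op_of_add)

lemma degree_op_D0: "degree_op B n 1 (D0_op :: ('a, 'p::ab_group_add) cell_module => _)"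
 unfolding degree_op_def
proof (intro conjI allI ballI impI)
 show "D0_op (x + y) = D0_op x + D0_op y" for x y :: "('a, 'p) cell_module"
  by (simp add: D0_op_def op_of_add)
 fix s :: "'a simplex" and c :: "'p qcube" assume s: "s \<in> simplices B" and c: "Rep_qcube c \<in> L_cubes n"
 have "cobd (face_tn s) [0..<Suc (fst s)] (frag_of c) \<in> frag_span (part_cells B n (int (fst s) + int (qdim c) - 1))"
  unfolding cobd_del_nth sum_fun_apply signed_fun_apply
 proof (intro frag_span_sum frag_span_signed face_tn_graded[OF s])
  show "frag_of c \<in> graded n (int (qdim c))" by (rule graded_of[OF c])
  fix j assume "j \<in> {..<length [0..<Suc (fst s)]}"
  then have "length (del_nth j [0..<Suc (fst s)]) = fst s"
   by (subst length_del_nth) (simp_all del: upt_Suc)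
  then show "int (length (del_nth j [0..<Suc (fst s)])) - 1 + int (qdim c) = int (fst s) + int (qdim c) - 1"
   by (simp del: upt_Suc)
 qed
 moreover have "tn s (cube_d (frag_of c)) \<in> frag_span (part_cells B n (int (fst s) + int (qdim c) - 1))"
  by (rule tn_graded[OF s cube_d_graded[OF c]]) simp
 ultimately show "D0_op (tn s (frag_of c)) \<in> frag_span (part_cells B n (int (fst s) + int (qdim c) - 1))"
  unfolding D0_op_tn[OF s] by (intro frag_span_add frag_span_signed)
qed

lemma degree_op_add:
 assumes "degree_op B n k P" "degree_op B n k Q"
 shows "degree_op B n k (\<lambda>x. P x + Q x)"
 unfolding degree_op_def
 using degree_opD[OF assms(1)] degree_opD[OF assms(2)] by (simp add: frag_span_add)

lemma chain_tn_boundary: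
 fixes s :: "'a simplex" and r :: "'p::ab_group_add cring"
 assumes s: "s \<in> simplices B"
 shows "sing_boundary (frag_of s) \<in> carrier (sing_chains B)"
  and "chain_tn (sing_boundary (frag_of s)) r = cobd (face_tn s) [0..<Suc (fst s)] r"
proof -
 obtain p \<sigma> where ps: "s = (p, \<sigma>)" and \<sigma>: "singular_simplex p B \<sigma>" using s by (auto simp: simplices_def)
 have cmul: "frag_cmul ((-1) ^ k) x = signed k x" for k and x :: "'a simplex \<Rightarrow>\<^sub>0 int"
  by (simp add: signed_def)
 have bd: "sing_boundary (frag_of s) = (if p = 0 then 0 else \<Sum>k\<le>p. signed k (frag_of (p - 1, singular_face p k \<sigma>)))"
  by (simp add: sing_boundary_def ps cmul)
 have face: "(p - 1, singular_face p k \<sigma>) \<in> simplices B" if "p \<noteq> 0" "k \<le> p" for k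
  using singular_simplex_singular_face[OF \<sigma>, of k] that by (simp add: simplices_def)
 show "sing_boundary (frag_of s) \<in> carrier (sing_chains B)"
  unfolding bd sing_chains_def frag_span_carrier[symmetric]
  using face by (auto intro!: frag_span_sum frag_span_signed)
 show "chain_tn (sing_boundary (frag_of s)) r = cobd (face_tn s) [0..<Suc (fst s)] r"
 proof (cases "p = 0")
  case True
  then show ?thesis
   using bd by (simp add: chain_tn_def ps cobd_del_nth del_nth_def face_tn_def)
 next
  case False
  have "chain_tn (sing_boundary (frag_of s)) r = (\<Sum>k\<le>p. signed k (tn (p - 1, singular_face p k \<sigma>) r))"
   using False
   by (simp add: bd additive_sum[of "%ch :: 'a simplex \<Rightarrow>\<^sub>0 int. chain_tn ch r", OF chain_tn_add]
    additive_zero(4)[of "%ch :: 'a simplex \<Rightarrow>\<^sub>0 int. chain_tn ch r", OF chain_tn_add]) (simp add: chain_tn_def)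
  also have "... = (\<Sum>k<Suc p. signed k (face_tn s (del_nth k [0..<Suc p]) r))"
  proof (rule sum.cong)
   fix k assume "k \<in> {..<Suc p}"
   then have k: "k \<le> p" by simp
   have len: "length (del_nth k [0..<Suc p]) = p" using k by (subst length_del_nth) (simp_all del: upt_Suc)
   then have ne: "del_nth k [0..<Suc p] \<noteq> []" using False by auto
   have min: "map (min p) (del_nth k [0..<Suc p]) = del_nth k [0..<Suc p]"
    by (rule map_min_upt) (use set_del_nth_upt[of k p] in auto)
   have "singular_face p k \<sigma> = vertex_face (del_nth k [0..<Suc p]) \<sigma>"
    by (rule singular_face_eq_vertex_face) (use False k in auto)
   then show "signed k (tn (p - 1, singular_face p k \<sigma>) r) = signed k (face_tn s (del_nth k [0..<Suc p]) r)"
    using ne by (simp add: face_tn_def face_simplex_def ps len min del: upt_Suc)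
  qed (simp add: lessThan_Suc_atMost)
  also have "... = cobd (face_tn s) [0..<Suc (fst s)] r"
   by (simp add: cobd_del_nth sum_fun_apply signed_fun_apply ps del: upt_Suc sum.lessThan_Suc)
  finally show ?thesis .
 qed
qed

text \<open>The operator \<open>P\<close> lowers the total degree by \<open>k\<close> and induces
 \<open>\<phi>\<close> on the model.\<close>

definition realizes :: "'a topology => nat => int => (('a, 'p::ab_group_add) model => ('a, 'p) model)
  => (('a, 'p) cell_module => ('a, 'p) cell_module) => bool" where
 "realizes B n k \<phi> P \<longleftrightarrow> degree_op B n k P \<and> \<phi> \<in> hom (Y_group B n) (Y_group B n) \<and>
  (\<forall>x\<in>frag_span (model_cells B n). \<phi> (model_class B n x) = model_class B n (P x))"

text \<open>The values are images of an additive operator under a homomorphism, which makes them additive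
 in the normalized chain.\<close>

lemma realizes_Y_hom:
 fixes P :: "('a, 'p::ab_group_add) cell_module => ('a, 'p) cell_module"
 assumes P: "degree_op B n k P"
  and h: "\<And>s r. s \<in> simplices B ==> r \<in> qchains n ==> h (fst s) (snd s) (cube_class n r) = model_class B n (P (tn s r))"
 shows "realizes B n k (Y_hom B n h) P"
proof -
 interpret Y: comm_group "Y_group B n" by (rule Y_comm_group)
 note Padd = degree_opD(1)[OF P]
 have Ptn: "P (tn s r) \<in> frag_span (model_cells B n)" if "s \<in> simplices B" "r \<in> qchains n" for s r
  by (rule degree_op_cells[OF P tn_model_span[OF that]])
 have hom: "h (fst s) (snd s) \<in> hom (L_chains n) (Y_group B n)" if s: "s \<in> simplices B" for s
 proof (rule homI)
  fix K K' :: "('p cube \<Rightarrow>\<^sub>0 int) set"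
  assume "K \<in> carrier (L_chains n)"
  then obtain r where r: "r \<in> qchains n" "K = cube_class n r" using cube_class_onto by blast
  then show "h (fst s) (snd s) K \<in> carrier (Y_group B n)"
   using h[OF s r(1)] model_class_apply(1)[OF Ptn[OF s r(1)]] by simp
  assume "K' \<in> carrier (L_chains n)"
  then obtain r' where r': "r' \<in> qchains n" "K' = cube_class n r'" using cube_class_onto by blast
  have "h (fst s) (snd s) (cube_class n (r + r')) = model_class B n (P (tn s r) + P (tn s r'))"
   using h[OF s qchains_add[OF r(1) r'(1)]] by (simp only: tn_add Padd)
  then show "h (fst s) (snd s) (K \<otimes>\<^bsub>L_chains n\<^esub> K') = h (fst s) (snd s) K \<otimes>\<^bsub>Y_group B n\<^esub> h (fst s) (snd s) K'"
   using cube_class_add[OF r(1) r'(1)] r(2) r'(2) h[OF s r(1)] h[OF s r'(1)]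
    model_class_apply(2)[OF Ptn[OF s r(1)] Ptn[OF s r'(1)]] by simp
 qed
 have Yh: "Y_hom B n h \<in> hom (Y_group B n) (Y_group B n)"
  by (rule Y_hom_tens(1)) (rule hom)
 have Yh2: "Y_hom B n h (Y_tens B n (frag_of s) K) = h (fst s) (snd s) K"
  if "s \<in> simplices B" "K \<in> carrier (L_chains n)" for s K
  by (rule Y_hom_tens(2)) (use hom that in auto)
 have "Y_hom B n h (model_class B n x) = model_class B n (P x)" if x: "x \<in> frag_span (model_cells B n)" for x
 proof (rule free_hom_eqI[OF Y.is_group _ _ _ x, of "%x. Y_hom B n h (model_class B n x)" "%x. model_class B n (P x)"])
  show "(%x. Y_hom B n h (model_class B n x)) \<in> hom (free_Abelian_group (model_cells B n)) (Y_group B n)"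
   using hom_compose[OF model_class_hom Yh] by (simp add: comp_def)
  show "(%x. model_class B n (P x)) \<in> hom (free_Abelian_group (model_cells B n)) (Y_group B n)"
   by (rule free_homI) (simp_all add: Padd model_class_apply degree_op_cells[OF P])
  fix sc :: "'a simplex \<times> 'p qcube" assume "sc \<in> model_cells B n"
  then obtain s c where sc: "sc = (s, c)" and s: "s \<in> simplices B" and c: "Rep_qcube c \<in> L_cubes n"
   unfolding model_cells_def by blast
  have fc: "frag_of c \<in> qchains n" using c by (simp add: qchains_span)
  have "Y_hom B n h (model_class B n (tn s (frag_of c))) = model_class B n (P (tn s (frag_of c)))"
   unfolding model_class_tn[OF s fc] Yh2[OF s cube_class_closed[OF fc]] by (rule h[OF s fc])
  then show "Y_hom B n h (model_class B n (frag_of sc)) = model_class B n (P (frag_of sc))"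
   by (simp add: sc)
 qed
 then show ?thesis unfolding realizes_def using P Yh by blast
qed

lemma realizes_Y_diff: "realizes B n 1 (Y_diff B n) (D0_op :: ('a, 'p::ab_group_add) cell_module => _)"
 unfolding Y_diff_def
proof (rule realizes_Y_hom[OF degree_op_D0])
 fix s :: "'a simplex" and r :: "'p cring" assume s: "s \<in> simplices B" and r: "r \<in> qchains n"
 have 1: "Y_tens B n (sing_boundary (frag_of s)) (cube_class n r) = model_class B n (cobd (face_tn s) [0..<Suc (fst s)] r)"
  using model_class_chain_tn[OF chain_tn_boundary(1)[OF s] r] chain_tn_boundary(2)[OF s, of r] by simp
 have sp1: "cobd (face_tn s) [0..<Suc (fst s)] r \<in> frag_span (model_cells B n)"
  using chain_tn_span[OF chain_tn_boundary(1)[OF s] r] chain_tn_boundary(2)[OF s, of r] by simp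
 have dr: "cube_d r \<in> qchains n" by (rule cube_d_qchains[OF r])
 have 2: "Y_tens B n (frag_of s) (L_diff n (cube_class n r)) [^]\<^bsub>Y_group B n\<^esub> ((-1) ^ fst s :: int)
  = model_class B n (signed (fst s) (tn s (cube_d r)))"
  unfolding L_diff_cube_class[OF r] model_class_apply(5)[OF tn_model_span[OF s dr]] model_class_tn[OF s dr] ..
 show "Y_tens B n (sing_boundary (frag_of (fst s, snd s))) (cube_class n r) \<otimes>\<^bsub>Y_group B n\<^esub>
  Y_tens B n (frag_of (fst s, snd s)) (L_diff n (cube_class n r)) [^]\<^bsub>Y_group B n\<^esub> ((-1) ^ fst s :: int)
  = model_class B n (D0_op (tn s r))"
  unfolding prod.collapse 1 2 D0_op_tn[OF s]
  by (rule model_class_apply(2)[symmetric, OF sp1 frag_span_signed[OF tn_model_span[OF s dr]]])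
qed

definition act_op :: "int => ('a simplex => nat list => 'p cring) => ('a, 'p::ab_group_add) cell_module => ('a, 'p) cell_module" where
 "act_op k F = (if even k then cap_op F else alt_cap_op F)"

lemma act_op_tn:
 fixes r :: "'p::ab_group_add cring"
 shows
 "act_op k F (tn s r) = (\<Sum>j<Suc (fst s). signed (if even (k * int j) then 0 else 1)
  (face_tn s [0..<Suc j] (F s [j..<Suc (fst s)] * r)))"
proof -
 let ?l = "[0..<Suc (fst s)]"
 have td: "take (Suc j) ?l = [0..<Suc j]" "drop j ?l = [j..<Suc (fst s)]" if "j < Suc (fst s)" for j
  using that by (simp_all add: take_upt drop_upt del: upt_Suc)
 have "act_op k F (tn s r) = (\<Sum>j<length ?l. signed (if even (k * int j) then 0 else 1)
  (face_tn s (take (Suc j) ?l) (F s (drop j ?l) * r)))"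
 proof (cases "even k")
  case True
  then show ?thesis by (simp add: act_op_def cap_op_tn cup_push_apply del: upt_Suc sum.lessThan_Suc)
 next
  case False
  have "alt (face_tn s) (take (Suc j) ?l) x = signed (if even (k * int j) then 0 else 1) (face_tn s (take (Suc j) ?l) x)"
   if "j < length ?l" for j and x :: "'p cring"
   using that False by (auto simp: alt_def signed_def signed_fun_apply simp del: upt_Suc)
  then show ?thesis
   using False by (simp add: act_op_def alt_cap_op_tn cup_push_apply del: upt_Suc sum.lessThan_Suc cong: sum.cong_simp)
 qed
 also have "... = (\<Sum>j<Suc (fst s). signed (if even (k * int j) then 0 else 1)
  (face_tn s [0..<Suc j] (F s [j..<Suc (fst s)] * r)))"
  by (rule sum.cong) (simp_all only: length_upt diff_zero td lessThan_iff)
 finally show ?thesis .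
qed

text \<open>By naturality the value of \<open>x\<close> at the back face of a simplex is the value of
 \<open>F\<close> at the back part of its vertex list.\<close>

lemma realizes_Y_act:
 fixes F :: "'a simplex => nat list => 'p::ab_group_add cring"
 assumes F: "graded_family B n k F" "natural_family F"
  and x: "\<And>s. s \<in> simplices B ==> x (frag_of s) = cube_class n (F s [0..<Suc (fst s)])"
 shows "realizes B n k (Y_act B n k x) (act_op k F)"
 unfolding Y_act_def
proof (rule realizes_Y_hom)
 show "degree_op B n k (act_op k F)"
  using degree_op_cap[OF F(1)] by (simp add: act_op_def)
 fix s :: "'a simplex" and r :: "'p cring" assume s: "s \<in> simplices B" and r: "r \<in> qchains n"
 interpret Y: comm_group "Y_group B n :: ('a, 'p) model monoid" by (rule Y_comm_group)
 obtain p \<sigma> where ps: "s = (p, \<sigma>)" by (cases s) auto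
 let ?e = "%j. if even (k * int j) then 0 else 1 :: nat"
 let ?t = "%j. tn (j, vertex_face [0..<Suc j] \<sigma>) (F s [j..<Suc p] * r)"
 have front: "face_simplex s [0..<Suc j] = (j, vertex_face [0..<Suc j] \<sigma>)" if "j \<le> p" for j
 proof -
  have "set [0..<Suc j] \<subseteq> {..p}" using that by auto
  from map_min_upt[OF this] show ?thesis by (simp add: face_simplex_def ps del: upt_Suc)
 qed
 have rear: "face_simplex s [j..<Suc p] = (p - j, vertex_face [j..<Suc p] \<sigma>)" if "j \<le> p" for j
 proof -
  have "set [j..<Suc p] \<subseteq> {..p}" by auto
  from map_min_upt[OF this] show ?thesis
   using that by (simp add: face_simplex_def ps Suc_diff_le del: upt_Suc)
 qed
 have Fq: "F s [j..<Suc p] \<in> qchains n" if "j \<le> p" for j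
  using F(1)[unfolded graded_family_def, rule_format, OF s, of "[j..<Suc p]"] that
  by (auto intro: graded_qchains simp del: upt_Suc)
 have fs: "(j, vertex_face [0..<Suc j] \<sigma>) \<in> simplices B" "(p - j, vertex_face [j..<Suc p] \<sigma>) \<in> simplices B" if "j \<le> p" for j
  using face_simplex_in_simplices[OF s, of "[0..<Suc j]"] face_simplex_in_simplices[OF s, of "[j..<Suc p]"]
   front[OF that] rear[OF that] that by (auto simp del: upt_Suc)
 have tq: "?t j \<in> frag_span (model_cells B n)" if "j \<le> p" for j
  by (rule tn_model_span[OF fs(1)[OF that] mult_qchains[OF Fq[OF that] r]])
 have summand: "Y_tens B n (frag_of (j, vertex_face [0..<Suc j] \<sigma>))
    (L_mult n (x (frag_of (p - j, vertex_face [j..<Suc p] \<sigma>))) (cube_class n r))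
   [^]\<^bsub>Y_group B n\<^esub> (if even (k * int j) then 1 else - 1 :: int)
  = model_class B n (signed (?e j) (?t j))" if j: "j \<le> p" for j
 proof -
  have "x (frag_of (p - j, vertex_face [j..<Suc p] \<sigma>)) = cube_class n (F (face_simplex s [j..<Suc p]) [0..<length [j..<Suc p]])"
   using x[OF fs(2)[OF j]] rear[OF j] j by (simp add: Suc_diff_le del: upt_Suc)
  also have "F (face_simplex s [j..<Suc p]) [0..<length [j..<Suc p]] = F s [j..<Suc p]"
   using natural_family_map[OF F(2), of "[j..<Suc p]" s "[0..<length [j..<Suc p]]"] j map_reindex[of "[j..<Suc p]"]
   by (simp del: upt_Suc)
  finally have "L_mult n (x (frag_of (p - j, vertex_face [j..<Suc p] \<sigma>))) (cube_class n r) = cube_class n (F s [j..<Suc p] * r)"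
   using L_mult_cube_class[OF Fq[OF j] r] by simp
  then show ?thesis
   using model_class_apply(5)[OF tq[OF j], of "?e j"] model_class_tn[OF fs(1)[OF j] mult_qchains[OF Fq[OF j] r]]
   by simp
 qed
 have "(\<Otimes>\<^bsub>Y_group B n\<^esub>i\<in>{..p}. Y_tens B n (frag_of (i, vertex_face [0..<Suc i] \<sigma>))
    (L_mult n (x (frag_of (p - i, vertex_face [i..<Suc p] \<sigma>))) (cube_class n r))
   [^]\<^bsub>Y_group B n\<^esub> (if even (k * int i) then 1 else - 1 :: int))
  = (\<Otimes>\<^bsub>Y_group B n\<^esub>i\<in>{..p}. model_class B n (signed (?e i) (?t i)))"
 proof (rule Y.finprod_cong')
  show "(%i. model_class B n (signed (?e i) (?t i))) \<in> {..p} \<rightarrow> carrier (Y_group B n)"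
   using tq by (intro Pi_I model_class_apply(1) frag_span_signed) (simp only: atMost_iff)
 qed (simp_all only: atMost_iff summand)
 also have "... = model_class B n (\<Sum>i\<in>{..p}. signed (?e i) (?t i))"
 proof (rule model_class_sum[symmetric])
  show "signed (?e i) (?t i) \<in> frag_span (model_cells B n)" if "i \<in> {..p}" for i
   using tq[of i] that by (intro frag_span_signed) simp
 qed simp
 also have "(\<Sum>i\<in>{..p}. signed (?e i) (?t i)) = act_op k F (tn s r)"
  unfolding act_op_tn
  by (rule sum.cong) (auto simp: ps face_tn_def front[unfolded ps] simp del: upt_Suc)
 finally show "(\<Otimes>\<^bsub>Y_group B n\<^esub>i\<in>{..fst s}. Y_tens B n (frag_of (i, vertex_face [0..<Suc i] (snd s)))
    (L_mult n (x (frag_of (fst s - i, vertex_face [i..<Suc (fst s)] (snd s)))) (cube_class n r))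
   [^]\<^bsub>Y_group B n\<^esub> (if even (k * int i) then 1 else - 1 :: int)) = model_class B n (act_op k F (tn s r))"
  by (simp add: ps del: upt_Suc)
qed

lemma realizes_mult:
 fixes P Q :: "('a, 'p::ab_group_add) cell_module => ('a, 'p) cell_module"
 assumes "realizes B n k \<phi> P" "realizes B n k \<psi> Q"
 shows "realizes B n k (\<lambda>y. \<phi> y \<otimes>\<^bsub>Y_group B n\<^esub> \<psi> y) (\<lambda>x. P x + Q x)"
 unfolding realizes_def
proof (intro conjI ballI)
 show "degree_op B n k (%x. P x + Q x)" using degree_op_add assms unfolding realizes_def by blast
 show "(%y. \<phi> y \<otimes>\<^bsub>Y_group B n\<^esub> \<psi> y) \<in> hom (Y_group B n) (Y_group B n)"
  using assms unfolding realizes_def by (intro hom_pointwise_mult[OF Y_comm_group]) blast+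
 fix x :: "('a, 'p) cell_module" assume x: "x \<in> frag_span (model_cells B n)"
 have "P x \<in> frag_span (model_cells B n)" "Q x \<in> frag_span (model_cells B n)"
  using assms degree_op_cells[OF _ x] unfolding realizes_def by blast+
 then show "\<phi> (model_class B n x) \<otimes>\<^bsub>Y_group B n\<^esub> \<psi> (model_class B n x) = model_class B n (P x + Q x)"
  using assms x by (simp add: realizes_def model_class_apply(2))
qed

section \<open>The twisted differential, the gauge maps and their homotopies on the model\<close>

text \<open>A cochain of \<open>B\<close> is specified only on \<open>n\<close>-simplices, and these are
 the only ones that matter.\<close>

lemma gauge_cochain_cong:
 assumes "\<And>l. length l = n + 1 ==> c l = c' l"
 shows "gauge_cochain n \<zeta> c = gauge_cochain n \<zeta> c'"
proof -
 have t: "twist_cochain n (lab_cocycle \<zeta> (top_cochain c)) = twist_cochain n (lab_cocycle \<zeta> (top_cochain c'))"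
 proof
  fix L :: "('a \<times> nat) list"
  show "twist_cochain n (lab_cocycle \<zeta> (top_cochain c)) L = twist_cochain n (lab_cocycle \<zeta> (top_cochain c')) L"
  proof (rule twist_cochain_cong)
   fix L' :: "('a \<times> nat) list" assume "length L' = n + 2"
   then have "cobd (top_cochain c) L' = cobd (top_cochain c') L'"
    by (intro cobd_cong) (simp add: top_cochain_def assms)
   then show "lab_cocycle \<zeta> (top_cochain c) L' = lab_cocycle \<zeta> (top_cochain c') L'"
    by (simp add: lab_cocycle_def)
  qed
 qed
 show ?thesis unfolding gauge_cochain_def t ..
qed

lemma vertex_face_chain:
 assumes "s \<in> simplices B" "length l = q + 1"
 shows "frag_of (vertex_face (map (min (fst s)) l) (snd s)) \<in> carrier (chain_group q B)"
proof -
 have "l \<noteq> []" using assms by auto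
 from face_simplex_in_simplices[OF assms(1) this] show ?thesis
  using assms(2) by (simp add: face_simplex_def simplices_def singular_chain_of)
qed

lemma list_cochain_apply:
 "length l = q + 1 ==> list_cochain c s l = c (frag_of (vertex_face (map (min (fst s)) l) (snd s)))"
 by (auto simp: list_cochain_def)

lemma list_cochain_mult:
 assumes "s \<in> simplices B" "length l = n + 1"
 shows "list_cochain (c \<otimes>\<^bsub>cochain_group n B\<^esub> c') s l = (list_cochain c s + list_cochain c' s) l"
 using vertex_face_chain[OF assms] assms(2)
 by (simp add: list_cochain_apply cochain_group_def Hom_group_def additive_group_def)

lemma list_cochain_one:
 assumes "s \<in> simplices B" "length l = n + 1"
 shows "list_cochain \<one>\<^bsub>cochain_group n B\<^esub> s l = (0 :: nat list => 'p::ab_group_add) l"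
 using vertex_face_chain[OF assms] assms(2)
 by (simp add: list_cochain_apply cochain_group_def Hom_group_def additive_group_def)

lemma list_cochain_coboundary:
 assumes "n \<ge> 1" "b \<in> carrier (cochain_group (n - 1) B)" "s \<in> simplices B" "length l = n + 1"
 shows "list_cochain (coboundary (n - 1) B b) s l = cobd (list_cochain b s) l"
 using cobd_list_cochain[OF assms(2,3), of l] vertex_face_chain[OF assms(3,4)] assms(1,4)
 by (simp add: list_cochain_apply coboundary_def)

lemma Y_part_eq:
 fixes B :: "'a topology"
 shows "(Y_part B n m :: ('a, 'p::ab_group_add) model monoid)
  = subgroup_generated (Y_group B n) (model_class B n ` frag_of ` part_cells B n m)"
proof -
 have "{Y_tens B n (frag_of s) (L_class n t) | s t. s \<in> simplices B \<and> t \<in> L_cubes n \<and> int (fst s) + int (fst t) = m}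
  = (model_class B n ` frag_of ` part_cells B n m :: ('a, 'p) model set)" (is "?L = ?R")
 proof (intro equalityI subsetI)
  fix y assume "y \<in> ?L"
  then obtain s t where y: "y = Y_tens B n (frag_of s) (L_class n t)" and s: "s \<in> simplices B"
   and t: "t \<in> L_cubes n" "int (fst s) + int (fst t) = m" by (elim CollectE exE conjE)
  obtain c where c: "t = Rep_qcube c" using L_cubes_Rep[OF t(1)] by blast
  have "(s, c) \<in> part_cells B n m" using s t by (simp add: part_cells_def model_cells_def c Rep_qcube_eq)
  moreover have "y = model_class B n (frag_of (s, c))" using model_class_of[OF s, of c n] t(1) by (simp add: y c)
  ultimately show "y \<in> ?R" by (intro image_eqI[of _ _ "frag_of (s, c)"] imageI)
 next
  fix y assume "y \<in> ?R"
  then obtain sc where y: "y = model_class B n (frag_of sc)" and "sc \<in> part_cells B n m" by (elim imageE) simp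
  then have s: "fst sc \<in> simplices B" and c: "Rep_qcube (snd sc) \<in> L_cubes n"
   and m: "int (fst (fst sc)) + int (fst (Rep_qcube (snd sc))) = m"
   by (auto simp: part_cells_def model_cells_def Rep_qcube_eq)
  have "y = Y_tens B n (frag_of (fst sc)) (L_class n (Rep_qcube (snd sc)))"
   using model_class_of[OF s c] y by simp
  then show "y \<in> ?L" using s c m by (intro CollectI exI conjI)
 qed
 then show ?thesis by (simp only: Y_part_def)
qed

lemma model_class_hom_part:
 "model_class B n \<in> hom (free_Abelian_group (part_cells B n m)) (Y_group B n)"
 by (rule free_homI) (simp_all add: model_class_apply frag_span_mono[OF part_cells_subset])

lemma Y_part_carrier:
 fixes B :: "'a topology"
 shows "(carrier (Y_part B n m) :: ('a, 'p::ab_group_add) model set) = model_class B n ` frag_span (part_cells B n m)"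
proof -
 interpret Y: comm_group "Y_group B n :: ('a, 'p) model monoid" by (rule Y_comm_group)
 let ?C = "part_cells B n m :: ('a simplex \<times> 'p qcube) set"
 let ?F = "free_Abelian_group ?C"
 have sub: "model_class B n ` frag_of ` ?C \<subseteq> model_class B n ` frag_span ?C"
  by auto
 have im: "subgroup (model_class B n ` carrier ?F) (Y_group B n)"
  by (rule subgroup_hom_image[OF _ Y.is_group model_class_hom_part]) simp
 have "generate (Y_group B n) (model_class B n ` frag_of ` ?C) \<subseteq> model_class B n ` frag_span ?C"
  using generate_subset_subgroup[OF Y.is_group im] sub by (simp only: frag_span_carrier)
 moreover have "model_class B n x \<in> generate (Y_group B n) (model_class B n ` frag_of ` ?C)"
  if "x \<in> frag_span ?C" for x
  by (rule generate_image[OF _ Y.is_group model_class_hom_part])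
   (use that generate_free_Abelian_group[of ?C] in \<open>auto simp: frag_span_carrier\<close>)
 moreover have "carrier (Y_group B n) \<inter> model_class B n ` frag_of ` ?C = model_class B n ` frag_of ` ?C"
  by (auto intro!: model_class_apply(1) dest: subsetD[OF part_cells_subset])
 ultimately show ?thesis
  unfolding Y_part_eq carrier_subgroup_generated by auto
qed

lemma Y_part_mult: "x \<otimes>\<^bsub>Y_part B n m\<^esub> y = x \<otimes>\<^bsub>Y_group B n\<^esub> y"
 and Y_part_one: "\<one>\<^bsub>Y_part B n m\<^esub> = \<one>\<^bsub>Y_group B n\<^esub>"
 by (simp_all add: Y_part_def subgroup_generated_def)

lemma Y_part_comm_group: "comm_group (Y_part B n m)"
 unfolding Y_part_def by (rule group.abelian_subgroup_generated[OF comm_group.axioms(2)[OF Y_comm_group] Y_comm_group])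

lemma Y_part_inv: "y \<in> carrier (Y_part B n m) ==> inv\<^bsub>Y_part B n m\<^esub> y = inv\<^bsub>Y_group B n\<^esub> y"
 unfolding Y_part_def by (rule group.inv_subgroup_generated[OF comm_group.axioms(2)[OF Y_comm_group]])

lemma Y_part_carrier_Y: "y \<in> carrier (Y_part B n m) ==> y \<in> carrier (Y_group B n)"
 unfolding Y_part_carrier using model_class_apply(1) frag_span_mono[OF part_cells_subset] by blast

lemma realizesD:
 assumes "realizes B n k \<phi> P"
 shows "degree_op B n k P" "\<phi> \<in> hom (Y_group B n) (Y_group B n)"
  and "x \<in> frag_span (model_cells B n) ==> \<phi> (model_class B n x) = model_class B n (P x)"
 using assms unfolding realizes_def by blast+

lemma realizes_hom:
 fixes \<phi> :: "('a, 'p::ab_group_add) model => ('a, 'p) model"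
 assumes "realizes B n k \<phi> P"
 shows "\<phi> \<in> hom (Y_part B n m) (Y_part B n (m - k))"
proof (rule homI)
 fix y :: "('a, 'p) model" assume y: "y \<in> carrier (Y_part B n m)"
 then obtain x where x: "x \<in> frag_span (part_cells B n m)" "y = model_class B n x" unfolding Y_part_carrier by blast
 have "\<phi> y = model_class B n (P x)"
  using realizesD(3)[OF assms frag_span_mono[OF part_cells_subset x(1)]] x(2) by simp
 then show "\<phi> y \<in> carrier (Y_part B n (m - k))"
  unfolding Y_part_carrier using degree_op_part[OF realizesD(1)[OF assms] x(1)] by blast
 fix y' :: "('a, 'p) model" assume "y' \<in> carrier (Y_part B n m)"
 then show "\<phi> (y \<otimes>\<^bsub>Y_part B n m\<^esub> y') = \<phi> y \<otimes>\<^bsub>Y_part B n (m - k)\<^esub> \<phi> y'"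
  unfolding Y_part_mult using hom_mult[OF realizesD(2)[OF assms]] y Y_part_carrier_Y by blast
qed

lemma twist_graded_family:
 assumes n: "n \<ge> 1" and z: "z \<in> cocycles (n + 1) B"
 shows "graded_family B n 1 (\<lambda>s. twist_cochain n (list_cochain z s))"
 unfolding graded_family_def
proof (intro ballI allI impI)
 fix s :: "'a simplex" and l :: "nat list" assume s: "s \<in> simplices B" and l: "l \<noteq> []"
 show "twist_cochain n (list_cochain z s) l \<in> graded n (int (length l) - 1 - 1)"
 proof (cases "length l \<le> 1")
  case True
  then have "twist_cochain n (list_cochain z s) l = 0" using twist_cochain_2[OF n, of l] by simp
  then show ?thesis by (simp add: graded_def)
 next
  case False
  then have "int (length l) - 1 - 1 = int (length l - 2)" by simp
  then show ?thesis using twist_part[OF z s, of l] by (simp only: cube_part_graded)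
 qed
qed

lemma gauge_graded_family:
 assumes z: "z \<in> cocycles (n + 1) B"
 shows "graded_family B n 0 (\<lambda>s. gauge_cochain n (list_cochain z s) (list_cochain c s))"
 unfolding graded_family_def
proof (intro ballI allI impI)
 fix s :: "'a simplex" and l :: "nat list" assume s: "s \<in> simplices B" and l: "l \<noteq> []"
 then have "int (length l) - 1 - 0 = int (length l - 1)" by (cases l) auto
 then show "gauge_cochain n (list_cochain z s) (list_cochain c s) l \<in> graded n (int (length l) - 1 - 0)"
  using gauge_part[OF z s, of "list_cochain c s" l] by (simp only: cube_part_graded)
qed

lemma triangle_graded_family:
 assumes z: "z \<in> cocycles (n + 1) B"
 shows "graded_family B n (- 1) (\<lambda>s. triangle_cochain n (list_cochain z s) (e s))"
 unfolding graded_family_def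
 using triangle_part[OF z] by (simp add: cube_part_graded)

lemma realizes_Yz_diff:
 assumes n: "n \<ge> 1" and z: "z \<in> cocycles (n + 1) B"
 shows "realizes B n 1 (Yz_diff B n z) (D_op (\<lambda>s. twist_cochain n (list_cochain z s)))"
proof -
 have "realizes B n 1 (%y. Y_diff B n y \<otimes>\<^bsub>Y_group B n\<^esub> Y_act B n 1 (alg_a B n z) y)
  (%x. D0_op x + act_op 1 (%s. twist_cochain n (list_cochain z s)) x)"
  by (intro realizes_mult realizes_Y_diff realizes_Y_act twist_graded_family natural_twist alg_a_value n z)
 then show ?thesis
  by (simp add: Yz_diff_def[abs_def] D_op_split[abs_def] act_op_def)
qed

lemma realizes_phi:
 assumes n: "n \<ge> 1" and z: "z \<in> cocycles (n + 1) B"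
 shows "realizes B n 0 (phi B n c z) (cap_op (\<lambda>s. gauge_cochain n (list_cochain z s) (list_cochain c s)))"
proof -
 have "realizes B n 0 (phi B n c z) (act_op 0 (%s. gauge_cochain n (list_cochain z s) (list_cochain c s)))"
  unfolding phi_def by (intro realizes_Y_act gauge_graded_family natural_gauge alg_gauge_value n z)
 then show ?thesis by (simp add: act_op_def)
qed

lemma realizes_homotopy:
 fixes h :: "'a simplex => nat list => 'p::ab_group_add cring"
 assumes h: "graded_family B n (- 1) h" "natural_family h"
 obtains K where "realizes B n (- 1) K (alt_cap_op h)"
proof
 let ?x = "alg_elt B n (%s. cube_class n (h s [0..<Suc (fst s)]))"
 have hq: "cube_class n (h s [0..<Suc (fst s)]) \<in> carrier (L_chains n)" if "s \<in> simplices B" for s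
  using h(1)[unfolded graded_family_def, rule_format, OF that, of "[0..<Suc (fst s)]"]
  by (intro cube_class_closed) (auto intro: graded_qchains simp del: upt_Suc)
 have "realizes B n (- 1) (Y_act B n (- 1) ?x) (act_op (- 1) h)"
  by (rule realizes_Y_act[OF h]) (rule alg_elt_of[OF hq])
 then show "realizes B n (- 1) (Y_act B n (- 1) ?x) (alt_cap_op h)" by (simp add: act_op_def)
qed

lemma Y_part_obtain:
 assumes "y \<in> carrier (Y_part B n m)"
 obtains x where "x \<in> frag_span (part_cells B n m)" "x \<in> frag_span (model_cells B n)" "y = model_class B n x"
 using assms unfolding Y_part_carrier using frag_span_mono[OF part_cells_subset] by blast

lemma Yz_diff_square:
 assumes n: "n \<ge> 1" and z: "z \<in> cocycles (n + 1) B" and y: "y \<in> carrier (Y_part B n m)"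
 shows "Yz_diff B n z (Yz_diff B n z y) = \<one>\<^bsub>Y_group B n\<^esub>"
proof -
 let ?D = "D_op (%s. twist_cochain n (list_cochain z s))"
 obtain x where x: "x \<in> frag_span (model_cells B n)" "y = model_class B n x" using Y_part_obtain[OF y] .
 note R = realizes_Yz_diff[OF n z]
 note add = degree_opD(1)[OF realizesD(1)[OF R]]
 have "?D (?D x) = 0"
  by (rule cells_eqI[of "%x. ?D (?D x)" "%x. 0" B n x])
   (simp_all only: add D_op_D_op[OF natural_twist twisting_twist_cochain[OF n]] add_0_left x(1))
 then show ?thesis
  using realizesD(3)[OF R] x degree_op_cells[OF realizesD(1)[OF R] x(1)] model_class_apply(3)[of B n] by simp
qed

lemma phi_Yz_diff:
 assumes n: "n \<ge> 1" and z: "z \<in> cocycles (n + 1) B" and c: "c \<in> cocycles n B" and y: "y \<in> carrier (Y_part B n m)"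
 shows "phi B n c z (Yz_diff B n z y) = Yz_diff B n z (phi B n c z y)"
proof -
 let ?D = "D_op (%s. twist_cochain n (list_cochain z s))"
 let ?U = "cap_op (%s. gauge_cochain n (list_cochain z s) (list_cochain c s))"
 obtain x where x: "x \<in> frag_span (model_cells B n)" "y = model_class B n x" using Y_part_obtain[OF y] .
 note R = realizes_Yz_diff[OF n z] and RU = realizes_phi[OF n z, of c]
 note add = degree_opD(1)[OF realizesD(1)[OF R]] degree_opD(1)[OF realizesD(1)[OF RU]]
 have "?D (?U x) = ?U (?D x)"
 proof (rule cells_eqI[of "%x. ?D (?U x)" "%x. ?U (?D x)" B n x])
  show "?D (?U (tn s (frag_of c'))) = ?U (?D (tn s (frag_of c')))" if "s \<in> simplices B" for s c'
   by (rule D_op_cap_op[OF natural_twist natural_gauge gauge_gauge_cochain[OF n]])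
    (rule cocycle_list_cochain[OF c that])
 qed (simp_all only: add x(1))
 then show ?thesis
  using realizesD(3)[OF R] realizesD(3)[OF RU] x degree_op_cells[OF realizesD(1)[OF R] x(1)]
   degree_op_cells[OF realizesD(1)[OF RU] x(1)] by simp
qed

text \<open>The homotopy may depend on the degree, because a carrier does not determine the group in
 which inverses and products are taken.\<close>

definition homotopic :: "(int => ('a, 'c) monoid_scheme) => ('a => 'a) => ('a => 'a) => ('a => 'a) => bool" where
 "homotopic P D \<phi> \<psi> \<longleftrightarrow> (\<exists>K. \<forall>m. K m \<in> hom (P m) (P (m + 1)) \<and>
  (\<forall>y\<in>carrier (P m). \<phi> y = \<psi> y \<otimes>\<^bsub>P m\<^esub> (D (K m y) \<otimes>\<^bsub>P m\<^esub> K (m - 1) (D y))))"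

lemma homotopicI:
 assumes "\<And>m. K \<in> hom (Y_part B n m) (Y_part B n (m + 1))"
  and "\<And>m y. y \<in> carrier (Y_part B n m) ==> \<phi> y = \<psi> y \<otimes>\<^bsub>Y_group B n\<^esub> (D (K y) \<otimes>\<^bsub>Y_group B n\<^esub> K (D y))"
 shows "homotopic (Y_part B n) D \<phi> \<psi>"
 unfolding homotopic_def Y_part_mult
 by (rule exI[of _ "\<lambda>m. K"], intro allI conjI ballI) (rule assms(1), erule assms(2))

lemma phi_homotopy:
 fixes z c1 c2 c3 :: "'a chain => 'p::ab_group_add"
 assumes n: "n \<ge> 1" and z: "z \<in> cocycles (n + 1) B"
  and h: "graded_family B n (- 1) h" "natural_family h"
  and hom: "\<And>s. s \<in> simplices B ==> cubical.gauge_homotopy (twist_cochain n (list_cochain z s)) (twist_cochain n (list_cochain z s)) (h s)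
   (cup (*) (gauge_cochain n (list_cochain z s) (list_cochain c1 s)) (gauge_cochain n (list_cochain z s) (list_cochain c2 s))
    - gauge_cochain n (list_cochain z s) (list_cochain c3 s))"
 shows "homotopic (Y_part B n) (Yz_diff B n z) (\<lambda>y. phi B n c1 z (phi B n c2 z y)) (phi B n c3 z)"
proof -
 obtain K where RK: "realizes B n (- 1) K (alt_cap_op h)" using realizes_homotopy[OF h] .
 let ?D = "D_op (%s. twist_cochain n (list_cochain z s))" and ?H = "alt_cap_op h"
 let ?u = "%c s. gauge_cochain n (list_cochain z s) (list_cochain c s)"
 note R = realizes_Yz_diff[OF n z] and RU = realizes_phi[OF n z]
 note add = degree_opD(1)[OF realizesD(1)[OF R]] degree_opD(1)[OF realizesD(1)[OF RU]] degree_opD(1)[OF realizesD(1)[OF RK]]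
 note cells = degree_op_cells[OF realizesD(1)[OF R]] degree_op_cells[OF realizesD(1)[OF RU]] degree_op_cells[OF realizesD(1)[OF RK]]
 have eq: "cap_op (?u c1) (cap_op (?u c2) x) = cap_op (?u c3) x + (?D (?H x) + ?H (?D x))"
  if x: "x \<in> frag_span (model_cells B n)" for x
 proof (rule cells_eqI[of "%x. cap_op (?u c1) (cap_op (?u c2) x)" "%x. cap_op (?u c3) x + (?D (?H x) + ?H (?D x))" B n x])
  fix s :: "'a simplex" and c :: "'p qcube" assume s: "s \<in> simplices B"
  show "cap_op (?u c1) (cap_op (?u c2) (tn s (frag_of c)))
   = cap_op (?u c3) (tn s (frag_of c)) + (?D (?H (tn s (frag_of c))) + ?H (?D (tn s (frag_of c))))"
   using homotopy_op[of "%s. twist_cochain n (list_cochain z s)" h s "%s. cup (*) (?u c1 s) (?u c2 s)" "?u c3" "frag_of c",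
     OF natural_twist h(2) hom[OF s]]
    cap_op_cap_op[OF natural_gauge, of n z c1 "?u c2" s "frag_of c"] by simp
 next
  show "cap_op (?u c1) (cap_op (?u c2) (x + y)) = cap_op (?u c1) (cap_op (?u c2) x) + cap_op (?u c1) (cap_op (?u c2) y)" for x y
   by (simp only: add)
  show "cap_op (?u c3) (x + y) + (?D (?H (x + y)) + ?H (?D (x + y)))
   = cap_op (?u c3) x + (?D (?H x) + ?H (?D x)) + (cap_op (?u c3) y + (?D (?H y) + ?H (?D y)))" for x y
   by (simp only: add) (simp add: algebra_simps)
 qed (rule x)
 show ?thesis
 proof (rule homotopicI[of K])
  show "K \<in> hom (Y_part B n m) (Y_part B n (m + 1))" for m using realizes_hom[OF RK, of m] by simp
  fix m and y :: "('a, 'p) model" assume "y \<in> carrier (Y_part B n m)"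
  then obtain x where x: "x \<in> frag_span (model_cells B n)" "y = model_class B n x" by (rule Y_part_obtain)
  show "phi B n c1 z (phi B n c2 z y)
   = phi B n c3 z y \<otimes>\<^bsub>Y_group B n\<^esub> (Yz_diff B n z (K y) \<otimes>\<^bsub>Y_group B n\<^esub> K (Yz_diff B n z y))"
   using eq[OF x(1)] x(1) cells
   by (simp add: x(2) realizesD(3)[OF R] realizesD(3)[OF RU] realizesD(3)[OF RK] model_class_apply frag_span_add)
 qed
qed

lemma phi_product:
 fixes z c c' :: "'a chain => 'p::ab_group_add"
 assumes n: "n \<ge> 1" and z: "z \<in> cocycles (n + 1) B" and c: "c \<in> cocycles n B" "c' \<in> cocycles n B"
 shows "homotopic (Y_part B n) (Yz_diff B n z) (\<lambda>y. phi B n c z (phi B n c' z y)) (phi B n (c \<otimes>\<^bsub>cochain_group n B\<^esub> c') z)"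
proof (rule phi_homotopy[OF n z triangle_graded_family[OF z] natural_sum_triangle])
 fix s :: "'a simplex" assume s: "s \<in> simplices B"
 show "cubical.gauge_homotopy (twist_cochain n (list_cochain z s)) (twist_cochain n (list_cochain z s))
   (triangle_cochain n (list_cochain z s) (sum_triangle (list_cochain c s) (list_cochain c' s)))
   (cup (*) (gauge_cochain n (list_cochain z s) (list_cochain c s)) (gauge_cochain n (list_cochain z s) (list_cochain c' s))
    - gauge_cochain n (list_cochain z s) (list_cochain (c \<otimes>\<^bsub>cochain_group n B\<^esub> c') s))"
 proof -
  have eq: "gauge_cochain n (list_cochain z s) (list_cochain (c \<otimes>\<^bsub>cochain_group n B\<^esub> c') s)
   = gauge_cochain n (list_cochain z s) (list_cochain c s + list_cochain c' s)"
   by (rule gauge_cochain_cong) (rule list_cochain_mult[OF s])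
  show ?thesis
   unfolding eq by (rule gauge_product_homotopy[OF n]) (use cocycle_list_cochain[OF _ s] c in auto)
 qed
qed

lemma phi_coboundary:
 fixes z b :: "'a chain => 'p::ab_group_add"
 assumes n: "n \<ge> 1" and z: "z \<in> cocycles (n + 1) B" and b: "b \<in> carrier (cochain_group (n - 1) B)"
 shows "homotopic (Y_part B n) (Yz_diff B n z) (\<lambda>y. phi B n (coboundary (n - 1) B b) z (phi B n \<one>\<^bsub>cochain_group n B\<^esub> z y)) (phi B n \<one>\<^bsub>cochain_group n B\<^esub> z)"
proof (rule phi_homotopy[OF n z triangle_graded_family[OF z] natural_cobd_triangle])
 fix s :: "'a simplex" assume s: "s \<in> simplices B"
 show "cubical.gauge_homotopy (twist_cochain n (list_cochain z s)) (twist_cochain n (list_cochain z s))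
   (triangle_cochain n (list_cochain z s) (cobd_triangle (list_cochain b s)))
   (cup (*) (gauge_cochain n (list_cochain z s) (list_cochain (coboundary (n - 1) B b) s)) (gauge_cochain n (list_cochain z s) (list_cochain \<one>\<^bsub>cochain_group n B\<^esub> s))
    - gauge_cochain n (list_cochain z s) (list_cochain \<one>\<^bsub>cochain_group n B\<^esub> s))"
 proof -
  have eq: "gauge_cochain n (list_cochain z s) (list_cochain (coboundary (n - 1) B b) s)
    = gauge_cochain n (list_cochain z s) (cobd (list_cochain b s))"
   "gauge_cochain n (list_cochain z s) (list_cochain \<one>\<^bsub>cochain_group n B\<^esub> s) = gauge_cochain n (list_cochain z s) 0"
   by (rule gauge_cochain_cong, erule list_cochain_coboundary[OF n b s],
     rule gauge_cochain_cong, erule list_cochain_one[OF s])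
  show ?thesis
   unfolding eq by (rule gauge_coboundary_homotopy[OF n])
 qed
qed

definition low_cells :: "'a topology => nat => int => nat => ('a simplex \<times> 'p::ab_group_add qcube) set" where
 "low_cells B n m k = {(s, c) \<in> part_cells B n m. fst s < k}"

lemma tn_low:
 assumes "tn s r \<in> frag_span (part_cells B n m)" "fst s < k"
 shows "tn s r \<in> frag_span (low_cells B n m k)"
proof -
 have "tn s r \<in> frag_span ({s} \<times> UNIV)" by (rule tn_span) (simp_all add: frag_span_def)
 with assms(1) have "tn s r \<in> frag_span (part_cells B n m \<inter> ({s} \<times> UNIV))"
  unfolding frag_span_def by blast
 then show ?thesis
  by (rule frag_span_mono[rotated]) (use assms(2) in \<open>auto simp: low_cells_def\<close>)
qed

text \<open>In \<open>1 + u(c, z)\<close> the unit part restores the full simplex, and the other term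
 with the full simplex as front part involves only an edge, where the twisting cochain vanishes.\<close>

lemma phi_one_lowers:
 fixes z :: "'a chain => 'p::ab_group_add"
 assumes n: "n \<ge> 1" and z: "z \<in> cocycles (n + 1) B" and x: "x \<in> frag_span (low_cells B n m (Suc k))"
 shows "x - cap_op (\<lambda>s. gauge_cochain n (list_cochain z s) (list_cochain c s)) x \<in> frag_span (low_cells B n m k)"
proof (rule additive_into_span[of "%x. x - cap_op (%s. gauge_cochain n (list_cochain z s) (list_cochain c s)) x" "low_cells B n m (Suc k)"])
 let ?u = "%s. gauge_cochain n (list_cochain z s) (list_cochain c s)"
 let ?v = "%s. unit_cochain - ?u s"
 show "x + y - cap_op ?u (x + y) = x - cap_op ?u x + (y - cap_op ?u y)" for x y
  by (simp add: cap_op_def op_of_add)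
 fix sc :: "'a simplex \<times> 'p qcube" assume "sc \<in> low_cells B n m (Suc k)"
 then obtain s c' where sc: "sc = (s, c')" and s: "s \<in> simplices B" and c': "Rep_qcube c' \<in> L_cubes n"
  and m: "int (fst s) + int (qdim c') = m" and k: "fst s < Suc k"
  by (cases sc) (auto simp: low_cells_def part_cells_def model_cells_def)
 let ?l = "[0..<Suc (fst s)]"
 have ft0: "face_tn s l (0 :: 'p cring) = 0" and Nil: "face_tn s [] = (0 :: 'p cring => _)" for l
  by (simp_all add: face_tn_def additive_zero(1)[of "tn s'" for s', OF tn_add])
 have unit: "cap_op (%s. unit_cochain) (tn s (frag_of c')) = tn s (frag_of c')"
  unfolding cap_op_tn
  by (subst cup_unit_right) (simp_all add: push_def Nil ft0 face_tn_all[OF s] zero_fun_def del: upt_Suc)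
 have "tn s (frag_of c') - cap_op ?u (tn s (frag_of c')) = cap_op ?v (tn s (frag_of c'))"
  using cap_op_diff[of ?v s "%s. unit_cochain" ?u "frag_of c'"] unit by simp
 also have "... = (\<Sum>j<Suc (fst s). face_tn s (take (Suc j) ?l) (?v s (drop j ?l) * frag_of c'))"
  unfolding cap_op_tn cup_push_apply by (simp del: upt_Suc sum.lessThan_Suc)
 also have "... \<in> frag_span (low_cells B n m k)"
 proof (rule frag_span_sum)
  fix j assume "j \<in> {..<Suc (fst s)}"
  then have j: "j \<le> fst s" by simp
  have v: "?v s (drop j ?l) \<in> graded n (int (fst s - j))"
  proof -
   have "unit_cochain (drop j ?l) \<in> (cube_part n (fst s - j) :: 'p cring set)"
    using j cube_part_one[where 'a = 'p, of n] by (auto simp: unit_cochain_def simp del: upt_Suc)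
   moreover have "?u s (drop j ?l) \<in> cube_part n (fst s - j)"
    using gauge_part[OF z s, of "list_cochain c s" "drop j ?l"] j by (simp add: Suc_diff_le del: upt_Suc)
   ultimately show ?thesis by (simp add: cube_part_diff cube_part_graded[symmetric] del: upt_Suc)
  qed
  show "face_tn s (take (Suc j) ?l) (?v s (drop j ?l) * frag_of c') \<in> frag_span (low_cells B n m k)"
  proof (cases "j = fst s")
   case True
   then have "drop j ?l = [j]" by simp
   then have "?v s (drop j ?l) = 0" by (simp add: gauge_cochain_def twist_cochain_2[OF n])
   then show ?thesis
    by (simp add: face_tn_def additive_zero(1)[of "tn s" for s, OF tn_add] del: upt_Suc)
  next
   case False
   have ne: "take (Suc j) ?l \<noteq> []" by (simp del: upt_Suc)
   have "face_tn s (take (Suc j) ?l) (?v s (drop j ?l) * frag_of c') \<in> frag_span (part_cells B n m)"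
    by (rule face_tn_graded[OF s mult_graded[OF v graded_of[OF c']]])
     (use j m in \<open>simp add: of_nat_diff del: upt_Suc\<close>)
   then show ?thesis
    unfolding face_tn_def if_not_P[OF ne]
    by (rule tn_low) (use False j k in \<open>simp del: upt_Suc\<close>)
  qed
 qed
 finally show "frag_of sc - cap_op ?u (frag_of sc) \<in> frag_span (low_cells B n m k)" by (simp add: sc)
qed (rule x)

lemma phi_one_nilpotent:
 fixes z c :: "'a chain => 'p::ab_group_add"
 assumes n: "n \<ge> 1" and z: "z \<in> cocycles (n + 1) B" and y: "y \<in> carrier (Y_part B n m)"
 shows "((\<lambda>y. y \<otimes>\<^bsub>Y_group B n\<^esub> inv\<^bsub>Y_group B n\<^esub> phi B n c z y) ^^ Suc (nat m)) y = \<one>\<^bsub>Y_group B n\<^esub>"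
proof -
 let ?u = "%s. gauge_cochain n (list_cochain z s) (list_cochain c s)"
 let ?N = "%y. y \<otimes>\<^bsub>Y_group B n\<^esub> inv\<^bsub>Y_group B n\<^esub> phi B n c z y"
 note RU = realizes_phi[OF n z, of c]
 have N: "(?N ^^ k) (model_class B n x) = \<one>\<^bsub>Y_group B n\<^esub>" if "x \<in> frag_span (low_cells B n m k)" for x k
  using that
 proof (induction k arbitrary: x)
  case 0
  then have "x = 0" by (simp add: frag_span_def low_cells_def)
  then show ?case using model_class_apply(3)[of B n] by simp
 next
  case (Suc k)
  have "low_cells B n m (Suc k) \<subseteq> model_cells B n" by (auto simp: low_cells_def part_cells_def)
  then have x: "x \<in> frag_span (model_cells B n)" using Suc.prems frag_span_mono by blast
  have ux: "cap_op ?u x \<in> frag_span (model_cells B n)" by (rule degree_op_cells[OF realizesD(1)[OF RU] x])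
  have "?N (model_class B n x) = model_class B n (x - cap_op ?u x)"
   using x ux by (simp only: realizesD(3)[OF RU] model_class_apply frag_span_uminus diff_conv_add_uminus)
  then show ?case
   using Suc.IH[OF phi_one_lowers[OF n z Suc.prems]] by (simp only: funpow_Suc_right comp_apply)
 qed
 obtain x where x: "x \<in> frag_span (part_cells B n m)" "y = model_class B n x" using Y_part_obtain[OF y] by blast
 have "part_cells B n m \<subseteq> low_cells B n m (Suc (nat m))"
  by (auto simp: low_cells_def part_cells_def)
 then have "x \<in> frag_span (low_cells B n m (Suc (nat m)))" using x(1) frag_span_mono by blast
 from N[OF this] show ?thesis by (simp only: x(2))
qed

section \<open>Additive functors applied to chain homotopies\<close>

lemma tensor_map_eqI:
 assumes "group A" "group B" "group G" "f \<in> hom A B" "h \<in> hom (tensor_group A G) (tensor_group B G)"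
  and "\<And>a g. a \<in> carrier A ==> g \<in> carrier G ==> h (tens A G a g) = tens B G (f a) g"
  and "x \<in> carrier (tensor_group A G)"
 shows "h x = tensor_map A B G f x"
 by (rule tensor_hom_eqI[OF assms(1,3) comm_group.axioms(2)[OF tensor_comm_group[OF assms(2,3)]] assms(5) tensor_map_hom(1)[OF assms(1-4)] _ assms(7)])
  (simp add: assms(6) tensor_map_hom(2)[OF assms(1-4)])

lemma tensor_map_compose:
 assumes "group A" "group B" "group C" "group G" "f \<in> hom A B" "g \<in> hom B C" "x \<in> carrier (tensor_group A G)"
 shows "tensor_map B C G g (tensor_map A B G f x) = tensor_map A C G (\<lambda>a. g (f a)) x"
proof (rule tensor_map_eqI[OF assms(1,3,4), of "%a. g (f a)" "%x. tensor_map B C G g (tensor_map A B G f x)", OF _ _ _ assms(7)])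
 show "(%a. g (f a)) \<in> hom A C" using hom_compose[OF assms(5,6)] by (simp add: comp_def)
 show "(%x. tensor_map B C G g (tensor_map A B G f x)) \<in> hom (tensor_group A G) (tensor_group C G)"
  using hom_compose[OF tensor_map_hom(1)[OF assms(1,2,4,5)] tensor_map_hom(1)[OF assms(2,3,4,6)]] by (simp add: comp_def)
 show "tensor_map B C G g (tensor_map A B G f (tens A G a b)) = tens C G (g (f a)) b"
  if "a \<in> carrier A" "b \<in> carrier G" for a b
  using that tensor_map_hom(2)[OF assms(1,2,4,5)] tensor_map_hom(2)[OF assms(2,3,4,6)] hom_in_carrier[OF assms(5)] by simp
qed

lemma tensor_map_mult:
 assumes "group A" "comm_group B" "group G" "f \<in> hom A B" "f' \<in> hom A B" "x \<in> carrier (tensor_group A G)"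
 shows "tensor_map A B G (\<lambda>a. f a \<otimes>\<^bsub>B\<^esub> f' a) x = tensor_map A B G f x \<otimes>\<^bsub>tensor_group B G\<^esub> tensor_map A B G f' x"
proof (rule tensor_map_eqI[symmetric, OF assms(1) _ assms(3) _ _ _ assms(6), of B "%a. f a \<otimes>\<^bsub>B\<^esub> f' a" "%x. tensor_map A B G f x \<otimes>\<^bsub>tensor_group B G\<^esub> tensor_map A B G f' x"])
 note B = comm_group.axioms(2)[OF assms(2)]
 show "group B" by (rule B)
 show "(%a. f a \<otimes>\<^bsub>B\<^esub> f' a) \<in> hom A B" by (rule hom_pointwise_mult[OF assms(2,4,5)])
 show "(%x. tensor_map A B G f x \<otimes>\<^bsub>tensor_group B G\<^esub> tensor_map A B G f' x) \<in> hom (tensor_group A G) (tensor_group B G)"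
  by (rule hom_pointwise_mult[OF tensor_comm_group[OF B assms(3)] tensor_map_hom(1)[OF assms(1) B assms(3,4)] tensor_map_hom(1)[OF assms(1) B assms(3,5)]])
 show "tensor_map A B G f (tens A G a g) \<otimes>\<^bsub>tensor_group B G\<^esub> tensor_map A B G f' (tens A G a g) = tens B G (f a \<otimes>\<^bsub>B\<^esub> f' a) g"
  if "a \<in> carrier A" "g \<in> carrier G" for a g
  using that tensor_map_hom(2)[OF assms(1) B assms(3,4)] tensor_map_hom(2)[OF assms(1) B assms(3,5)]
   hom_mult[OF tens_hom_left[OF B assms(3) that(2)]] hom_in_carrier[OF assms(4)] hom_in_carrier[OF assms(5)] by simp
qed

lemma tensor_map_cong:
 assumes "group A" "group B" "group G" "f \<in> hom A B" "f' \<in> hom A B" "x \<in> carrier (tensor_group A G)"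
  and "\<And>a. a \<in> carrier A ==> f a = f' a"
 shows "tensor_map A B G f x = tensor_map A B G f' x"
 by (rule tensor_map_eqI[OF assms(1-3,5) tensor_map_hom(1)[OF assms(1-4)] _ assms(6)])
  (simp add: tensor_map_hom(2)[OF assms(1-4)] assms(7))

lemma tensor_map_id:
 assumes "group A" "group G" "x \<in> carrier (tensor_group A G)"
 shows "tensor_map A A G (\<lambda>a. a) x = x"
 using tensor_map_eqI[OF assms(1,1,2), of "\<lambda>a. a" "\<lambda>x. x", OF _ _ _ assms(3)] by (simp add: hom_def)

lemma tensor_map_one:
 assumes "group A" "group B" "group G" "x \<in> carrier (tensor_group A G)"
 shows "tensor_map A B G (\<lambda>a. \<one>\<^bsub>B\<^esub>) x = \<one>\<^bsub>tensor_group B G\<^esub>"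
proof (rule tensor_map_eqI[symmetric, OF assms(1-3) hom_pointwise_one[OF assms(2)] _ _ assms(4), of "%x. \<one>\<^bsub>tensor_group B G\<^esub>"])
 have T: "group (tensor_group B G)" by (rule comm_group.axioms(2)[OF tensor_comm_group[OF assms(2,3)]])
 show "(%x. \<one>\<^bsub>tensor_group B G\<^esub>) \<in> hom (tensor_group A G) (tensor_group B G)" by (rule hom_pointwise_one[OF T])
 show "\<one>\<^bsub>tensor_group B G\<^esub> = tens B G \<one>\<^bsub>B\<^esub> g" if "g \<in> carrier G" for g
  using hom_one[OF tens_hom_left[OF assms(2,3) that] assms(2) T] by simp
qed

text \<open>The functor \<open>Hom(-, G)\<close> on maps, cut off to be extensional.\<close>

definition precomp :: "('a, 'c) monoid_scheme => ('a => 'b) => ('b => 'h) => 'a => 'h" where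
 "precomp A \<phi> g = (\<lambda>y\<in>carrier A. g (\<phi> y))"

lemma Hom_group_comm:
 assumes "group A" "comm_group H"
 shows "comm_group (Hom_group A H)"
proof (rule comm_groupI)
 interpret H: comm_group H by fact
 interpret A: group A by fact
 have ext: "(\<lambda>x\<in>carrier A. F x) \<in> carrier (Hom_group A H)" if "F \<in> hom A H" for F
  using that by (auto simp: Hom_group_def hom_def)
 show "f \<otimes>\<^bsub>Hom_group A H\<^esub> g \<in> carrier (Hom_group A H)"
  if "f \<in> carrier (Hom_group A H)" "g \<in> carrier (Hom_group A H)" for f g
  using ext[OF hom_pointwise_mult[OF assms(2)]] that by (simp add: Hom_group_def)
 show "\<one>\<^bsub>Hom_group A H\<^esub> \<in> carrier (Hom_group A H)"
  using ext[OF hom_pointwise_one[OF H.is_group]] by (simp add: Hom_group_def)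
 fix f assume f: "f \<in> carrier (Hom_group A H)"
 then have fh: "f \<in> hom A H" and fe: "f \<in> extensional (carrier A)" by (auto simp: Hom_group_def)
 note fc = hom_in_carrier[OF fh]
 show "\<one>\<^bsub>Hom_group A H\<^esub> \<otimes>\<^bsub>Hom_group A H\<^esub> f = f"
  using fc fe by (intro extensionalityI[of _ "carrier A"]) (auto simp: Hom_group_def)
 show "\<exists>g\<in>carrier (Hom_group A H). g \<otimes>\<^bsub>Hom_group A H\<^esub> f = \<one>\<^bsub>Hom_group A H\<^esub>"
 proof
  show "(\<lambda>x\<in>carrier A. inv\<^bsub>H\<^esub> f x) \<in> carrier (Hom_group A H)"
   by (rule ext[OF hom_pointwise_inv[OF assms(2) fh]])
  show "(\<lambda>x\<in>carrier A. inv\<^bsub>H\<^esub> f x) \<otimes>\<^bsub>Hom_group A H\<^esub> f = \<one>\<^bsub>Hom_group A H\<^esub>"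
   using fc by (auto simp: Hom_group_def fun_eq_iff)
 qed
 fix g assume g: "g \<in> carrier (Hom_group A H)"
 then have gc: "x \<in> carrier A ==> g x \<in> carrier H" for x using hom_in_carrier by (auto simp: Hom_group_def)
 show "f \<otimes>\<^bsub>Hom_group A H\<^esub> g = g \<otimes>\<^bsub>Hom_group A H\<^esub> f"
  using fc gc by (auto simp: Hom_group_def fun_eq_iff H.m_comm)
 fix h assume h: "h \<in> carrier (Hom_group A H)"
 then have hc: "x \<in> carrier A ==> h x \<in> carrier H" for x using hom_in_carrier by (auto simp: Hom_group_def)
 show "f \<otimes>\<^bsub>Hom_group A H\<^esub> g \<otimes>\<^bsub>Hom_group A H\<^esub> h = f \<otimes>\<^bsub>Hom_group A H\<^esub> (g \<otimes>\<^bsub>Hom_group A H\<^esub> h)"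
  using fc gc hc by (auto simp: Hom_group_def fun_eq_iff H.m_assoc)
qed

lemma precomp_hom:
 assumes "group A" "comm_group H" "\<phi> \<in> hom A B"
 shows "precomp A \<phi> \<in> hom (Hom_group B H) (Hom_group A H)"
proof (rule homI)
 fix g assume g: "g \<in> carrier (Hom_group B H)"
 show "precomp A \<phi> g \<in> carrier (Hom_group A H)"
  using g assms(3) group.is_monoid[OF assms(1)]
  by (auto simp: precomp_def Hom_group_def hom_def Pi_def monoid.m_closed)
 fix h assume h: "h \<in> carrier (Hom_group B H)"
 show "precomp A \<phi> (g \<otimes>\<^bsub>Hom_group B H\<^esub> h) = precomp A \<phi> g \<otimes>\<^bsub>Hom_group A H\<^esub> precomp A \<phi> h"
  using hom_in_carrier[OF assms(3)] by (auto simp: precomp_def Hom_group_def fun_eq_iff)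
qed

lemma precomp_compose:
 assumes "\<phi> \<in> hom A B"
 shows "precomp A \<phi> (precomp B \<psi> g) = precomp A (\<lambda>y. \<psi> (\<phi> y)) g"
 using hom_in_carrier[OF assms] by (auto simp: precomp_def fun_eq_iff)

lemma precomp_mult:
 assumes "g \<in> carrier (Hom_group B H)" "\<phi> \<in> hom A B" "\<phi>' \<in> hom A B"
 shows "precomp A (\<lambda>y. \<phi> y \<otimes>\<^bsub>B\<^esub> \<phi>' y) g = precomp A \<phi> g \<otimes>\<^bsub>Hom_group A H\<^esub> precomp A \<phi>' g"
 using assms hom_in_carrier[OF assms(2)] hom_in_carrier[OF assms(3)]
 by (auto simp: precomp_def Hom_group_def fun_eq_iff hom_mult)

lemma precomp_cong: "(\<And>y. y \<in> carrier A ==> \<phi> y = \<psi> y) ==> precomp A \<phi> g = precomp A \<psi> g"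
 by (auto simp: precomp_def fun_eq_iff)

lemma precomp_id: "g \<in> carrier (Hom_group A H) ==> precomp A (\<lambda>y. y) g = g"
 by (auto simp: precomp_def Hom_group_def extensional_restrict)

lemma precomp_one:
 assumes "g \<in> carrier (Hom_group B H)" "group B" "group H"
 shows "precomp A (\<lambda>y. \<one>\<^bsub>B\<^esub>) g = \<one>\<^bsub>Hom_group A H\<^esub>"
 using assms hom_one[of g B H] by (auto simp: precomp_def Hom_group_def)

section \<open>Actions up to homotopy\<close>

lemma chain_complexD:
 assumes "chain_complex P D"
 shows "comm_group (P m)" "group (P m)" "D \<in> hom (P m) (P (m - 1))" "D \<in> hom (P (m + 1)) (P m)"
  and "y \<in> carrier (P (m + 1)) ==> D (D y) = \<one>\<^bsub>P (m - 1)\<^esub>"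
proof -
 note P = assms[unfolded chain_complex_def, rule_format]
 show "comm_group (P m)" "D \<in> hom (P m) (P (m - 1))" using P[of m] by auto
 then show "group (P m)" by (simp add: comm_group.axioms)
 show "D \<in> hom (P (m + 1)) (P m)" using P[of "m + 1"] by simp
 have "m + 1 - 2 = m - 1" by simp
 then show "D (D y) = \<one>\<^bsub>P (m - 1)\<^esub>" if "y \<in> carrier (P (m + 1))" using P[of "m + 1"] that by metis
qed

text \<open>The pointwise inverse of a homotopy is a homotopy in the other direction.\<close>

lemma homotopic_sym:
 assumes P: "chain_complex P D" and h: "homotopic P D \<phi> \<psi>" and \<psi>: "\<And>m. \<psi> \<in> hom (P m) (P m)"
 shows "homotopic P D \<psi> \<phi>"
proof -
 obtain K where K: "!!m. K m \<in> hom (P m) (P (m + 1))"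
  and eq: "!!m y. y \<in> carrier (P m) ==> \<phi> y = \<psi> y \<otimes>\<^bsub>P m\<^esub> (D (K m y) \<otimes>\<^bsub>P m\<^esub> K (m - 1) (D y))"
  using h unfolding homotopic_def by metis
 let ?K = "%m y. inv\<^bsub>P (m + 1)\<^esub> K m y"
 show ?thesis
  unfolding homotopic_def
 proof (intro exI[of _ ?K] allI conjI ballI)
  fix m
  interpret Pm: comm_group "P m" by (rule chain_complexD(1)[OF P])
  show "?K m \<in> hom (P m) (P (m + 1))" by (rule hom_pointwise_inv[OF chain_complexD(1)[OF P] K])
  fix y assume y: "y \<in> carrier (P m)"
  interpret Dh: group_hom "P (m + 1)" "P m" D
   using chain_complexD[OF P] by (simp add: group_hom_def group_hom_axioms_def)
  have Ky: "K m y \<in> carrier (P (m + 1))" by (rule hom_in_carrier[OF K y])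
  have "K (m - 1) (D y) \<in> carrier (P (m - 1 + 1))"
   by (rule hom_in_carrier[OF K hom_in_carrier[OF chain_complexD(3)[OF P] y]])
  then have KDy: "K (m - 1) (D y) \<in> carrier (P m)" by simp
  have \<psi>y: "\<psi> y \<in> carrier (P m)" by (rule hom_in_carrier[OF \<psi> y])
  have "\<phi> y \<otimes>\<^bsub>P m\<^esub> (D (?K m y) \<otimes>\<^bsub>P m\<^esub> inv\<^bsub>P m\<^esub> K (m - 1) (D y))
   = \<psi> y \<otimes>\<^bsub>P m\<^esub> (D (K m y) \<otimes>\<^bsub>P m\<^esub> K (m - 1) (D y)) \<otimes>\<^bsub>P m\<^esub> inv\<^bsub>P m\<^esub> (D (K m y) \<otimes>\<^bsub>P m\<^esub> K (m - 1) (D y))"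
   using Ky KDy \<psi>y eq[OF y] by (simp add: Pm.inv_mult)
  also have "... = \<psi> y" using Ky KDy \<psi>y by (simp add: Pm.m_assoc)
  finally show "\<psi> y = \<phi> y \<otimes>\<^bsub>P m\<^esub> (D (?K m y) \<otimes>\<^bsub>P m\<^esub> ?K (m - 1) (D y))" by simp
 qed
qed

lemma homotopic_trans:
 assumes P: "chain_complex P D" and h1: "homotopic P D \<phi> \<psi>" and h2: "homotopic P D \<psi> \<theta>"
  and \<theta>: "\<And>m. \<theta> \<in> hom (P m) (P m)"
 shows "homotopic P D \<phi> \<theta>"
proof -
 obtain K where K: "!!m. K m \<in> hom (P m) (P (m + 1))"
  and eq: "!!m y. y \<in> carrier (P m) ==> \<phi> y = \<psi> y \<otimes>\<^bsub>P m\<^esub> (D (K m y) \<otimes>\<^bsub>P m\<^esub> K (m - 1) (D y))"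
  using h1 unfolding homotopic_def by metis
 obtain K' where K': "!!m. K' m \<in> hom (P m) (P (m + 1))"
  and eq': "!!m y. y \<in> carrier (P m) ==> \<psi> y = \<theta> y \<otimes>\<^bsub>P m\<^esub> (D (K' m y) \<otimes>\<^bsub>P m\<^esub> K' (m - 1) (D y))"
  using h2 unfolding homotopic_def by metis
 let ?K = "%m y. K m y \<otimes>\<^bsub>P (m + 1)\<^esub> K' m y"
 show ?thesis
  unfolding homotopic_def
 proof (intro exI[of _ ?K] allI conjI ballI)
  fix m
  interpret Pm: comm_group "P m" by (rule chain_complexD(1)[OF P])
  show "?K m \<in> hom (P m) (P (m + 1))" by (rule hom_pointwise_mult[OF chain_complexD(1)[OF P] K K'])
  fix y assume y: "y \<in> carrier (P m)"
  have Dy: "D y \<in> carrier (P (m - 1))" by (rule hom_in_carrier[OF chain_complexD(3)[OF P] y])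
  have Ky: "K m y \<in> carrier (P (m + 1))" "K' m y \<in> carrier (P (m + 1))"
   by (rule hom_in_carrier[OF K y], rule hom_in_carrier[OF K' y])
  note DKy = hom_in_carrier[OF chain_complexD(4)[OF P] Ky(1)] hom_in_carrier[OF chain_complexD(4)[OF P] Ky(2)]
  have "K (m - 1) (D y) \<in> carrier (P (m - 1 + 1))" "K' (m - 1) (D y) \<in> carrier (P (m - 1 + 1))"
   by (rule hom_in_carrier[OF K Dy], rule hom_in_carrier[OF K' Dy])
  then have KDy: "K (m - 1) (D y) \<in> carrier (P m)" "K' (m - 1) (D y) \<in> carrier (P m)" by simp_all
  show "\<phi> y = \<theta> y \<otimes>\<^bsub>P m\<^esub> (D (?K m y) \<otimes>\<^bsub>P m\<^esub> ?K (m - 1) (D y))"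
   using DKy KDy hom_in_carrier[OF \<theta> y]
   by (simp add: eq[OF y] eq'[OF y] hom_mult[OF chain_complexD(4)[OF P] Ky] Pm.m_ac)
 qed
qed

text \<open>On a cycle the second half of the homotopy formula vanishes and the first half is a
 boundary.\<close>

lemma homotopy_boundary:
 assumes Y: "homology_setup A f C g D"
  and "K0 y \<in> carrier A" "K1 \<one>\<^bsub>D\<^esub> = \<one>\<^bsub>C\<^esub>" "\<psi> y \<in> carrier C" "y \<in> kernel C D g"
  and "\<phi> y = \<psi> y \<otimes>\<^bsub>C\<^esub> (f (K0 y) \<otimes>\<^bsub>C\<^esub> K1 (g y))"
 shows "\<phi> y \<otimes>\<^bsub>C\<^esub> inv\<^bsub>C\<^esub> \<psi> y \<in> f ` carrier A"
proof -
 interpret C: comm_group C using Y by (simp add: homology_setup_def)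
 have f: "f (K0 y) \<in> carrier C" using Y assms(2) by (auto simp: homology_setup_def hom_def)
 have "\<phi> y \<otimes>\<^bsub>C\<^esub> inv\<^bsub>C\<^esub> \<psi> y = \<psi> y \<otimes>\<^bsub>C\<^esub> f (K0 y) \<otimes>\<^bsub>C\<^esub> inv\<^bsub>C\<^esub> \<psi> y"
  using assms(3-6) f by (simp add: kernel_def)
 also have "... = f (K0 y)"
  using C.m_comm[OF assms(4) f] assms(4) f by (simp add: C.m_assoc)
 finally show ?thesis using assms(2) by simp
qed

text \<open>A family of chain endomorphisms that represents the cohomology of \<open>X\<close> up to
 homotopy, with a unipotent map at the unit. All hypotheses are preserved by additive functors.\<close>

locale homotopy_action =
 fixes X0 :: "('x, 'i) monoid_scheme" and d0 and X1 :: "('y, 'j) monoid_scheme" and d1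
  and X2 :: "('w, 'k) monoid_scheme" and P :: "int => ('a, 'c) monoid_scheme" and D and E
 assumes X: "homology_setup X0 d0 X1 d1 X2" and P: "chain_complex P D"
  and E_hom: "c \<in> kernel X1 X2 d1 ==> E c \<in> hom (P m) (P m)"
  and E_D: "c \<in> kernel X1 X2 d1 ==> y \<in> carrier (P m) ==> E c (D y) = D (E c y)"
  and E_mult: "c \<in> kernel X1 X2 d1 ==> c' \<in> kernel X1 X2 d1 ==>
   homotopic P D (\<lambda>y. E c (E c' y)) (E (c \<otimes>\<^bsub>X1\<^esub> c'))"
  and E_cob: "b \<in> carrier X0 ==> homotopic P D (\<lambda>y. E (d0 b) (E \<one>\<^bsub>X1\<^esub> y)) (E \<one>\<^bsub>X1\<^esub>)"
  and nil: "\<exists>k. \<forall>y\<in>carrier (P m). ((\<lambda>y. y \<otimes>\<^bsub>P m\<^esub> inv\<^bsub>P m\<^esub> E \<one>\<^bsub>X1\<^esub> y) ^^ k) y = \<one>\<^bsub>P m\<^esub>"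
begin

lemmas grp = chain_complexD(2)[OF P]
lemmas comm = chain_complexD(1)[OF P]
lemmas D_hom = chain_complexD(3)[OF P]
lemmas D_hom' = chain_complexD(4)[OF P]

lemma one_cycle: "\<one>\<^bsub>X1\<^esub> \<in> kernel X1 X2 d1" and bd_cycle: "b \<in> carrier X0 ==> d0 b \<in> kernel X1 X2 d1"
 and mult_cycle: "c \<in> kernel X1 X2 d1 ==> c' \<in> kernel X1 X2 d1 ==> c \<otimes>\<^bsub>X1\<^esub> c' \<in> kernel X1 X2 d1"
 and mult_comm: "c \<in> kernel X1 X2 d1 ==> c' \<in> kernel X1 X2 d1 ==> c \<otimes>\<^bsub>X1\<^esub> c' = c' \<otimes>\<^bsub>X1\<^esub> c"
proof -
 interpret X: homology_setup X0 d0 X1 d1 X2 by (rule X)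
 have sub: "subgroup (kernel X1 X2 d1) X1" using X.cycles_subgroup by (simp add: X.cycles_def)
 show "\<one>\<^bsub>X1\<^esub> \<in> kernel X1 X2 d1" by (rule subgroup.one_closed[OF sub])
 show "b \<in> carrier X0 ==> d0 b \<in> kernel X1 X2 d1"
  using X.boundaries_subset by (auto simp: X.cycles_def)
 show "c \<in> kernel X1 X2 d1 ==> c' \<in> kernel X1 X2 d1 ==> c \<otimes>\<^bsub>X1\<^esub> c' \<in> kernel X1 X2 d1"
  by (rule subgroup.m_closed[OF sub])
 show "c \<in> kernel X1 X2 d1 ==> c' \<in> kernel X1 X2 d1 ==> c \<otimes>\<^bsub>X1\<^esub> c' = c' \<otimes>\<^bsub>X1\<^esub> c"
  using X.C by (intro comm_groupE(4)[OF X.C]) (simp_all add: kernel_def)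
qed

lemma EE_hom:
 assumes "c \<in> kernel X1 X2 d1" "c' \<in> kernel X1 X2 d1"
 shows "(\<lambda>y. E c (E c' y)) \<in> hom (P m) (P m)"
 using hom_compose[OF E_hom[OF assms(2)] E_hom[OF assms(1)]] by (simp add: comp_def)

lemma E_mult': "c \<in> kernel X1 X2 d1 ==> c' \<in> kernel X1 X2 d1 ==>
  homotopic P D (\<lambda>y. E c' (E c y)) (E (c \<otimes>\<^bsub>X1\<^esub> c'))"
 using E_mult[of c' c] mult_comm by simp

lemma E_cob': "b \<in> carrier X0 ==> homotopic P D (\<lambda>y. E \<one>\<^bsub>X1\<^esub> (E (d0 b) y)) (E \<one>\<^bsub>X1\<^esub>)"
proof -
 assume b: "b \<in> carrier X0"
 note c = bd_cycle[OF b] one_cycle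
 have "homotopic P D (E (d0 b \<otimes>\<^bsub>X1\<^esub> \<one>\<^bsub>X1\<^esub>)) (%y. E (d0 b) (E \<one>\<^bsub>X1\<^esub> y))"
  by (rule homotopic_sym[OF P E_mult[OF c] E_hom[OF mult_cycle[OF c]]])
 from homotopic_trans[OF P this E_cob[OF b] E_hom[OF one_cycle]]
 have "homotopic P D (E (d0 b \<otimes>\<^bsub>X1\<^esub> \<one>\<^bsub>X1\<^esub>)) (E \<one>\<^bsub>X1\<^esub>)" .
 from homotopic_trans[OF P E_mult'[OF c] this E_hom[OF one_cycle]] show ?thesis .
qed

abbreviation "N m \<equiv> \<lambda>y. y \<otimes>\<^bsub>P m\<^esub> inv\<^bsub>P m\<^esub> E \<one>\<^bsub>X1\<^esub> y"

lemma N_hom: "(N m ^^ k) \<in> hom (P m) (P m)"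
proof (induction k)
 case (Suc k)
 have "N m \<in> hom (P m) (P m)"
  by (rule hom_pointwise_mult[OF comm _ hom_pointwise_inv[OF comm E_hom[OF one_cycle]]]) (simp add: hom_def)
 from hom_compose[OF Suc this] show ?case by (simp add: comp_def)
qed (simp add: hom_def)

end

context homotopy_action begin

lemma N1_hom: "N m \<in> hom (P m) (P m)"
 using N_hom[where k = 1 and m = m] by simp

lemma N_split:
 assumes "y \<in> carrier (P m)"
 shows "N m y \<otimes>\<^bsub>P m\<^esub> E \<one>\<^bsub>X1\<^esub> y = y"
proof -
 interpret Pm: comm_group "P m" by (rule comm)
 show ?thesis using assms hom_in_carrier[OF E_hom[OF one_cycle] assms] by (simp add: Pm.m_assoc)
qed

lemma homotopic_at:
 assumes "homotopic P D \<phi> \<psi>"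
 shows "\<exists>K0 K1. K0 \<in> hom (P m) (P (m + 1)) \<and> K1 \<in> hom (P (m - 1)) (P m) \<and>
  (\<forall>y\<in>carrier (P m). \<phi> y = \<psi> y \<otimes>\<^bsub>P m\<^esub> (D (K0 y) \<otimes>\<^bsub>P m\<^esub> K1 (D y)))"
proof -
 obtain K where K: "!!m. K m \<in> hom (P m) (P (m + 1))"
  and eq: "!!m y. y \<in> carrier (P m) ==> \<phi> y = \<psi> y \<otimes>\<^bsub>P m\<^esub> (D (K m y) \<otimes>\<^bsub>P m\<^esub> K (m - 1) (D y))"
  using assms unfolding homotopic_def by metis
 have "K (m - 1) \<in> hom (P (m - 1)) (P m)" using K[of "m - 1"] by simp
 then show ?thesis
  by (intro exI[of _ "K m"] exI[of _ "K (m - 1)"] conjI ballI K eq)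
qed

lemma homotopy_parts_hom:
 assumes "K0 \<in> hom (P m) (P (m + 1))" "K1 \<in> hom (P (m - 1)) (P m)"
 shows "(\<lambda>y. D (K0 y)) \<in> hom (P m) (P m)" "(\<lambda>y. K1 (D y)) \<in> hom (P m) (P m)"
  "(\<lambda>y. D (K0 y) \<otimes>\<^bsub>P m\<^esub> K1 (D y)) \<in> hom (P m) (P m)"
proof -
 show DK: "(%y. D (K0 y)) \<in> hom (P m) (P m)" "(%y. K1 (D y)) \<in> hom (P m) (P m)"
  using hom_compose[OF assms(1) D_hom'] hom_compose[OF D_hom assms(2)] by (simp_all add: comp_def)
 show "(%y. D (K0 y) \<otimes>\<^bsub>P m\<^esub> K1 (D y)) \<in> hom (P m) (P m)"
  by (rule hom_pointwise_mult[OF comm DK])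
qed

text \<open>Tensoring with \<open>G\<close> preserves composites, pointwise products and the identity,
 hence homotopies and the power of the nilpotent operator.\<close>

theorem tensor_action:
 fixes G :: "('g, 'e) monoid_scheme"
 assumes G: "comm_group G"
 shows "\<exists>\<alpha>. group_action (homology_at X0 d0 X1 d1 X2)
   (carrier (homology_at (tensor_group (P (m + 1)) G) (tensor_map (P (m + 1)) (P m) G D) (tensor_group (P m) G)
    (tensor_map (P m) (P (m - 1)) G D) (tensor_group (P (m - 1)) G))) \<alpha> \<and>
  (\<forall>h\<in>carrier (homology_at X0 d0 X1 d1 X2). \<alpha> h \<in>
   auto (homology_at (tensor_group (P (m + 1)) G) (tensor_map (P (m + 1)) (P m) G D) (tensor_group (P m) G)
    (tensor_map (P m) (P (m - 1)) G D) (tensor_group (P (m - 1)) G))) \<and>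
  (\<forall>c\<in>kernel X1 X2 d1. \<forall>y\<in>kernel (tensor_group (P m) G) (tensor_group (P (m - 1)) G) (tensor_map (P m) (P (m - 1)) G D).
   \<alpha> (homology_class X0 d0 X1 c)
    (homology_class (tensor_group (P (m + 1)) G) (tensor_map (P (m + 1)) (P m) G D) (tensor_group (P m) G) y)
   = homology_class (tensor_group (P (m + 1)) G) (tensor_map (P (m + 1)) (P m) G D) (tensor_group (P m) G)
     (tensor_map (P m) (P m) G (E c) y))"
proof -
 let ?A = "tensor_group (P (m + 1)) G" and ?C = "tensor_group (P m) G" and ?B = "tensor_group (P (m - 1)) G"
 let ?f = "tensor_map (P (m + 1)) (P m) G D" and ?g = "tensor_map (P m) (P (m - 1)) G D"
 let ?T = "tensor_map (P m) (P m) G"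
 have gG: "group G" by (rule comm_group.axioms(2)[OF G])
 interpret C: comm_group ?C by (rule tensor_comm_group[OF grp gG])
 have f_hom: "?f \<in> hom ?A ?C" and g_hom: "?g \<in> hom ?C ?B"
  by (rule tensor_map_hom(1)[OF grp grp gG D_hom'], rule tensor_map_hom(1)[OF grp grp gG D_hom])
 have gB: "group ?B" and gA: "group ?A"
  by (rule comm_group.axioms(2)[OF tensor_comm_group[OF grp gG]])+
 have Y: "homology_setup ?A ?f ?C ?g ?B"
 proof (rule homology_setup.intro)
  fix x assume x: "x \<in> carrier ?A"
  have "?g (?f x) = tensor_map (P (m + 1)) (P (m - 1)) G (%y. D (D y)) x"
   by (rule tensor_map_compose[OF grp grp grp gG D_hom' D_hom x])
  also have "... = tensor_map (P (m + 1)) (P (m - 1)) G (%y. \<one>\<^bsub>P (m - 1)\<^esub>) x"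
   by (rule tensor_map_cong[OF grp grp gG _ hom_pointwise_one[OF grp] x chain_complexD(5)[OF P]])
    (use hom_compose[OF D_hom' D_hom] in \<open>simp_all add: comp_def\<close>)
  finally show "?g (?f x) = \<one>\<^bsub>?B\<^esub>" using tensor_map_one[OF grp grp gG x] by simp
 next
  show "?f \<in> hom ?A ?C" "?g \<in> hom ?C ?B" by (fact f_hom, fact g_hom)
 qed (rule tensor_comm_group[OF grp gG])+
 have commute: "tensor_map (P m') (P m'') G D (tensor_map (P m') (P m') G (E c) x)
   = tensor_map (P m'') (P m'') G (E c) (tensor_map (P m') (P m'') G D x)"
  if "c \<in> kernel X1 X2 d1" "x \<in> carrier (tensor_group (P m') G)" "D \<in> hom (P m') (P m'')" for c x m' m''
 proof -
  have "tensor_map (P m') (P m'') G D (tensor_map (P m') (P m') G (E c) x) = tensor_map (P m') (P m'') G (%y. D (E c y)) x"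
   by (rule tensor_map_compose[OF grp grp grp gG E_hom[OF that(1)] that(3,2)])
  also have "... = tensor_map (P m') (P m'') G (%y. E c (D y)) x"
  proof (rule tensor_map_cong[OF grp grp gG _ _ that(2)])
   show "(%y. D (E c y)) \<in> hom (P m') (P m'')" "(%y. E c (D y)) \<in> hom (P m') (P m'')"
    using hom_compose[OF E_hom[OF that(1)] that(3)] hom_compose[OF that(3) E_hom[OF that(1)]] by (simp_all add: comp_def)
  qed (rule E_D[OF that(1), symmetric])
  finally show ?thesis using tensor_map_compose[OF grp grp grp gG that(3) E_hom[OF that(1)] that(2)] by simp
 qed
 have homotopy: "?T \<phi> x \<otimes>\<^bsub>?C\<^esub> inv\<^bsub>?C\<^esub> ?T \<psi> x \<in> ?f ` carrier ?A"
  if h: "homotopic P D \<phi> \<psi>" and hom: "\<phi> \<in> hom (P m) (P m)" "\<psi> \<in> hom (P m) (P m)" and x: "x \<in> kernel ?C ?B ?g" for \<phi> \<psi> x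
 proof -
  obtain K0 K1 where K: "K0 \<in> hom (P m) (P (m + 1))" "K1 \<in> hom (P (m - 1)) (P m)"
   and eq': "\<forall>y\<in>carrier (P m). \<phi> y = \<psi> y \<otimes>\<^bsub>P m\<^esub> (D (K0 y) \<otimes>\<^bsub>P m\<^esub> K1 (D y))"
   using homotopic_at[OF h, of m] by (elim exE conjE) (rule that; assumption)
  note eq = bspec[OF eq'] and DK = homotopy_parts_hom[OF K]
  let ?V = "tensor_map (P m) (P (m + 1)) G K0" and ?W = "tensor_map (P (m - 1)) (P m) G K1"
  have xC: "x \<in> carrier ?C" using x by (simp add: kernel_def)
  have "?T \<phi> x = ?T (%y. \<psi> y \<otimes>\<^bsub>P m\<^esub> (D (K0 y) \<otimes>\<^bsub>P m\<^esub> K1 (D y))) x"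
   by (rule tensor_map_cong[OF grp grp gG hom(1) hom_pointwise_mult[OF comm hom(2) DK(3)] xC eq])
  also have "... = ?T \<psi> x \<otimes>\<^bsub>?C\<^esub> (?f (?V x) \<otimes>\<^bsub>?C\<^esub> ?W (?g x))"
   unfolding tensor_map_mult[OF grp comm gG hom(2) DK(3) xC] tensor_map_mult[OF grp comm gG DK(1,2) xC]
    tensor_map_compose[OF grp grp grp gG K(1) D_hom' xC] tensor_map_compose[OF grp grp grp gG D_hom K(2) xC] ..
  finally have eqx: "?T \<phi> x = ?T \<psi> x \<otimes>\<^bsub>?C\<^esub> (?f (?V x) \<otimes>\<^bsub>?C\<^esub> ?W (?g x))" .
  have v: "?V x \<in> carrier ?A" by (rule hom_in_carrier[OF tensor_map_hom(1)[OF grp grp gG K(1)] xC])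
  have w: "?W \<one>\<^bsub>?B\<^esub> = \<one>\<^bsub>?C\<^esub>" by (rule hom_one[OF tensor_map_hom(1)[OF grp grp gG K(2)] gB C.is_group])
  have t: "?T \<psi> x \<in> carrier ?C" by (rule hom_in_carrier[OF tensor_map_hom(1)[OF grp grp gG hom(2)] xC])
  show ?thesis
   by (rule homotopy_boundary[OF Y, of ?V x ?W "?T \<psi>" "?T \<phi>", OF v w t x eqx])
 qed
 have NT: "y \<otimes>\<^bsub>?C\<^esub> inv\<^bsub>?C\<^esub> ?T (E \<one>\<^bsub>X1\<^esub>) y = ?T (N m) y" if y: "y \<in> carrier ?C" for y
 proof -
  have c: "?T (N m) y \<in> carrier ?C" "?T (E \<one>\<^bsub>X1\<^esub>) y \<in> carrier ?C"
   by (rule hom_in_carrier[OF tensor_map_hom(1)[OF grp grp gG N1_hom] y],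
     rule hom_in_carrier[OF tensor_map_hom(1)[OF grp grp gG E_hom[OF one_cycle]] y])
  have "y = ?T (%a. a) y" by (rule tensor_map_id[symmetric, OF grp gG y])
  also have "... = ?T (%a. N m a \<otimes>\<^bsub>P m\<^esub> E \<one>\<^bsub>X1\<^esub> a) y"
   by (rule tensor_map_cong[OF grp grp gG _ hom_pointwise_mult[OF comm N1_hom E_hom[OF one_cycle]] y N_split[symmetric]])
    (simp_all add: hom_def)
  also have "... = ?T (N m) y \<otimes>\<^bsub>?C\<^esub> ?T (E \<one>\<^bsub>X1\<^esub>) y"
   by (rule tensor_map_mult[OF grp comm gG N1_hom E_hom[OF one_cycle] y])
  finally have "y = ?T (N m) y \<otimes>\<^bsub>?C\<^esub> ?T (E \<one>\<^bsub>X1\<^esub>) y" .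
  from arg_cong[where f = "%u. u \<otimes>\<^bsub>?C\<^esub> inv\<^bsub>?C\<^esub> ?T (E \<one>\<^bsub>X1\<^esub>) y", OF this]
  show ?thesis using c by (simp only: C.m_assoc C.r_inv C.r_one C.inv_closed)
 qed
 have NTk: "((%y. y \<otimes>\<^bsub>?C\<^esub> inv\<^bsub>?C\<^esub> ?T (E \<one>\<^bsub>X1\<^esub>) y) ^^ k) y = ?T (N m ^^ k) y" if y: "y \<in> carrier ?C" for y k
 proof (induction k)
  case 0
  have "(N m ^^ 0) = (%a. a)" by (simp add: id_def)
  then show ?case using tensor_map_id[OF grp gG y] by (simp only: funpow_0)
 next
  case (Suc k)
  have Tk: "?T (N m ^^ k) y \<in> carrier ?C" by (rule hom_in_carrier[OF tensor_map_hom(1)[OF grp grp gG N_hom] y])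
  have "(N m ^^ Suc k) = (%a. N m ((N m ^^ k) a))" by (simp add: comp_def)
  then show ?case
   using tensor_map_compose[OF grp grp grp gG N_hom N1_hom y, of k] NT[OF Tk] by (simp only: funpow.simps(2) comp_apply Suc)
 qed
 obtain k where k: "!!y. y \<in> carrier (P m) ==> (N m ^^ k) y = \<one>\<^bsub>P m\<^esub>" using nil by blast
 show ?thesis
 proof (rule homology_action[OF X Y, of "%c. ?T (E c)" k])
  show "?T (E c) \<in> hom ?C ?C" if "c \<in> kernel X1 X2 d1" for c
   by (rule tensor_map_hom(1)[OF grp grp gG E_hom[OF that]])
  show "?T (E c) y \<in> kernel ?C ?B ?g" if c: "c \<in> kernel X1 X2 d1" and y: "y \<in> kernel ?C ?B ?g" for c y
  proof -
   have y': "y \<in> carrier ?C" "?g y = \<one>\<^bsub>?B\<^esub>" using y by (auto simp: kernel_def)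
   have "?g (?T (E c) y) = \<one>\<^bsub>?B\<^esub>"
    unfolding commute[OF c y'(1) D_hom] y'(2)
    by (rule hom_one[OF tensor_map_hom(1)[OF grp grp gG E_hom[OF c]] gB gB])
   then show ?thesis
    using hom_in_carrier[OF tensor_map_hom(1)[OF grp grp gG E_hom[OF c]] y'(1)] by (simp add: kernel_def)
  qed
  show "?T (E c) y \<in> ?f ` carrier ?A" if c: "c \<in> kernel X1 X2 d1" and "y \<in> ?f ` carrier ?A" for c y
  proof -
   obtain x where x: "x \<in> carrier ?A" "y = ?f x" using \<open>y \<in> ?f ` carrier ?A\<close> by blast
   show ?thesis
    unfolding x(2) commute[OF c x(1) D_hom', symmetric]
    by (rule imageI, rule hom_in_carrier[OF tensor_map_hom(1)[OF grp grp gG E_hom[OF c]] x(1)])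
  qed
  show "?T (E c) (?T (E c') y) \<otimes>\<^bsub>?C\<^esub> inv\<^bsub>?C\<^esub> ?T (E (c \<otimes>\<^bsub>X1\<^esub> c')) y \<in> ?f ` carrier ?A"
   if c: "c \<in> kernel X1 X2 d1" "c' \<in> kernel X1 X2 d1" and y: "y \<in> kernel ?C ?B ?g" for c c' y
  proof -
   have y': "y \<in> carrier ?C" using y by (simp add: kernel_def)
   show ?thesis
    unfolding tensor_map_compose[OF grp grp grp gG E_hom[OF c(2)] E_hom[OF c(1)] y']
    by (rule homotopy[OF E_mult[OF c] EE_hom[OF c] E_hom[OF mult_cycle[OF c]] y])
  qed
  show "?T (E (d0 b)) (?T (E \<one>\<^bsub>X1\<^esub>) y) \<otimes>\<^bsub>?C\<^esub> inv\<^bsub>?C\<^esub> ?T (E \<one>\<^bsub>X1\<^esub>) y \<in> ?f ` carrier ?A"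
   if b: "b \<in> carrier X0" and y: "y \<in> kernel ?C ?B ?g" for b y
  proof -
   have y': "y \<in> carrier ?C" using y by (simp add: kernel_def)
   show ?thesis
    unfolding tensor_map_compose[OF grp grp grp gG E_hom[OF one_cycle] E_hom[OF bd_cycle[OF b]] y']
    by (rule homotopy[OF E_cob[OF b] EE_hom[OF bd_cycle[OF b] one_cycle] E_hom[OF one_cycle] y])
  qed
  show "((%y. y \<otimes>\<^bsub>?C\<^esub> inv\<^bsub>?C\<^esub> ?T (E \<one>\<^bsub>X1\<^esub>) y) ^^ k) y = \<one>\<^bsub>?C\<^esub>" if y: "y \<in> carrier ?C" for y
   by (rule trans[OF NTk[OF y] trans[OF tensor_map_cong[OF grp grp gG N_hom hom_pointwise_one[OF grp] y k]
      tensor_map_one[OF grp grp gG y]]])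
 qed
qed

text \<open>The functor reverses composition, so the homotopies of the locale are needed in the other
 order.\<close>

theorem Hom_action:
 fixes G :: "('g, 'e) monoid_scheme"
 assumes G: "comm_group G"
 shows "\<exists>\<beta>. group_action (homology_at X0 d0 X1 d1 X2)
   (carrier (homology_at (Hom_group (P (m - 1)) G) (precomp (P m) D) (Hom_group (P m) G)
    (precomp (P (m + 1)) D) (Hom_group (P (m + 1)) G))) \<beta> \<and>
  (\<forall>h\<in>carrier (homology_at X0 d0 X1 d1 X2). \<beta> h \<in>
   auto (homology_at (Hom_group (P (m - 1)) G) (precomp (P m) D) (Hom_group (P m) G)
    (precomp (P (m + 1)) D) (Hom_group (P (m + 1)) G))) \<and>
  (\<forall>c\<in>kernel X1 X2 d1. \<forall>f\<in>kernel (Hom_group (P m) G) (Hom_group (P (m + 1)) G) (precomp (P (m + 1)) D).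
   \<beta> (homology_class X0 d0 X1 c) (homology_class (Hom_group (P (m - 1)) G) (precomp (P m) D) (Hom_group (P m) G) f)
   = homology_class (Hom_group (P (m - 1)) G) (precomp (P m) D) (Hom_group (P m) G) (precomp (P m) (E c) f))"
proof -
 let ?A = "Hom_group (P (m - 1)) G" and ?C = "Hom_group (P m) G" and ?B = "Hom_group (P (m + 1)) G"
 let ?f = "precomp (P m) D" and ?g = "precomp (P (m + 1)) D"
 let ?T = "precomp (P m)"
 have gG: "group G" by (rule comm_group.axioms(2)[OF G])
 interpret C: comm_group ?C by (rule Hom_group_comm[OF grp G])
 have gB: "group ?B" by (rule comm_group.axioms(2)[OF Hom_group_comm[OF grp G]])
 have Y: "homology_setup ?A ?f ?C ?g ?B"
 proof (rule homology_setup.intro)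
  fix x assume x: "x \<in> carrier ?A"
  have "?g (?f x) = precomp (P (m + 1)) (%y. D (D y)) x"
   by (rule precomp_compose[OF D_hom'])
  also have "... = precomp (P (m + 1)) (%y. \<one>\<^bsub>P (m - 1)\<^esub>) x"
   by (rule precomp_cong[OF chain_complexD(5)[OF P]])
  finally show "?g (?f x) = \<one>\<^bsub>?B\<^esub>" using precomp_one[OF x grp gG] by simp
 next
  show "?f \<in> hom ?A ?C" "?g \<in> hom ?C ?B" by (rule precomp_hom[OF grp G D_hom], rule precomp_hom[OF grp G D_hom'])
 qed (rule Hom_group_comm[OF grp G])+
 have T_hom: "?T \<phi> \<in> hom ?C ?C" if "\<phi> \<in> hom (P m) (P m)" for \<phi>
  by (rule precomp_hom[OF grp G that])
 have homotopy: "?T \<phi> x \<otimes>\<^bsub>?C\<^esub> inv\<^bsub>?C\<^esub> ?T \<psi> x \<in> ?f ` carrier ?A"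
  if h: "homotopic P D \<phi> \<psi>" and hom: "\<phi> \<in> hom (P m) (P m)" "\<psi> \<in> hom (P m) (P m)" and x: "x \<in> kernel ?C ?B ?g" for \<phi> \<psi> x
 proof -
  obtain K0 K1 where K: "K0 \<in> hom (P m) (P (m + 1))" "K1 \<in> hom (P (m - 1)) (P m)"
   and eq': "\<forall>y\<in>carrier (P m). \<phi> y = \<psi> y \<otimes>\<^bsub>P m\<^esub> (D (K0 y) \<otimes>\<^bsub>P m\<^esub> K1 (D y))"
   using homotopic_at[OF h, of m] by (elim exE conjE) (rule that; assumption)
  note eq = bspec[OF eq'] and DK = homotopy_parts_hom[OF K]
  let ?V = "precomp (P (m - 1)) K1" and ?W = "precomp (P m) K0"
  have xC: "x \<in> carrier ?C" using x by (simp add: kernel_def)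
  have "?T \<phi> x = ?T (%y. \<psi> y \<otimes>\<^bsub>P m\<^esub> (D (K0 y) \<otimes>\<^bsub>P m\<^esub> K1 (D y))) x"
   by (rule precomp_cong[OF eq])
  also have "... = ?T \<psi> x \<otimes>\<^bsub>?C\<^esub> (?T (%y. D (K0 y)) x \<otimes>\<^bsub>?C\<^esub> ?T (%y. K1 (D y)) x)"
   unfolding precomp_mult[OF xC hom(2) DK(3)] precomp_mult[OF xC DK(1,2)] ..
  also have "... = ?T \<psi> x \<otimes>\<^bsub>?C\<^esub> (?T (%y. K1 (D y)) x \<otimes>\<^bsub>?C\<^esub> ?T (%y. D (K0 y)) x)"
   using C.m_comm[OF hom_in_carrier[OF T_hom[OF DK(1)] xC] hom_in_carrier[OF T_hom[OF DK(2)] xC]] by simp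
  also have "... = ?T \<psi> x \<otimes>\<^bsub>?C\<^esub> (?f (?V x) \<otimes>\<^bsub>?C\<^esub> ?W (?g x))"
   unfolding precomp_compose[OF K(1)] precomp_compose[OF D_hom] ..
  finally have eqx: "?T \<phi> x = ?T \<psi> x \<otimes>\<^bsub>?C\<^esub> (?f (?V x) \<otimes>\<^bsub>?C\<^esub> ?W (?g x))" .
  have v: "?V x \<in> carrier ?A" by (rule hom_in_carrier[OF precomp_hom[OF grp G K(2)] xC])
  have w: "?W \<one>\<^bsub>?B\<^esub> = \<one>\<^bsub>?C\<^esub>" by (rule hom_one[OF precomp_hom[OF grp G K(1)] gB C.is_group])
  have t: "?T \<psi> x \<in> carrier ?C" by (rule hom_in_carrier[OF T_hom[OF hom(2)] xC])
  show ?thesis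
   by (rule homotopy_boundary[OF Y, of ?V x ?W "?T \<psi>" "?T \<phi>", OF v w t x eqx])
 qed
 have NT: "y \<otimes>\<^bsub>?C\<^esub> inv\<^bsub>?C\<^esub> ?T (E \<one>\<^bsub>X1\<^esub>) y = ?T (N m) y" if y: "y \<in> carrier ?C" for y
 proof -
  have c: "?T (N m) y \<in> carrier ?C" "?T (E \<one>\<^bsub>X1\<^esub>) y \<in> carrier ?C"
   by (rule hom_in_carrier[OF T_hom[OF N1_hom] y], rule hom_in_carrier[OF T_hom[OF E_hom[OF one_cycle]] y])
  have "y = ?T (%a. a) y" by (rule precomp_id[symmetric, OF y])
  also have "... = ?T (%a. N m a \<otimes>\<^bsub>P m\<^esub> E \<one>\<^bsub>X1\<^esub> a) y"
   by (rule precomp_cong[OF N_split[symmetric]])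
  also have "... = ?T (N m) y \<otimes>\<^bsub>?C\<^esub> ?T (E \<one>\<^bsub>X1\<^esub>) y"
   by (rule precomp_mult[OF y N1_hom E_hom[OF one_cycle]])
  finally have "y = ?T (N m) y \<otimes>\<^bsub>?C\<^esub> ?T (E \<one>\<^bsub>X1\<^esub>) y" .
  from arg_cong[where f = "%u. u \<otimes>\<^bsub>?C\<^esub> inv\<^bsub>?C\<^esub> ?T (E \<one>\<^bsub>X1\<^esub>) y", OF this]
  show ?thesis using c by (simp only: C.m_assoc C.r_inv C.r_one C.inv_closed)
 qed
 have NTk: "((%y. y \<otimes>\<^bsub>?C\<^esub> inv\<^bsub>?C\<^esub> ?T (E \<one>\<^bsub>X1\<^esub>) y) ^^ k) y = ?T (N m ^^ k) y" if y: "y \<in> carrier ?C" for y k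
 proof (induction k)
  case 0
  have "(N m ^^ 0) = (%a. a)" by (simp add: id_def)
  then show ?case using precomp_id[OF y] by (simp only: funpow_0)
 next
  case (Suc k)
  have Tk: "?T (N m ^^ k) y \<in> carrier ?C" by (rule hom_in_carrier[OF T_hom[OF N_hom] y])
  have "(N m ^^ Suc k) = (%a. (N m ^^ k) (N m a))" by (simp only: funpow_Suc_right comp_def)
  then show ?case
   using precomp_compose[OF N1_hom, of m "N m ^^ k" y] NT[OF Tk] by (simp only: funpow.simps(2) comp_apply Suc)
 qed
 obtain k where k: "!!y. y \<in> carrier (P m) ==> (N m ^^ k) y = \<one>\<^bsub>P m\<^esub>" using nil by blast
 show ?thesis
 proof (rule homology_action[OF X Y, of "%c. ?T (E c)" k])
  show "?T (E c) \<in> hom ?C ?C" if "c \<in> kernel X1 X2 d1" for c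
   by (rule T_hom[OF E_hom[OF that]])
  have commute: "precomp (P m') D (precomp (P m'') (E c) x) = precomp (P m') (E c) (precomp (P m') D x)"
   if "c \<in> kernel X1 X2 d1" "D \<in> hom (P m') (P m'')" for c x m' m''
   unfolding precomp_compose[OF that(2)] precomp_compose[OF E_hom[OF that(1)]]
   by (rule precomp_cong) (rule E_D[OF that(1)])
  show "?T (E c) y \<in> kernel ?C ?B ?g" if c: "c \<in> kernel X1 X2 d1" and y: "y \<in> kernel ?C ?B ?g" for c y
  proof -
   have y': "y \<in> carrier ?C" "?g y = \<one>\<^bsub>?B\<^esub>" using y by (auto simp: kernel_def)
   have "?g (?T (E c) y) = \<one>\<^bsub>?B\<^esub>"
    unfolding commute[OF c D_hom'] y'(2)
    by (rule hom_one[OF precomp_hom[OF grp G E_hom[OF c]] gB gB])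
   then show ?thesis
    using hom_in_carrier[OF T_hom[OF E_hom[OF c]] y'(1)] by (simp add: kernel_def)
  qed
  show "?T (E c) y \<in> ?f ` carrier ?A" if c: "c \<in> kernel X1 X2 d1" and "y \<in> ?f ` carrier ?A" for c y
  proof -
   obtain x where x: "x \<in> carrier ?A" "y = ?f x" using \<open>y \<in> ?f ` carrier ?A\<close> by blast
   show ?thesis
    unfolding x(2) commute[OF c D_hom, symmetric]
    by (rule imageI, rule hom_in_carrier[OF precomp_hom[OF grp G E_hom[OF c]] x(1)])
  qed
  show "?T (E c) (?T (E c') y) \<otimes>\<^bsub>?C\<^esub> inv\<^bsub>?C\<^esub> ?T (E (c \<otimes>\<^bsub>X1\<^esub> c')) y \<in> ?f ` carrier ?A"
   if c: "c \<in> kernel X1 X2 d1" "c' \<in> kernel X1 X2 d1" and y: "y \<in> kernel ?C ?B ?g" for c c' y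
   unfolding precomp_compose[OF E_hom[OF c(1)]]
   by (rule homotopy[OF E_mult'[OF c] EE_hom[OF c(2,1)] E_hom[OF mult_cycle[OF c]] y])
  show "?T (E (d0 b)) (?T (E \<one>\<^bsub>X1\<^esub>) y) \<otimes>\<^bsub>?C\<^esub> inv\<^bsub>?C\<^esub> ?T (E \<one>\<^bsub>X1\<^esub>) y \<in> ?f ` carrier ?A"
   if b: "b \<in> carrier X0" and y: "y \<in> kernel ?C ?B ?g" for b y
   unfolding precomp_compose[OF E_hom[OF bd_cycle[OF b]]]
   by (rule homotopy[OF E_cob'[OF b] EE_hom[OF one_cycle bd_cycle[OF b]] E_hom[OF one_cycle] y])
  show "((%y. y \<otimes>\<^bsub>?C\<^esub> inv\<^bsub>?C\<^esub> ?T (E \<one>\<^bsub>X1\<^esub>) y) ^^ k) y = \<one>\<^bsub>?C\<^esub>" if y: "y \<in> carrier ?C" for y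
   by (rule trans[OF NTk[OF y] trans[OF precomp_cong[OF k] precomp_one[OF y grp gG]]])
 qed
qed

end

section \<open>The action of the cohomology of the base\<close>

lemma coboundary_precomp: "coboundary p B = precomp (chain_group (Suc p) B) (chain_boundary (Suc p))"
 by (rule ext) (simp add: coboundary_def precomp_def)

lemma chain_boundary_hom: "chain_boundary (Suc p) \<in> hom (chain_group (Suc p) B) (chain_group p B)"
 by (rule homI) (use singular_chain_boundary[of "Suc p" B] in \<open>auto simp: chain_boundary_add\<close>)

lemma cochain_homology_setup:
 assumes "n \<ge> 1"
 shows "homology_setup (cochain_group (n - 1) B :: ('a chain => 'p::ab_group_add) monoid) (coboundary (n - 1) B)
  (cochain_group n B) (coboundary n B) (cochain_group (Suc n) B)"
proof -
 obtain k where k: "n = Suc k" using assms by (cases n) auto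
 have ch: "group (chain_group p B)" for p by simp
 note comm = Hom_group_comm[OF ch additive_group_comm]
 show ?thesis
  unfolding k diff_Suc_1 coboundary_precomp cochain_group_def
 proof (rule homology_setup.intro)
  fix x :: "'a chain => 'p" assume x: "x \<in> carrier (Hom_group (chain_group k B) additive_group)"
  have "precomp (chain_group (Suc (Suc k)) B) (chain_boundary (Suc (Suc k))) (precomp (chain_group (Suc k) B) (chain_boundary (Suc k)) x)
   = precomp (chain_group (Suc (Suc k)) B) (%y. \<one>\<^bsub>chain_group k B\<^esub>) x"
   unfolding precomp_compose[OF chain_boundary_hom]
   by (rule precomp_cong) (simp add: chain_boundary_boundary_alt)
  also have "... = \<one>\<^bsub>Hom_group (chain_group (Suc (Suc k)) B) additive_group\<^esub>"
   by (rule precomp_one[OF x ch comm_group.axioms(2)[OF additive_group_comm]])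
  finally show "precomp (chain_group (Suc (Suc k)) B) (chain_boundary (Suc (Suc k))) (precomp (chain_group (Suc k) B) (chain_boundary (Suc k)) x)
   = \<one>\<^bsub>Hom_group (chain_group (Suc (Suc k)) B) additive_group\<^esub>" .
 qed (rule comm precomp_hom[OF ch additive_group_comm chain_boundary_hom])+
qed

lemma Y_chain_complex:
 assumes n: "n \<ge> 1" and z: "z \<in> cocycles (n + 1) B"
 shows "chain_complex (Y_part B n) (Yz_diff B n z)"
 unfolding chain_complex_def Y_part_one
 by (intro allI conjI ballI Y_part_comm_group realizes_hom[OF realizes_Yz_diff[OF n z]] Yz_diff_square[OF n z])

lemma phi_chain_endomorphism:
 assumes n: "n \<ge> 1" and z: "z \<in> cocycles (n + 1) B" and c: "c \<in> cocycles n B"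
 shows "chain_endomorphism (Y_part B n) (Yz_diff B n z) (phi B n c z)"
 unfolding chain_endomorphism_def
 using Y_chain_complex[OF n z] realizes_hom[OF realizes_phi[OF n z]] phi_Yz_diff[OF n z c] by simp

text \<open>The exponent \<open>Suc (nat m)\<close> bounds the nilpotency: the simplex factor of an
 element of degree \<open>m\<close> has dimension at most \<open>m\<close>.\<close>

lemma cohomology_homotopy_action:
 fixes z :: "'a chain => 'p::ab_group_add"
 assumes n: "n \<ge> 1" and z: "z \<in> cocycles (n + 1) B"
 shows "homotopy_action (cochain_group (n - 1) B) (coboundary (n - 1) B) (cochain_group n B) (coboundary n B)
  (cochain_group (Suc n) B) (Y_part B n) (Yz_diff B n z) (\<lambda>c. phi B n c z)"
proof (rule homotopy_action.intro)
 note coc = cocycles_def[of n B, symmetric]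
 interpret Y: comm_group "Y_group B n :: ('a, 'p) model monoid" by (rule Y_comm_group)
 show "homology_setup (cochain_group (n - 1) B :: ('a chain => 'p) monoid) (coboundary (n - 1) B)
  (cochain_group n B) (coboundary n B) (cochain_group (Suc n) B)" by (rule cochain_homology_setup[OF n])
 show "chain_complex (Y_part B n) (Yz_diff B n z)" by (rule Y_chain_complex[OF n z])
 fix c :: "'a chain => 'p" assume "c \<in> kernel (cochain_group n B) (cochain_group (Suc n) B) (coboundary n B)"
 then have c: "c \<in> cocycles n B" by (simp only: coc)
 show "phi B n c z \<in> hom (Y_part B n m) (Y_part B n m)" for m
  using realizes_hom[OF realizes_phi[OF n z], of c m] by simp
 show "phi B n c z (Yz_diff B n z y) = Yz_diff B n z (phi B n c z y)" if "y \<in> carrier (Y_part B n m)" for y m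
  by (rule phi_Yz_diff[OF n z c that])
 fix c' :: "'a chain => 'p" assume "c' \<in> kernel (cochain_group n B) (cochain_group (Suc n) B) (coboundary n B)"
 then have c': "c' \<in> cocycles n B" by (simp only: coc)
 show "homotopic (Y_part B n) (Yz_diff B n z) (%y. phi B n c z (phi B n c' z y)) (phi B n (c \<otimes>\<^bsub>cochain_group n B\<^esub> c') z)"
  by (rule phi_product[OF n z c c'])
next
 show "homotopic (Y_part B n) (Yz_diff B n z) (%y. phi B n (coboundary (n - 1) B b) z (phi B n \<one>\<^bsub>cochain_group n B\<^esub> z y))
  (phi B n \<one>\<^bsub>cochain_group n B\<^esub> z)" if "b \<in> carrier (cochain_group (n - 1) B)" for b
  by (rule phi_coboundary[OF n z that])
next
 fix m
 let ?\<phi> = "phi B n \<one>\<^bsub>cochain_group n B\<^esub> z :: ('a, 'p) model => ('a, 'p) model"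
 let ?f = "%y. y \<otimes>\<^bsub>Y_part B n m\<^esub> inv\<^bsub>Y_part B n m\<^esub> ?\<phi> y"
 let ?g = "%y. y \<otimes>\<^bsub>Y_group B n\<^esub> inv\<^bsub>Y_group B n\<^esub> ?\<phi> y"
 interpret Pm: comm_group "Y_part B n m :: ('a, 'p) model monoid" by (rule Y_part_comm_group)
 have \<phi>: "?\<phi> y \<in> carrier (Y_part B n m)" if "y \<in> carrier (Y_part B n m)" for y
  using hom_in_carrier[OF realizes_hom[OF realizes_phi[OF n z]] that] by simp
 have fg: "?f y = ?g y" if "y \<in> carrier (Y_part B n m)" for y
  by (simp only: Y_part_mult Y_part_inv[OF \<phi>[OF that]])
 have fc: "?f y \<in> carrier (Y_part B n m)" if "y \<in> carrier (Y_part B n m)" for y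
  by (rule Pm.m_closed[OF that Pm.inv_closed[OF \<phi>[OF that]]])
 have "(?f ^^ Suc (nat m)) y = \<one>\<^bsub>Y_part B n m\<^esub>" if y: "y \<in> carrier (Y_part B n m)" for y
 proof -
  have "(?f ^^ k) y = (?g ^^ k) y \<and> (?f ^^ k) y \<in> carrier (Y_part B n m)" for k
  proof (induction k)
   case (Suc k)
   then have 1: "(?f ^^ k) y = (?g ^^ k) y" and 2: "(?f ^^ k) y \<in> carrier (Y_part B n m)" by (elim conjunct1, elim conjunct2)
   have "?f ((?f ^^ k) y) = ?g ((?g ^^ k) y)" unfolding 1[symmetric] by (rule fg[OF 2])
   then show ?case using fc[OF 2] by (simp only: funpow.simps(2) comp_apply)
  qed (simp only: funpow_0 y)
  from conjunct1[OF this[of "Suc (nat m)"]]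
  show ?thesis using phi_one_nilpotent[OF n z y] by (simp only: Y_part_one)
 qed
 then show "\<exists>k. \<forall>y\<in>carrier (Y_part B n m). (?f ^^ k) y = \<one>\<^bsub>Y_part B n m\<^esub>"
  by (intro exI[of _ "Suc (nat m)"] ballI)
qed

theorem theorem7p1:
  fixes B :: "'a topology" and n :: nat and z :: "'a chain \<Rightarrow> 'p::ab_group_add"
    and G :: "('g, 'b) monoid_scheme" and q :: int
  assumes "n \<ge> 1" and "z \<in> cocycles (n + 1) B" and "comm_group G"
  shows "(\<forall>c\<in>cocycles n B. chain_endomorphism (Y_part B n) (Yz_diff B n z) (phi B n c z)) \<and>
    (\<exists>\<alpha>. group_action (cohomology_group n B) (carrier (Y_homology B n z G (q + 1))) \<alpha> \<and>
      (\<forall>h\<in>carrier (cohomology_group n B). \<alpha> h \<in> auto (Y_homology B n z G (q + 1))) \<and>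
      (\<forall>c\<in>cocycles n B. \<forall>y\<in>YG_cycles B n z G (q + 1).
         \<alpha> (cohomology_class n B c) (Y_homology_class B n z G (q + 1) y) =
           Y_homology_class B n z G (q + 1) (phi_tensor B n c z G (q + 1) y))) \<and>
    (\<exists>\<beta>. group_action (cohomology_group n B) (carrier (Y_cohomology B n z G (q + 1))) \<beta> \<and>
      (\<forall>h\<in>carrier (cohomology_group n B). \<beta> h \<in> auto (Y_cohomology B n z G (q + 1))) \<and>
      (\<forall>c\<in>cocycles n B. \<forall>f\<in>HomYG_cocycles B n z G (q + 1).
         \<beta> (cohomology_class n B c) (Y_cohomology_class B n z G (q + 1) f) =
           Y_cohomology_class B n z G (q + 1) (phi_dual B n c z (q + 1) f)))"
proof -
 note action = cohomology_homotopy_action[OF assms(1,2)]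
 define m where "m = q + 1"
 have d: "YG_diff B n z G (m + 1) = tensor_map (Y_part B n (m + 1)) (Y_part B n m) G (Yz_diff B n z)"
  "YG_diff B n z G m = tensor_map (Y_part B n m) (Y_part B n (m - 1)) G (Yz_diff B n z)"
  by (simp_all add: YG_diff_def)
 have e: "(HomYG_diff B n z (m - 1) :: (('a, 'p) model => 'g) => _) = precomp (Y_part B n m) (Yz_diff B n z)"
  "(HomYG_diff B n z m :: (('a, 'p) model => 'g) => _) = precomp (Y_part B n (m + 1)) (Yz_diff B n z)"
  "(phi_dual B n c z m :: (('a, 'p) model => 'g) => _) = precomp (Y_part B n m) (phi B n c z)" for c
  by (rule ext, simp add: HomYG_diff_def phi_dual_def precomp_def)+
 have chain: "\<forall>c\<in>cocycles n B. chain_endomorphism (Y_part B n) (Yz_diff B n z) (phi B n c z)"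
  by (intro ballI phi_chain_endomorphism[OF assms(1,2)])
 show ?thesis
  unfolding m_def[symmetric] cohomology_group_def cohomology_class_def Y_homology_def Y_homology_class_def YG_cycles_def
   Y_cohomology_def Y_cohomology_class_def HomYG_cocycles_def phi_tensor_def d e
  unfolding cocycles_def[of n B]
  by (rule conjI[OF chain[unfolded cocycles_def[of n B]] conjI[OF homotopy_action.tensor_action[OF action assms(3)] homotopy_action.Hom_action[OF action assms(3)]]])
qed

end
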